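(* Let $F:\hat\Omega\to\overline\Omega$ be a polar mapping which has a first order polar singularity, and let $W^0_h,W^1_h,W^2_h$ be the pushforward tensor-product spline spaces on $\Omega$ with bases $T^0_{ij}$, $\{\boldsymbol T^s_{ij},\boldsymbol T^\theta_{ij}\}$, $T^2_{ij}$ (all defined in the context). Define $$V^0_h := W^0_h\cap H^1(\Omega),\qquad V^1_h := W^1_h\cap H(\mathrm{curl};\Omega),\qquad V^2_h := W^2_h\cap L^2(\Omega).$$ Then $$V^0_h=\Big\{\phi=\sum_{i,j}\phi_{ij}T^0_{ij}\in W^0_h:\ \phi_{0j}=\gamma_0\ \text{ for all } j\Big\},$$ $$V^1_h=\Big\{\boldsymbol v=\sum_{i,j}v^s_{ij}\boldsymbol T^s_{ij}+\sum_{i,j}v^\theta_{ij}\boldsymbol T^\theta_{ij}\in W^1_h:\ v^\theta_{0j}=0\ \text{ and }\ v^\theta_{1j}=v^s_{0(j+1)}-v^s_{0j}\ \text{ for all } j\Big\},$$ $$V^2_h=\Big\{f=\sum_{i,j}f_{ij}T^2_{ij}\in W^2_h:\ f_{0j}=0\ \text{ for all } j\Big\},$$ where $\gamma_0$ is a real parameter that may differ for each $\phi\in V^0_h$ and that corresponds to its value at the pole, $\phi(\boldsymbol x_0)=\gamma_0$. Moreover $V^0_h=W^0_h\cap C^0(\Omega)$.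
   Context: **Polar mapping.** Let $L>0$ and $\hat\Omega=[0,L]\times(\mathbb R/2\pi\mathbb Z)$ with coordinates $(s,\theta)$. A polar mapping is a surjective $C^1$ map $F:\hat\Omega\to\overline\Omega$, with $\Omega\subset\mathbb R^2$ a bounded open domain, which collapses the edge $\{s=0\}$ to a single point $\boldsymbol x_0\in\Omega$ (the pole) and restricts to a $C^1$ diffeomorphism from $\hat\Omega_0=\hat\Omega\setminus\{s=0\}$ onto $\overline\Omega\setminus\{\boldsymbol x_0\}$; moreover $\Omega=F(\{s<L\})$. $J_F$ denotes the Jacobian matrix of $F=(F_1,F_2)$ in the variables $(s,\theta)$. **First order polar singularity.** $F$ has a first order polar singularity if: (i) $$J_F(s,\theta)=\begin{pmatrix}C(\theta)+\mathcal O(s)& s(C'(\theta)+\mathcal O(s))\\ S(\theta)+\mathcal O(s)& s(S'(\theta)+\mathcal O(s))\end{pmatrix},\qquad \det J_F(s,\theta)=s(D(\theta)+\mathcal O(s)),$$ where $C,S$ are $C^1$ ($2\pi$-periodic) functions, $D=CS'-SC'$ satisfies $D(\theta)>0$ for all $\theta$, and $\mathcal O(s)$ denotes generic functions of $(s,\theta)$ (possibly different at each occurrence) with $|\mathcal O(s)|\le c\,s$ for some constant $c>0$; (ii) $sD_*\le\det J_F(s,\theta)$ for some constant $D_*>0$, and $(\det J_F)^{-1}(s,\theta)=\frac{1+\mathcal O(s)}{sD(\theta)}$. **Splines.** Let $p\ge1$. $B_i$, $0\le i<n_s$, are the normalized (partition of unity) B-splines of degree $p$ on $[0,L]$ for the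 open knot sequence $0=s_0=\dots=s_p<s_{p+1}<\dots<s_{n_s-1}<s_{n_s}=\dots=s_{n_s+p}=L$. $M_i$, $0\le i<n_s-1$, is $\frac{p}{s_{i+p+1}-s_{i+1}}$ times the normalized B-spline of degree $p-1$ with knots $s_{i+1},\dots,s_{i+p+1}$, so $B_i'=M_{i-1}-M_i$ with $M_{-1}=M_{n_s-1}=0$. In the angle, $\theta_j=j\Delta\theta$, $\Delta\theta=2\pi/n_\theta$, $n_\theta\ge p+1$, and the index $j$ is understood modulo $n_\theta$. $\mathring B_j$ is the $2\pi$-periodic normalized B-spline of degree $p$ with knots $\theta_j,\dots,\theta_{j+p+1}$, and $\mathring M_j$ is $\frac1{\Delta\theta}$ times the $2\pi$-periodic normalized B-spline of degree $p-1$ with knots $\theta_{j+1},\dots,\theta_{j+p+1}$, so $\mathring B_j'=\mathring M_{j-1}-\mathring M_j$. **Pushforward spaces.** With $\boldsymbol x=F(s,\theta)$, $s>0$, define functions a.e. on $\Omega$ by $T^0_{ij}(\boldsymbol x)=B_i(s)\mathring B_j(\theta)$ ($0\le i<n_s$); $\boldsymbol T^s_{ij}(\boldsymbol x)=J_F^{-T}(s,\theta)\,(M_i(s)\mathring B_j(\theta),\,0)^T$ ($0\le i<n_s-1$); $\boldsymbol T^\theta_{ij}(\boldsymbol x)=J_F^{-T}(s,\theta)\,(0,\,B_i(s)\mathring M_j(\theta))^T$ ($0\le i<n_s$); $T^2_{ij}(\boldsymbol x)=(\det J_F(s,\theta))^{-1}M_i(s)\mathring M_j(\theta)$ ($0\le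 i<n_s-1$); always $0\le j<n_\theta$. $W^0_h=\mathrm{Span}\{T^0_{ij}\}$, $W^1_h=\mathrm{Span}(\{\boldsymbol T^s_{ij}\}\cup\{\boldsymbol T^\theta_{ij}\})$, $W^2_h=\mathrm{Span}\{T^2_{ij}\}$. Intersections with $H^1$, $H(\mathrm{curl})$, $L^2$, $C^0$ are understood for functions up to a.e. equality (i.e. up to the value at the pole). For a vector field, $\mathrm{curl}\,\boldsymbol v=\partial_1v_2-\partial_2v_1$ and $H(\mathrm{curl};\Omega)=\{\boldsymbol v\in L^2(\Omega)^2:\mathrm{curl}\,\boldsymbol v\in L^2(\Omega)\}$. *)

theory Defs
  imports "HOL-Analysis.Analysis"
begin

section \<open>Sobolev spaces\<close>

text \<open>The spaces below are sets of representatives: membership of a function depends only on its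
  a.e. equivalence class on \<open>\<Omega>\<close>.\<close>

definition partial :: "'n::finite \<Rightarrow> (real^'n \<Rightarrow> real) \<Rightarrow> real^'n \<Rightarrow> real" where
  "partial i f x = frechet_derivative f (at x) (axis i 1)"

primrec Ck :: "nat \<Rightarrow> (real^'n::finite \<Rightarrow> real) \<Rightarrow> bool" where
  "Ck 0 f \<longleftrightarrow> continuous_on UNIV f"
| "Ck (Suc k) f \<longleftrightarrow> (\<forall>x. f differentiable (at x)) \<and> (\<forall>i. Ck k (partial i f))"

definition test_functions :: "(real^'n::finite) set \<Rightarrow> (real^'n \<Rightarrow> real) set" where
  "test_functions \<Omega> = {\<phi>. (\<forall>k. Ck k \<phi>) \<and> compact (closure {x. \<phi> x \<noteq> 0})
     \<and> closure {x. \<phi> x \<noteq> 0} \<subseteq> \<Omega>}"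

definition L2 :: "'a::euclidean_space set \<Rightarrow> ('a \<Rightarrow> 'b::euclidean_space) set" where
  "L2 \<Omega> = {f. f \<in> borel_measurable (lebesgue_on \<Omega>)
     \<and> integrable (lebesgue_on \<Omega>) (\<lambda>x. (norm (f x))\<^sup>2)}"

definition weak_partial ::
    "(real^'n::finite) set \<Rightarrow> 'n \<Rightarrow> (real^'n \<Rightarrow> real) \<Rightarrow> (real^'n \<Rightarrow> real) \<Rightarrow> bool" where
  "weak_partial \<Omega> i u g \<longleftrightarrow> (\<forall>\<phi>\<in>test_functions \<Omega>.
     (LINT x|lebesgue_on \<Omega>. u x * partial i \<phi> x) = - (LINT x|lebesgue_on \<Omega>. g x * \<phi> x))"

definition H1 :: "(real^'n::finite) set \<Rightarrow> (real^'n \<Rightarrow> real) set" where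
  "H1 \<Omega> = {u \<in> L2 \<Omega>. \<forall>i. \<exists>g\<in>L2 \<Omega>. weak_partial \<Omega> i u g}"

text \<open>The distributional curl \<open>\<partial>\<^sub>1 v\<^sub>2 - \<partial>\<^sub>2 v\<^sub>1\<close>; both derivatives are moved onto the test function.\<close>

definition weak_curl :: "(real^2) set \<Rightarrow> (real^2 \<Rightarrow> real^2) \<Rightarrow> (real^2 \<Rightarrow> real) \<Rightarrow> bool" where
  "weak_curl \<Omega> v w \<longleftrightarrow> (\<forall>\<phi>\<in>test_functions \<Omega>.
     - (LINT x|lebesgue_on \<Omega>. v x $ 2 * partial 1 \<phi> x - v x $ 1 * partial 2 \<phi> x)
     = (LINT x|lebesgue_on \<Omega>. w x * \<phi> x))"

definition Hcurl :: "(real^2) set \<Rightarrow> (real^2 \<Rightarrow> real^2) set" where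
  "Hcurl \<Omega> = {v \<in> L2 \<Omega>. \<exists>w\<in>L2 \<Omega>. weak_curl \<Omega> v w}"

definition continuous_representative ::
    "(real^2) set \<Rightarrow> (real^2 \<Rightarrow> real) \<Rightarrow> (real^2 \<Rightarrow> real) \<Rightarrow> bool" where
  "continuous_representative \<Omega> f g \<longleftrightarrow>
     continuous_on \<Omega> g \<and> (AE x in lebesgue_on \<Omega>. f x = g x)"

definition C0 :: "(real^2) set \<Rightarrow> (real^2 \<Rightarrow> real) set" where
  "C0 \<Omega> = {f. \<exists>g. continuous_representative \<Omega> f g}"


section \<open>Polar mappings\<close>

text \<open>A point \<open>(s, \<theta>)\<close> of \<open>[0,L] \<times> (\<real>/2\<pi>\<int>)\<close> is represented by vectors \<open>z\<close> with \<open>z $ 1 = s\<close> and with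
  \<open>z $ 2\<close> a real lift of \<open>\<theta>\<close>; maps on this set are maps on the strip that are \<open>2\<pi>\<close>-periodic in
  \<open>z $ 2\<close>.\<close>

definition strip :: "real \<Rightarrow> (real^2) set" where
  "strip L = {z. 0 \<le> z $ 1 \<and> z $ 1 \<le> L}"

definition strip0 :: "real \<Rightarrow> (real^2) set" where
  "strip0 L = {z. 0 < z $ 1 \<and> z $ 1 \<le> L}"

definition C1_map_on :: "(real^'m::finite) set \<Rightarrow> (real^'m \<Rightarrow> real^'n::finite) \<Rightarrow> bool" where
  "C1_map_on X f \<longleftrightarrow> (\<exists>A. (\<forall>x\<in>X. (f has_derivative (\<lambda>h. A x *v h)) (at x within X))
     \<and> continuous_on X A)"

text \<open>\<open>F\<close> induces a \<open>C\<^sup>1\<close> diffeomorphism from \<open>(0,L] \<times> (\<real>/2\<pi>\<int>)\<close> onto \<open>Y\<close>. Its inverse takes values in a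
  quotient, so being \<open>C\<^sup>1\<close> is expressed through local lifts \<open>G\<close> of the inverse to the strip.\<close>

definition polar_diffeo :: "real \<Rightarrow> (real^2 \<Rightarrow> real^2) \<Rightarrow> (real^2) set \<Rightarrow> bool" where
  "polar_diffeo L F Y \<longleftrightarrow>
     C1_map_on (strip0 L) F \<and>
     F ` strip0 L = Y \<and>
     (\<forall>z\<in>strip0 L. \<forall>w\<in>strip0 L. F z = F w \<longrightarrow>
        z $ 1 = w $ 1 \<and> (\<exists>k::int. z $ 2 = w $ 2 + 2 * pi * of_int k)) \<and>
     (\<forall>y\<in>Y. \<exists>U G. open U \<and> y \<in> U \<and> C1_map_on (U \<inter> Y) G \<and>
        G ` (U \<inter> Y) \<subseteq> strip0 L \<and> (\<forall>x\<in>U \<inter> Y. F (G x) = x))"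

definition polar_mapping ::
    "real \<Rightarrow> (real^2) set \<Rightarrow> real^2 \<Rightarrow> (real^2 \<Rightarrow> real^2) \<Rightarrow> bool" where
  "polar_mapping L \<Omega> x0 F \<longleftrightarrow>
     0 < L \<and> open \<Omega> \<and> bounded \<Omega> \<and> connected \<Omega> \<and> x0 \<in> \<Omega> \<and>
     (\<forall>z\<in>strip L. F (z + vector [0, 2 * pi]) = F z) \<and>
     C1_map_on (strip L) F \<and>
     F ` strip L = closure \<Omega> \<and>
     (\<forall>z\<in>strip L. z $ 1 = 0 \<longrightarrow> F z = x0) \<and>
     polar_diffeo L F (closure \<Omega> - {x0}) \<and>
     F ` {z \<in> strip L. z $ 1 < L} = \<Omega>"

definition JF :: "real \<Rightarrow> (real^2 \<Rightarrow> real^2) \<Rightarrow> real^2 \<Rightarrow> real^2^2" where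
  "JF L F z = jacobian F (at z within strip L)"

definition Os :: "real \<Rightarrow> (real^2 \<Rightarrow> real) \<Rightarrow> bool" where
  "Os L r \<longleftrightarrow> (\<exists>c>0. \<forall>z\<in>strip L. \<bar>r z\<bar> \<le> c * z $ 1)"

definition C1_periodic :: "(real \<Rightarrow> real) \<Rightarrow> (real \<Rightarrow> real) \<Rightarrow> bool" where
  "C1_periodic f f' \<longleftrightarrow> (\<forall>t. (f has_real_derivative f' t) (at t)) \<and> continuous_on UNIV f' \<and>
     (\<forall>t. f (t + 2 * pi) = f t)"

definition first_order_polar_singularity :: "real \<Rightarrow> (real^2 \<Rightarrow> real^2) \<Rightarrow> bool" where
  "first_order_polar_singularity L F \<longleftrightarrow>
     (\<exists>C C' S S' D. C1_periodic C C' \<and> C1_periodic S S' \<and>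
        (\<forall>t. D t = C t * S' t - S t * C' t) \<and> (\<forall>t. 0 < D t) \<and>
        (\<exists>r11 r12 r21 r22. Os L r11 \<and> Os L r12 \<and> Os L r21 \<and> Os L r22 \<and>
           (\<forall>z\<in>strip L. JF L F z =
              vector [vector [C (z $ 2) + r11 z, z $ 1 * (C' (z $ 2) + r12 z)],
                      vector [S (z $ 2) + r21 z, z $ 1 * (S' (z $ 2) + r22 z)]])) \<and>
        (\<exists>r. Os L r \<and> (\<forall>z\<in>strip L. det (JF L F z) = z $ 1 * (D (z $ 2) + r z))) \<and>
        (\<exists>Dmin>0. \<forall>z\<in>strip L. z $ 1 * Dmin \<le> det (JF L F z)) \<and>
        (\<exists>r. Os L r \<and>
           (\<forall>z\<in>strip0 L. inverse (det (JF L F z)) = (1 + r z) / (z $ 1 * D (z $ 2)))))"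


section \<open>Splines\<close>

text \<open>Cox--de Boor recursion. Terms with coinciding knots vanish since \<open>x / 0 = 0\<close>. The half-open
  convention makes every spline vanish at the last knot \<open>L\<close>; this affects only the boundary of the
  domain.\<close>

fun bspline :: "(nat \<Rightarrow> real) \<Rightarrow> nat \<Rightarrow> nat \<Rightarrow> real \<Rightarrow> real" where
  "bspline t 0 i x = (if t i \<le> x \<and> x < t (i + 1) then 1 else 0)"
| "bspline t (Suc p) i x =
     (x - t i) / (t (i + p + 1) - t i) * bspline t p i x +
     (t (i + p + 2) - x) / (t (i + p + 2) - t (i + 1)) * bspline t p (i + 1) x"

definition open_knots :: "real \<Rightarrow> nat \<Rightarrow> nat \<Rightarrow> (nat \<Rightarrow> real) \<Rightarrow> bool" where
  "open_knots L p ns s \<longleftrightarrow> p < ns \<and> (\<forall>k\<le>p. s k = 0) \<and> strict_mono_on {p..ns} s \<and>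
     (\<forall>k. ns \<le> k \<and> k \<le> ns + p \<longrightarrow> s k = L)"

definition Bs :: "nat \<Rightarrow> (nat \<Rightarrow> real) \<Rightarrow> nat \<Rightarrow> real \<Rightarrow> real" where
  "Bs p s i x = bspline s p i x"

definition Ms :: "nat \<Rightarrow> (nat \<Rightarrow> real) \<Rightarrow> nat \<Rightarrow> real \<Rightarrow> real" where
  "Ms p s i x = real p / (s (i + p + 1) - s (i + 1)) * bspline s (p - 1) (i + 1) x"

definition dtheta :: "nat \<Rightarrow> real" where
  "dtheta nt = 2 * pi / real nt"

text \<open>For each argument only finitely many terms of the sum are nonzero.\<close>

definition periodic_bspline :: "nat \<Rightarrow> nat \<Rightarrow> nat \<Rightarrow> real \<Rightarrow> real" where
  "periodic_bspline nt p j x =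
     (\<Sum>\<^sub>\<infinity>k::int. bspline (\<lambda>m. real m * dtheta nt) p j (x + 2 * pi * of_int k))"

definition Bt :: "nat \<Rightarrow> nat \<Rightarrow> nat \<Rightarrow> real \<Rightarrow> real" where
  "Bt p nt j x = periodic_bspline nt p j x"

definition Mt :: "nat \<Rightarrow> nat \<Rightarrow> nat \<Rightarrow> real \<Rightarrow> real" where
  "Mt p nt j x = 1 / dtheta nt * periodic_bspline nt (p - 1) (j + 1) x"


section \<open>Pushforward spline spaces\<close>

text \<open>Polar coordinates of a point of \<open>\<Omega>\<close> other than the pole; at the pole and outside the range of
  \<open>F\<close> the value is unspecified and irrelevant.\<close>

definition polar_coords :: "real \<Rightarrow> (real^2 \<Rightarrow> real^2) \<Rightarrow> real^2 \<Rightarrow> real^2" where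
  "polar_coords L F = inv_into {z \<in> strip0 L. 0 \<le> z $ 2 \<and> z $ 2 < 2 * pi} F"

definition T0 :: "real \<Rightarrow> (real^2 \<Rightarrow> real^2) \<Rightarrow> nat \<Rightarrow> (nat \<Rightarrow> real) \<Rightarrow> nat
    \<Rightarrow> nat \<Rightarrow> nat \<Rightarrow> real^2 \<Rightarrow> real" where
  "T0 L F p s nt i j x =
     (let z = polar_coords L F x in Bs p s i (z $ 1) * Bt p nt j (z $ 2))"

definition T1s :: "real \<Rightarrow> (real^2 \<Rightarrow> real^2) \<Rightarrow> nat \<Rightarrow> (nat \<Rightarrow> real) \<Rightarrow> nat
    \<Rightarrow> nat \<Rightarrow> nat \<Rightarrow> real^2 \<Rightarrow> real^2" where
  "T1s L F p s nt i j x =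
     (let z = polar_coords L F x in
        transpose (matrix_inv (JF L F z)) *v vector [Ms p s i (z $ 1) * Bt p nt j (z $ 2), 0])"

definition T1t :: "real \<Rightarrow> (real^2 \<Rightarrow> real^2) \<Rightarrow> nat \<Rightarrow> (nat \<Rightarrow> real) \<Rightarrow> nat
    \<Rightarrow> nat \<Rightarrow> nat \<Rightarrow> real^2 \<Rightarrow> real^2" where
  "T1t L F p s nt i j x =
     (let z = polar_coords L F x in
        transpose (matrix_inv (JF L F z)) *v vector [0, Bs p s i (z $ 1) * Mt p nt j (z $ 2)])"

definition T2 :: "real \<Rightarrow> (real^2 \<Rightarrow> real^2) \<Rightarrow> nat \<Rightarrow> (nat \<Rightarrow> real) \<Rightarrow> nat
    \<Rightarrow> nat \<Rightarrow> nat \<Rightarrow> real^2 \<Rightarrow> real" where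
  "T2 L F p s nt i j x =
     (let z = polar_coords L F x in
        inverse (det (JF L F z)) * (Ms p s i (z $ 1) * Mt p nt j (z $ 2)))"

definition comb0 :: "real \<Rightarrow> (real^2 \<Rightarrow> real^2) \<Rightarrow> nat \<Rightarrow> nat \<Rightarrow> (nat \<Rightarrow> real) \<Rightarrow> nat
    \<Rightarrow> (nat \<Rightarrow> nat \<Rightarrow> real) \<Rightarrow> real^2 \<Rightarrow> real" where
  "comb0 L F p ns s nt c = (\<lambda>x. \<Sum>i<ns. \<Sum>j<nt. c i j * T0 L F p s nt i j x)"

definition comb1 :: "real \<Rightarrow> (real^2 \<Rightarrow> real^2) \<Rightarrow> nat \<Rightarrow> nat \<Rightarrow> (nat \<Rightarrow> real) \<Rightarrow> nat
    \<Rightarrow> (nat \<Rightarrow> nat \<Rightarrow> real) \<Rightarrow> (nat \<Rightarrow> nat \<Rightarrow> real) \<Rightarrow> real^2 \<Rightarrow> real^2" where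
  "comb1 L F p ns s nt cs ct = (\<lambda>x.
     (\<Sum>i<ns - 1. \<Sum>j<nt. cs i j *\<^sub>R T1s L F p s nt i j x) +
     (\<Sum>i<ns. \<Sum>j<nt. ct i j *\<^sub>R T1t L F p s nt i j x))"

definition comb2 :: "real \<Rightarrow> (real^2 \<Rightarrow> real^2) \<Rightarrow> nat \<Rightarrow> nat \<Rightarrow> (nat \<Rightarrow> real) \<Rightarrow> nat
    \<Rightarrow> (nat \<Rightarrow> nat \<Rightarrow> real) \<Rightarrow> real^2 \<Rightarrow> real" where
  "comb2 L F p ns s nt c = (\<lambda>x. \<Sum>i<ns - 1. \<Sum>j<nt. c i j * T2 L F p s nt i j x)"

text \<open>The spans of the finite families, as sets of all linear combinations.\<close>

definition W0 where "W0 L F p ns s nt = range (comb0 L F p ns s nt)"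
definition W1 where "W1 L F p ns s nt = {comb1 L F p ns s nt cs ct | cs ct. True}"
definition W2 where "W2 L F p ns s nt = range (comb2 L F p ns s nt)"

definition V0 where "V0 L \<Omega> F p ns s nt = W0 L F p ns s nt \<inter> H1 \<Omega>"
definition V1 where "V1 L \<Omega> F p ns s nt = W1 L F p ns s nt \<inter> Hcurl \<Omega>"
definition V2 where "V2 L \<Omega> F p ns s nt = W2 L F p ns s nt \<inter> L2 \<Omega>"

end

theory Submission
  imports Defs
begin

text \<open>
  Away from the pole the three spaces form a discrete de Rham complex: the gradient of a combination
  in \<open>W\<^sup>0\<close> has the coefficient differences in \<open>W\<^sup>1\<close>, and similarly for the curl
  from \<open>W\<^sup>1\<close> to \<open>W\<^sup>2\<close>. Combinations satisfying the conditions on the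
  innermost coefficients are bounded near the pole, as are their derivatives, and a cutoff argument
  shows that a point is removable for bounded weak derivatives. Conversely, if one of the
  conditions fails, then the field (or its gradient or curl) grows like \<open>1/s\<close> in some sector,
  hence on discs of radius comparable to \<open>s\<close>; by scaling, each of these
  carries a fixed amount of \<open>L\<^sup>2\<close> energy although the discs shrink to the pole.
  Splines are only Lipschitz, so
  weak derivatives are computed with difference quotients and translation invariance of the
  Lebesgue measure.
\<close>

section \<open>B-splines\<close>

text \<open>All three conditions come from two blow-up statements. The gradient of
  \<open>comb0\<close> has the angular coefficients \<open>cyc_diff (c i)\<close>, the curl of
  \<open>comb1\<close> has the coefficients \<open>curl_coeff\<close>. So the condition for H^1 says
  that the innermost angular row of the gradient vanishes, and the one for H(curl) joins the same
  condition on the field to the condition for L^2 on its curl. A weak derivative is known only by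
  its action on test functions. Instead of identifying it almost everywhere with the classical one,
  the blow-up statements use \<open>dual_L2\<close>, which compares an explicit function with a
  square integrable one through test functions supported off the pole. No integral is transformed to
  polar coordinates: near the pole there are only pointwise bounds in powers of s, and ordinary
  discs. What has to be known of F is the derivative of its local inverses and the size of the
  entries of \<open>J\<close>. The chosen polar coordinates jump across a ray. Functions of the
  angle are regular there only by periodicity, so derivatives go through local lifts, and
  \<open>sin\<close> and \<open>cos\<close> of the angle replace it where a global function is
  required.\<close>

lemma bspline_cong:
  "(\<And>k. i \<le> k \<Longrightarrow> k \<le> i + p + 1 \<Longrightarrow> t k = t' k) \<Longrightarrow> bspline t p i x = bspline t' p i x"
proof (induction p arbitrary: i)
  case (Suc p)
  have "bspline t p i x = bspline t' p i x" "bspline t p (i + 1) x = bspline t' p (i + 1) x"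
    by (rule Suc.IH; use Suc.prems in simp)+
  then show ?case using Suc.prems by simp
qed simp

text \<open>Trades a shift of the index for a translation of the argument. The use is with a full
  period: \<open>nt\<close> indices against the angle 2 pi.\<close>

lemma bspline_shift:
  assumes "\<And>m. t (m + k) = t m + a"
  shows "bspline t p (i + k) (x + a) = bspline t p i x"
proof (induction p arbitrary: i)
  case 0
  then show ?case using assms[of i] assms[of "Suc i"] by simp
next
  case (Suc p)
  show ?case
    using assms[of i] assms[of "Suc i"] assms[of "i + p + 1"] assms[of "i + p + 2"]
      Suc.IH[of i] Suc.IH[of "i + 1"]
    by (simp add: algebra_simps)
qed

lemma bspline_support:
  assumes "mono t" "bspline t p i x \<noteq> 0"
  shows "t i \<le> x \<and> x < t (i + p + 1)"
  using assms(2)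
proof (induction p arbitrary: i)
  case 0
  then show ?case by (auto split: if_splits)
next
  case (Suc p)
  then consider "bspline t p i x \<noteq> 0" | "bspline t p (i + 1) x \<noteq> 0" by fastforce
  then show ?case
  proof cases
    case 1
    with Suc.IH[of i] monoD[OF assms(1), of "i + p + 1" "i + p + 2"] show ?thesis by simp
  next
    case 2
    with Suc.IH[of "i + 1"] monoD[OF assms(1), of i "i + 1"] show ?thesis by simp
  qed
qed

lemma bspline_eq_0:
  assumes "mono t" "x < t i \<or> t (i + p + 1) \<le> x"
  shows "bspline t p i x = 0"
  using bspline_support[OF assms(1), of p i x] assms(2) by force

text \<open>A crude bound read off the recursion, whose coefficients are affine in x and hence
  bounded for |x| <= R. Local boundedness is all that is used later.\<close>

lemma bspline_bounded: "\<exists>K. \<forall>x. \<bar>x\<bar> \<le> R \<longrightarrow> \<bar>bspline t p i x\<bar> \<le> K"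
proof (induction p arbitrary: i)
  case 0
  show ?case by (rule exI[of _ 1]) simp
next
  case (Suc p)
  obtain K1 K2 where K: "\<And>x. \<bar>x\<bar> \<le> R \<Longrightarrow> \<bar>bspline t p i x\<bar> \<le> K1"
     "\<And>x. \<bar>x\<bar> \<le> R \<Longrightarrow> \<bar>bspline t p (i + 1) x\<bar> \<le> K2"
    using Suc[of i] Suc[of "i + 1"] by metis
  let ?d = "\<bar>t (i + p + 1) - t i\<bar>" and ?e = "\<bar>t (i + p + 2) - t (i + 1)\<bar>"
  have "\<bar>bspline t (Suc p) i x\<bar> \<le> (R + \<bar>t i\<bar>) / ?d * K1 + (R + \<bar>t (i + p + 2)\<bar>) / ?e * K2"
    if "\<bar>x\<bar> \<le> R" for x
  proof -
    have "\<bar>bspline t (Suc p) i x\<bar> \<le> \<bar>x - t i\<bar> / ?d * \<bar>bspline t p i x\<bar>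
        + \<bar>t (i + p + 2) - x\<bar> / ?e * \<bar>bspline t p (i + 1) x\<bar>"
      unfolding bspline.simps abs_mult[symmetric] abs_divide[symmetric] by (rule abs_triangle_ineq)
    also have "\<dots> \<le> (R + \<bar>t i\<bar>) / ?d * K1 + (R + \<bar>t (i + p + 2)\<bar>) / ?e * K2"
      using that by (intro add_mono mult_mono divide_right_mono K) auto
    finally show ?thesis .
  qed
  then show ?case by blast
qed

text \<open>Away from the knots each summand of the recursion is differentiable, so the formula
  reduces to an algebraic identity between values of splines of lower degree. Repeated knots are
  covered: quotients by 0 vanish on both sides.\<close>

lemma bspline_has_derivative:
  assumes "mono t" and "x \<notin> range t"
  shows "(bspline t p i has_real_derivative
     real p * (bspline t (p - 1) i x / (t (i + p) - t i) -
               bspline t (p - 1) (i + 1) x / (t (i + p + 1) - t (i + 1)))) (at x)"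
proof (induction p arbitrary: i)
  case 0
  have ne: "x \<noteq> t i" "x \<noteq> t (i + 1)" using assms(2) by auto
  define e where "e = min \<bar>x - t i\<bar> \<bar>x - t (i + 1)\<bar>"
  have "e > 0" using ne by (simp add: e_def)
  have "bspline t 0 i y = bspline t 0 i x" if "dist y x < e" for y
    using that by (auto simp: e_def dist_real_def)
  then have ev: "\<forall>\<^sub>F y in nhds x. bspline t 0 i y = bspline t 0 i x"
    using \<open>e > 0\<close> unfolding eventually_nhds_metric by blast
  have "(bspline t 0 i has_real_derivative 0) (at x)"
    unfolding DERIV_cong_ev[OF refl ev refl] by (rule DERIV_const)
  then show ?case by (simp del: bspline.simps)
next
  case (Suc p)
  define e where "e k = inverse (t (k + p) - t k)" for k
  define d where "d k = inverse (t (k + Suc p) - t k)" for k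
  let ?B = "\<lambda>k. bspline t p k x" and ?C = "\<lambda>k. bspline t (p - 1) k x"
  have IH: "(bspline t p k has_real_derivative real p * (?C k * e k - ?C (k + 1) * e (k + 1))) (at x)"
    for k using Suc.IH[of k] by (simp add: e_def divide_inverse add_ac del: bspline.simps)
  have eq: "bspline t (Suc p) i = (\<lambda>x. (x - t i) * d i * bspline t p i x
      + (t (i + p + 2) - x) * d (i + 1) * bspline t p (i + 1) x)"
    by (rule ext) (simp add: d_def divide_inverse add_ac)
  have "real p * ((x - t i) * d i * (?C i * e i - ?C (i + 1) * e (i + 1)) +
        (t (i + p + 2) - x) * d (i + 1) * (?C (i + 1) * e (i + 1) - ?C (i + 2) * e (i + 2)))
      = real p * (d i * ?B i - d (i + 1) * ?B (i + 1))"
  proof (cases p)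
    case (Suc q)
    have B: "?B k = (x - t k) * e k * ?C k + (t (k + p + 1) - x) * e (k + 1) * ?C (k + 1)" for k
      using Suc by (simp add: e_def divide_inverse add_ac)
    \<comment> \<open>After expanding \<open>?B\<close>, the terms in \<open>?C i\<close> and
      \<open>?C (i + 2)\<close> agree at once and only the coefficient of \<open>?C (i + 1)\<close>
      needs an argument. It carries the factor \<open>e (i + 1)\<close>: if this is not 0, then
      \<open>t (i + 1) < t (i + p + 1)\<close>, so \<open>d i\<close> and \<open>d (i + 1)\<close>
      are genuine inverses.\<close>
    have "e (i + 1) * (d (i + 1) * (t (i + p + 2) - t (i + 1)) - d i * (t (i + p + 1) - t i)) = 0"
    proof (cases "e (i + 1) = 0")
      case False
      then have "t (i + 1) < t (i + 1 + p)"
        using monoD[OF assms(1), of "i + 1" "i + 1 + p"] by (auto simp: e_def)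
      then have "t (i + 1) < t (i + p + 2)" "t i < t (i + p + 1)"
        using monoD[OF assms(1), of "i + 1 + p" "i + p + 2"] monoD[OF assms(1), of i "i + 1"]
        by (auto simp: add_ac)
      then show ?thesis by (simp add: d_def)
    qed simp
    then have "e (i + 1) * ((t (i + p + 2) - x) * d (i + 1) - (x - t i) * d i)
       = e (i + 1) * (d i * (t (i + p + 1) - x) - d (i + 1) * (x - t (i + 1)))"
      by (simp add: algebra_simps)
    then have "?C (i + 1) * (e (i + 1) * ((t (i + p + 2) - x) * d (i + 1) - (x - t i) * d i))
       = ?C (i + 1) * (e (i + 1) * (d i * (t (i + p + 1) - x) - d (i + 1) * (x - t (i + 1))))"
      by simp
    then show ?thesis unfolding B by (simp add: algebra_simps)
  qed simp
  then have "(bspline t (Suc p) i has_real_derivative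
      (1 + real p) * (d i * ?B i - d (i + 1) * ?B (i + 1))) (at x)"
    unfolding eq using IH[of i] IH[of "i + 1"]
    by (auto intro!: derivative_eq_intros simp: algebra_simps)
  then show ?case by (simp add: d_def divide_inverse add_ac mult.commute del: bspline.simps)
qed

text \<open>The summands of the recursion are regrouped by the spline of lower degree that they
  contain. The two coefficients \<open>l\<close> and \<open>r\<close> of that spline add up to 1,
  and the index shift between them loses nothing because the outermost splines vanish at x.\<close>

lemma bspline_partition_of_unity:
  assumes "mono t" and "t p \<le> x" and "x < t (n + 1)"
  shows "(\<Sum>i\<le>n. bspline t p i x) = 1"
  using assms(2)
proof (induction p)
  case 0
  have "(\<Sum>i\<le>m. bspline t 0 i x) = (if x < t (m + 1) then 1 else 0)" for m
  proof (induction m)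
    case (Suc m)
    then show ?case using monoD[OF assms(1), of "m + 1" "m + 2"] by auto
  qed (use 0 in simp)
  then show ?case using assms(3) by simp
next
  case (Suc p)
  define l where "l i = (x - t i) / (t (i + p + 1) - t i) * bspline t p i x" for i
  define r where "r i = (t (i + p + 1) - x) / (t (i + p + 1) - t i) * bspline t p i x" for i
  have lr: "l i + r i = bspline t p i x" for i
  proof (cases "t (i + p + 1) = t i")
    case True
    then have "bspline t p i x = 0"
      using bspline_eq_0[OF assms(1), of x i p] by force
    then show ?thesis by (simp add: l_def r_def)
  next
    case False
    then show ?thesis
      unfolding l_def r_def distrib_right[symmetric] add_divide_distrib[symmetric] by simp
  qed
  \<comment> \<open>x lies to the right of the support of the first of these splines and to the left
    of the support of the last one.\<close>
  have "bspline t p 0 x = 0" "bspline t p (n + 1) x = 0"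
    using Suc.prems assms by (auto intro!: bspline_eq_0)
  then have 0: "l 0 = 0" "r 0 = 0" "r (Suc n) = 0" by (auto simp: l_def r_def)
  have "(\<Sum>i\<le>n. bspline t (Suc p) i x) = (\<Sum>i\<le>n. l i) + (\<Sum>i\<le>n. r (Suc i))"
    by (simp add: l_def r_def sum.distrib add_ac)
  also have "(\<Sum>i\<le>n. r (Suc i)) = (\<Sum>i\<le>n. r i)"
    using sum.atMost_Suc_shift[of r n] 0 by simp
  also have "(\<Sum>i\<le>n. l i) + (\<Sum>i\<le>n. r i) = (\<Sum>i\<le>n. bspline t p i x)"
    by (simp add: sum.distrib[symmetric] lr)
  also have "\<dots> = 1"
    using Suc.IH Suc.prems monoD[OF assms(1), of p "Suc p"] by simp
  finally show ?case .
qed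

section \<open>Real-valued Lipschitz functions on a set\<close>

definition lipschitzian_on :: "'a::metric_space set \<Rightarrow> ('a \<Rightarrow> real) \<Rightarrow> bool" where
  "lipschitzian_on X f \<longleftrightarrow> (\<exists>K\<ge>0. \<forall>x\<in>X. \<forall>y\<in>X. \<bar>f x - f y\<bar> \<le> K * dist x y)"

lemma lipschitzian_onI:
  "(\<And>x y. x \<in> X \<Longrightarrow> y \<in> X \<Longrightarrow> \<bar>f x - f y\<bar> \<le> K * dist x y) \<Longrightarrow> lipschitzian_on X f"
  unfolding lipschitzian_on_def
  by (rule exI[of _ "max 0 K"]) (meson max.cobounded1 max.cobounded2 mult_right_mono order_trans zero_le_dist)

lemma lipschitzian_onE:
  assumes "lipschitzian_on X f"
  obtains K where "K \<ge> 0" "\<And>x y. x \<in> X \<Longrightarrow> y \<in> X \<Longrightarrow> \<bar>f x - f y\<bar> \<le> K * dist x y"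
  using assms unfolding lipschitzian_on_def by blast

lemma lipschitzian_on_cong:
  "lipschitzian_on X f \<Longrightarrow> (\<And>x. x \<in> X \<Longrightarrow> f x = g x) \<Longrightarrow> lipschitzian_on X g"
  unfolding lipschitzian_on_def by simp

lemma lipschitzian_on_subset: "lipschitzian_on X f \<Longrightarrow> Y \<subseteq> X \<Longrightarrow> lipschitzian_on Y f"
  unfolding lipschitzian_on_def by blast

lemma lipschitzian_on_const [simp]: "lipschitzian_on X (\<lambda>x. c)"
  by (rule lipschitzian_onI[of _ _ 0]) simp

lemma lipschitzian_on_add:
  assumes "lipschitzian_on X f" "lipschitzian_on X g"
  shows "lipschitzian_on X (\<lambda>x. f x + g x)"
proof -
  obtain K M where "\<And>x y. x \<in> X \<Longrightarrow> y \<in> X \<Longrightarrow> \<bar>f x - f y\<bar> \<le> K * dist x y"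
    "\<And>x y. x \<in> X \<Longrightarrow> y \<in> X \<Longrightarrow> \<bar>g x - g y\<bar> \<le> M * dist x y"
    using assms by (meson lipschitzian_onE)
  then show ?thesis
    by (intro lipschitzian_onI[of _ _ "K + M"])
       (smt (verit, best) distrib_right)
qed

lemma lipschitzian_on_bounded:
  assumes "lipschitzian_on X f" "bounded X"
  shows "\<exists>B\<ge>0. \<forall>x\<in>X. \<bar>f x\<bar> \<le> B"
proof (cases "X = {}")
  case False
  then obtain a where a: "a \<in> X" by blast
  obtain K where K: "K \<ge> 0" "\<And>x y. x \<in> X \<Longrightarrow> y \<in> X \<Longrightarrow> \<bar>f x - f y\<bar> \<le> K * dist x y"
    using assms(1) lipschitzian_onE by blast
  obtain R where R: "\<And>x. x \<in> X \<Longrightarrow> dist a x \<le> R"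
    using assms(2) bounded_any_center[of X a] by blast
  have "\<bar>f x\<bar> \<le> \<bar>f a\<bar> + K * \<bar>R\<bar>" if "x \<in> X" for x
  proof -
    have "K * dist a x \<le> K * \<bar>R\<bar>" using R[OF that] K(1) by (intro mult_left_mono) auto
    then show ?thesis using K(2)[OF a that] by linarith
  qed
  moreover have "\<bar>f a\<bar> + K * \<bar>R\<bar> \<ge> 0" using K(1) by simp
  ultimately show ?thesis by blast
qed auto

lemma lipschitzian_on_mult:
  assumes "lipschitzian_on X f" "lipschitzian_on X g" "bounded X"
  shows "lipschitzian_on X (\<lambda>x. f x * g x)"
proof -
  obtain K M where K: "\<And>x y. x \<in> X \<Longrightarrow> y \<in> X \<Longrightarrow> \<bar>f x - f y\<bar> \<le> K * dist x y" "K \<ge> 0"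
    and M: "\<And>x y. x \<in> X \<Longrightarrow> y \<in> X \<Longrightarrow> \<bar>g x - g y\<bar> \<le> M * dist x y" "M \<ge> 0"
    using assms by (meson lipschitzian_onE)
  obtain A where A: "\<And>x. x \<in> X \<Longrightarrow> \<bar>f x\<bar> \<le> A" "A \<ge> 0"
    using lipschitzian_on_bounded[OF assms(1,3)] by blast
  obtain B where B: "\<And>x. x \<in> X \<Longrightarrow> \<bar>g x\<bar> \<le> B" "B \<ge> 0"
    using lipschitzian_on_bounded[OF assms(2,3)] by blast
  show ?thesis
  proof (rule lipschitzian_onI[of _ _ "A * M + B * K"])
    fix x y assume xy: "x \<in> X" "y \<in> X"
    have "f x * g x - f y * g y = f x * (g x - g y) + g y * (f x - f y)" by (simp add: algebra_simps)
    then have "\<bar>f x * g x - f y * g y\<bar> \<le> \<bar>f x\<bar> * \<bar>g x - g y\<bar> + \<bar>g y\<bar> * \<bar>f x - f y\<bar>"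
      by (metis abs_mult abs_triangle_ineq)
    also have "\<dots> \<le> A * (M * dist x y) + B * (K * dist x y)"
      using xy K M A B by (intro add_mono mult_mono) auto
    finally show "\<bar>f x * g x - f y * g y\<bar> \<le> (A * M + B * K) * dist x y"
      by (simp add: algebra_simps)
  qed
qed

lemma lipschitzian_on_sum:
  assumes "\<And>i. i \<in> I \<Longrightarrow> lipschitzian_on X (f i)"
  shows "lipschitzian_on X (\<lambda>x. \<Sum>i\<in>I. f i x)"
  using assms by (induction I rule: infinite_finite_induct) (auto intro: lipschitzian_on_add)

lemma lipschitzian_on_affine: "lipschitzian_on X (\<lambda>x::real. a + b * x)"
  by (rule lipschitzian_onI[of _ _ "\<bar>b\<bar>"])
     (simp add: dist_real_def abs_mult[symmetric] algebra_simps)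

lemma lipschitzian_on_max:
  "lipschitzian_on X f \<Longrightarrow> lipschitzian_on X g \<Longrightarrow> lipschitzian_on X (\<lambda>x. max (f x) (g x))"
proof -
  assume "lipschitzian_on X f" "lipschitzian_on X g"
  then obtain K M where K: "\<And>x y. x \<in> X \<Longrightarrow> y \<in> X \<Longrightarrow> \<bar>f x - f y\<bar> \<le> K * dist x y" "K \<ge> 0"
    and M: "\<And>x y. x \<in> X \<Longrightarrow> y \<in> X \<Longrightarrow> \<bar>g x - g y\<bar> \<le> M * dist x y" "M \<ge> 0"
    by (meson lipschitzian_onE)
  show ?thesis
  proof (rule lipschitzian_onI[of _ _ "K + M"])
    fix x y assume xy: "x \<in> X" "y \<in> X"
    have "K * dist x y \<ge> 0" "M * dist x y \<ge> 0" using K M by auto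
    then show "\<bar>max (f x) (g x) - max (f y) (g y)\<bar> \<le> (K + M) * dist x y"
      using K(1)[OF xy] M(1)[OF xy] unfolding distrib_right by linarith
  qed
qed

lemma lipschitzian_on_uminus: "lipschitzian_on X f \<Longrightarrow> lipschitzian_on X (\<lambda>x. - f x)"
  unfolding lipschitzian_on_def by (simp add: abs_minus_commute)

lemma lipschitzian_on_min:
  "lipschitzian_on X f \<Longrightarrow> lipschitzian_on X g \<Longrightarrow> lipschitzian_on X (\<lambda>x. min (f x) (g x))"
  using lipschitzian_on_uminus[OF lipschitzian_on_max[OF lipschitzian_on_uminus lipschitzian_on_uminus], of X f g]
  by (rule lipschitzian_on_cong) auto

text \<open>Repeated knots make splines discontinuous, so they are only admitted at the ends of \<open>X\<close>.\<close>

lemma bspline_lipschitzian: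
  assumes "mono t" "bounded X"
    and dbl: "\<And>k. t k = t (Suc k) \<Longrightarrow> X \<subseteq> {t k..} \<or> X \<subseteq> {..<t k}"
    and "p \<ge> 1"
  shows "lipschitzian_on X (bspline t p i)"
  using \<open>p \<ge> 1\<close>
proof (induction p arbitrary: i rule: dec_induct)
  case base
  define u where "u x = (x - t i) / (t (i + 1) - t i)" for x
  define v where "v x = (t (i + 2) - x) / (t (i + 2) - t (i + 1))" for x
  have eq: "bspline t 1 i x = u x * (if t i \<le> x \<and> x < t (i + 1) then 1 else 0) +
     v x * (if t (i + 1) \<le> x \<and> x < t (i + 2) then 1 else 0)" for x
    by (simp add: u_def v_def numeral_2_eq_2)
  have le: "t i \<le> t (i + 1)" "t (i + 1) \<le> t (i + 2)" using assms(1) by (auto intro: monoD)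
  have u: "lipschitzian_on X u"
    using lipschitzian_on_affine[of X "- t i / (t (i + 1) - t i)" "1 / (t (i + 1) - t i)"]
    by (rule lipschitzian_on_cong) (simp add: u_def diff_divide_distrib)
  have v: "lipschitzian_on X v"
    using lipschitzian_on_affine[of X "t (i + 2) / (t (i + 2) - t (i + 1))" "- 1 / (t (i + 2) - t (i + 1))"]
    by (rule lipschitzian_on_cong) (simp add: v_def diff_divide_distrib)
  consider "t i = t (i + 1)" "t (i + 1) = t (i + 2)" | "t i = t (i + 1)" "t (i + 1) < t (i + 2)"
    | "t i < t (i + 1)" "t (i + 1) = t (i + 2)" | "t i < t (i + 1)" "t (i + 1) < t (i + 2)"
    using le by linarith
  then show ?case
  proof cases
    case 1
    then show ?thesis by (auto intro: lipschitzian_on_cong[OF lipschitzian_on_const[of X 0]] simp: eq)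
  next
    case 2
    \<comment> \<open>The left knot is double, so the spline jumps from 0 to 1 there and only its
      falling branch remains. \<open>X\<close> lies on one side of the jump.\<close>
    from dbl[of i] 2 consider "X \<subseteq> {t (i + 1)..}" | "X \<subseteq> {..<t (i + 1)}" by auto
    then show ?thesis
    proof cases
      case 1
      show ?thesis
        by (rule lipschitzian_on_cong[OF lipschitzian_on_max[OF lipschitzian_on_const[of X 0] v]])
          (use 1 2 in \<open>auto simp: eq u_def v_def max_def field_simps\<close>)
    next
      case below: 2
      show ?thesis
        by (rule lipschitzian_on_cong[OF lipschitzian_on_const[of X 0]]) (use 2 below in \<open>auto simp: eq\<close>)
    qed
  next
    case 3
    from dbl[of "i + 1"] 3 consider "X \<subseteq> {t (i + 1)..}" | "X \<subseteq> {..<t (i + 1)}" by auto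
    then show ?thesis
    proof cases
      case 1
      show ?thesis
        by (rule lipschitzian_on_cong[OF lipschitzian_on_const[of X 0]]) (use 3 1 in \<open>auto simp: eq\<close>)
    next
      case 2
      show ?thesis
        by (rule lipschitzian_on_cong[OF lipschitzian_on_max[OF lipschitzian_on_const[of X 0] u]])
          (use 3 2 in \<open>auto simp: eq u_def v_def max_def field_simps\<close>)
    qed
  next
    case 4
    \<comment> \<open>With three distinct knots the spline is the hat function: the smaller of its
      two affine branches, cut off at 0.\<close>
    have "max 0 (min (u x) (v x)) = bspline t 1 i x" for x
    proof -
      consider "x < t i" | "t i \<le> x" "x < t (i + 1)" | "t (i + 1) \<le> x" "x < t (i + 2)" | "t (i + 2) \<le> x"
        by linarith
      then show ?thesis
      proof cases
        case 1
        then have "u x \<le> 0" using 4 by (simp add: u_def v_def field_simps)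
        then show ?thesis unfolding eq using 1 4 by auto
      next
        case 2
        then have "0 \<le> u x" "u x \<le> 1" "1 \<le> v x" using 4 by (simp_all add: u_def v_def field_simps)
        then show ?thesis unfolding eq using 2 4 by auto
      next
        case 3
        then have "0 \<le> v x" "v x \<le> 1" "1 \<le> u x" using 4 by (simp_all add: u_def v_def field_simps)
        then show ?thesis unfolding eq using 3 4 by auto
      next
        case right: 4
        then have "v x \<le> 0" using 4 by (simp add: u_def v_def field_simps)
        then show ?thesis unfolding eq using right 4 by auto
      qed
    qed
    then show ?thesis
      by (intro lipschitzian_on_cong[OF lipschitzian_on_max[OF lipschitzian_on_const[of X 0] lipschitzian_on_min[OF u v]]])
  qed
next
  case (step p)
  have "lipschitzian_on X (\<lambda>x. (- t i / (t (i + p + 1) - t i) + 1 / (t (i + p + 1) - t i) * x) * bspline t p i x +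
     (t (i + p + 2) / (t (i + p + 2) - t (i + 1)) + - 1 / (t (i + p + 2) - t (i + 1)) * x) * bspline t p (i + 1) x)"
    by (intro lipschitzian_on_add lipschitzian_on_mult lipschitzian_on_affine step.IH assms(2))
  then show ?case
    by (rule lipschitzian_on_cong) (simp add: diff_divide_distrib add_divide_distrib)
qed

lemma bspline_measurable [measurable]: "bspline t p i \<in> borel_measurable borel"
proof (induction p arbitrary: i)
  case 0
  have "bspline t 0 i = indicator {t i..<t (i + 1)}" by (auto simp: indicator_def fun_eq_iff)
  then show ?case by simp
next
  case (Suc p)
  note [measurable] = Suc
  have "bspline t (Suc p) i = (\<lambda>x. (x - t i) / (t (i + p + 1) - t i) * bspline t p i x +
     (t (i + p + 2) - x) / (t (i + p + 2) - t (i + 1)) * bspline t p (i + 1) x)"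
    by (rule ext) simp
  then show ?case by simp
qed

subsection \<open>Periodic splines\<close>

locale periodic_knots =
  fixes nt :: nat
  assumes nt_pos: "nt > 0"
begin

abbreviation "\<tau> \<equiv> \<lambda>m::nat. real m * dtheta nt"

lemma dtheta_pos: "dtheta nt > 0"
  using nt_pos by (simp add: dtheta_def)

lemma nt_dtheta: "real nt * dtheta nt = 2 * pi"
  using nt_pos by (simp add: dtheta_def)

lemma mono_\<tau>: "mono \<tau>"
  using dtheta_pos by (auto intro!: monoI mult_right_mono)

lemma bspline_\<tau>_shift: "bspline \<tau> q (j + nt) (x + 2 * pi) = bspline \<tau> q j x"
  by (rule bspline_shift) (simp add: distrib_right nt_dtheta)

lemma bspline_\<tau>_shift_multiple: "bspline \<tau> q (j + m * nt) x = bspline \<tau> q j (x - 2 * pi * real m)"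
proof (induction m arbitrary: x)
  case (Suc m)
  have "bspline \<tau> q (j + Suc m * nt) x = bspline \<tau> q ((j + m * nt) + nt) ((x - 2 * pi) + 2 * pi)"
    by (simp add: add_ac)
  also have "\<dots> = bspline \<tau> q (j + m * nt) (x - 2 * pi)" by (rule bspline_\<tau>_shift)
  finally show ?case using Suc[of "x - 2 * pi"] by (simp add: algebra_simps)
qed simp

lemma periodic_bspline_eq_sum:
  assumes "finite K" "\<And>k. k \<notin> K \<Longrightarrow> bspline \<tau> q j (x + 2 * pi * of_int k) = 0"
  shows "periodic_bspline nt q j x = (\<Sum>k\<in>K. bspline \<tau> q j (x + 2 * pi * of_int k))"
proof -
  have "periodic_bspline nt q j x = (\<Sum>\<^sub>\<infinity>k\<in>K. bspline \<tau> q j (x + 2 * pi * of_int k))"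
    unfolding periodic_bspline_def by (rule infsum_cong_neutral) (use assms in auto)
  then show ?thesis using assms(1) by simp
qed

text \<open>On a bounded set one finite range of translates serves all x, so local properties pass
  through a finite sum. Any larger \<open>n\<close> is allowed, so that several splines can share
  one range.\<close>

lemma periodic_bspline_eq_sum_bounded:
  obtains N where "\<And>n x. N \<le> n \<Longrightarrow> \<bar>x\<bar> \<le> R \<Longrightarrow>
     periodic_bspline nt q j x = (\<Sum>k\<in>{- int n..int n}. bspline \<tau> q j (x + 2 * pi * of_int k))"
proof -
  obtain N where N: "real N \<ge> \<bar>R\<bar> + \<tau> (j + q + 1)" using real_arch_simple by blast
  show ?thesis
  proof (rule that[of N])
    fix n and x :: real assume n: "N \<le> n" "\<bar>x\<bar> \<le> R"
    show "periodic_bspline nt q j x = (\<Sum>k\<in>{- int n..int n}. bspline \<tau> q j (x + 2 * pi * of_int k))"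
    proof (rule periodic_bspline_eq_sum)
      fix k assume "k \<notin> {- int n..int n}"
      then consider "k < - int n" | "k > int n" by fastforce
      then show "bspline \<tau> q j (x + 2 * pi * of_int k) = 0"
      proof cases
        case 1
        then have k: "real_of_int k < - real n" by linarith
        have "2 * pi * real_of_int k \<le> 1 * real_of_int k"
          using k pi_gt3 by (intro mult_right_mono_neg) auto
        then have "x + 2 * pi * real_of_int k < 0"
          using k n N dtheta_pos by (smt (verit) mult_nonneg_nonneg of_nat_0_le_iff of_nat_le_iff)
        then show ?thesis
          using mono_\<tau> dtheta_pos by (intro bspline_eq_0 disjI1) (auto simp: less_le_trans)
      next
        case 2
        then have k: "real_of_int k > real n" by linarith
        have "2 * pi * real_of_int k \<ge> 1 * real_of_int k"
          using k pi_gt3 by (intro mult_right_mono) auto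
        then have "x + 2 * pi * real_of_int k \<ge> \<tau> (j + q + 1)"
          using k n N by (smt (verit) of_nat_le_iff)
        then show ?thesis using mono_\<tau> by (intro bspline_eq_0 disjI2) auto
      qed
    qed simp
  qed
qed

lemma periodic_bspline_periodic: "periodic_bspline nt q j (x + 2 * pi) = periodic_bspline nt q j x"
proof -
  have "bij_betw (\<lambda>k::int. k + 1) UNIV UNIV"
    by (rule bij_betwI[of _ _ _ "\<lambda>k. k - 1"]) auto
  from infsum_reindex_bij_betw[OF this, of "\<lambda>k. bspline \<tau> q j (x + 2 * pi * of_int k)"]
  show ?thesis unfolding periodic_bspline_def by (simp add: algebra_simps)
qed

lemma periodic_bspline_index_periodic: "periodic_bspline nt q (j + nt) x = periodic_bspline nt q j x"
proof -
  have "bij_betw (\<lambda>k::int. k - 1) UNIV UNIV"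
    by (rule bij_betwI[of _ _ _ "\<lambda>k. k + 1"]) auto
  from infsum_reindex_bij_betw[OF this, of "\<lambda>k. bspline \<tau> q j (x + 2 * pi * of_int k)"]
  show ?thesis unfolding periodic_bspline_def
    using bspline_\<tau>_shift[of q j "x + 2 * pi * of_int k - 2 * pi" for k]
    by (simp add: algebra_simps)
qed

lemma periodic_bspline_mod: "periodic_bspline nt q (j mod nt) x = periodic_bspline nt q j x"
proof -
  have "periodic_bspline nt q (i + m * nt) x = periodic_bspline nt q i x" for i m
  proof (induction m)
    case (Suc m)
    then show ?case using periodic_bspline_index_periodic[of q "i + m * nt" x] by (simp add: algebra_simps)
  qed simp
  from this[of "j mod nt" "j div nt"] show ?thesis by (simp add: mult.commute)
qed

text \<open>The range of translates that matter grows with |x|, so the spline is taken as the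
  pointwise limit of finite sums, which at each x are eventually constant.\<close>

lemma periodic_bspline_measurable [measurable]: "periodic_bspline nt q j \<in> borel_measurable borel"
proof (rule borel_measurable_LIMSEQ_real)
  fix x :: real
  obtain N where N: "\<And>n y. N \<le> n \<Longrightarrow> \<bar>y\<bar> \<le> \<bar>x\<bar> \<Longrightarrow>
     periodic_bspline nt q j y = (\<Sum>k\<in>{- int n..int n}. bspline \<tau> q j (y + 2 * pi * of_int k))"
    using periodic_bspline_eq_sum_bounded[of "\<bar>x\<bar>" q j] by metis
  show "(\<lambda>n. \<Sum>k\<in>{- int n..int n}. bspline \<tau> q j (x + 2 * pi * of_int k)) \<longlonglongrightarrow> periodic_bspline nt q j x"
    by (rule tendsto_eventually) (use N[of _ x] in \<open>auto simp: eventually_sequentially intro!: exI[of _ N]\<close>)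
qed measurable

lemma periodic_bspline_lipschitzian:
  assumes "q \<ge> 1" "bounded X"
  shows "lipschitzian_on X (periodic_bspline nt q j)"
proof -
  obtain R where R: "\<And>x. x \<in> X \<Longrightarrow> \<bar>x\<bar> \<le> R"
    using assms(2) unfolding bounded_iff real_norm_def by blast
  obtain N where N: "\<And>x. \<bar>x\<bar> \<le> R \<Longrightarrow>
     periodic_bspline nt q j x = (\<Sum>k\<in>{- int N..int N}. bspline \<tau> q j (x + 2 * pi * of_int k))"
    using periodic_bspline_eq_sum_bounded[of R q j] by (metis order_refl)
  have sh: "lipschitzian_on X (\<lambda>x. bspline \<tau> q j (x + a))" for a
  proof -
    have "lipschitzian_on ((\<lambda>x. x + a) ` X) (bspline \<tau> q j)"
    proof (rule bspline_lipschitzian)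
      show "bounded ((\<lambda>x. x + a) ` X)"
        using bounded_translation[OF assms(2), of a] by (simp add: add.commute)
    qed (use mono_\<tau> assms dtheta_pos in auto)
    then show ?thesis unfolding lipschitzian_on_def by (auto simp: dist_real_def)
  qed
  show ?thesis
    by (rule lipschitzian_on_cong[OF lipschitzian_on_sum[of "{- int N..int N}"
          X "\<lambda>k x. bspline \<tau> q j (x + 2 * pi * of_int k)"]])
      (use sh N R in auto)
qed

lemma periodic_bspline_bounded: "\<exists>K. \<forall>x. \<bar>x\<bar> \<le> R \<longrightarrow> \<bar>periodic_bspline nt q j x\<bar> \<le> K"
proof -
  obtain N where N: "\<And>x. \<bar>x\<bar> \<le> R \<Longrightarrow>
     periodic_bspline nt q j x = (\<Sum>k\<in>{- int N..int N}. bspline \<tau> q j (x + 2 * pi * of_int k))"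
    using periodic_bspline_eq_sum_bounded[of R q j] by (metis order_refl)
  obtain K where K: "\<And>x. \<bar>x\<bar> \<le> \<bar>R\<bar> + 2 * pi * real N \<Longrightarrow> \<bar>bspline \<tau> q j x\<bar> \<le> K"
    using bspline_bounded[of "\<bar>R\<bar> + 2 * pi * real N" \<tau> q j] by blast
  have "\<bar>periodic_bspline nt q j x\<bar> \<le> (\<Sum>k\<in>{- int N..int N}. K)" if x: "\<bar>x\<bar> \<le> R" for x
  proof -
    have "\<bar>periodic_bspline nt q j x\<bar> \<le> (\<Sum>k\<in>{- int N..int N}. \<bar>bspline \<tau> q j (x + 2 * pi * of_int k)\<bar>)"
      using N[OF x] by simp
    also have "\<dots> \<le> (\<Sum>k\<in>{- int N..int N}. K)"
    proof (intro sum_mono K)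
      fix k assume "k \<in> {- int N..int N}"
      then have "\<bar>real_of_int k\<bar> \<le> real N" by auto
      then have "\<bar>2 * pi * real_of_int k\<bar> \<le> 2 * pi * real N" by (simp add: abs_mult)
      then show "\<bar>x + 2 * pi * real_of_int k\<bar> \<le> \<bar>R\<bar> + 2 * pi * real N" using x by linarith
    qed
    finally show ?thesis .
  qed
  then show ?thesis by blast
qed

text \<open>Integer multiples, whereas \<open>\<tau>\<close> is indexed by natural numbers: the
  exceptional set has to be invariant under translation by 2 pi.\<close>

definition knots :: "real set" where
  "knots = range (\<lambda>k::int. of_int k * dtheta nt)"

lemma knots_shift: "x + 2 * pi * of_int k \<in> knots \<longleftrightarrow> x \<in> knots"
proof -
  have *: "y + 2 * pi * of_int m \<in> knots" if y: "y \<in> knots" for y and m :: int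
  proof -
    obtain l where "y = of_int l * dtheta nt" using y by (auto simp: knots_def)
    moreover have "of_int (l + int nt * m) * dtheta nt = of_int l * dtheta nt + of_int m * (real nt * dtheta nt)"
      by (simp add: algebra_simps)
    ultimately have "y + 2 * pi * of_int m = of_int (l + int nt * m) * dtheta nt"
      by (simp add: nt_dtheta)
    then show ?thesis unfolding knots_def by blast
  qed
  from *[of x k] *[of "x + 2 * pi * of_int k" "- k"] show ?thesis by auto
qed

lemma countable_knots: "countable knots"
  by (simp add: knots_def)

lemma closed_knots: "closed knots"
proof -
  have "knots = (\<lambda>x. dtheta nt *\<^sub>R x) ` \<int>"
    by (auto simp: knots_def Ints_def mult.commute)
  then show ?thesis using closed_scaling[OF closed_of_int_image[of UNIV], of "dtheta nt"]
    by (metis Ints_def)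
qed

lemma periodic_bspline_has_derivative:
  assumes "x \<notin> knots"
  shows "(periodic_bspline nt (Suc q) j has_real_derivative
     (periodic_bspline nt q j x - periodic_bspline nt q (j + 1) x) / dtheta nt) (at x)"
proof -
  obtain N1 where N1: "\<And>n y. N1 \<le> n \<Longrightarrow> \<bar>y\<bar> \<le> \<bar>x\<bar> + 1 \<Longrightarrow>
     periodic_bspline nt (Suc q) j y = (\<Sum>k\<in>{- int n..int n}. bspline \<tau> (Suc q) j (y + 2 * pi * of_int k))"
    using periodic_bspline_eq_sum_bounded by metis
  obtain N2 where N2: "\<And>n y. N2 \<le> n \<Longrightarrow> \<bar>y\<bar> \<le> \<bar>x\<bar> + 1 \<Longrightarrow>
     periodic_bspline nt q j y = (\<Sum>k\<in>{- int n..int n}. bspline \<tau> q j (y + 2 * pi * of_int k))"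
    using periodic_bspline_eq_sum_bounded by metis
  obtain N3 where N3: "\<And>n y. N3 \<le> n \<Longrightarrow> \<bar>y\<bar> \<le> \<bar>x\<bar> + 1 \<Longrightarrow>
     periodic_bspline nt q (j + 1) y = (\<Sum>k\<in>{- int n..int n}. bspline \<tau> q (j + 1) (y + 2 * pi * of_int k))"
    using periodic_bspline_eq_sum_bounded by metis
  \<comment> \<open>One range of translates for the spline and for both splines in its derivative,
    valid on the unit neighbourhood of x.\<close>
  define n where "n = max N1 (max N2 N3)"
  have d: "((\<lambda>y. bspline \<tau> (Suc q) j (y + 2 * pi * of_int k)) has_real_derivative
     (bspline \<tau> q j (x + 2 * pi * of_int k) - bspline \<tau> q (j + 1) (x + 2 * pi * of_int k)) / dtheta nt) (at x)"
    for k
  proof -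
    have "x + 2 * pi * of_int k \<notin> range \<tau>"
    proof
      assume "x + 2 * pi * of_int k \<in> range \<tau>"
      then obtain m where "x + 2 * pi * of_int k = of_int (int m) * dtheta nt" by auto
      then have "x + 2 * pi * of_int k \<in> knots" unfolding knots_def by blast
      then show False using assms knots_shift[of x k] by blast
    qed
    from bspline_has_derivative[OF mono_\<tau> this, of "Suc q" j]
    have "(bspline \<tau> (Suc q) j has_real_derivative
     (bspline \<tau> q j (x + 2 * pi * of_int k) - bspline \<tau> q (j + 1) (x + 2 * pi * of_int k)) / dtheta nt)
     (at (x + 2 * pi * of_int k))"
    proof (rule DERIV_cong)
      \<comment> \<open>The knots are equidistant: the factor q + 1 of the derivative formula
        cancels against the knot distance \<open>real (Suc q) * dtheta nt\<close>.\<close>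
      have "real (Suc q) * (a / (real (Suc q) * dtheta nt) - b / (real (Suc q) * dtheta nt)) = (a - b) / dtheta nt"
        for a b by (simp add: diff_divide_distrib right_diff_distrib del: of_nat_Suc)
      moreover have "\<tau> (j + Suc q) - \<tau> j = real (Suc q) * dtheta nt"
        "\<tau> (j + Suc q + 1) - \<tau> (j + 1) = real (Suc q) * dtheta nt" by (simp_all add: algebra_simps)
      ultimately show "real (Suc q) * (bspline \<tau> (Suc q - 1) j (x + 2 * pi * of_int k) / (\<tau> (j + Suc q) - \<tau> j) -
          bspline \<tau> (Suc q - 1) (j + 1) (x + 2 * pi * of_int k) / (\<tau> (j + Suc q + 1) - \<tau> (j + 1))) =
         (bspline \<tau> q j (x + 2 * pi * of_int k) - bspline \<tau> q (j + 1) (x + 2 * pi * of_int k)) / dtheta nt"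
        by (simp only: diff_Suc_1)
    qed
    then show ?thesis by (simp add: DERIV_shift)
  qed
  have "((\<lambda>y. \<Sum>k\<in>{- int n..int n}. bspline \<tau> (Suc q) j (y + 2 * pi * of_int k)) has_real_derivative
     (\<Sum>k\<in>{- int n..int n}. (bspline \<tau> q j (x + 2 * pi * of_int k) - bspline \<tau> q (j + 1) (x + 2 * pi * of_int k)) / dtheta nt)) (at x)"
    by (intro DERIV_sum d)
  also have "(\<Sum>k\<in>{- int n..int n}. (bspline \<tau> q j (x + 2 * pi * of_int k) - bspline \<tau> q (j + 1) (x + 2 * pi * of_int k)) / dtheta nt)
    = (periodic_bspline nt q j x - periodic_bspline nt q (j + 1) x) / dtheta nt"
    using N2[of n x] N3[of n x] by (simp add: n_def sum_divide_distrib[symmetric] sum_subtractf)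
  finally show ?thesis
  proof (rule DERIV_cong_ev[OF refl _ refl, THEN iffD1, rotated])
    show "\<forall>\<^sub>F y in nhds x. (\<Sum>k\<in>{- int n..int n}. bspline \<tau> (Suc q) j (y + 2 * pi * of_int k)) = periodic_bspline nt (Suc q) j y"
      unfolding eventually_nhds_metric
      by (rule exI[of _ 1]) (auto simp: dist_real_def n_def simp del: bspline.simps intro!: N1[symmetric])
  qed
qed

lemma periodic_bspline_shift: "periodic_bspline nt q j (x + 2 * pi * of_int k) = periodic_bspline nt q j x"
proof (induction k rule: int_induct[of _ 0])
  case (step1 i)
  then show ?case using periodic_bspline_periodic[of q j "x + 2 * pi * of_int i"] by (simp add: algebra_simps)
next
  case (step2 i)
  then show ?case using periodic_bspline_periodic[of q j "x + 2 * pi * of_int (i - 1)"] by (simp add: algebra_simps)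
qed simp

text \<open>Moving x to the right by many periods leaves only translates that can be rewritten as
  shifts of the index by natural multiples of \<open>nt\<close>. The double sum over j and the
  translates becomes one sum over consecutive indices, to which the partition of unity on a monotone
  knot sequence applies.\<close>

lemma periodic_bspline_partition_of_unity: "(\<Sum>j<nt. periodic_bspline nt q j x) = 1"
proof -
  \<comment> \<open>T bounds the supports of all splines with index below \<open>nt\<close>; from a
    point beyond T, translates further to the right contribute nothing.\<close>
  define T where "T = \<tau> (nt + q)"
  obtain K :: nat where K: "real K \<ge> T + \<bar>x\<bar>" using real_arch_simple by blast
  define y where "y = x + 2 * pi * of_int (int K)"
  have "T \<ge> 0" using dtheta_pos by (simp add: T_def)
  then have yT: "y \<ge> T"
    using K pi_gt3 mult_right_mono[of 1 "2 * pi" "real K"] by (simp add: y_def)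
  obtain N :: nat where N: "real N \<ge> y" using real_arch_simple by blast
  have yN: "y < 2 * pi * real (N + 1)"
  proof -
    have "1 * real (N + 1) \<le> 2 * pi * real (N + 1)" by (intro mult_right_mono) (use pi_gt3 in auto)
    moreover have "y < 1 * real (N + 1)" using N by simp
    ultimately show ?thesis by (rule less_le_trans[rotated])
  qed
  have P: "periodic_bspline nt q j x = (\<Sum>m<N + 1. bspline \<tau> q (m * nt + j) y)" if "j < nt" for j
  proof -
    have "periodic_bspline nt q j x = periodic_bspline nt q j y" unfolding y_def by (rule periodic_bspline_shift[symmetric])
    also have "\<dots> = (\<Sum>k\<in>(\<lambda>m. - int m) ` {..<N + 1}. bspline \<tau> q j (y + 2 * pi * of_int k))"
    proof (rule periodic_bspline_eq_sum)
      fix k assume k: "k \<notin> (\<lambda>m. - int m) ` {..<N + 1}"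
      have "k > 0 \<or> k \<le> - int (N + 1)"
      proof (rule ccontr)
        assume "\<not> (k > 0 \<or> k \<le> - int (N + 1))"
        then have "k = - int (nat (- k))" "nat (- k) < N + 1" by linarith+
        then show False using k by blast
      qed
      then consider "k > 0" | "k \<le> - int (N + 1)" by blast
      then show "bspline \<tau> q j (y + 2 * pi * of_int k) = 0"
      proof cases
        case 1
        have "\<tau> (j + q + 1) \<le> T" using that unfolding T_def by (intro monoD[OF mono_\<tau>]) simp
        also have "T \<le> y + 2 * pi * of_int k" using yT 1 by (simp add: add_increasing2)
        finally show ?thesis using mono_\<tau> by (intro bspline_eq_0 disjI2)
      next
        case 2
        then have "real_of_int k \<le> real_of_int (- int (N + 1))" by (simp only: of_int_le_iff)
        then have "2 * pi * real_of_int k \<le> 2 * pi * real_of_int (- int (N + 1))"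
          by (intro mult_left_mono) auto
        also have "\<dots> = - (2 * pi * real (N + 1))" by (simp add: algebra_simps)
        finally have "y + 2 * pi * of_int k < 0" using yN by linarith
        also have "0 \<le> \<tau> j" using dtheta_pos by simp
        finally show ?thesis by (intro bspline_eq_0 mono_\<tau> disjI1)
      qed
    qed simp
    also have "\<dots> = (\<Sum>m<N + 1. bspline \<tau> q j (y - 2 * pi * real m))"
      by (subst sum.reindex) (auto simp: inj_on_def)
    also have "\<dots> = (\<Sum>m<N + 1. bspline \<tau> q (m * nt + j) y)"
      by (intro sum.cong refl) (metis add.commute bspline_\<tau>_shift_multiple)
    finally show ?thesis .
  qed
  have "(\<Sum>j<nt. periodic_bspline nt q j x) = (\<Sum>m<N + 1. \<Sum>j<nt. bspline \<tau> q (m * nt + j) y)"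
    by (subst sum.swap) (intro sum.cong refl P, simp)
  also have "\<dots> = (\<Sum>m<N + 1. sum (\<lambda>i. bspline \<tau> q i y) {m * nt..<m * nt + nt})"
  proof (rule sum.cong[OF refl])
    show "(\<Sum>j<nt. bspline \<tau> q (m * nt + j) y) = (\<Sum>i = m * nt..<m * nt + nt. bspline \<tau> q i y)" for m
      by (simp add: sum.atLeastLessThan_shift_0[of _ "m * nt"] atLeast0LessThan)
  qed
  also have "\<dots> = (\<Sum>i<(N + 1) * nt. bspline \<tau> q i y)" by (rule sum.nat_group)
  also have "\<dots> = (\<Sum>i\<le>(N + 1) * nt - 1. bspline \<tau> q i y)"
    using nt_pos lessThan_Suc_atMost[of "(N + 1) * nt - 1"] by simp
  also have "\<dots> = 1"
  proof (rule bspline_partition_of_unity[OF mono_\<tau>])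
    show "\<tau> q \<le> y" using yT monoD[OF mono_\<tau>, of q "nt + q"] by (simp add: T_def)
    have "\<tau> ((N + 1) * nt - 1 + 1) = (real nt * dtheta nt) * real (N + 1)"
      using nt_pos by (simp add: algebra_simps)
    then show "y < \<tau> ((N + 1) * nt - 1 + 1)" using yN by (simp only: nt_dtheta)
  qed
  finally show ?thesis .
qed

lemma sum_cyclic_shift: "(\<Sum>j<nt. f ((j + 1) mod nt)) = (\<Sum>j<nt. f j)" for f :: "nat \<Rightarrow> real"
proof -
  obtain m where m: "nt = Suc m" using nt_pos by (cases nt) auto
  have "(\<Sum>j<nt. f ((j + 1) mod nt)) = (\<Sum>j<m. f ((j + 1) mod nt)) + f 0" by (simp add: m)
  also have "(\<Sum>j<m. f ((j + 1) mod nt)) = (\<Sum>j<m. f (Suc j))" by (intro sum.cong) (auto simp: m)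
  finally show ?thesis by (simp add: m sum.lessThan_Suc_shift del: sum.lessThan_Suc)
qed

lemma half_not_knot: "(real j + 1 / 2) * dtheta nt \<notin> knots"
proof
  assume "(real j + 1 / 2) * dtheta nt \<in> knots"
  then obtain k :: int where "(real j + 1 / 2) * dtheta nt = of_int k * dtheta nt" by (auto simp: knots_def)
  then have "real j + 1 / 2 = of_int k" using dtheta_pos by simp
  then have "2 * int j + 1 = 2 * k" by linarith
  then show False by presburger
qed

text \<open>Differentiation lowers the degree and replaces the coefficients by their cyclic
  differences. So by induction all coefficients agree, and the partition of unity forces their
  common value to be 0. In degree 0 the midpoints of the cells separate the splines.\<close>

lemma periodic_bspline_independent:
  assumes "\<And>x. x \<notin> knots \<Longrightarrow> (\<Sum>j<nt. c j * periodic_bspline nt q j x) = 0" and "j < nt"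
  shows "c j = 0"
  using assms
proof (induction q arbitrary: c j)
  case 0
  define x where "x = (real j + 1 / 2) * dtheta nt"
  have P: "periodic_bspline nt 0 i x = (if i = j then 1 else 0)" if "i < nt" for i
  proof -
    have x: "0 < x" "x < 2 * pi"
    proof -
      have "x < real nt * dtheta nt" unfolding x_def using 0 dtheta_pos by (intro mult_strict_right_mono) auto
      then show "x < 2 * pi" by (simp add: nt_dtheta)
    qed (use dtheta_pos in \<open>simp add: x_def\<close>)
    have "periodic_bspline nt 0 i x = (\<Sum>k\<in>{0}. bspline \<tau> 0 i (x + 2 * pi * of_int k))"
    proof (rule periodic_bspline_eq_sum)
      fix k :: int assume "k \<notin> {0}"
      then consider "k \<ge> 1" | "k \<le> -1" by force
      then show "bspline \<tau> 0 i (x + 2 * pi * of_int k) = 0"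
      proof cases
        case 1
        then have "2 * pi * 1 \<le> 2 * pi * real_of_int k" by (intro mult_left_mono) auto
        moreover have "\<tau> (i + 0 + 1) \<le> 2 * pi"
          using that monoD[OF mono_\<tau>, of "i + 0 + 1" nt] by (simp add: nt_dtheta)
        ultimately have "\<tau> (i + 0 + 1) \<le> x + 2 * pi * of_int k" using x by linarith
        then show ?thesis by (intro bspline_eq_0 mono_\<tau> disjI2)
      next
        case 2
        then have "2 * pi * real_of_int k \<le> 2 * pi * - 1" by (intro mult_left_mono) auto
        then have "x + 2 * pi * of_int k < 0" using x by simp
        then show ?thesis
          using mono_\<tau> dtheta_pos by (intro bspline_eq_0 disjI1) (auto simp: less_le_trans)
      qed
    qed simp
    moreover have "\<tau> i \<le> x \<and> x < \<tau> (i + 1) \<longleftrightarrow> i = j"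
      unfolding x_def using dtheta_pos by (auto simp: mult_le_cancel_right mult_less_cancel_right)
    ultimately show ?thesis by simp
  qed
  have "(\<Sum>i<nt. c i * periodic_bspline nt 0 i x) = (\<Sum>i<nt. if i = j then c i else 0)"
    by (intro sum.cong) (auto simp: P)
  then show ?case using 0 half_not_knot[of j] by (simp add: x_def)
next
  case (Suc q)
  let ?P = "\<lambda>q j x. periodic_bspline nt q j x"
  have d0: "c ((i + 1) mod nt) - c i = 0" if i: "i < nt" for i
  proof -
    \<comment> \<open>A backward cyclic difference; adding \<open>nt\<close> before subtracting 1
      avoids truncation at i = 0.\<close>
    define e where "e i = c i - c ((i + nt - 1) mod nt)" for i
    have "e ((i + 1) mod nt) = 0"
    proof (rule Suc.IH)
      fix x assume x: "x \<notin> knots"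
      have "((\<lambda>y. \<Sum>j<nt. c j * ?P (Suc q) j y) has_real_derivative
         (\<Sum>j<nt. c j * ((?P q j x - ?P q (j + 1) x) / dtheta nt))) (at x)"
        by (intro DERIV_sum DERIV_cmult periodic_bspline_has_derivative x)
      moreover have "((\<lambda>y. \<Sum>j<nt. c j * ?P (Suc q) j y) has_real_derivative 0) (at x)"
      proof (rule DERIV_cong_ev[OF refl _ refl, THEN iffD2])
        have "\<forall>\<^sub>F y in nhds x. y \<in> - knots"
          using closed_knots x by (intro eventually_nhds_in_open) auto
        then show "\<forall>\<^sub>F y in nhds x. (\<Sum>j<nt. c j * ?P (Suc q) j y) = 0"
          by eventually_elim (use Suc.prems in auto)
      qed simp
      ultimately have "(\<Sum>j<nt. c j * ((?P q j x - ?P q (j + 1) x) / dtheta nt)) = 0"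
        by (rule DERIV_unique)
      moreover have "(\<Sum>j<nt. c j * ((?P q j x - ?P q (j + 1) x) / dtheta nt)) =
          (\<Sum>j<nt. c j * (?P q j x - ?P q (j + 1) x)) / dtheta nt"
        by (simp add: sum_divide_distrib)
      ultimately have "(\<Sum>j<nt. c j * ?P q j x) = (\<Sum>j<nt. c j * ?P q (j + 1) x)"
        using dtheta_pos by (simp add: right_diff_distrib sum_subtractf)
      also have "\<dots> = (\<Sum>j<nt. c (((j + 1) mod nt + nt - 1) mod nt) * ?P q ((j + 1) mod nt) x)"
      proof (intro sum.cong refl)
        fix j assume j: "j \<in> {..<nt}"
        have "((j + 1) mod nt + nt - 1) mod nt = j"
          using j nt_pos by (cases "j + 1 = nt") auto
        then show "c j * ?P q (j + 1) x = c (((j + 1) mod nt + nt - 1) mod nt) * ?P q ((j + 1) mod nt) x"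
          by (simp add: periodic_bspline_mod)
      qed
      also have "\<dots> = (\<Sum>j<nt. c ((j + nt - 1) mod nt) * ?P q j x)"
        by (rule sum_cyclic_shift[of "\<lambda>j. c ((j + nt - 1) mod nt) * ?P q j x"])
      finally show "(\<Sum>j<nt. e j * ?P q j x) = 0"
        by (simp add: e_def left_diff_distrib sum_subtractf)
    qed (use nt_pos in auto)
    moreover have "((i + 1) mod nt + nt - 1) mod nt = i"
      using i nt_pos by (cases "i + 1 = nt") auto
    ultimately show ?thesis by (simp add: e_def)
  qed
  have c0: "c i = c 0" if "i < nt" for i
    using that
  proof (induction i)
    case (Suc i)
    then show ?case using d0[of i] by simp
  qed simp
  have "0 = (\<Sum>j<nt. c j * ?P (Suc q) j ((real 0 + 1 / 2) * dtheta nt))"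
    using Suc.prems half_not_knot[of 0] by metis
  also have "\<dots> = c 0 * (\<Sum>j<nt. ?P (Suc q) j ((real 0 + 1 / 2) * dtheta nt))"
    unfolding sum_distrib_left by (intro sum.cong) (auto simp: c0[symmetric])
  finally have "c 0 = 0" by (simp only: periodic_bspline_partition_of_unity mult_1_right)
  then show ?case using c0[OF Suc.prems(2)] by (rule trans[rotated])
qed

end

declare bspline.simps [simp del]

context periodic_knots
begin

lemma Bt_shift: "Bt p nt j (x + 2 * pi * of_int k) = Bt p nt j x"
  by (simp add: Bt_def periodic_bspline_shift)

text \<open>Summation by parts around the circle, where no boundary terms occur. \<open>Mt\<close>
  with index j is built from the periodic spline with index j + 1, which is why forward differences
  appear.\<close>

lemma Bt_has_derivative:
  assumes "1 \<le> p" "x \<notin> knots"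
  shows "((\<lambda>y. \<Sum>j<nt. c j * Bt p nt j y) has_real_derivative
     (\<Sum>j<nt. (c ((j + 1) mod nt) - c j) * Mt p nt j x)) (at x)"
proof -
  obtain q where q: "p = Suc q" using assms(1) by (cases p) auto
  let ?P = "\<lambda>j. periodic_bspline nt q j x"
  have "((\<lambda>y. \<Sum>j<nt. c j * Bt p nt j y) has_real_derivative
     (\<Sum>j<nt. c j * ((?P j - ?P (j + 1)) / dtheta nt))) (at x)"
    unfolding Bt_def q by (intro DERIV_sum DERIV_cmult periodic_bspline_has_derivative assms(2))
  also have "(\<Sum>j<nt. c j * ((?P j - ?P (j + 1)) / dtheta nt)) =
     (\<Sum>j<nt. c j * ?P j / dtheta nt) - (\<Sum>j<nt. c j * ?P (j + 1) / dtheta nt)"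
    by (simp add: sum_subtractf[symmetric] right_diff_distrib diff_divide_distrib)
  also have "(\<Sum>j<nt. c j * ?P j / dtheta nt) = (\<Sum>j<nt. c ((j + 1) mod nt) * ?P ((j + 1) mod nt) / dtheta nt)"
    using sum_cyclic_shift[of "\<lambda>j. c j * ?P j / dtheta nt"] by simp
  also have "(\<Sum>j<nt. c ((j + 1) mod nt) * ?P ((j + 1) mod nt) / dtheta nt) - (\<Sum>j<nt. c j * ?P (j + 1) / dtheta nt)
     = (\<Sum>j<nt. (c ((j + 1) mod nt) - c j) * Mt p nt j x)"
    unfolding sum_subtractf[symmetric] periodic_bspline_mod
    by (intro sum.cong refl) (simp add: Mt_def q left_diff_distrib diff_divide_distrib)
  finally show ?thesis .
qed

lemma Bt_lipschitzian:
  assumes "1 \<le> p" "bounded X"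
  shows "lipschitzian_on X (\<lambda>x. \<Sum>j<nt. c j * Bt p nt j x)"
  unfolding Bt_def
  by (intro lipschitzian_on_sum lipschitzian_on_mult lipschitzian_on_const
      periodic_bspline_lipschitzian assms)

lemma Bt_partition_of_unity: "(\<Sum>j<nt. Bt p nt j x) = 1"
  by (simp add: Bt_def periodic_bspline_partition_of_unity)

lemma Bt_Mt_measurable [measurable]:
  "Bt p nt j \<in> borel_measurable borel" "Mt p nt j \<in> borel_measurable borel"
  unfolding Bt_def[abs_def] Mt_def[abs_def] by measurable

lemma Bt_Mt_bounded: "\<exists>K. \<forall>x j. 0 \<le> x \<and> x \<le> 2 * pi \<and> j < nt \<longrightarrow> \<bar>Bt p nt j x\<bar> \<le> K \<and> \<bar>Mt p nt j x\<bar> \<le> K"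
proof -
  obtain K where K: "\<And>q j x. \<bar>x\<bar> \<le> 2 * pi \<Longrightarrow> \<bar>periodic_bspline nt q j x\<bar> \<le> K q j"
    using periodic_bspline_bounded[of "2 * pi"] by metis
  define M where "M = (\<Sum>j<nt. \<bar>K p j\<bar>) + (\<Sum>j<nt. \<bar>K (p - 1) (j + 1) / dtheta nt\<bar>)"
  have "\<bar>Bt p nt j x\<bar> \<le> M \<and> \<bar>Mt p nt j x\<bar> \<le> M" if "0 \<le> x" "x \<le> 2 * pi" "j < nt" for x j
  proof -
    have "\<bar>K p j\<bar> \<le> (\<Sum>j<nt. \<bar>K p j\<bar>)"
      using member_le_sum[of j "{..<nt}" "\<lambda>j. \<bar>K p j\<bar>"] that by auto
    moreover have "\<bar>K (p - 1) (j + 1) / dtheta nt\<bar> \<le> (\<Sum>j<nt. \<bar>K (p - 1) (j + 1) / dtheta nt\<bar>)"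
      using member_le_sum[of j "{..<nt}" "\<lambda>j. \<bar>K (p - 1) (j + 1) / dtheta nt\<bar>"] that by auto
    moreover have "0 \<le> (\<Sum>j<nt. \<bar>K p j\<bar>)" "0 \<le> (\<Sum>j<nt. \<bar>K (p - 1) (j + 1) / dtheta nt\<bar>)"
      by (auto intro: sum_nonneg)
    moreover have "\<bar>Bt p nt j x\<bar> \<le> K p j" using K[of x p j] that by (simp add: Bt_def)
    moreover have "\<bar>Mt p nt j x\<bar> \<le> K (p - 1) (j + 1) / dtheta nt"
      using K[of x "p - 1" "j + 1"] that dtheta_pos by (simp add: Mt_def abs_mult divide_right_mono)
    ultimately show ?thesis unfolding M_def by linarith
  qed
  then show ?thesis by blast
qed

lemma Mt_partition_of_unity: "(\<Sum>j<nt. Mt p nt j x) = 1 / dtheta nt"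
proof -
  have "(\<Sum>j<nt. Mt p nt j x) = (\<Sum>j<nt. periodic_bspline nt (p - 1) ((j + 1) mod nt) x) / dtheta nt"
    unfolding sum_divide_distrib by (intro sum.cong refl) (simp add: Mt_def periodic_bspline_mod)
  then show ?thesis
    using sum_cyclic_shift[of "\<lambda>j. periodic_bspline nt (p - 1) j x"]
    by (simp add: periodic_bspline_partition_of_unity)
qed

lemma Mt_shift: "Mt p nt j (x + 2 * pi * of_int k) = Mt p nt j x"
  by (simp add: Mt_def periodic_bspline_shift)

text \<open>For p = 1 these functions are piecewise constant, so continuity off the knots is the
  most one can expect. It follows from differentiability there; degree 0 is treated apart, because
  the periodic derivative formula starts at degree 1.\<close>

lemma isCont_Mt:
  assumes "x \<notin> knots"
  shows "isCont (Mt p nt j) x"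
proof -
  have c: "isCont (periodic_bspline nt q i) x" for q i
  proof (cases q)
    case 0
    obtain N where N: "\<And>y. \<bar>y\<bar> \<le> \<bar>x\<bar> + 1 \<Longrightarrow>
       periodic_bspline nt q i y = (\<Sum>k\<in>{- int N..int N}. bspline \<tau> q i (y + 2 * pi * of_int k))"
      using periodic_bspline_eq_sum_bounded[of "\<bar>x\<bar> + 1" q i] by (metis order_refl)
    have c: "isCont (\<lambda>y. bspline \<tau> q i (y + 2 * pi * of_int k)) x" for k
    proof -
      have "x + 2 * pi * of_int k \<notin> range \<tau>"
      proof
        assume "x + 2 * pi * of_int k \<in> range \<tau>"
        then obtain m where "x + 2 * pi * of_int k = of_int (int m) * dtheta nt" by auto
        then have "x + 2 * pi * of_int k \<in> knots" unfolding knots_def by blast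
        then show False using assms knots_shift[of x k] by blast
      qed
      from DERIV_isCont[OF bspline_has_derivative[OF mono_\<tau> this, of q i]]
      have b: "isCont (bspline \<tau> q i) (x + 2 * pi * of_int k)" .
      show ?thesis
        by (rule isCont_o2[where f = "\<lambda>y. y + 2 * pi * of_int k", OF _ b]) (intro continuous_intros)
    qed
    have "isCont (\<lambda>y. \<Sum>k\<in>{- int N..int N}. bspline \<tau> q i (y + 2 * pi * of_int k)) x"
      by (intro isCont_sum ballI c)
    moreover have "\<forall>\<^sub>F y in nhds x. (\<Sum>k\<in>{- int N..int N}. bspline \<tau> q i (y + 2 * pi * of_int k)) = periodic_bspline nt q i y"
      unfolding eventually_nhds_metric
      by (rule exI[of _ 1]) (auto simp: dist_real_def intro!: N[symmetric])
    ultimately show ?thesis by (rule isCont_cong[THEN iffD1, rotated])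
  next
    case (Suc r)
    show ?thesis unfolding Suc by (rule DERIV_isCont[OF periodic_bspline_has_derivative[OF assms]])
  qed
  show ?thesis unfolding Mt_def[abs_def] by (intro isCont_mult continuous_const c)
qed

lemma Mt_independent:
  assumes "\<And>x. x \<notin> knots \<Longrightarrow> (\<Sum>j<nt. c j * Mt p nt j x) = 0" and "j < nt"
  shows "c j = 0"
proof -
  define e where "e i = c ((i + nt - 1) mod nt)" for i
  have sh: "((i + 1) mod nt + nt - 1) mod nt = i" if "i < nt" for i
    using that nt_pos by (cases "i + 1 = nt") auto
  have "e ((j + 1) mod nt) = 0"
  proof (rule periodic_bspline_independent)
    fix x assume x: "x \<notin> knots"
    have "(\<Sum>j<nt. e j * periodic_bspline nt (p - 1) j x) =
       (\<Sum>j<nt. e ((j + 1) mod nt) * periodic_bspline nt (p - 1) ((j + 1) mod nt) x)"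
      using sum_cyclic_shift[of "\<lambda>j. e j * periodic_bspline nt (p - 1) j x"] by simp
    also have "\<dots> = (\<Sum>j<nt. c j * Mt p nt j x) * dtheta nt"
      unfolding sum_distrib_right
      by (intro sum.cong refl) (use dtheta_pos in \<open>simp add: e_def sh[simplified] Mt_def periodic_bspline_mod[of _ "Suc _"]\<close>)
    finally show "(\<Sum>j<nt. e j * periodic_bspline nt (p - 1) j x) = 0" using assms(1)[OF x] by simp
  qed (use nt_pos in auto)
  then show ?thesis using sh[OF assms(2)] by (simp add: e_def)
qed

text \<open>The mean of the coefficients is what obstructs a periodic antiderivative.\<close>

lemma Mt_antiderivative:
  assumes "1 \<le> p"
  obtains b where "\<And>x. x \<notin> knots \<Longrightarrow>
     ((\<lambda>y. \<Sum>j<nt. b j * Bt p nt j y) has_real_derivative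
      (\<Sum>j<nt. c j * Mt p nt j x) - (\<Sum>j<nt. c j) / (2 * pi)) (at x)"
proof -
  \<comment> \<open>Subtracting the mean makes the partial sums \<open>b\<close> close up after
    \<open>nt\<close> steps, so that they are the coefficients of a periodic spline.\<close>
  define m where "m = (\<Sum>j<nt. c j) / real nt"
  define b where "b j = (\<Sum>k<j. c k - m)" for j
  have b: "b ((j + 1) mod nt) - b j = c j - m" if "j < nt" for j
  proof (cases "j + 1 = nt")
    case True
    have "b nt = 0" using nt_pos by (simp add: b_def sum_subtractf m_def)
    then show ?thesis using True nt_pos by (auto simp: b_def)
  next
    case False
    then show ?thesis using that by (simp add: b_def)
  qed
  show ?thesis
  proof (rule that[of b])
    fix x assume x: "x \<notin> knots"
    have "(\<Sum>j<nt. (b ((j + 1) mod nt) - b j) * Mt p nt j x) = (\<Sum>j<nt. (c j - m) * Mt p nt j x)"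
      by (intro sum.cong refl) (use b in auto)
    also have "\<dots> = (\<Sum>j<nt. c j * Mt p nt j x) - m * (\<Sum>j<nt. Mt p nt j x)"
      by (simp add: left_diff_distrib sum_subtractf sum_distrib_left)
    also have "m * (\<Sum>j<nt. Mt p nt j x) = (\<Sum>j<nt. c j) / (2 * pi)"
      using nt_pos by (simp add: Mt_partition_of_unity m_def dtheta_def)
    finally show "((\<lambda>y. \<Sum>j<nt. b j * Bt p nt j y) has_real_derivative
      (\<Sum>j<nt. c j * Mt p nt j x) - (\<Sum>j<nt. c j) / (2 * pi)) (at x)"
      using Bt_has_derivative[OF assms x, of b] by simp
  qed
qed

end

subsection \<open>Splines on an open knot sequence\<close>

locale radial_knots =
  fixes L :: real and p ns :: nat and s :: "nat \<Rightarrow> real"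
  assumes open_knots: "open_knots L p ns s" and p_pos: "1 \<le> p"
begin

lemma p_less_ns: "p < ns"
  using open_knots by (simp add: open_knots_def)

lemma s_low: "k \<le> p \<Longrightarrow> s k = 0"
  using open_knots by (simp add: open_knots_def)

lemma s_high: "ns \<le> k \<Longrightarrow> k \<le> ns + p \<Longrightarrow> s k = L"
  using open_knots by (simp add: open_knots_def)

lemma s_less: "p \<le> k \<Longrightarrow> k < l \<Longrightarrow> l \<le> ns \<Longrightarrow> s k < s l"
  using open_knots by (auto simp: open_knots_def intro: strict_mono_onD)

lemma right_end_pos: "0 < L"
  using s_less[of p ns] s_low[of p] s_high[of ns] p_less_ns by simp

text \<open>The knots continued constantly beyond the last one: \<open>s\<close> is arbitrary there,
  while the lemmas on splines ask for a sequence that is monotone on all natural numbers.\<close>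

definition s' :: "nat \<Rightarrow> real" where
  "s' k = s (min k (ns + p))"

lemma s'_Suc: "s' k \<le> s' (Suc k)" "s' k = s' (Suc k) \<longleftrightarrow> k < p \<or> ns \<le> k"
proof -
  consider "k < p" | "p \<le> k" "k < ns" | "ns \<le> k" by linarith
  then have "s' k \<le> s' (Suc k) \<and> (s' k = s' (Suc k) \<longleftrightarrow> k < p \<or> ns \<le> k)"
  proof cases
    case 1
    then show ?thesis using s_low[of k] s_low[of "Suc k"] by (simp add: s'_def min_def)
  next
    case 2
    then show ?thesis using s_less[of k "Suc k"] p_less_ns by (simp add: s'_def min_def)
  next
    case 3
    then show ?thesis using s_high[of "min k (ns + p)"] s_high[of "min (Suc k) (ns + p)"] by (auto simp: s'_def)
  qed
  then show "s' k \<le> s' (Suc k)" "s' k = s' (Suc k) \<longleftrightarrow> k < p \<or> ns \<le> k" by blast+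
qed

lemma mono_s': "mono s'"
  using s'_Suc by (simp add: mono_iff_le_Suc)

lemma bspline_s': "i + q + 1 \<le> ns + p \<Longrightarrow> bspline s q i x = bspline s' q i x"
  by (rule bspline_cong) (simp add: s'_def min_def)

definition breakpoints :: "real set" where
  "breakpoints = s ` {..ns + p}"

lemma finite_breakpoints: "finite breakpoints"
  by (simp add: breakpoints_def)

lemma range_s': "range s' \<subseteq> breakpoints"
  by (auto simp: s'_def breakpoints_def)

text \<open>Repeated knots occur only at 0 and L, which are admissible as ends of the interval. The
  right end stays open, since by the half-open convention a spline may drop to 0 at L.\<close>

lemma Bs_lipschitzian:
  assumes "i < ns"
  shows "lipschitzian_on {0..<L} (Bs p s i)"
proof -
  have "lipschitzian_on {0..<L} (bspline s' p i)"
  proof (rule bspline_lipschitzian[OF mono_s' _ _ p_pos])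
    fix k assume "s' k = s' (Suc k)"
    then consider "k < p" | "ns \<le> k" by (auto simp: s'_Suc)
    then show "{0..<L} \<subseteq> {s' k..} \<or> {0..<L} \<subseteq> {..<s' k}"
    proof cases
      case 1
      then show ?thesis using s_low[of k] by (auto simp: s'_def min_def)
    next
      case 2
      then show ?thesis using s_high[of "min k (ns + p)"] by (auto simp: s'_def)
    qed
  qed (rule bounded_subset[of "{0..L}"], auto)
  then show ?thesis by (rule lipschitzian_on_cong) (use assms in \<open>simp add: Bs_def bspline_s'\<close>)
qed

text \<open>The quotient in \<open>Ms\<close> has the denominator L - L here, and the convention x /
  0 = 0 turns it into the vanishing boundary term of the derivative formula.\<close>

lemma Ms_last: "Ms p s (ns - 1) x = 0"
  using p_less_ns s_high[of ns] s_high[of "ns + p"] by (simp add: Ms_def)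

lemma Bs_has_derivative:
  assumes "i < ns" "x \<notin> breakpoints"
  shows "(Bs p s i has_real_derivative (if i = 0 then 0 else Ms p s (i - 1) x) - Ms p s i x) (at x)"
proof -
  have "(bspline s' p i has_real_derivative
     real p * (bspline s' (p - 1) i x / (s' (i + p) - s' i) -
               bspline s' (p - 1) (i + 1) x / (s' (i + p + 1) - s' (i + 1)))) (at x)"
    using range_s' assms(2) by (intro bspline_has_derivative mono_s') auto
  moreover have "bspline s' p i = Bs p s i"
    using assms(1) by (auto simp: Bs_def bspline_s')
  moreover have "bspline s' (p - 1) k = bspline s (p - 1) k" if "k \<le> i + 1" for k
    using assms(1) p_pos that by (auto simp: bspline_s')
  moreover have "s' (i + p) = s (i + p)" "s' i = s i" "s' (i + p + 1) = s (i + p + 1)" "s' (i + 1) = s (i + 1)"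
    using assms(1) p_pos by (auto simp: s'_def min_def)
  ultimately have "(Bs p s i has_real_derivative
     real p * (bspline s (p - 1) i x / (s (i + p) - s i) -
               bspline s (p - 1) (i + 1) x / (s (i + p + 1) - s (i + 1)))) (at x)" by simp
  \<comment> \<open>For i = 0 the first quotient has the denominator \<open>s p - s 0 = 0\<close>
    and vanishes, as the term with index -1 should.\<close>
  then show ?thesis
    by (rule DERIV_cong) (auto simp: Ms_def right_diff_distrib s_low)
qed

text \<open>Interpolation at the clamped end: among the splines of degree q only the one whose first
  q + 1 knots are all 0 and whose last knot is positive survives at 0, with the value 1.\<close>

lemma bspline_at_0:
  assumes "q \<le> p" "i + q + 1 \<le> ns + p"
  shows "bspline s q i 0 = (if i + q = p then 1 else 0)"
  using assms
proof (induction q arbitrary: i)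
  case 0
  have "s i \<le> 0 \<and> 0 < s (i + 1) \<longleftrightarrow> i = p"
  proof -
    consider "i < p" | "i = p" | "p < i" "i < ns" | "ns \<le> i" by linarith
    then show ?thesis
    proof cases
      case 1
      then show ?thesis using s_low[of "i + 1"] by auto
    next
      case 2
      then show ?thesis using s_low[of p] s_less[of p "p + 1"] p_less_ns by auto
    next
      case 3
      then show ?thesis using s_low[of p] s_less[of p i] by auto
    next
      case 4
      then show ?thesis using s_high[of i] 0 right_end_pos p_less_ns by auto
    qed
  qed
  then show ?case by (simp add: bspline.simps)
next
  case (Suc q)
  have 1: "bspline s q i 0 = (if i + q = p then 1 else 0)"
    and 2: "bspline s q (i + 1) 0 = (if i + 1 + q = p then 1 else 0)"
    using Suc.prems by (intro Suc.IH; simp)+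
  have 3: "s i * bspline s q i 0 = 0" using 1 s_low[of i] by auto
  have "bspline s (Suc q) i 0 = s (i + q + 2) / (s (i + q + 2) - s (i + 1)) * (if i + 1 + q = p then 1 else 0)"
    using 3 by (simp add: bspline.simps 2[simplified])
  also have "\<dots> = (if i + Suc q = p then 1 else 0)"
  proof (cases "i + Suc q = p")
    case True
    then have "s (i + 1) = 0" "0 < s (i + q + 2)"
      using s_low[of "i + 1"] s_low[of p] s_less[of p "p + 1"] p_less_ns by auto
    then show ?thesis using True by simp
  qed simp
  finally show ?case .
qed

text \<open>A Lipschitz bound with one point fixed at 0. It persists in degree 0, where splines
  jump, and degree 0 does occur: \<open>Ms\<close> has degree p - 1.\<close>

lemma bspline_near_0:
  assumes "i + q + 1 \<le> ns + p"
  shows "\<exists>K\<ge>0. \<forall>x\<in>{0..<L}. \<bar>bspline s q i x - bspline s q i 0\<bar> \<le> K * x"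
  using assms
proof (induction q arbitrary: i)
  case 0
  \<comment> \<open>The smallest positive knot: the spline is constant on [0, e), and for x >= e the
    difference, at most 1, is dominated by x / e.\<close>
  define e where "e = Min (insert L {k \<in> breakpoints. 0 < k})"
  have e: "e > 0" unfolding e_def using finite_breakpoints right_end_pos by (subst Min_gr_iff) auto
  have ek: "e \<le> s k" if "k \<le> ns + p" "0 < s k" for k
    unfolding e_def using that finite_breakpoints by (intro Min_le) (auto simp: breakpoints_def)
  have s0: "s k \<ge> 0" if "k \<le> ns + p" for k
    using monoD[OF mono_s', of 0 k] that s_low[of 0] by (simp add: s'_def min_def)
  have "\<bar>bspline s 0 i x - bspline s 0 i 0\<bar> \<le> 1 / e * x" if "x \<in> {0..<L}" for x
  proof (cases "x < e")
    case True
    have "s k \<le> x \<longleftrightarrow> s k \<le> 0" if k: "k \<le> ns + p" for k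
      using ek[OF k] s0[OF k] True \<open>x \<in> _\<close> by force
    then have "bspline s 0 i x = bspline s 0 i 0" using 0 by (simp add: bspline.simps not_le[symmetric])
    then show ?thesis using e that by simp
  next
    case False
    then have "1 \<le> 1 / e * x" using e by (simp add: field_simps)
    then show ?thesis by (auto simp: bspline.simps)
  qed
  moreover have "1 / e \<ge> 0" using e by simp
  ultimately show ?case by blast
next
  case (Suc q)
  obtain K1 where K1: "K1 \<ge> 0" "\<And>x. x \<in> {0..<L} \<Longrightarrow> \<bar>bspline s q i x - bspline s q i 0\<bar> \<le> K1 * x"
    using Suc.IH[of i] Suc.prems by auto
  obtain K2 where K2: "K2 \<ge> 0" "\<And>x. x \<in> {0..<L} \<Longrightarrow> \<bar>bspline s q (i + 1) x - bspline s q (i + 1) 0\<bar> \<le> K2 * x"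
    using Suc.IH[of "i + 1"] Suc.prems by auto
  have lin: "\<bar>(a + b * x) * f x - a * f 0\<bar> \<le> (\<bar>b\<bar> * (\<bar>f 0\<bar> + K * L) + \<bar>a\<bar> * K) * x"
    if f: "\<bar>f x - f 0\<bar> \<le> K * x" and x: "x \<in> {0..<L}" and K: "K \<ge> 0" for f :: "real \<Rightarrow> real" and a b K x
  proof -
    have "K * x \<le> K * L" using K x by (intro mult_left_mono) auto
    then have fx: "\<bar>f x\<bar> \<le> \<bar>f 0\<bar> + K * L" using f by linarith
    have "(a + b * x) * f x - a * f 0 = b * x * f x + a * (f x - f 0)" by (simp add: algebra_simps)
    also have "\<bar>\<dots>\<bar> \<le> \<bar>b * x * f x\<bar> + \<bar>a * (f x - f 0)\<bar>" by (rule abs_triangle_ineq)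
    also have "\<dots> \<le> \<bar>b\<bar> * x * (\<bar>f 0\<bar> + K * L) + \<bar>a\<bar> * (K * x)"
      unfolding abs_mult using x f fx by (intro add_mono mult_mono) auto
    finally show ?thesis by (simp add: algebra_simps)
  qed
  define a1 b1 where "a1 = - s i / (s (i + q + 1) - s i)" and "b1 = 1 / (s (i + q + 1) - s i)"
  define a2 b2 where "a2 = s (i + q + 2) / (s (i + q + 2) - s (i + 1))" and "b2 = - 1 / (s (i + q + 2) - s (i + 1))"
  have eq: "bspline s (Suc q) i x = (a1 + b1 * x) * bspline s q i x + (a2 + b2 * x) * bspline s q (i + 1) x" for x
    by (simp add: bspline.simps a1_def a2_def b1_def b2_def diff_divide_distrib)
  define A1 where "A1 = \<bar>b1\<bar> * (\<bar>bspline s q i 0\<bar> + K1 * L) + \<bar>a1\<bar> * K1"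
  define A2 where "A2 = \<bar>b2\<bar> * (\<bar>bspline s q (i + 1) 0\<bar> + K2 * L) + \<bar>a2\<bar> * K2"
  have "\<bar>bspline s (Suc q) i x - bspline s (Suc q) i 0\<bar> \<le> (A1 + A2) * x" if x: "x \<in> {0..<L}" for x
    using lin[of "bspline s q i" x K1 a1 b1, OF K1(2)[OF x] x K1(1), folded A1_def]
      lin[of "bspline s q (i + 1)" x K2 a2 b2, OF K2(2)[OF x] x K2(1), folded A2_def]
    unfolding eq distrib_right by simp
  moreover have "A1 + A2 \<ge> 0" using K1(1) K2(1) right_end_pos by (auto simp: A1_def A2_def)
  ultimately show ?case by blast
qed

text \<open>The value is \<open>p / s (p + 1)\<close>, since the spline of degree p - 1 with index 1
  is the one that equals 1 at the clamped end. It is the leading coefficient in the blow-up of the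
  curl.\<close>

lemma Ms_0_pos: "Ms p s 0 0 > 0"
  using bspline_at_0[of "p - 1" 1] p_less_ns p_pos s_low[of 1] s_low[of p] s_less[of p "p + 1"]
  by (simp add: Ms_def)

lemma Bs_near_0: "i < ns \<Longrightarrow> \<exists>K\<ge>0. \<forall>x\<in>{0..<L}. \<bar>Bs p s i x - (if i = 0 then 1 else 0)\<bar> \<le> K * x"
  using bspline_near_0[of i p] bspline_at_0[of p i] by (simp add: Bs_def)

lemma Ms_near_0:
  assumes "i < ns - 1"
  shows "\<exists>K\<ge>0. \<forall>x\<in>{0..<L}. \<bar>Ms p s i x - (if i = 0 then Ms p s 0 0 else 0)\<bar> \<le> K * x"
proof -
  have le: "i + 1 + (p - 1) + 1 \<le> ns + p" using assms p_pos by simp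
  obtain K where K: "K \<ge> 0" "\<And>x. x \<in> {0..<L} \<Longrightarrow> \<bar>bspline s (p - 1) (i + 1) x - bspline s (p - 1) (i + 1) 0\<bar> \<le> K * x"
    using bspline_near_0[OF le] by blast
  define d where "d = real p / (s (i + p + 1) - s (i + 1))"
  have "Ms p s i 0 = (if i = 0 then Ms p s 0 0 else 0)"
    using bspline_at_0[of "p - 1" "i + 1"] assms p_pos by (auto simp: Ms_def)
  moreover have "\<bar>Ms p s i x - Ms p s i 0\<bar> \<le> (\<bar>d\<bar> * K) * x" if "x \<in> {0..<L}" for x
    unfolding Ms_def d_def[symmetric] right_diff_distrib[symmetric] abs_mult mult.assoc
    using K(2)[OF that] by (intro mult_left_mono) auto
  ultimately show ?thesis using K(1) by (intro exI[of _ "\<bar>d\<bar> * K"]) auto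
qed

lemma Bs_Ms_measurable [measurable]:
  "Bs p s i \<in> borel_measurable borel" "Ms p s i \<in> borel_measurable borel"
  unfolding Bs_def[abs_def] Ms_def[abs_def] by measurable

lemma Bs_sum_has_derivative:
  assumes "x \<notin> breakpoints"
  shows "((\<lambda>y. \<Sum>i<ns. c i * Bs p s i y) has_real_derivative
     (\<Sum>i<ns - 1. (c (i + 1) - c i) * Ms p s i x)) (at x)"
proof -
  obtain m where m: "ns = Suc m" using p_less_ns by (cases ns) auto
  have "((\<lambda>y. \<Sum>i<ns. c i * Bs p s i y) has_real_derivative
     (\<Sum>i<ns. c i * ((if i = 0 then 0 else Ms p s (i - 1) x) - Ms p s i x))) (at x)"
    using assms by (intro DERIV_sum DERIV_cmult Bs_has_derivative) auto
  also have "(\<Sum>i<ns. c i * ((if i = 0 then 0 else Ms p s (i - 1) x) - Ms p s i x)) =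
     (\<Sum>i<Suc m. c i * (if i = 0 then 0 else Ms p s (i - 1) x)) - (\<Sum>i<Suc m. c i * Ms p s i x)"
    by (simp add: m right_diff_distrib sum_subtractf)
  also have "(\<Sum>i<Suc m. c i * (if i = 0 then 0 else Ms p s (i - 1) x)) = (\<Sum>i<m. c (i + 1) * Ms p s i x)"
    by (simp add: sum.lessThan_Suc_shift del: sum.lessThan_Suc)
  also have "(\<Sum>i<Suc m. c i * Ms p s i x) = (\<Sum>i<m. c i * Ms p s i x)"
    using Ms_last[of x] m by simp
  finally show ?thesis by (simp add: m left_diff_distrib sum_subtractf)
qed

text \<open>Step coefficients have a single nonzero difference. Thus \<open>Ms p s i\<close> times
  ds is the differential of a Lipschitz function, although \<open>Ms\<close> itself may
  jump.\<close>

lemma Ms_antiderivative: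
  assumes "i < ns - 1" "x \<notin> breakpoints"
  shows "((\<lambda>y. \<Sum>k<ns. (if i < k then 1 else 0) * Bs p s k y) has_real_derivative Ms p s i x) (at x)"
proof -
  have "(\<Sum>k<ns - 1. ((if i < k + 1 then 1 else 0) - (if i < k then 1 else 0)) * Ms p s k x)
     = (\<Sum>k<ns - 1. if k = i then Ms p s i x else 0)" by (intro sum.cong) auto
  then show ?thesis
    using Bs_sum_has_derivative[OF assms(2), of "\<lambda>k. if i < k then 1 else 0"] assms(1) by simp
qed

lemma Bs_sum_lipschitzian: "lipschitzian_on {0..<L} (\<lambda>x. \<Sum>i<ns. c i * Bs p s i x)"
  by (intro lipschitzian_on_sum lipschitzian_on_mult lipschitzian_on_const Bs_lipschitzian)
     (auto intro: bounded_subset[of "{0..L}"])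

end

section \<open>Locally Lipschitz, almost everywhere differentiable functions\<close>

definition loc_lip :: "'a::metric_space set \<Rightarrow> ('a \<Rightarrow> real) \<Rightarrow> bool" where
  "loc_lip U f \<longleftrightarrow> (\<forall>x\<in>U. \<exists>r>0. ball x r \<subseteq> U \<and> lipschitzian_on (ball x r) f)"

text \<open>Differentiability almost everywhere is carried as a clause, in place of an appeal to
  Rademacher's theorem: for splines it is visible directly, the exceptional points lying over
  countably many knots.\<close>

definition lip_ae_diff :: "(real^'n::finite) set \<Rightarrow> (real^'n \<Rightarrow> real) \<Rightarrow> bool" where
  "lip_ae_diff U f \<longleftrightarrow> loc_lip U f \<and> (AE x in lebesgue. x \<in> U \<longrightarrow> f differentiable (at x))"

lemma loc_lip_binop:
  assumes "loc_lip U f" "loc_lip U g"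
    and op: "\<And>x r. lipschitzian_on (ball x r) f \<Longrightarrow> lipschitzian_on (ball x r) g \<Longrightarrow> lipschitzian_on (ball x r) h"
  shows "loc_lip U h"
  unfolding loc_lip_def
proof
  fix x assume "x \<in> U"
  then obtain r q where "r > 0" "ball x r \<subseteq> U" "lipschitzian_on (ball x r) f"
      "q > 0" "lipschitzian_on (ball x q) g"
    using assms(1,2) unfolding loc_lip_def by meson
  then show "\<exists>r>0. ball x r \<subseteq> U \<and> lipschitzian_on (ball x r) h"
    by (intro exI[of _ "min r q"] conjI op)
       (auto elim!: lipschitzian_on_subset)
qed

lemma loc_lip_continuous_on:
  assumes "loc_lip U f"
  shows "continuous_on U f"
proof (rule continuous_at_imp_continuous_on, rule ballI)
  fix x assume "x \<in> U"
  then obtain r where r: "r > 0" "lipschitzian_on (ball x r) f"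
    using assms unfolding loc_lip_def by blast
  then obtain M where M: "M \<ge> 0" "\<And>y. y \<in> ball x r \<Longrightarrow> \<bar>f y - f x\<bar> \<le> M * dist y x"
    using centre_in_ball[of x r] by (elim lipschitzian_onE) blast
  have "((\<lambda>y. f y - f x) \<longlongrightarrow> 0) (at x)"
  proof (rule Lim_null_comparison)
    show "\<forall>\<^sub>F y in at x. norm (f y - f x) \<le> M * dist y x"
      unfolding eventually_at using r M by (intro exI[of _ r]) (auto simp: dist_commute)
    have "((\<lambda>y. M * dist y x) \<longlongrightarrow> M * dist x x) (at x)"
      by (intro tendsto_intros)
    then show "((\<lambda>y. M * dist y x) \<longlongrightarrow> 0) (at x)" by simp
  qed
  then show "isCont f x" unfolding isCont_def by (simp add: LIM_zero_iff)
qed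

text \<open>A Lebesgue number argument: balls of half the radius already cover, so x and every y
  within d of it share one full ball. The second point may leave \<open>K\<close>, as the points of
  a difference quotient do.\<close>

lemma loc_lip_uniform:
  assumes "loc_lip U f" "compact K" "K \<subseteq> U"
  obtains M d where "M \<ge> 0" "d > 0" "\<forall>x\<in>K. \<forall>y. dist x y < d \<longrightarrow> y \<in> U \<and> \<bar>f y - f x\<bar> \<le> M * dist x y"
proof (cases "K = {}")
  case True
  then show thesis using that[of 0 1] by auto
next
  case False
  obtain r where r: "\<And>x. x \<in> U \<Longrightarrow> r x > 0 \<and> ball x (r x) \<subseteq> U \<and> lipschitzian_on (ball x (r x)) f"
    using assms(1) unfolding loc_lip_def by metis
  then obtain m where m: "\<And>x y z. x \<in> U \<Longrightarrow> y \<in> ball x (r x) \<Longrightarrow> z \<in> ball x (r x) \<Longrightarrow> \<bar>f y - f z\<bar> \<le> m x * dist y z"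
    unfolding lipschitzian_on_def by metis
  obtain T where T: "T \<subseteq> K" "finite T" "K \<subseteq> (\<Union>x\<in>T. ball x (r x / 2))"
  proof (rule compactE_image[OF assms(2), of K "\<lambda>x. ball x (r x / 2)"])
    show "K \<subseteq> (\<Union>x\<in>K. ball x (r x / 2))" using r assms(3) by fastforce
  qed auto
  have "T \<noteq> {}" using T False by auto
  define d where "d = Min ((\<lambda>x. r x / 2) ` T)"
  define M where "M = Max (insert 0 (m ` T))"
  have "d > 0" unfolding d_def using T r assms(3) \<open>T \<noteq> {}\<close> by (subst Min_gr_iff) auto
  moreover have "M \<ge> 0" unfolding M_def using T by (intro Max_ge) auto
  moreover have "y \<in> U \<and> \<bar>f y - f x\<bar> \<le> M * dist x y" if x: "x \<in> K" "dist x y < d" for x y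
  proof -
    obtain t where t: "t \<in> T" "x \<in> ball t (r t / 2)" using T x by blast
    have "d \<le> r t / 2" unfolding d_def using T t by (intro Min_le) auto
    then have xy: "x \<in> ball t (r t)" "y \<in> ball t (r t)"
      using t(2) x(2) dist_triangle[of t y x] zero_le_dist[of t x] unfolding mem_ball by linarith+
    have tU: "t \<in> U" using T t assms(3) by auto
    have "m t \<le> M" unfolding M_def using T t by (intro Max_ge) auto
    then have "m t * dist x y \<le> M * dist x y" by (intro mult_right_mono) auto
    then show ?thesis using m[OF tU xy(2) xy(1)] r[OF tU] xy by (auto simp: dist_commute)
  qed
  ultimately show thesis using that by blast
qed

lemma lip_ae_diff_add:
  assumes "lip_ae_diff U f" "lip_ae_diff U g"
  shows "lip_ae_diff U (\<lambda>x. f x + g x)"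
proof -
  have "loc_lip U (\<lambda>x. f x + g x)"
    by (rule loc_lip_binop[of U f g]) (use assms in \<open>simp_all add: lip_ae_diff_def lipschitzian_on_add\<close>)
  moreover have "AE x in lebesgue. x \<in> U \<longrightarrow> (\<lambda>x. f x + g x) differentiable (at x)"
    using assms[unfolded lip_ae_diff_def, THEN conjunct2]
    by eventually_elim auto
  ultimately show ?thesis by (simp add: lip_ae_diff_def)
qed

lemma lip_ae_diff_mult:
  assumes "lip_ae_diff U f" "lip_ae_diff U g"
  shows "lip_ae_diff U (\<lambda>x. f x * g x)"
proof -
  have "loc_lip U (\<lambda>x. f x * g x)"
    by (rule loc_lip_binop[of U f g]) (use assms in \<open>simp_all add: lip_ae_diff_def lipschitzian_on_mult\<close>)
  moreover have "AE x in lebesgue. x \<in> U \<longrightarrow> (\<lambda>x. f x * g x) differentiable (at x)"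
    using assms[unfolded lip_ae_diff_def, THEN conjunct2]
    by eventually_elim auto
  ultimately show ?thesis by (simp add: lip_ae_diff_def)
qed

lemma lip_ae_diff_subset:
  assumes "lip_ae_diff U f" "V \<subseteq> U" "open V"
  shows "lip_ae_diff V f"
proof -
  have "loc_lip V f" unfolding loc_lip_def
  proof
    fix x assume x: "x \<in> V"
    then obtain r where "r > 0" "lipschitzian_on (ball x r) f"
      using assms unfolding lip_ae_diff_def loc_lip_def by blast
    moreover obtain q where "q > 0" "ball x q \<subseteq> V" using assms(3) x open_contains_ball by blast
    ultimately show "\<exists>r>0. ball x r \<subseteq> V \<and> lipschitzian_on (ball x r) f"
      by (intro exI[of _ "min r q"]) (auto elim!: lipschitzian_on_subset)
  qed
  moreover have "AE x in lebesgue. x \<in> V \<longrightarrow> f differentiable (at x)"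
    using assms(1)[unfolded lip_ae_diff_def, THEN conjunct2]
    by eventually_elim (use assms in auto)
  ultimately show ?thesis by (simp add: lip_ae_diff_def)
qed

lemma lip_ae_diff_lipschitzian:
  assumes "lipschitzian_on UNIV f" "AE x in lebesgue. f differentiable (at x)" "open U"
  shows "lip_ae_diff U f"
proof (rule lip_ae_diff_subset[of UNIV])
  show "lip_ae_diff UNIV f" unfolding lip_ae_diff_def loc_lip_def
    using assms by (auto intro: lipschitzian_on_subset intro!: exI[of _ 1])
qed (use assms in auto)

lemma lip_ae_diff_const: "open U \<Longrightarrow> lip_ae_diff U (\<lambda>x. c)"
  by (intro lip_ae_diff_lipschitzian) auto

lemma lip_ae_diff_nth: "open U \<Longrightarrow> lip_ae_diff U (\<lambda>x::real^'n::finite. x $ i)"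
proof (intro lip_ae_diff_lipschitzian)
  show "lipschitzian_on UNIV (\<lambda>x::real^'n. x $ i)"
    by (rule lipschitzian_onI[of _ _ 1])
       (metis dist_norm mult_1 component_le_norm_cart vector_minus_component)
qed (auto intro!: bounded_linear_imp_differentiable bounded_linear_vec_nth)

section \<open>Partial derivatives and difference quotients\<close>

lemma partial_eqI:
  "(f has_derivative f') (at x) \<Longrightarrow> partial i f x = f' (axis i 1)"
  unfolding partial_def by (metis frechet_derivative_at)

lemma partial_mult:
  assumes "f differentiable (at x)" "g differentiable (at x)"
  shows "partial i (\<lambda>x. f x * g x) x = f x * partial i g x + partial i f x * g x"
proof -
  obtain f' g' where d: "(f has_derivative f') (at x)" "(g has_derivative g') (at x)"
    using assms unfolding differentiable_def by blast
  show ?thesis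
    using partial_eqI[OF has_derivative_mult[OF d]] partial_eqI[OF d(1)] partial_eqI[OF d(2)] by simp
qed

lemma partial_const [simp]: "partial i (\<lambda>x. c) x = 0"
  by (rule partial_eqI[THEN trans]) (auto intro: has_derivative_const)

lemma partial_nth: "partial i (\<lambda>x. x $ j) x = (if i = j then 1 else 0)"
proof -
  have "((\<lambda>x. x $ j) has_derivative (\<lambda>x. x $ j)) (at x)"
    by (intro bounded_linear_imp_has_derivative bounded_linear_vec_nth)
  from partial_eqI[OF this, of i] show ?thesis by (auto simp: axis_def)
qed

text \<open>Valid at points of non-differentiability too: the candidates for a derivative are the
  same for both functions, hence so is the one chosen by \<open>frechet_derivative\<close>.\<close>

lemma partial_cong:
  assumes "open U" "x \<in> U" "\<And>y. y \<in> U \<Longrightarrow> f y = g y"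
  shows "partial i f x = partial i g x"
proof -
  have "(f has_derivative f') (at x) \<longleftrightarrow> (g has_derivative f') (at x)" for f'
    using has_derivative_transform_within_open[OF _ assms(1,2)] assms(3) by metis
  then show ?thesis unfolding partial_def frechet_derivative_def by simp
qed

lemma difference_quotient_tendsto:
  fixes f :: "real^'n::finite \<Rightarrow> real"
  assumes "f differentiable (at x)" "h \<longlonglongrightarrow> 0" "\<And>n. h n \<noteq> 0"
  shows "(\<lambda>n. (f (x + h n *\<^sub>R axis i 1) - f x) / h n) \<longlonglongrightarrow> partial i f x"
proof -
  obtain f' where f': "(f has_derivative f') (at x)" using assms(1) unfolding differentiable_def by blast
  have l: "((\<lambda>t. x + t *\<^sub>R axis i 1) has_derivative (\<lambda>t. t *\<^sub>R axis i 1)) (at 0)"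
    by (auto intro!: derivative_eq_intros)
  have "((\<lambda>t. f (x + t *\<^sub>R axis i 1)) has_derivative (\<lambda>t. f' (t *\<^sub>R axis i 1))) (at 0)"
    by (rule has_derivative_compose[OF l, of f f']) (use f' in simp)
  moreover have "(\<lambda>t. f' (t *\<^sub>R axis i 1)) = (*) (partial i f x)"
    using partial_eqI[OF f', of i] linear_scale[OF has_derivative_linear[OF f']] by (auto simp: mult.commute)
  ultimately have "((\<lambda>t. f (x + t *\<^sub>R axis i 1)) has_real_derivative partial i f x) (at 0)"
    by (simp add: has_field_derivative_def)
  then have "((\<lambda>t. (f (x + t *\<^sub>R axis i 1) - f x) / t) \<longlongrightarrow> partial i f x) (at 0)"
    by (simp add: DERIV_def)
  moreover have "filterlim h (at 0) sequentially"
    using assms by (auto simp: filterlim_at)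
  ultimately show ?thesis by (rule filterlim_compose)
qed

section \<open>An integration by parts formula\<close>

lemma integral_translate_lborel:
  fixes f :: "'a::euclidean_space \<Rightarrow> real"
  assumes [measurable]: "f \<in> borel_measurable borel"
  shows "(LINT x|lborel. f (x + c)) = (LINT x|lborel. f x)"
  using integral_distr[of "(+) c" lborel borel f] by (simp add: lborel_distr_plus add.commute)

text \<open>The difference-quotient version of the formula is exact, by translation invariance.\<close>

lemma discrete_integration_by_parts:
  fixes \<psi> \<alpha> :: "'a::euclidean_space \<Rightarrow> real"
  assumes [measurable]: "\<psi> \<in> borel_measurable borel" "\<alpha> \<in> borel_measurable borel"
    and int: "\<And>a b. integrable lborel (\<lambda>x. \<psi> (x + a) * \<alpha> (x + b))"
  shows "(LINT x|lborel. (\<psi> (x + u) - \<psi> x) * (\<alpha> (x + v) - \<alpha> x)) =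
         (LINT x|lborel. (\<psi> (x - v) - \<psi> x) * (\<alpha> (x - u) - \<alpha> x))"
proof -
  define T where "T c = (LINT x|lborel. \<psi> x * \<alpha> (x + c))" for c
  have T: "(LINT x|lborel. \<psi> (x + a) * \<alpha> (x + b)) = T (b - a)" for a b
    unfolding T_def using integral_translate_lborel[of "\<lambda>x. \<psi> x * \<alpha> (x + (b - a))" a] by simp
  have ex: "(LINT x|lborel. (\<psi> (x + a) - \<psi> x) * (\<alpha> (x + b) - \<alpha> x)) = T (b - a) - T (- a) - T b + T 0" for a b
  proof -
    have "(LINT x|lborel. (\<psi> (x + a) - \<psi> x) * (\<alpha> (x + b) - \<alpha> x)) =
      (LINT x|lborel. \<psi> (x + a) * \<alpha> (x + b) - \<psi> (x + a) * \<alpha> (x + 0) - \<psi> (x + 0) * \<alpha> (x + b) + \<psi> (x + 0) * \<alpha> (x + 0))"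
      by (simp add: algebra_simps)
    also have "\<dots> = T (b - a) - T (0 - a) - T (b - 0) + T (0 - 0)"
      by (simp only: Bochner_Integration.integral_add Bochner_Integration.integral_diff
          Bochner_Integration.integrable_diff int T)
    finally show ?thesis by simp
  qed
  show ?thesis using ex[of u v] ex[of "- v" "- u"] by simp
qed

lemma difference_bound:
  assumes "loc_lip U f" "compact K" "K \<subseteq> U" "\<And>x. x \<notin> K \<Longrightarrow> f x = 0"
  obtains M d where "M \<ge> 0" "d > 0" "\<forall>x y. dist x y < d \<longrightarrow> \<bar>f y - f x\<bar> \<le> M * dist x y"
proof -
  obtain M d where "M \<ge> 0" "d > 0"
    and M: "\<forall>x\<in>K. \<forall>y. dist x y < d \<longrightarrow> y \<in> U \<and> \<bar>f y - f x\<bar> \<le> M * dist x y"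
    by (rule loc_lip_uniform[OF assms(1-3)])
  moreover have "\<bar>f y - f x\<bar> \<le> M * dist x y" if "dist x y < d" for x y
  proof (cases "x \<in> K \<or> y \<in> K")
    case True
    then show ?thesis using M that by (auto simp: dist_commute abs_minus_commute)
  next
    case False
    then show ?thesis using assms(4) \<open>M \<ge> 0\<close> by simp
  qed
  ultimately show thesis using that by blast
qed

lemma compact_neighbourhood:
  fixes K :: "'a::euclidean_space set"
  assumes "compact K" "open U" "K \<subseteq> U"
  obtains e where "e > 0" "compact {x + y |x y. x \<in> K \<and> y \<in> cball 0 e}" "{x + y |x y. x \<in> K \<and> y \<in> cball 0 e} \<subseteq> U"
proof -
  obtain e where "e > 0" "(\<Union>x\<in>K. ball x e) \<subseteq> U"
    using compact_subset_open_imp_ball_epsilon_subset[OF assms] by blast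
  then have "{x + y |x y. x \<in> K \<and> y \<in> cball 0 (e / 2)} \<subseteq> U"
    by (force simp: dist_norm)
  moreover have "compact {x + y |x y. x \<in> K \<and> y \<in> cball 0 (e / 2)}"
    by (intro compact_sums assms compact_cball)
  ultimately show thesis using that[of "e / 2"] \<open>e > 0\<close> by auto
qed

text \<open>For smooth functions this is the symmetry of second derivatives of \<alpha>, which do
  not exist here. Instead the exact identity for difference quotients is passed to the limit by
  dominated convergence; it matches forward steps on the left with backward steps, in exchanged
  directions, on the right.\<close>

lemma integration_by_parts_lip_ae_diff:
  fixes \<psi> \<alpha> :: "real^'n::finite \<Rightarrow> real"
  assumes "open U" and \<psi>: "lip_ae_diff U \<psi>" and \<alpha>: "lip_ae_diff U \<alpha>"
    and K: "compact K" "K \<subseteq> U" and supp: "\<And>x. x \<notin> K \<Longrightarrow> \<psi> x = 0"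
  shows "integrable lebesgue (\<lambda>x. partial i \<psi> x * partial j \<alpha> x)"
    and "(LINT x|lebesgue. partial i \<psi> x * partial j \<alpha> x) = (LINT x|lebesgue. partial j \<psi> x * partial i \<alpha> x)"
proof -
  obtain e where e: "e > 0" and cK: "compact {x + y |x y. x \<in> K \<and> y \<in> cball 0 e}"
    and KU: "{x + y |x y. x \<in> K \<and> y \<in> cball 0 e} \<subseteq> U"
    by (rule compact_neighbourhood[OF K(1) assms(1) K(2)])
  have \<psi>l: "loc_lip U \<psi>" and \<alpha>l: "loc_lip U \<alpha>" using \<psi> \<alpha> by (simp_all add: lip_ae_diff_def)
  define K' where "K' = {x + y |x y. x \<in> K \<and> y \<in> cball 0 e}"
  have K': "compact K'" "K' \<subseteq> U" using cK KU by (auto simp: K'_def)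
  have inK': "y \<in> K'" if "x \<in> K" "dist x y \<le> e" for x y
  proof -
    have "y = x + (y - x)" "y - x \<in> cball 0 e" using that by (simp_all add: dist_norm norm_minus_commute)
    then show ?thesis unfolding K'_def using that(1) by blast
  qed
  obtain M1 d1 where M1: "M1 \<ge> 0" "d1 > 0" "\<forall>x y. dist x y < d1 \<longrightarrow> \<bar>\<psi> y - \<psi> x\<bar> \<le> M1 * dist x y"
    by (rule difference_bound[OF \<psi>l K supp])
  obtain M2 d2 where M2: "M2 \<ge> 0" "d2 > 0" "\<forall>x\<in>K'. \<forall>y. dist x y < d2 \<longrightarrow> y \<in> U \<and> \<bar>\<alpha> y - \<alpha> x\<bar> \<le> M2 * dist x y"
    by (rule loc_lip_uniform[OF \<alpha>l K'])
  \<comment> \<open>Cutting \<alpha> off makes it bounded and measurable on the whole space. The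
    jump this creates at the boundary of \<open>K'\<close> is never seen: the quotient of \<psi>
    vanishes unless one of its points is in \<open>K\<close>, and then both points of the quotient
    of \<open>a\<close> lie in \<open>K'\<close>.\<close>
  define a where "a x = (if x \<in> K' then \<alpha> x else 0)" for x
  have borelK: "K \<in> sets borel" "K' \<in> sets borel" using K K' by (auto intro: borel_compact)
  have \<psi>c: "continuous_on K \<psi>" and \<alpha>c: "continuous_on K' \<alpha>"
    using continuous_on_subset[OF loc_lip_continuous_on[OF \<psi>l] K(2)]
      continuous_on_subset[OF loc_lip_continuous_on[OF \<alpha>l] K'(2)] by auto
  have [measurable]: "a \<in> borel_measurable borel"
  proof -
    have "a = (\<lambda>x. indicator K' x *\<^sub>R \<alpha> x)" by (auto simp: a_def indicator_def)
    then show ?thesis using borel_measurable_continuous_on_indicator[OF borelK(2) \<alpha>c] by simp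
  qed
  have [measurable]: "\<psi> \<in> borel_measurable borel"
  proof -
    have "\<psi> = (\<lambda>x. indicator K x *\<^sub>R \<psi> x)"
      by (rule ext, case_tac "x \<in> K") (auto simp: supp)
    then show ?thesis using borel_measurable_continuous_on_indicator[OF borelK(1) \<psi>c] by simp
  qed
  have "bounded (\<psi> ` K)" "bounded (\<alpha> ` K')"
    using compact_continuous_image[OF \<psi>c K(1)] compact_continuous_image[OF \<alpha>c K'(1)]
    by (auto intro: compact_imp_bounded)
  then obtain A B where "\<forall>x\<in>K. \<bar>\<psi> x\<bar> \<le> A" "\<forall>x\<in>K'. \<bar>\<alpha> x\<bar> \<le> B"
    unfolding bounded_iff by auto
  then have AB: "\<bar>\<psi> x\<bar> \<le> \<bar>A\<bar>" "\<bar>a x\<bar> \<le> \<bar>B\<bar>" for x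
    using supp[of x] by (cases "x \<in> K"; force simp: a_def)+
  have int: "integrable lborel (\<lambda>x. \<psi> (x + u) * a (x + v))" for u v
  proof (rule integrableI_bounded_set[where A = "(\<lambda>x. x - u) ` K" and B = "\<bar>A\<bar> * \<bar>B\<bar>"])
    have c: "compact ((\<lambda>x. x - u) ` K)"
      using K(1) by (intro compact_continuous_image continuous_intros)
    then show "(\<lambda>x. x - u) ` K \<in> sets lborel" by (simp add: borel_compact)
    show "emeasure lborel ((\<lambda>x. x - u) ` K) < \<infinity>" by (rule emeasure_compact_finite[OF c])
    show "AE x\<in>(\<lambda>x. x - u) ` K in lborel. norm (\<psi> (x + u) * a (x + v)) \<le> \<bar>A\<bar> * \<bar>B\<bar>"
      using AB by (intro AE_I2) (auto simp: abs_mult intro!: mult_mono)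
    have "\<psi> (x + u) = 0" if "x \<notin> (\<lambda>x. x - u) ` K" for x
    proof (rule supp)
      show "x + u \<notin> K" using that by (metis add_diff_cancel imageI)
    qed
    then show "AE x in lborel. x \<notin> (\<lambda>x. x - u) ` K \<longrightarrow> \<psi> (x + u) * a (x + v) = 0"
      by (intro AE_I2) auto
  qed measurable
  \<comment> \<open>At most two steps separate a point of \<open>K\<close> from the points that
    occur, hence e / 2; the other two bounds put the steps within reach of the Lipschitz
    estimates.\<close>
  define h where "h n = min (e / 2) (min (d1 / 2) (d2 / 2)) / real (n + 1)" for n
  have h: "h n > 0" "h n \<le> e / 2" "h n < d1" "h n < d2" for n
  proof -
    let ?m = "min (e / 2) (min (d1 / 2) (d2 / 2))"
    have m: "?m > 0" using e M1(2) M2(2) by auto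
    then show "h n > 0" unfolding h_def by simp
    have "h n \<le> ?m" unfolding h_def using m frac_le[of ?m ?m 1 "real (n + 1)"] by simp
    then show "h n \<le> e / 2" "h n < d1" "h n < d2" using M1(2) M2(2) by auto
  qed
  have h0: "h \<longlonglongrightarrow> 0"
    unfolding h_def using LIMSEQ_Suc[OF lim_const_over_n] by simp
  text \<open>\<open>q \<sigma> k l\<close> is the product of the two difference quotients with steps \<open>\<sigma> h\<close> in directions \<open>k\<close>, \<open>l\<close>.\<close>
  define q where "q \<sigma> k l n x = (\<psi> (x + (\<sigma> * h n) *\<^sub>R axis k 1) - \<psi> x) / (\<sigma> * h n) *
      ((a (x + (\<sigma> * h n) *\<^sub>R axis l 1) - a x) / (\<sigma> * h n))" for \<sigma> :: real and k l n x
  have ae\<psi>: "AE x in lebesgue. x \<in> U \<longrightarrow> \<psi> differentiable (at x)"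
    and ae\<alpha>: "AE x in lebesgue. x \<in> U \<longrightarrow> \<alpha> differentiable (at x)"
    using \<psi> \<alpha> by (auto simp: lip_ae_diff_def)
  have lim: "AE x in lebesgue. (\<lambda>n. q \<sigma> k l n x) \<longlonglongrightarrow> partial k \<psi> x * partial l \<alpha> x" if \<sigma>: "\<bar>\<sigma>\<bar> = 1" for \<sigma> k l
    using ae\<psi> ae\<alpha>
  proof eventually_elim
    case (elim x)
    have sh: "(\<lambda>n. \<sigma> * h n) \<longlonglongrightarrow> 0" "\<sigma> * h n \<noteq> 0" for n
      using tendsto_mult_right_zero[OF h0, of \<sigma>] h(1)[of n] \<sigma> by auto
    show ?case
    proof (cases "x \<in> K")
      case True
      have ball: "ball x e \<subseteq> K'" using inK'[OF True] by auto
      have d: "\<alpha> differentiable (at x)" "\<psi> differentiable (at x)" using elim True K by auto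
      have "a differentiable (at x)"
        by (rule differentiable_transform_within[OF d(1) e])
           (use ball e in \<open>auto simp: a_def dist_commute subset_eq\<close>)
      moreover have "partial l a x = partial l \<alpha> x"
        using ball e by (intro partial_cong[of "ball x e"]) (auto simp: a_def)
      ultimately show ?thesis
        unfolding q_def using tendsto_mult[OF difference_quotient_tendsto[OF d(2) sh, of k]
            difference_quotient_tendsto[OF _ sh, of a x l]] by simp
    next
      case False
      have oK: "open (- K)" using K(1) by (simp add: compact_imp_closed open_Compl)
      have "partial k \<psi> x = partial k (\<lambda>x. 0) x"
        using False supp by (intro partial_cong[OF oK]) auto
      moreover have "\<forall>\<^sub>F n in sequentially. q \<sigma> k l n x = 0"
      proof -
        have "(\<lambda>n. x + (\<sigma> * h n) *\<^sub>R axis k 1) \<longlonglongrightarrow> x + 0 *\<^sub>R axis k 1"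
          by (intro tendsto_intros sh)
        then have "\<forall>\<^sub>F n in sequentially. x + (\<sigma> * h n) *\<^sub>R axis k 1 \<in> - K"
          using False oK by (intro topological_tendstoD) auto
        then show ?thesis by eventually_elim (use supp False in \<open>auto simp: q_def\<close>)
      qed
      ultimately show ?thesis by (auto intro: tendsto_eventually)
    qed
  qed
  have bound: "norm (q \<sigma> k l n x) \<le> M1 * M2 * indicator K' x" if \<sigma>: "\<bar>\<sigma>\<bar> = 1" for \<sigma> k l n x
  proof (cases "x \<in> K \<or> x + (\<sigma> * h n) *\<^sub>R axis k 1 \<in> K")
    case True
    have d: "dist y (y + (\<sigma> * h n) *\<^sub>R axis m 1) = h n" for y :: "real^'n" and m
      using h(1)[of n] \<sigma> by (simp add: dist_norm abs_mult)
    have close: "\<exists>z\<in>K. dist z x \<le> h n" using True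
    proof
      assume "x \<in> K" then show ?thesis using h(1)[of n] by (intro bexI[of _ x]) auto
    next
      assume "x + (\<sigma> * h n) *\<^sub>R axis k 1 \<in> K" then show ?thesis using d[of x k]
        by (metis dist_commute order_refl)
    qed
    then obtain z where z: "z \<in> K" "dist z x \<le> h n" by blast
    have xK: "x \<in> K'" using inK'[OF z(1), of x] z h(2)[of n] e by linarith
    have yK: "x + (\<sigma> * h n) *\<^sub>R axis l 1 \<in> K'"
      using inK'[OF z(1)] z h(2)[of n] e d[of x l] dist_triangle[of z "x + (\<sigma> * h n) *\<^sub>R axis l 1" x]
      by force
    have "\<bar>\<psi> (x + (\<sigma> * h n) *\<^sub>R axis k 1) - \<psi> x\<bar> \<le> M1 * h n"
      using M1(3)[rule_format, of x "x + (\<sigma> * h n) *\<^sub>R axis k 1"] d[of x k] h(3)[of n] by metis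
    moreover have "\<bar>a (x + (\<sigma> * h n) *\<^sub>R axis l 1) - a x\<bar> \<le> M2 * h n"
      using M2(3)[rule_format, OF xK, of "x + (\<sigma> * h n) *\<^sub>R axis l 1"] d[of x l] h(4)[of n] xK yK by (simp add: a_def)
    ultimately have "\<bar>\<psi> (x + (\<sigma> * h n) *\<^sub>R axis k 1) - \<psi> x\<bar> / h n * (\<bar>a (x + (\<sigma> * h n) *\<^sub>R axis l 1) - a x\<bar> / h n) \<le> M1 * M2"
      using h(1)[of n] M1(1) M2(1) by (intro mult_mono) (auto simp: field_simps)
    then show ?thesis using xK h(1)[of n] \<sigma> by (simp add: q_def abs_mult)
  next
    case False
    then show ?thesis using supp M1(1) M2(1) by (simp add: q_def)
  qed
  have qm: "q \<sigma> k l n \<in> borel_measurable borel" for \<sigma> k l n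
    unfolding q_def[abs_def] by measurable
  have qml: "q \<sigma> k l n \<in> borel_measurable lebesgue" for \<sigma> k l n
    using qm[of \<sigma> k l n] by (auto intro: measurable_completion)
  have w: "integrable lebesgue (\<lambda>x. M1 * M2 * indicator K' x)"
    using K'(1) by (intro integrable_mult_right) (auto intro!: integrable_real_indicator
      simp: borelK emeasure_compact_finite[OF K'(1), unfolded infinity_ennreal_def])
  \<comment> \<open>\<open>partial\<close> is unspecified where differentiability fails, so
    measurability is obtained from the quotients, whose limit it is almost everywhere; the
    completeness of the measure does the rest.\<close>
  have fm: "(\<lambda>x. partial k \<psi> x * partial l \<alpha> x) \<in> borel_measurable lebesgue" for k l
  proof (rule borel_measurable_AE)
    show "(\<lambda>x. lim (\<lambda>n. q 1 k l n x)) \<in> borel_measurable lebesgue"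
      using qml by (rule borel_measurable_lim_metric)
    show "AE x in lebesgue. lim (\<lambda>n. q 1 k l n x) = partial k \<psi> x * partial l \<alpha> x"
      using lim[of 1 k l] by (auto elim!: eventually_mono intro: limI)
  qed
  note dc = integrable_dominated_convergence integral_dominated_convergence
  show "integrable lebesgue (\<lambda>x. partial i \<psi> x * partial j \<alpha> x)"
    using lim[of 1 i j] bound[of 1 i j]
    by (intro dc(1)[OF fm qml w]) auto
  have "(\<lambda>n. LINT x|lebesgue. q \<sigma> k l n x) \<longlonglongrightarrow> (LINT x|lebesgue. partial k \<psi> x * partial l \<alpha> x)"
    if "\<bar>\<sigma>\<bar> = 1" for \<sigma> k l
    using lim[OF that] bound[OF that] by (intro dc(2)[OF fm qml w]) auto
  from this[of 1 i j] this[of "-1" j i]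
  have l1: "(\<lambda>n. LINT x|lebesgue. q 1 i j n x) \<longlonglongrightarrow> (LINT x|lebesgue. partial i \<psi> x * partial j \<alpha> x)"
    and l2: "(\<lambda>n. LINT x|lebesgue. q (-1) j i n x) \<longlonglongrightarrow> (LINT x|lebesgue. partial j \<psi> x * partial i \<alpha> x)"
    by auto
  have "(LINT x|lebesgue. q 1 i j n x) = (LINT x|lebesgue. q (-1) j i n x)" for n
  proof -
    have "(LINT x|lborel. q 1 i j n x) = (LINT x|lborel. (\<psi> (x + h n *\<^sub>R axis i 1) - \<psi> x) * (a (x + h n *\<^sub>R axis j 1) - a x) / (h n)\<^sup>2)"
      by (simp add: q_def power2_eq_square)
    also have "\<dots> = (LINT x|lborel. (\<psi> (x - h n *\<^sub>R axis j 1) - \<psi> x) * (a (x - h n *\<^sub>R axis i 1) - a x) / (h n)\<^sup>2)"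
      using discrete_integration_by_parts[OF _ _ int, of "h n *\<^sub>R axis i 1" "h n *\<^sub>R axis j 1"] by simp
    also have "\<dots> = (LINT x|lborel. q (-1) j i n x)"
      by (simp add: q_def power2_eq_square)
    finally show ?thesis using qm by (simp add: integral_completion)
  qed
  then show "(LINT x|lebesgue. partial i \<psi> x * partial j \<alpha> x) = (LINT x|lebesgue. partial j \<psi> x * partial i \<alpha> x)"
    using l1 l2 LIMSEQ_unique by auto
qed

section \<open>Weak divergences on an open subset of the plane\<close>

lemma integrable_AE_lebesgue:
  fixes f :: "'a::euclidean_space \<Rightarrow> real"
  assumes "integrable lebesgue f" "AE x in lebesgue. f x = g x"
  shows "integrable lebesgue g" "(LINT x|lebesgue. g x) = (LINT x|lebesgue. f x)"
proof -
  have m: "f \<in> borel_measurable lebesgue" "g \<in> borel_measurable lebesgue"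
    using assms borel_measurable_AE by auto
  show "integrable lebesgue g" using integrable_cong_AE[OF m assms(2)] assms(1) by simp
  show "(LINT x|lebesgue. g x) = (LINT x|lebesgue. f x)" using integral_cong_AE[OF m assms(2)] by simp
qed

lemma integrable_mult_supported:
  fixes u :: "'a::euclidean_space \<Rightarrow> real"
  assumes "compact K" "continuous_on K u" "integrable lebesgue g" "\<And>x. x \<notin> K \<Longrightarrow> g x = 0"
  shows "integrable lebesgue (\<lambda>x. u x * g x)"
proof -
  have "bounded (u ` K)" using compact_continuous_image[OF assms(2,1)] by (rule compact_imp_bounded)
  then obtain B where B: "\<And>x. x \<in> K \<Longrightarrow> \<bar>u x\<bar> \<le> B" unfolding bounded_iff by auto
  have "(\<lambda>x. indicator K x *\<^sub>R u x) \<in> borel_measurable borel"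
    using assms by (intro borel_measurable_continuous_on_indicator borel_compact)
  then have [measurable]: "(\<lambda>x. indicator K x *\<^sub>R u x) \<in> borel_measurable lebesgue"
    by (auto intro: measurable_completion)
  have [measurable]: "g \<in> borel_measurable lebesgue" using assms(3) by simp
  have eq: "u x * g x = indicator K x *\<^sub>R u x * g x" for x
    using assms(4)[of x] by (cases "x \<in> K") auto
  show ?thesis
  proof (rule Bochner_Integration.integrable_bound)
    show "integrable lebesgue (\<lambda>x. B * g x)" using assms(3) by simp
    show "(\<lambda>x. u x * g x) \<in> borel_measurable lebesgue" unfolding eq by measurable
    show "AE x in lebesgue. norm (u x * g x) \<le> norm (B * g x)"
    proof (rule AE_I2)
      fix x show "norm (u x * g x) \<le> norm (B * g x)"
      proof (cases "x \<in> K")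
        case True
        then have "\<bar>u x\<bar> \<le> \<bar>B\<bar>" using B by fastforce
        then show ?thesis by (auto simp: abs_mult intro: mult_right_mono)
      qed (simp add: assms(4))
    qed
  qed
qed

lemma partial_zero_outside:
  assumes "compact K" "\<And>x. x \<notin> K \<Longrightarrow> f x = 0" "x \<notin> K"
  shows "partial i f x = 0"
proof -
  have "partial i f x = partial i (\<lambda>x. 0) x"
    using assms by (intro partial_cong[of "- K"]) (auto simp: compact_imp_closed open_Compl)
  then show ?thesis by simp
qed

text \<open>Lipschitz rather than smooth test functions, so that the product of a test function with
  a piecewise linear cutoff around the pole is still allowed.\<close>

definition admissible :: "(real^2) set \<Rightarrow> (real^2 \<Rightarrow> real) \<Rightarrow> bool" where
  "admissible U \<eta> \<longleftrightarrow> lip_ae_diff UNIV \<eta> \<and> (\<exists>K. compact K \<and> K \<subseteq> U \<and> (\<forall>x. x \<notin> K \<longrightarrow> \<eta> x = 0))"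

text \<open>Integrability belongs to the notion, because an integral that does not exist has the
  value 0 and additivity would fail. Both weak partial derivatives (with \<open>V\<close> along an
  axis) and the weak curl (with \<open>V\<close> a rotated field) are of this form.\<close>

definition weak_div :: "(real^2) set \<Rightarrow> (real^2 \<Rightarrow> real^2) \<Rightarrow> (real^2 \<Rightarrow> real) \<Rightarrow> bool" where
  "weak_div U V w \<longleftrightarrow> (\<forall>\<eta>. admissible U \<eta> \<longrightarrow>
     integrable lebesgue (\<lambda>x. V x $ 1 * partial 1 \<eta> x + V x $ 2 * partial 2 \<eta> x) \<and>
     integrable lebesgue (\<lambda>x. w x * \<eta> x) \<and>
     (LINT x|lebesgue. V x $ 1 * partial 1 \<eta> x + V x $ 2 * partial 2 \<eta> x) = - (LINT x|lebesgue. w x * \<eta> x))"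

lemma weak_div_zero: "weak_div U (\<lambda>x. 0) (\<lambda>x. 0)"
  by (simp add: weak_div_def)

lemma weak_div_add:
  assumes "weak_div U V w" "weak_div U V' w'"
  shows "weak_div U (\<lambda>x. V x + V' x) (\<lambda>x. w x + w' x)"
  unfolding weak_div_def
proof (intro allI impI)
  fix \<eta> assume \<eta>: "admissible U \<eta>"
  let ?f = "\<lambda>V x. V x $ 1 * partial 1 \<eta> x + V x $ 2 * partial 2 \<eta> x"
  have 1: "integrable lebesgue (?f V)" "integrable lebesgue (\<lambda>x. w x * \<eta> x)" "integral\<^sup>L lebesgue (?f V) = - (LINT x|lebesgue. w x * \<eta> x)"
    and 2: "integrable lebesgue (?f V')" "integrable lebesgue (\<lambda>x. w' x * \<eta> x)" "integral\<^sup>L lebesgue (?f V') = - (LINT x|lebesgue. w' x * \<eta> x)"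
    using assms \<eta> unfolding weak_div_def by blast+
  have eq: "?f (\<lambda>x. V x + V' x) = (\<lambda>x. ?f V x + ?f V' x)" "(\<lambda>x. (w x + w' x) * \<eta> x) = (\<lambda>x. w x * \<eta> x + w' x * \<eta> x)"
    by (auto simp: algebra_simps)
  show "integrable lebesgue (?f (\<lambda>x. V x + V' x)) \<and> integrable lebesgue (\<lambda>x. (w x + w' x) * \<eta> x) \<and>
     integral\<^sup>L lebesgue (?f (\<lambda>x. V x + V' x)) = - (LINT x|lebesgue. (w x + w' x) * \<eta> x)"
    unfolding eq
    by (simp only: Bochner_Integration.integral_add[OF 1(1) 2(1)] Bochner_Integration.integral_add[OF 1(2) 2(2)]
        Bochner_Integration.integrable_add[OF 1(1) 2(1)] Bochner_Integration.integrable_add[OF 1(2) 2(2)] 1(3) 2(3)) simp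
qed

lemma weak_div_sum:
  "(\<And>i. i \<in> I \<Longrightarrow> weak_div U (V i) (w i)) \<Longrightarrow> weak_div U (\<lambda>x. \<Sum>i\<in>I. V i x) (\<lambda>x. \<Sum>i\<in>I. w i x)"
  by (induction I rule: infinite_finite_induct) (auto intro: weak_div_add weak_div_zero)

lemma weak_div_cong_AE:
  assumes "weak_div U V w" "AE x in lebesgue. x \<in> U \<longrightarrow> V x = V' x" "AE x in lebesgue. x \<in> U \<longrightarrow> w x = w' x"
  shows "weak_div U V' w'"
  unfolding weak_div_def
proof (intro allI impI)
  fix \<eta> assume \<eta>: "admissible U \<eta>"
  then obtain K where K: "compact K" "K \<subseteq> U" "\<And>x. x \<notin> K \<Longrightarrow> \<eta> x = 0" unfolding admissible_def by blast
  let ?f = "\<lambda>V x. V x $ 1 * partial 1 \<eta> x + V x $ 2 * partial 2 \<eta> x"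
  have 1: "integrable lebesgue (?f V)" "integrable lebesgue (\<lambda>x. w x * \<eta> x)" "integral\<^sup>L lebesgue (?f V) = - (LINT x|lebesgue. w x * \<eta> x)"
    using assms \<eta> unfolding weak_div_def by blast+
  have 2: "AE x in lebesgue. ?f V x = ?f V' x"
    using assms(2)
  proof eventually_elim
    case (elim x)
    then show ?case using K(2) partial_zero_outside[OF K(1,3)] by (cases "x \<in> K") auto
  qed
  have 3: "AE x in lebesgue. w x * \<eta> x = w' x * \<eta> x"
    using assms(3)
  proof eventually_elim
    case (elim x)
    then show ?case using K(2,3) by (cases "x \<in> K") auto
  qed
  show "integrable lebesgue (?f V') \<and> integrable lebesgue (\<lambda>x. w' x * \<eta> x) \<and>
     integral\<^sup>L lebesgue (?f V') = - (LINT x|lebesgue. w' x * \<eta> x)"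
    using integrable_AE_lebesgue[OF 1(1) 2] integrable_AE_lebesgue[OF 1(2) 3] 1(3) by simp
qed

text \<open>\<open>d(\<beta> d\<alpha>) = d\<beta> \<and> d\<alpha>\<close>.\<close>

lemma weak_div_curl:
  assumes "open U" and \<beta>: "lip_ae_diff U \<beta>" and \<alpha>: "lip_ae_diff U \<alpha>"
  shows "weak_div U (\<lambda>x. vector [\<beta> x * partial 2 \<alpha> x, - \<beta> x * partial 1 \<alpha> x])
     (\<lambda>x. partial 1 \<beta> x * partial 2 \<alpha> x - partial 2 \<beta> x * partial 1 \<alpha> x)"
  unfolding weak_div_def
proof (intro allI impI)
  fix \<eta> assume adm: "admissible U \<eta>"
  then obtain K where K: "compact K" "K \<subseteq> U" and supp: "\<And>x. x \<notin> K \<Longrightarrow> \<eta> x = 0" unfolding admissible_def by blast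
  have \<eta>: "lip_ae_diff U \<eta>" using adm assms(1) by (auto simp: admissible_def intro: lip_ae_diff_subset)
  \<comment> \<open>Integration by parts is applied to \<beta> \<eta> in place of \<eta>; the
    product rule then separates the derivative of \<beta> from that of \<eta>, and the symmetric
    terms cancel.\<close>
  define \<psi> where "\<psi> x = \<beta> x * \<eta> x" for x
  have \<psi>: "lip_ae_diff U \<psi>" unfolding \<psi>_def[abs_def] by (rule lip_ae_diff_mult[OF \<beta> \<eta>])
  have supp\<psi>: "\<psi> x = 0" if "x \<notin> K" for x using supp[OF that] by (simp add: \<psi>_def)
  note ibp = integration_by_parts_lip_ae_diff[OF assms(1) \<psi> \<alpha> K supp\<psi>]
  have \<beta>c: "continuous_on K \<beta>"
    using \<beta> K by (metis lip_ae_diff_def loc_lip_continuous_on continuous_on_subset)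
  have int: "integrable lebesgue (\<lambda>x. \<beta> x * (partial i \<eta> x * partial j \<alpha> x))" for i j
    by (rule integrable_mult_supported[OF K(1) \<beta>c integration_by_parts_lip_ae_diff(1)[OF assms(1) \<eta> \<alpha> K supp]])
       (use partial_zero_outside[OF K(1) supp] in auto)
  have eq: "AE x in lebesgue. partial i \<psi> x * partial j \<alpha> x - \<beta> x * (partial i \<eta> x * partial j \<alpha> x)
      = partial i \<beta> x * partial j \<alpha> x * \<eta> x" for i j
    using \<beta>[unfolded lip_ae_diff_def, THEN conjunct2] \<eta>[unfolded lip_ae_diff_def, THEN conjunct2]
  proof eventually_elim
    case (elim x)
    show ?case
    proof (cases "x \<in> K")
      case True
      then have "partial i \<psi> x = \<beta> x * partial i \<eta> x + partial i \<beta> x * \<eta> x"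
        unfolding \<psi>_def[abs_def] using elim K by (intro partial_mult) auto
      then show ?thesis by (simp add: algebra_simps)
    next
      case False
      then show ?thesis
        using partial_zero_outside[OF K(1) supp False] partial_zero_outside[OF K(1) supp\<psi> False] supp[OF False]
        by simp
    qed
  qed
  note I = integrable_AE_lebesgue[OF Bochner_Integration.integrable_diff[OF ibp(1) int] eq]
  let ?I = "\<lambda>i j. LINT x|lebesgue. \<beta> x * (partial i \<eta> x * partial j \<alpha> x)"
  have i2: "(LINT x|lebesgue. partial i \<beta> x * partial j \<alpha> x * \<eta> x) = (LINT x|lebesgue. partial i \<psi> x * partial j \<alpha> x) - ?I i j" for i j
    using I(2)[of i j] Bochner_Integration.integral_diff[OF ibp(1)[of i j] int[of i j]] by simp
  have e1: "(\<lambda>x. (vector [\<beta> x * partial 2 \<alpha> x, - \<beta> x * partial 1 \<alpha> x] :: real^2) $ 1 * partial 1 \<eta> x +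
       (vector [\<beta> x * partial 2 \<alpha> x, - \<beta> x * partial 1 \<alpha> x] :: real^2) $ 2 * partial 2 \<eta> x)
     = (\<lambda>x. \<beta> x * (partial 1 \<eta> x * partial 2 \<alpha> x) - \<beta> x * (partial 2 \<eta> x * partial 1 \<alpha> x))"
    by (auto simp: algebra_simps)
  have e2: "(\<lambda>x. (partial 1 \<beta> x * partial 2 \<alpha> x - partial 2 \<beta> x * partial 1 \<alpha> x) * \<eta> x) =
     (\<lambda>x. partial 1 \<beta> x * partial 2 \<alpha> x * \<eta> x - partial 2 \<beta> x * partial 1 \<alpha> x * \<eta> x)"
    by (auto simp: algebra_simps)
  show "integrable lebesgue (\<lambda>x. (vector [\<beta> x * partial 2 \<alpha> x, - \<beta> x * partial 1 \<alpha> x] :: real^2) $ 1 * partial 1 \<eta> x +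
       (vector [\<beta> x * partial 2 \<alpha> x, - \<beta> x * partial 1 \<alpha> x] :: real^2) $ 2 * partial 2 \<eta> x) \<and>
     integrable lebesgue (\<lambda>x. (partial 1 \<beta> x * partial 2 \<alpha> x - partial 2 \<beta> x * partial 1 \<alpha> x) * \<eta> x) \<and>
     (LINT x|lebesgue. (vector [\<beta> x * partial 2 \<alpha> x, - \<beta> x * partial 1 \<alpha> x] :: real^2) $ 1 * partial 1 \<eta> x +
       (vector [\<beta> x * partial 2 \<alpha> x, - \<beta> x * partial 1 \<alpha> x] :: real^2) $ 2 * partial 2 \<eta> x) =
     - (LINT x|lebesgue. (partial 1 \<beta> x * partial 2 \<alpha> x - partial 2 \<beta> x * partial 1 \<alpha> x) * \<eta> x)"
    unfolding e1 e2
    using int I(1) ibp(2)[of 1 2] i2[of 1 2] i2[of 2 1] by simp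
qed

text \<open>The case of \<open>weak_div_curl\<close> in which \<alpha> is a signed coordinate:
  \<open>j\<close> is the index other than \<open>i\<close>, and the sign \<sigma> makes the rotated
  gradient of \<alpha> the unit vector in direction \<open>i\<close>.\<close>

lemma weak_div_grad:
  assumes "open U" and u: "lip_ae_diff U u"
  shows "weak_div U (\<lambda>x. axis i (u x)) (partial i u)"
proof -
  define j :: 2 where "j = (if i = 1 then 2 else 1)"
  have ij: "i = 1 \<or> i = 2" using exhaust_2 by blast
  define \<sigma> :: real where "\<sigma> = (if i = 1 then 1 else - 1)"
  have l: "lip_ae_diff U (\<lambda>x. \<sigma> * x $ j)"
    using assms(1) by (intro lip_ae_diff_mult lip_ae_diff_const lip_ae_diff_nth)
  have p: "partial k (\<lambda>x. \<sigma> * x $ j) x = (if k = j then \<sigma> else 0)" for k x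
  proof -
    have "(\<lambda>x::real^2. x $ j) differentiable (at x)"
      by (intro bounded_linear_imp_differentiable bounded_linear_vec_nth)
    then show ?thesis by (subst partial_mult) (auto simp: partial_nth)
  qed
  show ?thesis
  proof (rule weak_div_cong_AE[OF weak_div_curl[OF assms(1) u l]]; rule AE_I2; rule impI)
    fix x
    show "vector [u x * partial 2 (\<lambda>x. \<sigma> * x $ j) x, - u x * partial 1 (\<lambda>x. \<sigma> * x $ j) x] = axis i (u x)"
      unfolding p using ij by (auto simp: vec_eq_iff forall_2 j_def \<sigma>_def axis_def)
    show "partial 1 u x * partial 2 (\<lambda>x. \<sigma> * x $ j) x - partial 2 u x * partial 1 (\<lambda>x. \<sigma> * x $ j) x = partial i u x"
      unfolding p using ij by (auto simp: j_def \<sigma>_def)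
  qed
qed

subsection \<open>Test functions\<close>

lemma frechet_derivative_partial:
  assumes "f differentiable (at x)"
  shows "(f has_derivative (\<lambda>h. \<Sum>i\<in>UNIV. h $ i * partial i f x)) (at x)"
proof -
  obtain f' where f': "(f has_derivative f') (at x)" using assms unfolding differentiable_def by blast
  have lin: "linear f'" using f' by (rule has_derivative_linear)
  have "f' h = (\<Sum>i\<in>UNIV. h $ i * partial i f x)" for h
  proof -
    have "f' h = f' (\<Sum>i\<in>UNIV. h $ i *\<^sub>R axis i 1)"
      using basis_expansion[of h] by (simp add: scalar_mult_eq_scaleR)
    also have "\<dots> = (\<Sum>i\<in>UNIV. h $ i * partial i f x)"
      by (simp add: linear_sum[OF lin] linear_scale[OF lin] partial_eqI[OF f'])
    finally show ?thesis .
  qed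
  then have "f' = (\<lambda>h. \<Sum>i\<in>UNIV. h $ i * partial i f x)" by blast
  then show ?thesis using f' by simp
qed

lemma Ck_lip_ae_diff:
  assumes "Ck 1 f"
  shows "lip_ae_diff UNIV f"
proof -
  have d: "f differentiable (at x)" and c: "continuous_on UNIV (partial i f)" for x i
    using assms by (auto simp: One_nat_def simp del: One_nat_def[symmetric])
  have "loc_lip UNIV f" unfolding loc_lip_def
  proof
    fix x
    have "\<exists>B. \<forall>y\<in>cball x 1. \<bar>partial i f y\<bar> \<le> B" for i
    proof -
      have "bounded (partial i f ` cball x 1)"
        by (intro compact_imp_bounded compact_continuous_image compact_cball continuous_on_subset[OF c]) auto
      then show ?thesis unfolding bounded_iff by auto
    qed
    then obtain B where B: "\<And>i y. y \<in> cball x 1 \<Longrightarrow> \<bar>partial i f y\<bar> \<le> B i" by metis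
    define M where "M = (\<Sum>i\<in>UNIV. B i)"
    have "norm (f y - f z) \<le> M * norm (y - z)" if "y \<in> ball x 1" "z \<in> ball x 1" for y z
    proof (rule differentiable_bound[OF convex_ball _ _ that(1) that(2)])
      fix v assume v: "v \<in> ball x 1"
      show "(f has_derivative (\<lambda>h. \<Sum>i\<in>UNIV. h $ i * partial i f v)) (at v within ball x 1)"
        using frechet_derivative_partial[OF d] by (rule has_derivative_at_withinI)
      show "onorm (\<lambda>h. \<Sum>i\<in>UNIV. h $ i * partial i f v) \<le> M"
      proof (rule onorm_le)
        fix h :: "real^'a"
        have "norm (\<Sum>i\<in>UNIV. h $ i * partial i f v) \<le> (\<Sum>i\<in>UNIV. \<bar>h $ i\<bar> * \<bar>partial i f v\<bar>)"
          by (metis (no_types, lifting) abs_mult norm_sum real_norm_def sum.cong)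
        also have "\<dots> \<le> (\<Sum>i\<in>UNIV. norm h * B i)"
          using v B by (intro sum_mono mult_mono component_le_norm_cart) auto
        finally show "norm (\<Sum>i\<in>UNIV. h $ i * partial i f v) \<le> M * norm h"
          by (simp add: M_def sum_distrib_left mult.commute)
      qed
    qed
    then show "\<exists>r>0. ball x r \<subseteq> UNIV \<and> lipschitzian_on (ball x r) f"
      by (intro exI[of _ 1] conjI lipschitzian_onI[of _ _ M]) (auto simp: dist_norm)
  qed
  then show ?thesis using d by (simp add: lip_ae_diff_def)
qed

lemma test_function_admissible:
  assumes "\<phi> \<in> test_functions \<Omega>" "closure {x. \<phi> x \<noteq> 0} \<subseteq> U"
  shows "admissible U \<phi>"
proof -
  have "Ck 1 \<phi>" and "compact (closure {x. \<phi> x \<noteq> 0})" using assms by (auto simp: test_functions_def)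
  moreover have "\<phi> x = 0" if "x \<notin> closure {x. \<phi> x \<noteq> 0}" for x
    using that closure_subset[of "{x. \<phi> x \<noteq> 0}"] by blast
  ultimately show ?thesis
    unfolding admissible_def using assms(2) Ck_lip_ae_diff by blast
qed

lemma Ck_const: "Ck k (\<lambda>x::real^'n::finite. c)"
proof (induction k arbitrary: c)
  case (Suc k)
  have "partial i (\<lambda>x::real^'n. c) = (\<lambda>x. 0)" for i by (rule ext) simp
  then show ?case using Suc by simp
qed simp

lemma Ck_Suc_imp: "Ck (Suc k) f \<Longrightarrow> Ck k f"
proof (induction k arbitrary: f)
  case 0
  then show ?case
    by (auto intro!: continuous_at_imp_continuous_on differentiable_imp_continuous_within)
next
  case (Suc k)
  have "Ck k (partial i f)" for i using Suc by auto
  then show ?case using Suc.prems by simp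
qed

lemma Ck_add: "Ck k f \<Longrightarrow> Ck k g \<Longrightarrow> Ck k (\<lambda>x. f x + g x)"
proof (induction k arbitrary: f g)
  case 0
  then show ?case by (auto intro: continuous_intros)
next
  case (Suc k)
  have "partial i (\<lambda>x. f x + g x) = (\<lambda>x. partial i f x + partial i g x)" for i
  proof
    fix x
    obtain f' g' where d: "(f has_derivative f') (at x)" "(g has_derivative g') (at x)"
      using Suc.prems unfolding Ck.simps differentiable_def by blast
    show "partial i (\<lambda>x. f x + g x) x = partial i f x + partial i g x"
      using partial_eqI[OF has_derivative_add[OF d]] partial_eqI[OF d(1)] partial_eqI[OF d(2)] by simp
  qed
  then show ?case using Suc by auto
qed

lemma Ck_mult: "Ck k f \<Longrightarrow> Ck k g \<Longrightarrow> Ck k (\<lambda>x. f x * g x)"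
proof (induction k arbitrary: f g)
  case 0
  then show ?case by (auto intro: continuous_intros)
next
  case (Suc k)
  have "partial i (\<lambda>x. f x * g x) = (\<lambda>x. f x * partial i g x + partial i f x * g x)" for i
    using Suc.prems by (intro ext partial_mult) auto
  moreover have "Ck k (\<lambda>x. f x * partial i g x + partial i f x * g x)" for i
    using Suc.prems Ck_Suc_imp[OF Suc.prems(1)] Ck_Suc_imp[OF Suc.prems(2)]
    by (intro Ck_add Suc.IH) auto
  moreover have "(\<lambda>x. f x * g x) differentiable (at x)" for x
    using Suc.prems by (intro differentiable_mult) auto
  ultimately show ?case by simp
qed

lemma Ck_nth: "Ck k (\<lambda>x::real^'n::finite. x $ i)"
proof (cases k)
  case 0
  then show ?thesis by (auto intro: continuous_intros)
next
  case (Suc m)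
  have "partial j (\<lambda>x::real^'n. x $ i) = (\<lambda>x. if j = i then 1 else 0)" for j
    by (rule ext) (simp add: partial_nth)
  then show ?thesis
    by (auto simp: Suc Ck_const intro!: bounded_linear_imp_differentiable bounded_linear_vec_nth)
qed

section \<open>Smooth bump functions\<close>

definition flat :: "nat \<Rightarrow> real \<Rightarrow> real" where
  "flat k t = (if t > 0 then (1 / t) ^ k * exp (- 1 / t) else 0)"

text \<open>With n = k + 1, the inequality y <= exp y at y = 1 / (t n), raised to the n-th power,
  gives (1 / t)^n <= n^n exp (1 / t).\<close>

lemma flat_bound: "\<bar>flat k t\<bar> \<le> real (Suc k) ^ Suc k * \<bar>t\<bar>"
proof (cases "t > 0")
  case True
  let ?n = "Suc k"
  define N where "N = real ?n ^ ?n"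
  have N: "N > 0" by (simp add: N_def)
  have "(1 / t) ^ ?n / N = (1 / t / real ?n) ^ ?n" unfolding N_def by (rule power_divide[symmetric])
  also have "\<dots> \<le> exp (1 / t / real ?n) ^ ?n"
  proof (rule power_mono)
    show "1 / t / real ?n \<le> exp (1 / t / real ?n)" using exp_ge_add_one_self[of "1 / t / real ?n"] by linarith
  qed (use True in simp)
  also have "\<dots> = exp (1 / t)" by (rule exp_divide_power_eq) simp
  finally have le: "(1 / t) ^ ?n \<le> exp (1 / t) * N" using N by (simp only: pos_divide_le_eq)
  have "(1 / t) ^ k * exp (- 1 / t) = (1 / t) ^ ?n * (t * exp (- 1 / t))" using True by simp
  also have "\<dots> \<le> exp (1 / t) * N * (t * exp (- 1 / t))"
    using le True by (intro mult_right_mono) auto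
  also have "\<dots> = N * t * exp (1 / t + - 1 / t)" by (simp only: exp_add mult_ac)
  also have "\<dots> = N * t" by simp
  finally show ?thesis using True unfolding N_def[symmetric] by (simp add: flat_def)
next
  case False
  then have "flat k t = 0" by (simp add: flat_def)
  moreover have "0 \<le> real (Suc k) ^ Suc k * \<bar>t\<bar>" by (intro mult_nonneg_nonneg) auto
  ultimately show ?thesis by simp
qed

text \<open>The span of the family is closed under differentiation, so the smoothness of bumps can
  be proved by an induction that treats all k at once. At t = 0 the difference quotient of
  \<open>flat k\<close> is \<open>flat (k + 1)\<close>, which tends to 0 by
  \<open>flat_bound\<close>.\<close>

lemma flat_has_derivative:
  "(flat k has_real_derivative flat (k + 2) t - real k * flat (k + 1) t) (at t)"
proof -
  consider "t > 0" | "t < 0" | "t = 0" by linarith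
  then show ?thesis
  proof cases
    case 1
    have "((\<lambda>t. (1 / t) ^ k * exp (- 1 / t)) has_real_derivative flat (k + 2) t - real k * flat (k + 1) t) (at t)"
    proof -
      have a: "((\<lambda>t. 1 / t) has_real_derivative (- ((1 / t) ^ 2))) (at t)"
        using 1 by (auto intro!: derivative_eq_intros simp: power2_eq_square)
      have b: "((\<lambda>t. exp (- (1 / t))) has_real_derivative exp (- (1 / t)) * (1 / t) ^ 2) (at t)"
        using DERIV_chain2[OF DERIV_exp DERIV_minus[OF a]] by simp
      have c: "((\<lambda>t. (1 / t) ^ k) has_real_derivative (- (real k * (1 / t) ^ (k + 1)))) (at t)"
        by (rule DERIV_cong[OF DERIV_power[OF a, of k]])
           (cases k; simp add: power2_eq_square)
      show ?thesis
        using 1 DERIV_mult[OF c b]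
        by (simp add: flat_def algebra_simps power_add power2_eq_square)
    qed
    then show ?thesis
      by (rule DERIV_cong_ev[OF refl _ refl, THEN iffD1, rotated])
         (rule eventually_mono[OF eventually_nhds_in_open[of "{0<..}"]], use 1 in \<open>auto simp: flat_def\<close>)
  next
    case 2
    have "((\<lambda>t. 0) has_real_derivative flat (k + 2) t - real k * flat (k + 1) t) (at t)"
      using 2 by (simp add: flat_def)
    then show ?thesis
      by (rule DERIV_cong_ev[OF refl _ refl, THEN iffD1, rotated])
         (rule eventually_mono[OF eventually_nhds_in_open[of "{..<0}"]], use 2 in \<open>auto simp: flat_def\<close>)
  next
    case 3
    have "((\<lambda>h. (flat k (0 + h) - flat k 0) / h) \<longlongrightarrow> 0) (at 0)"
    proof (rule Lim_null_comparison)
      have "norm ((flat k (0 + h) - flat k 0) / h) \<le> real (Suc (k + 1)) ^ Suc (k + 1) * \<bar>h\<bar>" if "h \<noteq> 0" for h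
      proof -
        have "(flat k (0 + h) - flat k 0) / h = flat (k + 1) h" using that by (simp add: flat_def)
        then show ?thesis unfolding real_norm_def by (simp only: flat_bound)
      qed
      then show "\<forall>\<^sub>F h in at 0. norm ((flat k (0 + h) - flat k 0) / h) \<le> real (Suc (k + 1)) ^ Suc (k + 1) * \<bar>h\<bar>"
        unfolding eventually_at by (intro exI[of _ 1]) auto
      have "((\<lambda>h::real. real (Suc (k + 1)) ^ Suc (k + 1) * \<bar>h\<bar>) \<longlongrightarrow> real (Suc (k + 1)) ^ Suc (k + 1) * \<bar>0\<bar>) (at 0)"
        by (intro tendsto_intros)
      then show "((\<lambda>h::real. real (Suc (k + 1)) ^ Suc (k + 1) * \<bar>h\<bar>) \<longlongrightarrow> 0) (at 0)" by simp
    qed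
    then show ?thesis using 3 by (simp add: DERIV_def flat_def)
  qed
qed

text \<open>The squared distance is written out as a polynomial in the coordinates, which is the
  form that \<open>Ck_bump\<close> differentiates; \<open>bump_eq\<close> leads back to
  \<open>dist\<close>.\<close>

definition bump :: "real^'n::finite \<Rightarrow> real \<Rightarrow> real^'n \<Rightarrow> real" where
  "bump a \<rho> x = flat 0 (1 - (\<Sum>i\<in>UNIV. (x $ i - a $ i)\<^sup>2) / \<rho>\<^sup>2)"

lemma bump_eq: "bump a \<rho> x = flat 0 (1 - (dist x a)\<^sup>2 / \<rho>\<^sup>2)"
proof -
  have "(dist x a)\<^sup>2 = (\<Sum>i\<in>UNIV. (x $ i - a $ i)\<^sup>2)"
    by (simp add: dist_vec_def L2_set_def sum_nonneg dist_real_def)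
  then show ?thesis by (simp add: bump_def)
qed

lemma Ck_bump: "Ck m (bump a \<rho>)"
proof -
  define g where "g x = 1 - (\<Sum>i\<in>UNIV. (x $ i - a $ i)\<^sup>2) / \<rho>\<^sup>2" for x
  have g': "(g has_derivative (\<lambda>h. - (\<Sum>i\<in>UNIV. 2 * h $ i * (x $ i - a $ i)) / \<rho>\<^sup>2)) (at x)" for x
    unfolding g_def
    by (auto intro!: derivative_eq_intros bounded_linear_imp_has_derivative bounded_linear_vec_nth
        simp: algebra_simps divide_inverse)
  have "Ck m (\<lambda>x. flat k (g x))" for k
  proof (induction m arbitrary: k)
    case 0
    have "continuous_on UNIV (flat k)"
      by (rule continuous_at_imp_continuous_on) (use DERIV_isCont[OF flat_has_derivative] in blast)
    moreover have "continuous_on UNIV g"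
      by (rule continuous_at_imp_continuous_on) (use has_derivative_continuous[OF g'] in blast)
    ultimately show ?case using continuous_on_compose2[of UNIV "flat k" UNIV g] by auto
  next
    case (Suc m)
    have d: "((\<lambda>x. flat k (g x)) has_derivative
        (\<lambda>h. (flat (k + 2) (g x) - real k * flat (k + 1) (g x)) * (- (\<Sum>i\<in>UNIV. 2 * h $ i * (x $ i - a $ i)) / \<rho>\<^sup>2))) (at x)" for x
      by (rule has_derivative_compose[OF g' flat_has_derivative[unfolded has_field_derivative_def]])
    have "partial j (\<lambda>x. flat k (g x)) = (\<lambda>x. (flat (k + 2) (g x) + (- real k) * flat (k + 1) (g x)) * ((- 2 / \<rho>\<^sup>2) * (x $ j + - (a $ j))))" for j
    proof
      fix x
      have "(\<Sum>i\<in>UNIV. 2 * axis j 1 $ i * (x $ i - a $ i)) = (\<Sum>i\<in>UNIV. if i = j then 2 * (x $ j - a $ j) else 0)"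
        by (intro sum.cong) (auto simp: axis_def)
      then have S: "(\<Sum>i\<in>UNIV. 2 * axis j 1 $ i * (x $ i - a $ i)) = 2 * (x $ j - a $ j)" by simp
      show "partial j (\<lambda>x. flat k (g x)) x = (flat (k + 2) (g x) + (- real k) * flat (k + 1) (g x)) * ((- 2 / \<rho>\<^sup>2) * (x $ j + - (a $ j)))"
        unfolding partial_eqI[OF d] S by (simp add: algebra_simps diff_divide_distrib)
    qed
    moreover have "Ck m (\<lambda>x. (flat (k + 2) (g x) + (- real k) * flat (k + 1) (g x)) * ((- 2 / \<rho>\<^sup>2) * (x $ j + - (a $ j))))" for j
      by (intro Ck_mult Ck_add Ck_const Ck_nth Suc)
    ultimately show ?case using d by (auto simp: differentiable_def)
  qed
  from this[of 0] show ?thesis unfolding g_def bump_def[abs_def] .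
qed

lemma bump_bounds:
  assumes "\<rho> > 0"
  shows "0 \<le> bump a \<rho> x" "bump a \<rho> x \<le> 1" "dist x a \<ge> \<rho> \<Longrightarrow> bump a \<rho> x = 0"
    "dist x a \<le> \<rho> / 2 \<Longrightarrow> exp (- 4 / 3) \<le> bump a \<rho> x"
proof -
  show "0 \<le> bump a \<rho> x" by (simp add: bump_eq flat_def)
  show "bump a \<rho> x \<le> 1" by (simp add: bump_eq flat_def)
  show "bump a \<rho> x = 0" if "dist x a \<ge> \<rho>"
  proof -
    have "1 \<le> (dist x a)\<^sup>2 / \<rho>\<^sup>2"
      using that assms by (subst le_divide_eq_1_pos) (auto intro: power_mono)
    then show ?thesis unfolding bump_eq flat_def by simp
  qed
  show "exp (- 4 / 3) \<le> bump a \<rho> x" if "dist x a \<le> \<rho> / 2"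
  proof -
    have "(dist x a)\<^sup>2 \<le> (\<rho> / 2)\<^sup>2" using that by (intro power_mono) auto
    then have "(dist x a)\<^sup>2 / \<rho>\<^sup>2 \<le> (\<rho> / 2)\<^sup>2 / \<rho>\<^sup>2" by (intro divide_right_mono) auto
    also have "(\<rho> / 2)\<^sup>2 / \<rho>\<^sup>2 = 1 / 4" using assms by (simp add: power2_eq_square)
    finally have le: "(dist x a)\<^sup>2 / \<rho>\<^sup>2 \<le> 1 / 4" .
    \<comment> \<open>Within half the radius the argument of \<open>flat 0\<close> is at least 3 /
      4, which is the origin of the constant exp (- 4 / 3).\<close>
    define T where "T = 1 - (dist x a)\<^sup>2 / \<rho>\<^sup>2"
    have T: "T \<ge> 3 / 4" using le by (simp add: T_def)
    then have "1 / T \<le> 1 / (3 / 4)" by (intro divide_left_mono) auto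
    moreover have "bump a \<rho> x = exp (- 1 / T)"
      using T unfolding bump_eq T_def[symmetric] by (simp add: flat_def)
    ultimately show ?thesis by simp
  qed
qed

lemma bump_support:
  assumes "\<rho> > 0"
  shows "closure {x. bump a \<rho> x \<noteq> 0} \<subseteq> cball a \<rho>"
proof (rule closure_minimal)
  show "{x. bump a \<rho> x \<noteq> 0} \<subseteq> cball a \<rho>"
  proof
    fix x assume "x \<in> {x. bump a \<rho> x \<noteq> 0}"
    then have "\<not> dist x a \<ge> \<rho>" using bump_bounds(3)[OF assms] by blast
    then show "x \<in> cball a \<rho>" by (simp add: dist_commute)
  qed
qed simp

lemma bump_test_function:
  assumes "\<rho> > 0" "cball a \<rho> \<subseteq> \<Omega>"
  shows "bump a \<rho> \<in> test_functions \<Omega>"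
proof -
  have "compact (closure {x. bump a \<rho> x \<noteq> 0})"
    by (rule compact_closure[THEN iffD2])
       (rule bounded_subset[OF bounded_cball closure_subset[THEN subset_trans, OF bump_support[OF assms(1)]]])
  then show ?thesis
    unfolding test_functions_def using Ck_bump bump_support[OF assms(1)] assms(2) by blast
qed

subsection \<open>Removing a point\<close>

lemma integral_lebesgue_on_supported:
  fixes f :: "'a::euclidean_space \<Rightarrow> real"
  assumes "open \<Omega>" "\<And>x. x \<notin> \<Omega> \<Longrightarrow> f x = 0"
  shows "(LINT x|lebesgue_on \<Omega>. f x) = (LINT x|lebesgue. f x)"
proof -
  have "(\<lambda>x. indicator \<Omega> x *\<^sub>R f x) = f" using assms(2) by (auto simp: indicator_def fun_eq_iff)
  then show ?thesis using assms(1) by (subst integral_restrict_space) auto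
qed

lemma AE_not_negligible: "negligible N \<Longrightarrow> AE x in lebesgue. x \<notin> N"
  by (simp add: AE_not_in negligible_iff_null_sets)

lemma AE_not_point: "AE x in lebesgue. x \<noteq> (a::'a::euclidean_space)"
  using AE_not_negligible[OF negligible_sing[of a]] by simp

lemma differentiable_transform_open:
  assumes "f differentiable (at x)" "open S" "x \<in> S" "\<And>y. y \<in> S \<Longrightarrow> f y = g y"
  shows "g differentiable (at x)"
  using assms unfolding differentiable_def by (metis has_derivative_transform_within_open)

lemma measurable_lebesgue_on_minus_point:
  fixes f :: "'a::euclidean_space \<Rightarrow> 'b::euclidean_space"
  assumes "open \<Omega>" "(\<lambda>x. indicator (\<Omega> - {a}) x *\<^sub>R f x) \<in> borel_measurable lebesgue"
  shows "f \<in> borel_measurable (lebesgue_on \<Omega>)"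
proof -
  from AE_not_point have "AE x in lebesgue. indicator (\<Omega> - {a}) x *\<^sub>R f x = indicator \<Omega> x *\<^sub>R f x"
    by eventually_elim (auto simp: indicator_def)
  then have "(\<lambda>x. indicator \<Omega> x *\<^sub>R f x) \<in> borel_measurable lebesgue"
    by (rule borel_measurable_AE[OF assms(2)])
  then show ?thesis using assms(1) by (subst borel_measurable_restrict_space_iff) auto
qed

lemma L2_bounded:
  fixes f :: "'a::euclidean_space \<Rightarrow> 'b::euclidean_space"
  assumes "open \<Omega>" "bounded \<Omega>"
    and m: "(\<lambda>x. indicator (\<Omega> - {a}) x *\<^sub>R f x) \<in> borel_measurable lebesgue"
    and b: "\<And>x. x \<in> \<Omega> - {a} \<Longrightarrow> norm (f x) \<le> B"
  shows "f \<in> L2 \<Omega>"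
proof -
  have fm: "f \<in> borel_measurable (lebesgue_on \<Omega>)" by (rule measurable_lebesgue_on_minus_point[OF assms(1) m])
  have fin: "emeasure (lebesgue_on \<Omega>) \<Omega> < \<infinity>"
    using assms(1,2) by (auto simp: emeasure_restrict_space emeasure_bounded_finite[OF assms(2), unfolded infinity_ennreal_def] infinity_ennreal_def)
  have "AE x in lebesgue. x \<in> \<Omega> \<longrightarrow> x \<noteq> a" using AE_not_point[of a] by eventually_elim auto
  then have "AE x in lebesgue_on \<Omega>. x \<noteq> a"
    using assms(1) by (subst AE_restrict_space_iff) auto
  then have ae: "AE x in lebesgue_on \<Omega>. x \<in> \<Omega> \<longrightarrow> norm ((norm (f x))\<^sup>2) \<le> B\<^sup>2"
  proof eventually_elim
    case (elim x)
    then show ?case using b[of x] by (auto intro!: power_mono)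
  qed
  have "integrable (lebesgue_on \<Omega>) (\<lambda>x. (norm (f x))\<^sup>2)"
  proof (rule integrableI_bounded_set[where A = \<Omega> and B = "B\<^sup>2"])
    show "\<Omega> \<in> sets (lebesgue_on \<Omega>)" using assms(1) by (simp add: sets_restrict_space_iff)
    show "(\<lambda>x. (norm (f x))\<^sup>2) \<in> borel_measurable (lebesgue_on \<Omega>)" using fm by measurable
    show "AE x in lebesgue_on \<Omega>. x \<notin> \<Omega> \<longrightarrow> (norm (f x))\<^sup>2 = 0" by (rule AE_I2) simp
  qed (use fin ae in auto)
  then show ?thesis using fm by (simp add: L2_def)
qed

definition cutoff :: "'a::euclidean_space \<Rightarrow> real \<Rightarrow> 'a \<Rightarrow> real" where
  "cutoff a \<epsilon> x = max 0 (min 1 (dist x a / \<epsilon> - 1))"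

lemma cutoff_lipschitz: "\<epsilon> > 0 \<Longrightarrow> \<bar>cutoff a \<epsilon> x - cutoff a \<epsilon> y\<bar> \<le> dist x y / \<epsilon>"
proof -
  assume "\<epsilon> > 0"
  have "\<bar>dist x a - dist y a\<bar> \<le> dist x y" using dist_triangle[of x a y] dist_triangle[of y a x] by (simp add: dist_commute)
  then have "\<bar>dist x a - dist y a\<bar> / \<epsilon> \<le> dist x y / \<epsilon>" using \<open>\<epsilon> > 0\<close> by (intro divide_right_mono) auto
  then have "\<bar>dist x a / \<epsilon> - dist y a / \<epsilon>\<bar> \<le> dist x y / \<epsilon>"
    using \<open>\<epsilon> > 0\<close> by (simp add: diff_divide_distrib[symmetric])
  then show ?thesis unfolding cutoff_def by linarith
qed

lemma cutoff_bounds: "0 \<le> cutoff a \<epsilon> x" "cutoff a \<epsilon> x \<le> 1"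
  by (auto simp: cutoff_def)

lemma cutoff_eq_0: "\<epsilon> > 0 \<Longrightarrow> dist x a \<le> \<epsilon> \<Longrightarrow> cutoff a \<epsilon> x = 0"
  by (simp add: cutoff_def field_simps)

lemma cutoff_eq_1: "\<epsilon> > 0 \<Longrightarrow> 2 * \<epsilon> \<le> dist x a \<Longrightarrow> cutoff a \<epsilon> x = 1"
  by (simp add: cutoff_def field_simps)

text \<open>The kinks lie on two spheres, which are null sets. At the centre, where the distance is
  not differentiable, the cutoff is locally constant.\<close>

lemma lip_ae_diff_cutoff:
  assumes "\<epsilon> > 0"
  shows "lip_ae_diff UNIV (cutoff a \<epsilon>)"
proof (rule lip_ae_diff_lipschitzian)
  show "lipschitzian_on UNIV (cutoff a \<epsilon>)"
    using cutoff_lipschitz[OF assms] by (intro lipschitzian_onI[of _ _ "1 / \<epsilon>"]) (auto simp: divide_inverse mult.commute)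
  have "negligible (sphere a \<epsilon> \<union> sphere a (2 * \<epsilon>))"
    by (intro negligible_Un negligible_sphere)
  then have "AE x in lebesgue. x \<notin> sphere a \<epsilon> \<union> sphere a (2 * \<epsilon>)" by (rule AE_not_negligible)
  then show "AE x in lebesgue. cutoff a \<epsilon> differentiable (at x)"
  proof eventually_elim
    case (elim x)
    consider "dist x a < \<epsilon>" | "\<epsilon> < dist x a" "dist x a < 2 * \<epsilon>" | "2 * \<epsilon> < dist x a"
      using elim by (force simp: dist_commute)
    then show ?case
    proof cases
      case 1
      have "(\<lambda>x. 0::real) differentiable (at x)" by simp
      then show ?thesis
        by (rule differentiable_transform_open[where S = "ball a \<epsilon>"])
          (use 1 assms cutoff_eq_0[of \<epsilon> _ a] in \<open>auto simp: dist_commute\<close>)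
    next
      case 2
      have o: "open {x. \<epsilon> < dist x a \<and> dist x a < 2 * \<epsilon>}"
        by (intro open_Collect_conj open_Collect_less continuous_intros)
      have "x \<noteq> a" using 2 assms by auto
      then have "(\<lambda>x. norm (x - a)) differentiable (at x)"
        using differentiable_norm_at[of "x - a"] differentiable_chain_at[of "\<lambda>x. x - a" x norm]
        by (auto simp: o_def)
      then have "(\<lambda>x. norm (x - a) * (1 / \<epsilon>) - 1) differentiable (at x)"
        by (intro differentiable_diff differentiable_mult) auto
      then show ?thesis
        by (rule differentiable_transform_open[where S = "{x. \<epsilon> < dist x a \<and> dist x a < 2 * \<epsilon>}"])
          (use 2 assms o in \<open>auto simp: cutoff_def dist_norm field_simps\<close>)
    next
      case 3
      have o: "open {x. 2 * \<epsilon> < dist x a}"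
        by (intro open_Collect_less continuous_intros)
      have "(\<lambda>x. 1::real) differentiable (at x)" by simp
      then show ?thesis
        by (rule differentiable_transform_open[where S = "{x. 2 * \<epsilon> < dist x a}"])
          (use 3 assms o cutoff_eq_1[of \<epsilon> _ a] in auto)
    qed
  qed
qed simp

lemma partial_bound:
  assumes "f differentiable (at x)" "\<And>y. \<bar>f y - f x\<bar> \<le> M * dist y x"
  shows "\<bar>partial i f x\<bar> \<le> M"
proof -
  have h: "(\<lambda>n. 1 / real (Suc n)) \<longlonglongrightarrow> 0" by (rule LIMSEQ_Suc[OF lim_1_over_n])
  have "(\<lambda>n. (f (x + (1 / real (Suc n)) *\<^sub>R axis i 1) - f x) / (1 / real (Suc n))) \<longlonglongrightarrow> partial i f x"
    by (rule difference_quotient_tendsto[OF assms(1) h]) simp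
  then have "(\<lambda>n. \<bar>(f (x + (1 / real (Suc n)) *\<^sub>R axis i 1) - f x) / (1 / real (Suc n))\<bar>) \<longlonglongrightarrow> \<bar>partial i f x\<bar>"
    by (rule tendsto_rabs)
  moreover have "\<bar>(f (x + (1 / real (Suc n)) *\<^sub>R axis i 1) - f x) / (1 / real (Suc n))\<bar> \<le> M" for n
  proof -
    have "dist (x + (1 / real (Suc n)) *\<^sub>R axis i 1) x = 1 / real (Suc n)" by (simp add: dist_norm)
    then have "\<bar>f (x + (1 / real (Suc n)) *\<^sub>R axis i 1) - f x\<bar> \<le> M * (1 / real (Suc n))"
      using assms(2)[of "x + (1 / real (Suc n)) *\<^sub>R axis i 1"] by metis
    moreover have \<delta>: "1 / real (Suc n) > 0" by simp
    ultimately show ?thesis unfolding abs_divide[of _ "1 / real (Suc n)"] abs_of_pos[OF \<delta>] pos_divide_le_eq[OF \<delta>] by blast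
  qed
  ultimately show ?thesis by (intro LIMSEQ_le_const2) auto
qed

text \<open>The cutoff costs \<open>O(1/\<epsilon>)\<close> in the gradient on a disc of area \<open>O(\<epsilon>\<^sup>2)\<close>.\<close>

lemma weak_div_remove_point:
  assumes \<Omega>: "open \<Omega>" and wd: "weak_div (\<Omega> - {a}) V w"
    and Vm: "(\<lambda>x. indicator (\<Omega> - {a}) x *\<^sub>R V x) \<in> borel_measurable lebesgue"
    and wm: "(\<lambda>x. indicator (\<Omega> - {a}) x *\<^sub>R w x) \<in> borel_measurable lebesgue"
    and VB: "\<And>x. x \<in> \<Omega> - {a} \<Longrightarrow> norm (V x) \<le> B" and wB: "\<And>x. x \<in> \<Omega> - {a} \<Longrightarrow> \<bar>w x\<bar> \<le> B"
    and \<phi>: "\<phi> \<in> test_functions \<Omega>"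
  shows "(LINT x|lebesgue_on \<Omega>. V x $ 1 * partial 1 \<phi> x + V x $ 2 * partial 2 \<phi> x) = - (LINT x|lebesgue_on \<Omega>. w x * \<phi> x)"
proof -
  define K where "K = closure {x. \<phi> x \<noteq> 0}"
  have K: "compact K" "K \<subseteq> \<Omega>" using \<phi> by (auto simp: test_functions_def K_def)
  have supp: "\<phi> x = 0" if "x \<notin> K" for x
    using that closure_subset[of "{x. \<phi> x \<noteq> 0}"] unfolding K_def by blast
  have supp': "partial i \<phi> x = 0" if "x \<notin> K" for x i by (rule partial_zero_outside[OF K(1) supp that])
  have C: "Ck k \<phi>" for k using \<phi> by (auto simp: test_functions_def)
  have d\<phi>: "\<phi> differentiable (at x)" for x using C[of 1] by (simp add: One_nat_def)
  have c\<phi>: "continuous_on UNIV \<phi>" and cp: "continuous_on UNIV (partial i \<phi>)" for i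
    using C[of 0] C[of 1] by (simp_all add: One_nat_def)
  have ld: "lip_ae_diff UNIV \<phi>" by (rule Ck_lip_ae_diff[OF C])
  have bdd: "bounded (f ` K)" if "continuous_on UNIV f" for f :: "real^2 \<Rightarrow> real"
    using that K(1) by (intro compact_imp_bounded compact_continuous_image) (auto intro: continuous_on_subset)
  obtain P0 where P0: "\<forall>x\<in>K. \<bar>\<phi> x\<bar> \<le> P0" using bdd[OF c\<phi>] unfolding bounded_iff by auto
  obtain P1 where P1: "\<forall>x\<in>K. \<bar>partial 1 \<phi> x\<bar> \<le> P1" using bdd[OF cp[of 1]] unfolding bounded_iff by auto
  obtain P2 where P2: "\<forall>x\<in>K. \<bar>partial 2 \<phi> x\<bar> \<le> P2" using bdd[OF cp[of 2]] unfolding bounded_iff by auto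
  define P where "P = \<bar>P0\<bar> + \<bar>P1\<bar> + \<bar>P2\<bar>"
  have P: "\<bar>\<phi> x\<bar> \<le> P" "\<bar>partial 1 \<phi> x\<bar> \<le> P" "\<bar>partial 2 \<phi> x\<bar> \<le> P" for x
    using P0 P1 P2 supp[of x] supp'[of x] by (cases "x \<in> K"; force simp: P_def)+
  have "P \<ge> 0" by (simp add: P_def)
  have Bn: "\<bar>V x $ i\<bar> \<le> B" if "x \<in> \<Omega> - {a}" for x i
    using VB[OF that] component_le_norm_cart[of "V x" i] by linarith
  define U where "U = \<Omega> - {a}"
  \<comment> \<open>\<open>V\<close> and \<open>w\<close> are controlled only off the point
    \<open>a\<close>. Extended by 0 they are measurable and bounded everywhere, and on \<Omega> they
    differ from the originals at most at \<open>a\<close>.\<close>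
  define v where "v i x = indicator U x * V x $ i" for i x
  define w' where "w' x = indicator U x * w x" for x
  have vm [measurable]: "v i \<in> borel_measurable lebesgue" for i
  proof -
    have "(\<lambda>x. (indicator U x *\<^sub>R V x) $ i) \<in> borel_measurable lebesgue"
      using Vm unfolding U_def by (rule measurable_compose[OF _ borel_measurable_continuous_onI]) (intro continuous_intros)
    then show ?thesis by (simp add: v_def[abs_def])
  qed
  have wm' [measurable]: "w' \<in> borel_measurable lebesgue" using wm by (simp add: w'_def[abs_def] U_def)
  have cm: "f \<in> borel_measurable lebesgue" if "continuous_on UNIV f" for f :: "real^2 \<Rightarrow> real"
    using borel_measurable_continuous_onI[OF that] by (auto intro: measurable_completion)
  have [measurable]: "\<phi> \<in> borel_measurable lebesgue" "partial i \<phi> \<in> borel_measurable lebesgue" for i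
    using cm c\<phi> cp by auto
  have B0: "\<bar>v i x\<bar> \<le> \<bar>B\<bar>" "\<bar>w' x\<bar> \<le> \<bar>B\<bar>" for i x
    using Bn[of x i] wB[of x] by (auto simp: v_def w'_def U_def indicator_def)
  define \<zeta> where "\<zeta> n = cutoff a (1 / real (Suc n))" for n
  have \<epsilon>: "1 / real (Suc n) > 0" for n by simp
  have \<zeta>b: "0 \<le> \<zeta> n x" "\<zeta> n x \<le> 1" for n x by (auto simp: \<zeta>_def cutoff_bounds)
  have \<zeta>c: "continuous_on UNIV (\<zeta> n)" for n
    unfolding \<zeta>_def cutoff_def[abs_def] by (intro continuous_intros) auto
  have [measurable]: "\<zeta> n \<in> borel_measurable lebesgue" for n by (rule cm[OF \<zeta>c])
  have \<zeta>d: "AE x in lebesgue. \<zeta> n differentiable (at x)" for n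
    using lip_ae_diff_cutoff[OF \<epsilon>, of a n] by (simp add: lip_ae_diff_def \<zeta>_def)
  have \<zeta>1: "\<forall>\<^sub>F n in sequentially. \<zeta> n x = 1" if "x \<noteq> a" for x
  proof -
    have "(\<lambda>n. 2 * (1 / real (Suc n))) \<longlonglongrightarrow> 2 * 0"
      by (intro tendsto_intros LIMSEQ_Suc[OF lim_1_over_n])
    then have "\<forall>\<^sub>F n in sequentially. 2 * (1 / real (Suc n)) < dist x a"
      using that by (intro order_tendstoD(2)) auto
    then show ?thesis
      by eventually_elim (auto simp: \<zeta>_def intro!: cutoff_eq_1)
  qed
  \<comment> \<open>Lipschitz with compact support off the point, hence a legitimate test function
    for \<open>wd\<close>, though not a smooth one.\<close>
  define \<eta> where "\<eta> n x = \<phi> x * \<zeta> n x" for n x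
  have adm: "admissible U (\<eta> n)" for n
    unfolding admissible_def
  proof (intro conjI exI[of _ "K \<inter> {x. 1 / real (Suc n) \<le> dist x a}"])
    show "lip_ae_diff UNIV (\<eta> n)"
      unfolding \<eta>_def[abs_def] \<zeta>_def using lip_ae_diff_mult[OF ld lip_ae_diff_cutoff[OF \<epsilon>, of a n]] by simp
    show "compact (K \<inter> {x. 1 / real (Suc n) \<le> dist x a})"
      by (intro compact_Int_closed K closed_Collect_le continuous_intros)
    have "a \<notin> {x. 1 / real (Suc n) \<le> dist x a}" using \<epsilon>[of n] by (simp add: not_le)
    then show "K \<inter> {x. 1 / real (Suc n) \<le> dist x a} \<subseteq> U" using K(2) unfolding U_def by blast
    show "\<forall>x. x \<notin> K \<inter> {x. 1 / real (Suc n) \<le> dist x a} \<longrightarrow> \<eta> n x = 0"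
      using supp cutoff_eq_0[OF \<epsilon>, of _ a n] by (auto simp: \<eta>_def \<zeta>_def not_le less_imp_le simp del: of_nat_Suc)
  qed
  have indK: "integrable lebesgue (\<lambda>x. c * indicator K x)" for c :: real
    using K(1) by (intro integrable_mult_right)
      (auto intro!: integrable_real_indicator simp: borel_compact emeasure_compact_finite[OF K(1), unfolded infinity_ennreal_def])
  have w_lim: "(\<lambda>n. LINT x|lebesgue. w' x * \<phi> x * \<zeta> n x) \<longlonglongrightarrow> (LINT x|lebesgue. w' x * \<phi> x)"
  proof (rule integral_dominated_convergence[OF _ _ indK[of "\<bar>B\<bar> * P"]])
    show "AE x in lebesgue. (\<lambda>n. w' x * \<phi> x * \<zeta> n x) \<longlonglongrightarrow> w' x * \<phi> x"
      using AE_not_point[of a]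
    proof eventually_elim
      case (elim x)
      show ?case by (rule tendsto_eventually) (use \<zeta>1[OF elim] in eventually_elim, simp)
    qed
    show "AE x in lebesgue. norm (w' x * \<phi> x * \<zeta> n x) \<le> \<bar>B\<bar> * P * indicator K x" for n
    proof (rule AE_I2)
      fix x
      have "\<bar>w' x\<bar> * \<bar>\<phi> x\<bar> * \<bar>\<zeta> n x\<bar> \<le> \<bar>B\<bar> * P * 1"
        using B0 P \<zeta>b \<open>P \<ge> 0\<close> by (intro mult_mono) auto
      then show "norm (w' x * \<phi> x * \<zeta> n x) \<le> \<bar>B\<bar> * P * indicator K x"
        using supp[of x] by (cases "x \<in> K") (auto simp: abs_mult)
    qed
  qed measurable
  define g where "g x = v 1 x * partial 1 \<phi> x + v 2 x * partial 2 \<phi> x" for x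
  have gB: "\<bar>g x\<bar> \<le> 2 * \<bar>B\<bar> * P" for x
  proof -
    have "\<bar>v i x * partial i \<phi> x\<bar> \<le> \<bar>B\<bar> * P" if "i = 1 \<or> i = 2" for i
      unfolding abs_mult using B0 P that by (intro mult_mono) auto
    from this[of 1] this[of 2] show ?thesis unfolding g_def by auto
  qed
  have g_supp: "g x = 0" if "x \<notin> K" for x using supp'[OF that] by (simp add: g_def)
  have gm [measurable]: "g \<in> borel_measurable lebesgue" unfolding g_def[abs_def] by measurable
  have gi: "integrable lebesgue (\<lambda>x. g x * \<zeta> n x)" for n
  proof (rule Bochner_Integration.integrable_bound[OF indK[of "2 * \<bar>B\<bar> * P"]])
    show "AE x in lebesgue. norm (g x * \<zeta> n x) \<le> norm (2 * \<bar>B\<bar> * P * indicator K x)"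
    proof (rule AE_I2)
      fix x
      have "\<bar>g x\<bar> * \<bar>\<zeta> n x\<bar> \<le> 2 * \<bar>B\<bar> * P * 1" using gB \<zeta>b \<open>P \<ge> 0\<close> by (intro mult_mono) auto
      then show "norm (g x * \<zeta> n x) \<le> norm (2 * \<bar>B\<bar> * P * indicator K x)"
        using g_supp[of x] \<open>P \<ge> 0\<close> by (cases "x \<in> K") (auto simp: abs_mult)
    qed
  qed measurable
  have g_lim: "(\<lambda>n. LINT x|lebesgue. g x * \<zeta> n x) \<longlonglongrightarrow> (LINT x|lebesgue. g x)"
  proof (rule integral_dominated_convergence[OF _ _ indK[of "2 * \<bar>B\<bar> * P"]])
    show "AE x in lebesgue. (\<lambda>n. g x * \<zeta> n x) \<longlonglongrightarrow> g x"
      using AE_not_point[of a]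
    proof eventually_elim
      case (elim x)
      show ?case by (rule tendsto_eventually) (use \<zeta>1[OF elim] in eventually_elim, simp)
    qed
    show "AE x in lebesgue. norm (g x * \<zeta> n x) \<le> 2 * \<bar>B\<bar> * P * indicator K x" for n
    proof (rule AE_I2)
      fix x
      have "\<bar>g x\<bar> * \<bar>\<zeta> n x\<bar> \<le> 2 * \<bar>B\<bar> * P * 1" using gB \<zeta>b \<open>P \<ge> 0\<close> by (intro mult_mono) auto
      then show "norm (g x * \<zeta> n x) \<le> 2 * \<bar>B\<bar> * P * indicator K x"
        using g_supp[of x] by (cases "x \<in> K") (auto simp: abs_mult)
    qed
  qed measurable
  define f where "f n x = v 1 x * partial 1 (\<eta> n) x + v 2 x * partial 2 (\<eta> n) x" for n x
  have Uout: "\<eta> n x = 0" "partial i (\<eta> n) x = 0" if "x \<notin> U" for n x i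
  proof -
    obtain K' where K': "compact K'" "K' \<subseteq> U" "\<And>x. x \<notin> K' \<Longrightarrow> \<eta> n x = 0"
      using adm[of n] unfolding admissible_def by blast
    then have "x \<notin> K'" using that by blast
    then show "\<eta> n x = 0" "partial i (\<eta> n) x = 0" using K'(3) partial_zero_outside[OF K'(1,3)] by auto
  qed
  have fi: "integrable lebesgue (f n)" and feq: "(LINT x|lebesgue. f n x) = - (LINT x|lebesgue. w' x * \<phi> x * \<zeta> n x)" for n
  proof -
    have 1: "f n x = V x $ 1 * partial 1 (\<eta> n) x + V x $ 2 * partial 2 (\<eta> n) x" for x
      using Uout[where x = x and n = n] by (cases "x \<in> U") (auto simp: f_def v_def)
    have 2: "w' x * \<phi> x * \<zeta> n x = w x * \<eta> n x" for x
      using Uout[where x = x and n = n] by (cases "x \<in> U") (auto simp: w'_def \<eta>_def)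
    show "integrable lebesgue (f n)" "(LINT x|lebesgue. f n x) = - (LINT x|lebesgue. w' x * \<phi> x * \<zeta> n x)"
      unfolding 1 2 using wd[folded U_def] adm[of n] unfolding weak_div_def 1[abs_def] by auto
  qed
  \<comment> \<open>The terms in which the derivative falls on the cutoff. They are at most
    \<open>D * real (Suc n)\<close> on a disc of radius 2 / (n + 1) and 0 outside, so their integral
    is O(1 / n).\<close>
  define r where "r n x = f n x - g x * \<zeta> n x" for n x
  define D where "D = 2 * \<bar>B\<bar> * P"
  have r_bound: "AE x in lebesgue. norm (r n x) \<le> D * real (Suc n) * indicator (cball a (2 / real (Suc n))) x" for n
    using \<zeta>d[of n]
  proof eventually_elim
    case (elim x)
    have pm: "partial i (\<eta> n) x = \<phi> x * partial i (\<zeta> n) x + partial i \<phi> x * \<zeta> n x" for i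
      unfolding \<eta>_def[abs_def] by (rule partial_mult[OF d\<phi> elim])
    have r: "r n x = v 1 x * \<phi> x * partial 1 (\<zeta> n) x + v 2 x * \<phi> x * partial 2 (\<zeta> n) x"
      unfolding r_def f_def g_def pm by (simp add: algebra_simps)
    have pb: "\<bar>partial i (\<zeta> n) x\<bar> \<le> real (Suc n)" for i
      using cutoff_lipschitz[OF \<epsilon>[of n], of a _ x] by (intro partial_bound[OF elim]) (simp add: \<zeta>_def mult.commute)
    show ?case
    proof (cases "x \<in> cball a (2 / real (Suc n))")
      case True
      have "\<bar>v i x * \<phi> x * partial i (\<zeta> n) x\<bar> \<le> \<bar>B\<bar> * P * real (Suc n)" for i
        unfolding abs_mult using B0 P pb \<open>P \<ge> 0\<close> by (intro mult_mono) (auto simp del: of_nat_Suc)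
      from this[of 1] this[of 2] show ?thesis unfolding r D_def using True by auto
    next
      case False
      have "partial i (\<zeta> n) x = partial i (\<lambda>x. 1) x" for i
      proof (rule partial_cong[where U = "- cball a (2 / real (Suc n))"])
        fix y assume "y \<in> - cball a (2 / real (Suc n))"
        then have "2 * (1 / real (Suc n)) \<le> dist y a" by (simp add: dist_commute del: of_nat_Suc)
        then show "\<zeta> n y = 1" unfolding \<zeta>_def by (rule cutoff_eq_1[OF \<epsilon>])
      qed (use False in auto)
      then show ?thesis unfolding r using False by simp
    qed
  qed
  have r_lim: "(\<lambda>n. LINT x|lebesgue. r n x) \<longlonglongrightarrow> 0"
  proof (rule Lim_null_comparison)
    define c where "c = unit_ball_vol (real (DIM(real^2)))"
    have "norm (LINT x|lebesgue. r n x) \<le> D * c * 4 * (1 / real (Suc n))" for n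
    proof -
      have ib: "integrable lebesgue (\<lambda>x. D * real (Suc n) * indicator (cball a (2 / real (Suc n))) x)"
        by (intro integrable_mult_right)
          (auto intro!: integrable_real_indicator simp: emeasure_bounded_finite[unfolded infinity_ennreal_def])
      have "norm (LINT x|lebesgue. r n x) \<le> (LINT x|lebesgue. D * real (Suc n) * indicator (cball a (2 / real (Suc n))) x)"
      proof (rule order_trans[OF integral_norm_bound integral_mono_AE[OF _ ib r_bound]])
        show "integrable lebesgue (\<lambda>x. norm (r n x))" unfolding r_def using fi gi by auto
      qed
      also have "\<dots> = D * real (Suc n) * measure lebesgue (cball a (2 / real (Suc n)))" by simp
      also have "measure lebesgue (cball a (2 / real (Suc n))) = c * (2 / real (Suc n))\<^sup>2"
        using content_cball[of "2 / real (Suc n)" a] by (simp add: c_def)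
      also have "D * real (Suc n) * (c * (2 / real (Suc n))\<^sup>2) = D * c * 4 * (1 / real (Suc n))"
        by (simp add: power2_eq_square field_simps del: of_nat_Suc)
      finally show ?thesis .
    qed
    then show "\<forall>\<^sub>F n in sequentially. norm (LINT x|lebesgue. r n x) \<le> D * c * 4 * (1 / real (Suc n))" by simp
    have "(\<lambda>n. D * c * 4 * (1 / real (Suc n))) \<longlonglongrightarrow> D * c * 4 * 0"
      by (intro tendsto_intros LIMSEQ_Suc[OF lim_1_over_n])
    then show "(\<lambda>n. D * c * 4 * (1 / real (Suc n))) \<longlonglongrightarrow> 0" by simp
  qed
  have req: "(LINT x|lebesgue. r n x) = - (LINT x|lebesgue. w' x * \<phi> x * \<zeta> n x) - (LINT x|lebesgue. g x * \<zeta> n x)" for n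
    unfolding r_def feq[symmetric] by (rule Bochner_Integration.integral_diff[OF fi gi])
  have "(\<lambda>n. - (LINT x|lebesgue. w' x * \<phi> x * \<zeta> n x) - (LINT x|lebesgue. g x * \<zeta> n x)) \<longlonglongrightarrow>
      - (LINT x|lebesgue. w' x * \<phi> x) - (LINT x|lebesgue. g x)"
    by (intro tendsto_intros w_lim g_lim)
  then have "- (LINT x|lebesgue. w' x * \<phi> x) - (LINT x|lebesgue. g x) = 0"
    by (rule LIMSEQ_unique) (use r_lim in \<open>simp only: req\<close>)
  then have main: "(LINT x|lebesgue. g x) = - (LINT x|lebesgue. w' x * \<phi> x)" by simp
  have out: "\<phi> x = 0" "partial i \<phi> x = 0" if "x \<notin> \<Omega>" for x i
    using that K(2) supp supp' by blast+
  have "(LINT x|lebesgue_on \<Omega>. V x $ 1 * partial 1 \<phi> x + V x $ 2 * partial 2 \<phi> x) =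
      (LINT x|lebesgue. V x $ 1 * partial 1 \<phi> x + V x $ 2 * partial 2 \<phi> x)"
    by (rule integral_lebesgue_on_supported[OF \<Omega>]) (simp add: out)
  also have "\<dots> = (LINT x|lebesgue. g x)"
  proof (rule integrable_AE_lebesgue(2))
    show "integrable lebesgue g"
      by (rule Bochner_Integration.integrable_bound[OF indK[of "2 * \<bar>B\<bar> * P"] gm], rule AE_I2)
         (use gB g_supp \<open>P \<ge> 0\<close> in \<open>auto simp: indicator_def\<close>)
    show "AE x in lebesgue. g x = V x $ 1 * partial 1 \<phi> x + V x $ 2 * partial 2 \<phi> x"
      using AE_not_point[of a]
    proof eventually_elim
      case (elim x)
      then show ?case using out[of x] by (cases "x \<in> \<Omega>") (auto simp: g_def v_def U_def)
    qed
  qed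
  also note main
  also have "(LINT x|lebesgue. w' x * \<phi> x) = (LINT x|lebesgue. w x * \<phi> x)"
  proof (rule integrable_AE_lebesgue(2)[symmetric])
    show "integrable lebesgue (\<lambda>x. w' x * \<phi> x)"
    proof (rule Bochner_Integration.integrable_bound[OF indK[of "\<bar>B\<bar> * P"]])
      show "AE x in lebesgue. norm (w' x * \<phi> x) \<le> norm (\<bar>B\<bar> * P * indicator K x)"
      proof (rule AE_I2)
        fix x
        have "\<bar>w' x\<bar> * \<bar>\<phi> x\<bar> \<le> \<bar>B\<bar> * P" using B0 P by (intro mult_mono) auto
        then show "norm (w' x * \<phi> x) \<le> norm (\<bar>B\<bar> * P * indicator K x)"
          using supp[of x] \<open>P \<ge> 0\<close> by (cases "x \<in> K") (auto simp: abs_mult)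
      qed
    qed measurable
    show "AE x in lebesgue. w' x * \<phi> x = w x * \<phi> x"
      using AE_not_point[of a]
    proof eventually_elim
      case (elim x)
      then show ?case using out[of x] by (cases "x \<in> \<Omega>") (auto simp: w'_def U_def)
    qed
  qed
  also have "(LINT x|lebesgue. w x * \<phi> x) = (LINT x|lebesgue_on \<Omega>. w x * \<phi> x)"
    by (rule integral_lebesgue_on_supported[OF \<Omega>, symmetric]) (simp add: out)
  finally show ?thesis .
qed

subsection \<open>A scaling obstruction to square integrability\<close>

text \<open>Testing with bumps of size \<open>\<sigma>\<close> shows that a function of size \<open>1/\<sigma>\<close> on discs of radius
  proportional to \<open>\<sigma>\<close> that shrink to a point carries a fixed amount of energy on each disc.\<close>

lemma not_L2_blow_up:
  fixes w w0 :: "real^2 \<Rightarrow> real"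
  assumes \<Omega>: "open \<Omega>" and wL2: "w \<in> L2 \<Omega>" and pos: "c > 0" "\<kappa> > 0" "\<sigma>0 > 0" and e: "\<bar>e\<bar> = 1"
    and X: "(X \<longlongrightarrow> a) (at_right 0)"
    and balls: "\<And>\<sigma>. 0 < \<sigma> \<Longrightarrow> \<sigma> < \<sigma>0 \<Longrightarrow> ball (X \<sigma>) (\<kappa> * \<sigma>) \<subseteq> \<Omega> - {a}"
    and low: "\<And>\<sigma> x. 0 < \<sigma> \<Longrightarrow> \<sigma> < \<sigma>0 \<Longrightarrow> x \<in> ball (X \<sigma>) (\<kappa> * \<sigma>) \<Longrightarrow> c / \<sigma> \<le> e * w0 x"
    and dual: "\<And>\<phi>. \<phi> \<in> test_functions \<Omega> \<Longrightarrow> closure {x. \<phi> x \<noteq> 0} \<subseteq> \<Omega> - {a} \<Longrightarrow>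
       integrable lebesgue (\<lambda>x. w0 x * \<phi> x) \<and> (LINT x|lebesgue. w0 x * \<phi> x) = (LINT x|lebesgue_on \<Omega>. w x * \<phi> x)"
  shows False
proof -
  define c0 where "c0 = unit_ball_vol (real (DIM(real^2)))"
  have c0: "c0 > 0" unfolding c0_def by simp
  \<comment> \<open>Chosen to balance Young's inequality with weight
    \<open>\<tau> / \<sigma>\<close>: the pairing with the bump is at least
    \<open>\<tau> / \<sigma>\<close> times the area of the disc, and the constant term of Young's
    inequality accounts for only half of that. The other half must come from the energy
    \<open>W\<close>, and the powers of \<sigma> cancel.\<close>
  define \<tau> where "\<tau> = c * exp (- 4 / 3) / 4"
  have \<tau>: "\<tau> > 0" using pos by (simp add: \<tau>_def)
  define Bl where "Bl \<sigma> = cball (X \<sigma>) (\<kappa> * \<sigma> / 2)" for \<sigma>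
  define W where "W \<sigma> = (LINT x|lebesgue_on \<Omega>. indicator (Bl \<sigma>) x * (w x)\<^sup>2)" for \<sigma>
  have wm [measurable]: "w \<in> borel_measurable (lebesgue_on \<Omega>)" and wi: "integrable (lebesgue_on \<Omega>) (\<lambda>x. (w x)\<^sup>2)"
    using wL2 by (auto simp: L2_def)
  have Blm [measurable]: "Bl \<sigma> \<in> sets lebesgue" for \<sigma> by (simp add: Bl_def)
  have Blm2 [measurable]: "indicat_real (Bl \<sigma>) \<in> borel_measurable (lebesgue_on \<Omega>)" for \<sigma>
    by (intro measurable_restrict_space1 borel_measurable_indicator Blm)
  have Wi: "integrable (lebesgue_on \<Omega>) (\<lambda>x. indicator (Bl \<sigma>) x * (w x)\<^sup>2)" for \<sigma>
  proof (rule Bochner_Integration.integrable_bound[OF wi])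
    show "(\<lambda>x. indicator (Bl \<sigma>) x * (w x)\<^sup>2) \<in> borel_measurable (lebesgue_on \<Omega>)" by measurable
  qed (rule AE_I2, auto simp: indicator_def)
  have W_low: "W \<sigma> \<ge> \<tau>\<^sup>2 * c0 * \<kappa>\<^sup>2 / 4" if \<sigma>: "0 < \<sigma>" "\<sigma> < \<sigma>0" for \<sigma>
  proof -
    define \<rho> where "\<rho> = \<kappa> * \<sigma> / 2"
    have \<rho>: "\<rho> > 0" using \<sigma> pos by (simp add: \<rho>_def)
    have BU: "Bl \<sigma> \<subseteq> ball (X \<sigma>) (\<kappa> * \<sigma>)" using \<rho> by (auto simp: Bl_def \<rho>_def)
    have BO: "Bl \<sigma> \<subseteq> \<Omega> - {a}" using BU balls[OF \<sigma>] by blast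
    define \<phi> where "\<phi> = bump (X \<sigma>) \<rho>"
    have \<phi>t: "\<phi> \<in> test_functions \<Omega>" unfolding \<phi>_def
      using BO by (intro bump_test_function[OF \<rho>]) (auto simp: Bl_def \<rho>_def)
    have "closure {x. \<phi> x \<noteq> 0} \<subseteq> \<Omega> - {a}"
      using bump_support[OF \<rho>, of "X \<sigma>"] BO unfolding \<phi>_def Bl_def \<rho>_def by blast
    from dual[OF \<phi>t this] have int0: "integrable lebesgue (\<lambda>x. w0 x * \<phi> x)"
      and eq: "(LINT x|lebesgue. w0 x * \<phi> x) = (LINT x|lebesgue_on \<Omega>. w x * \<phi> x)" by auto
    have \<phi>0: "0 \<le> \<phi> x" "\<phi> x \<le> 1" for x unfolding \<phi>_def using bump_bounds(1,2)[OF \<rho>] by auto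
    have \<phi>out: "\<phi> x = 0" if "x \<notin> Bl \<sigma>" for x
      unfolding \<phi>_def using that by (intro bump_bounds(3)[OF \<rho>]) (auto simp: Bl_def \<rho>_def dist_commute)
    have \<phi>B: "\<phi> x \<le> indicator (Bl \<sigma>) x" for x using \<phi>0[of x] \<phi>out[of x] by (auto simp: indicator_def)
    have ib: "integrable lebesgue (\<lambda>x. k * indicat_real (cball (X \<sigma>) r) x)" for k r
      by (intro integrable_mult_right)
         (auto intro!: integrable_real_indicator simp: emeasure_bounded_finite[unfolded infinity_ennreal_def])
    have vol: "(LINT x|lebesgue. k * indicat_real (cball (X \<sigma>) r) x) = k * (c0 * r\<^sup>2)" if "r \<ge> 0" for k r
      using content_cball[OF that, of "X \<sigma>"] by (simp add: c0_def)
    have lower: "c / \<sigma> * exp (- 4 / 3) * (c0 * (\<rho> / 2)\<^sup>2) \<le> e * (LINT x|lebesgue. w0 x * \<phi> x)"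
    proof -
      have "(LINT x|lebesgue. c / \<sigma> * exp (- 4 / 3) * indicat_real (cball (X \<sigma>) (\<rho> / 2)) x) \<le> (LINT x|lebesgue. e * (w0 x * \<phi> x))"
      proof (rule integral_mono[OF ib])
        show "integrable lebesgue (\<lambda>x. e * (w0 x * \<phi> x))" using int0 by simp
        fix x
        show "c / \<sigma> * exp (- 4 / 3) * indicat_real (cball (X \<sigma>) (\<rho> / 2)) x \<le> e * (w0 x * \<phi> x)"
        proof (cases "x \<in> Bl \<sigma>")
          case True
          then have l: "c / \<sigma> \<le> e * w0 x" using BU low[OF \<sigma>] by blast
          have "exp (- 4 / 3) * indicat_real (cball (X \<sigma>) (\<rho> / 2)) x \<le> \<phi> x"
            using bump_bounds(4)[OF \<rho>, of x "X \<sigma>"] \<phi>0(1)[of x]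
            by (auto simp: indicator_def \<phi>_def dist_commute)
          then have "c / \<sigma> * (exp (- 4 / 3) * indicat_real (cball (X \<sigma>) (\<rho> / 2)) x) \<le> e * w0 x * \<phi> x"
            using l pos \<sigma> \<phi>0(1)[of x] by (intro mult_mono) (auto intro: order_trans[of _ "c / \<sigma>"])
          then show ?thesis by (simp add: mult.assoc)
        next
          case False
          then have "x \<notin> cball (X \<sigma>) (\<rho> / 2)" using \<rho> by (auto simp: Bl_def \<rho>_def)
          then show ?thesis using \<phi>out[OF False] by simp
        qed
      qed
      moreover have "(LINT x|lebesgue. c / \<sigma> * exp (- 4 / 3) * indicat_real (cball (X \<sigma>) (\<rho> / 2)) x) =
          c / \<sigma> * exp (- 4 / 3) * (c0 * (\<rho> / 2)\<^sup>2)"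
        by (rule vol) (use \<rho> in simp)
      ultimately show ?thesis by (simp only: integral_mult_right_zero)
    qed
    have upper: "e * (LINT x|lebesgue_on \<Omega>. w x * \<phi> x) \<le> \<tau> / (2 * \<sigma>) * (c0 * \<rho>\<^sup>2) + \<sigma> / (2 * \<tau>) * W \<sigma>"
    proof -
      have i1: "integrable (lebesgue_on \<Omega>) (\<lambda>x. \<tau> / (2 * \<sigma>) * indicat_real (Bl \<sigma>) x)"
      proof -
        have "(\<lambda>x. indicator \<Omega> x *\<^sub>R (\<tau> / (2 * \<sigma>) * indicat_real (Bl \<sigma>) x)) = (\<lambda>x. \<tau> / (2 * \<sigma>) * indicat_real (Bl \<sigma>) x)"
          using BO by (auto simp: indicator_def fun_eq_iff)
        then show ?thesis
          using ib[of "\<tau> / (2 * \<sigma>)" "\<kappa> * \<sigma> / 2", folded Bl_def] \<Omega>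
          by (subst integrable_restrict_space) (simp_all only: borel_open sets_completionI_sets sets_lborel space_completion space_lborel space_borel Int_UNIV_right)
      qed
      have i2: "integrable (lebesgue_on \<Omega>) (\<lambda>x. \<sigma> / (2 * \<tau>) * (indicator (Bl \<sigma>) x * (w x)\<^sup>2))"
        using Wi by simp
      have young: "\<bar>w x\<bar> \<le> \<tau> / (2 * \<sigma>) + \<sigma> / (2 * \<tau>) * (w x)\<^sup>2" for x
      proof -
        define l where "l = \<tau> / \<sigma>"
        have l: "l > 0" using \<tau> \<sigma> by (simp add: l_def)
        have "0 \<le> (\<bar>w x\<bar> - l)\<^sup>2 / (2 * l)" using l by simp
        also have "(\<bar>w x\<bar> - l)\<^sup>2 / (2 * l) = (w x)\<^sup>2 / (2 * l) + l / 2 - \<bar>w x\<bar>"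
          using l by (simp add: power2_diff field_simps power2_eq_square)
        also have "(w x)\<^sup>2 / (2 * l) = \<sigma> / (2 * \<tau>) * (w x)\<^sup>2" using \<tau> \<sigma> by (simp add: l_def field_simps)
        also have "l / 2 = \<tau> / (2 * \<sigma>)" by (simp add: l_def)
        finally show ?thesis by linarith
      qed
      have pw: "\<bar>w x * \<phi> x\<bar> \<le> \<tau> / (2 * \<sigma>) * indicat_real (Bl \<sigma>) x + \<sigma> / (2 * \<tau>) * (indicator (Bl \<sigma>) x * (w x)\<^sup>2)" for x
      proof (cases "x \<in> Bl \<sigma>")
        case True
        have "\<bar>w x * \<phi> x\<bar> \<le> \<bar>w x\<bar> * 1" unfolding abs_mult using \<phi>0[of x] by (intro mult_left_mono) auto
        then show ?thesis using young[of x] True by simp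
      qed (simp add: \<phi>out)
      have [measurable]: "\<phi> \<in> borel_measurable (lebesgue_on \<Omega>)"
      proof -
        have "continuous_on UNIV \<phi>" using Ck_bump[of 0 "X \<sigma>" \<rho>] by (simp add: \<phi>_def)
        then show ?thesis
          by (intro continuous_imp_measurable_on_sets_lebesgue) (use \<Omega> in \<open>auto intro: continuous_on_subset\<close>)
      qed
      have i3: "integrable (lebesgue_on \<Omega>) (\<lambda>x. w x * \<phi> x)"
        by (rule Bochner_Integration.integrable_bound[OF Bochner_Integration.integrable_add[OF i1 i2]])
           (auto intro!: AE_I2 order_trans[OF pw] simp del: of_real_add)
      have "(LINT x|lebesgue_on \<Omega>. e * (w x * \<phi> x)) \<le> (LINT x|lebesgue_on \<Omega>. \<tau> / (2 * \<sigma>) * indicat_real (Bl \<sigma>) x + \<sigma> / (2 * \<tau>) * (indicator (Bl \<sigma>) x * (w x)\<^sup>2))"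
      proof (rule integral_mono)
        show "integrable (lebesgue_on \<Omega>) (\<lambda>x. e * (w x * \<phi> x))" using i3 by simp
        show "integrable (lebesgue_on \<Omega>) (\<lambda>x. \<tau> / (2 * \<sigma>) * indicat_real (Bl \<sigma>) x + \<sigma> / (2 * \<tau>) * (indicator (Bl \<sigma>) x * (w x)\<^sup>2))"
          by (rule Bochner_Integration.integrable_add[OF i1 i2])
        fix x
        have "e * (w x * \<phi> x) \<le> \<bar>e * (w x * \<phi> x)\<bar>" by simp
        also have "\<dots> = \<bar>w x * \<phi> x\<bar>" using e by (simp add: abs_mult)
        finally show "e * (w x * \<phi> x) \<le> \<tau> / (2 * \<sigma>) * indicat_real (Bl \<sigma>) x + \<sigma> / (2 * \<tau>) * (indicator (Bl \<sigma>) x * (w x)\<^sup>2)"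
          using pw[of x] by linarith
      qed
      also have "\<dots> = (LINT x|lebesgue_on \<Omega>. \<tau> / (2 * \<sigma>) * indicat_real (Bl \<sigma>) x) + (LINT x|lebesgue_on \<Omega>. \<sigma> / (2 * \<tau>) * (indicator (Bl \<sigma>) x * (w x)\<^sup>2))"
        by (rule Bochner_Integration.integral_add[OF i1 i2])
      also have "(LINT x|lebesgue_on \<Omega>. \<tau> / (2 * \<sigma>) * indicat_real (Bl \<sigma>) x) = (LINT x|lebesgue. \<tau> / (2 * \<sigma>) * indicat_real (Bl \<sigma>) x)"
        using BO by (intro integral_lebesgue_on_supported[OF \<Omega>]) (auto simp: indicator_def)
      also have "\<dots> = \<tau> / (2 * \<sigma>) * (c0 * \<rho>\<^sup>2)"
        unfolding Bl_def \<rho>_def[symmetric] by (rule vol) (use \<rho> in simp)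
      also have "(LINT x|lebesgue_on \<Omega>. \<sigma> / (2 * \<tau>) * (indicator (Bl \<sigma>) x * (w x)\<^sup>2)) = \<sigma> / (2 * \<tau>) * W \<sigma>"
        by (simp add: W_def)
      finally show ?thesis by simp
    qed
    have "\<tau> / \<sigma> * (c0 * \<rho>\<^sup>2) = c / \<sigma> * exp (- 4 / 3) * (c0 * (\<rho> / 2)\<^sup>2)"
      by (simp add: \<tau>_def power_divide)
    also have "\<dots> \<le> \<tau> / (2 * \<sigma>) * (c0 * \<rho>\<^sup>2) + \<sigma> / (2 * \<tau>) * W \<sigma>"
      using lower upper eq by simp
    also have "\<tau> / \<sigma> * (c0 * \<rho>\<^sup>2) = \<tau> / (2 * \<sigma>) * (c0 * \<rho>\<^sup>2) + \<tau> / (2 * \<sigma>) * (c0 * \<rho>\<^sup>2)" by simp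
    finally have "\<tau> / (2 * \<sigma>) * (c0 * \<rho>\<^sup>2) \<le> \<sigma> / (2 * \<tau>) * W \<sigma>" by (simp only: add_le_cancel_left)
    then have "\<tau> / (2 * \<sigma>) * (c0 * \<rho>\<^sup>2) * (2 * \<tau> / \<sigma>) \<le> \<sigma> / (2 * \<tau>) * W \<sigma> * (2 * \<tau> / \<sigma>)"
      using \<tau> \<sigma> by (intro mult_right_mono) auto
    also have "\<sigma> / (2 * \<tau>) * W \<sigma> * (2 * \<tau> / \<sigma>) = W \<sigma>" using \<tau> \<sigma> by simp
    also have "\<tau> / (2 * \<sigma>) * (c0 * \<rho>\<^sup>2) * (2 * \<tau> / \<sigma>) = \<tau>\<^sup>2 * c0 * \<kappa>\<^sup>2 / 4"
      using \<sigma> by (simp add: \<rho>_def power2_eq_square)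
    finally show ?thesis .
  qed
  \<comment> \<open>Along this sequence the discs shrink to \<open>a\<close>, so by dominated
    convergence their energies tend to 0, against the uniform lower bound. The offset 2 keeps every
    term strictly below \<open>\<sigma>0\<close>.\<close>
  define \<sigma> where "\<sigma> n = \<sigma>0 / real (n + 2)" for n
  have \<sigma>: "0 < \<sigma> n" "\<sigma> n < \<sigma>0" for n using pos by (auto simp: \<sigma>_def field_simps add_pos_nonneg)
  have \<sigma>lim: "\<sigma> \<longlonglongrightarrow> 0"
    unfolding \<sigma>_def using LIMSEQ_ignore_initial_segment[OF lim_const_over_n[of \<sigma>0], of 2] by simp
  have "filterlim \<sigma> (at_right 0) sequentially"
    using \<sigma>lim \<sigma> by (intro tendsto_imp_filterlim_at_right) auto
  then have Xlim: "(\<lambda>n. X (\<sigma> n)) \<longlonglongrightarrow> a" using X filterlim_compose by blast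
  have "(\<lambda>n. W (\<sigma> n)) \<longlonglongrightarrow> (LINT x|lebesgue_on \<Omega>. 0)"
    unfolding W_def
  proof (rule integral_dominated_convergence[OF _ _ wi])
    have "AE x in lebesgue. x \<in> \<Omega> \<longrightarrow> x \<noteq> a" using AE_not_point[of a] by eventually_elim auto
    then have "AE x in lebesgue_on \<Omega>. x \<noteq> a" using \<Omega> by (subst AE_restrict_space_iff) auto
    then show "AE x in lebesgue_on \<Omega>. (\<lambda>n. indicat_real (Bl (\<sigma> n)) x * (w x)\<^sup>2) \<longlonglongrightarrow> 0"
    proof eventually_elim
      case (elim x)
      have "(\<lambda>n. dist (X (\<sigma> n)) x - \<kappa> * \<sigma> n / 2) \<longlonglongrightarrow> dist a x - \<kappa> * 0 / 2"
        by (intro tendsto_intros Xlim \<sigma>lim) simp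
      then have "\<forall>\<^sub>F n in sequentially. 0 < dist (X (\<sigma> n)) x - \<kappa> * \<sigma> n / 2"
        using elim by (intro order_tendstoD(1)) auto
      then have "\<forall>\<^sub>F n in sequentially. indicat_real (Bl (\<sigma> n)) x * (w x)\<^sup>2 = 0"
        by eventually_elim (auto simp: Bl_def)
      then show ?case by (rule tendsto_eventually)
    qed
    show "AE x in lebesgue_on \<Omega>. norm (indicat_real (Bl (\<sigma> n)) x * (w x)\<^sup>2) \<le> (w x)\<^sup>2" for n
      by (rule AE_I2) (auto simp: indicator_def)
  qed measurable
  then have "(\<lambda>n. W (\<sigma> n)) \<longlonglongrightarrow> 0" by simp
  then have "\<tau>\<^sup>2 * c0 * \<kappa>\<^sup>2 / 4 \<le> 0"
    using W_low[OF \<sigma>] by (intro LIMSEQ_le_const) auto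
  moreover have "\<tau>\<^sup>2 * c0 * \<kappa>\<^sup>2 / 4 > 0" using \<tau> c0 pos by simp
  ultimately show False by simp
qed

section \<open>Polar mappings\<close>

lemma matrix_inv_2x2:
  fixes A :: "real^2^2"
  assumes "det A \<noteq> 0"
  shows "matrix_inv A = vector [vector [A$2$2 / det A, - A$1$2 / det A], vector [- A$2$1 / det A, A$1$1 / det A]]"
    (is "_ = ?B")
proof -
  define d where "d = det A"
  have d: "d \<noteq> 0" "A$1$1 * A$2$2 = d + A$1$2 * A$2$1" using assms by (simp_all add: d_def det_2)
  have "A ** ?B = mat 1" unfolding d_def[symmetric]
    using d by (auto simp: vec_eq_iff forall_2 matrix_matrix_mult_def sum_2 mat_def field_simps)
  moreover have "?B ** A = mat 1" unfolding d_def[symmetric]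
    using d by (auto simp: vec_eq_iff forall_2 matrix_matrix_mult_def sum_2 mat_def field_simps)
  ultimately have B: "A ** ?B = mat 1 \<and> ?B ** A = mat 1" by blast
  then have I: "A ** matrix_inv A = mat 1 \<and> matrix_inv A ** A = mat 1"
    unfolding matrix_inv_def by (rule someI)
  have "matrix_inv A = (?B ** A) ** matrix_inv A" by (simp only: B matrix_mul_lid)
  also have "\<dots> = ?B ** (A ** matrix_inv A)" by (rule matrix_mul_assoc[symmetric])
  also have "\<dots> = ?B" by (simp only: I matrix_mul_rid)
  finally show ?thesis .
qed

locale polar_map =
  fixes L :: real and \<Omega> :: "(real^2) set" and x0 :: "real^2" and F :: "real^2 \<Rightarrow> real^2"
  assumes polar_mapping: "polar_mapping L \<Omega> x0 F"
    and first_order: "first_order_polar_singularity L F"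
begin

abbreviation "P \<equiv> polar_coords L F"
abbreviation "J \<equiv> JF L F"

definition "\<Omega>0 = \<Omega> - {x0}"

lemmas polar_mapping_unfolded = polar_mapping[unfolded polar_mapping_def polar_diffeo_def]

lemmas L_pos = polar_mapping_unfolded[THEN conjunct1]
lemmas open_\<Omega> = polar_mapping_unfolded[THEN conjunct2, THEN conjunct1]
lemmas bounded_\<Omega> = polar_mapping_unfolded[THEN conjunct2, THEN conjunct2, THEN conjunct1]
lemmas x0_in = polar_mapping_unfolded[THEN conjunct2, THEN conjunct2, THEN conjunct2, THEN conjunct2, THEN conjunct1]
lemmas F_C1 = polar_mapping_unfolded[THEN conjunct2, THEN conjunct2, THEN conjunct2, THEN conjunct2, THEN conjunct2, THEN conjunct2, THEN conjunct1]
lemmas F_diffeo = polar_mapping_unfolded[THEN conjunct2, THEN conjunct2, THEN conjunct2, THEN conjunct2, THEN conjunct2, THEN conjunct2, THEN conjunct2, THEN conjunct2, THEN conjunct2, THEN conjunct1]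
lemmas F_strip0 = F_diffeo[THEN conjunct2, THEN conjunct1]
lemmas F_inner = polar_mapping_unfolded[THEN conjunct2, THEN conjunct2, THEN conjunct2, THEN conjunct2, THEN conjunct2, THEN conjunct2, THEN conjunct2, THEN conjunct2, THEN conjunct2, THEN conjunct2]

lemma F_pole: "z \<in> strip L \<Longrightarrow> z $ 1 = 0 \<Longrightarrow> F z = x0"
proof -
  have "\<forall>z\<in>strip L. z $ 1 = 0 \<longrightarrow> F z = x0" by (rule polar_mapping_unfolded[THEN conjunct2, THEN conjunct2, THEN conjunct2, THEN conjunct2, THEN conjunct2, THEN conjunct2, THEN conjunct2, THEN conjunct2, THEN conjunct1])
  then show "z \<in> strip L \<Longrightarrow> z $ 1 = 0 \<Longrightarrow> F z = x0" by blast
qed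

lemma F_period: "z \<in> strip L \<Longrightarrow> F (z + vector [0, 2 * pi]) = F z"
proof -
  have "\<forall>z\<in>strip L. F (z + vector [0, 2 * pi]) = F z" by (rule polar_mapping_unfolded[THEN conjunct2, THEN conjunct2, THEN conjunct2, THEN conjunct2, THEN conjunct2, THEN conjunct1])
  then show "z \<in> strip L \<Longrightarrow> F (z + vector [0, 2 * pi]) = F z" by blast
qed

lemma F_inj:
  assumes "z \<in> strip0 L" "w \<in> strip0 L" "F z = F w"
  shows "z $ 1 = w $ 1 \<and> (\<exists>k::int. z $ 2 = w $ 2 + 2 * pi * of_int k)"
proof -
  have "\<forall>z\<in>strip0 L. \<forall>w\<in>strip0 L. F z = F w \<longrightarrow>
      z $ 1 = w $ 1 \<and> (\<exists>k::int. z $ 2 = w $ 2 + 2 * pi * of_int k)"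
    by (rule F_diffeo[THEN conjunct2, THEN conjunct2, THEN conjunct1])
  then show ?thesis using assms by blast
qed

lemma local_inverse:
  assumes "y \<in> closure \<Omega> - {x0}"
  obtains U G where "open U" "y \<in> U" "C1_map_on (U \<inter> (closure \<Omega> - {x0})) G"
     "G ` (U \<inter> (closure \<Omega> - {x0})) \<subseteq> strip0 L" "\<forall>x\<in>U \<inter> (closure \<Omega> - {x0}). F (G x) = x"
proof -
  have "\<forall>y\<in>closure \<Omega> - {x0}. \<exists>U G. open U \<and> y \<in> U \<and> C1_map_on (U \<inter> (closure \<Omega> - {x0})) G \<and>
        G ` (U \<inter> (closure \<Omega> - {x0})) \<subseteq> strip0 L \<and> (\<forall>x\<in>U \<inter> (closure \<Omega> - {x0}). F (G x) = x)"
    by (rule F_diffeo[THEN conjunct2, THEN conjunct2, THEN conjunct2])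
  from bspec[OF this assms] show thesis by (elim exE conjE) (rule that)
qed

lemma open_\<Omega>0: "open \<Omega>0"
  using open_\<Omega> by (simp add: \<Omega>0_def open_delete)

lemma F_shift:
  assumes "z \<in> strip L"
  shows "F (z + vector [0, 2 * pi * of_int k]) = F z"
proof (induction k rule: int_induct[of _ 0])
  case base
  have "vector [0, 2 * pi * of_int 0] = (0::real^2)" by (simp add: vec_eq_iff forall_2)
  then show ?case by simp
next
  case (step1 i)
  have e1: "z + vector [0, 2 * pi * of_int (i + 1)] = (z + vector [0, 2 * pi * of_int i]) + vector [0, 2 * pi]"
    by (simp add: vec_eq_iff forall_2 algebra_simps)
  have e2: "z + vector [0, 2 * pi * of_int i] \<in> strip L" using assms by (simp add: strip_def)
  show ?case unfolding e1 by (rule trans[OF F_period[OF e2] step1(2)])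
next
  case (step2 i)
  have "(z + vector [0, 2 * pi * of_int (i - 1)]) + vector [0, 2 * pi] = z + vector [0, 2 * pi * of_int i]"
    by (simp add: vec_eq_iff forall_2 algebra_simps)
  moreover have "z + vector [0, 2 * pi * of_int (i - 1)] \<in> strip L" using assms by (simp add: strip_def)
  ultimately show ?case using step2 F_period by metis
qed

lemma strip0_subset: "z \<in> strip0 L \<Longrightarrow> z \<in> strip L"
  by (simp add: strip_def strip0_def)

lemma polar_coords:
  assumes "x \<in> closure \<Omega> - {x0}"
  shows "P x \<in> strip0 L" "0 \<le> P x $ 2" "P x $ 2 < 2 * pi" "F (P x) = x"
proof -
  let ?D = "{z \<in> strip0 L. 0 \<le> z $ 2 \<and> z $ 2 < 2 * pi}"
  have x: "x \<in> F ` ?D"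
  proof -
    obtain z where z: "z \<in> strip0 L" "F z = x" using assms F_strip0 by (metis imageE)
    define k where "k = \<lfloor>z $ 2 / (2 * pi)\<rfloor>"
    define w where "w = z + vector [0, 2 * pi * of_int (- k)]"
    have "of_int k \<le> z $ 2 / (2 * pi)" "z $ 2 / (2 * pi) < of_int k + 1" unfolding k_def by linarith+
    then have "2 * pi * of_int k \<le> z $ 2" "z $ 2 < 2 * pi * of_int k + 2 * pi"
      by (simp_all add: field_simps)
    then have "w \<in> ?D" using z by (auto simp: w_def strip0_def)
    have "F w = F z" unfolding w_def by (rule F_shift[OF strip0_subset[OF z(1)]])
    then have "x = F w" using z(2) by simp
    then show ?thesis using \<open>w \<in> ?D\<close> by (rule image_eqI)
  qed
  have "P x \<in> ?D" unfolding polar_coords_def by (rule inv_into_into[OF x])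
  then show "P x \<in> strip0 L" "0 \<le> P x $ 2" "P x $ 2 < 2 * pi" by simp_all
  show "F (P x) = x" unfolding polar_coords_def by (rule f_inv_into_f[OF x])
qed

lemma \<Omega>0_subset: "x \<in> \<Omega>0 \<Longrightarrow> x \<in> closure \<Omega> - {x0}"
  using closure_subset[of \<Omega>] by (auto simp: \<Omega>0_def)

lemma F_in_\<Omega>0:
  assumes "0 < z $ 1" "z $ 1 < L"
  shows "F z \<in> \<Omega>0"
proof -
  have "F z \<in> \<Omega>" using assms F_inner by (force simp: strip_def)
  moreover have "F z \<noteq> x0" using assms F_strip0 by (force simp: strip0_def)
  ultimately show ?thesis by (simp add: \<Omega>0_def)
qed

lemma polar_coords_F:
  assumes "0 < z $ 1" "z $ 1 < L"
  shows "P (F z) $ 1 = z $ 1" "\<exists>k::int. z $ 2 = P (F z) $ 2 + 2 * pi * of_int k"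
proof -
  have x: "F z \<in> closure \<Omega> - {x0}" using F_in_\<Omega>0[OF assms] by (rule \<Omega>0_subset)
  have "z \<in> strip0 L" using assms by (simp add: strip0_def)
  from F_inj[OF this polar_coords(1)[OF x]] polar_coords(4)[OF x]
  show "P (F z) $ 1 = z $ 1" "\<exists>k::int. z $ 2 = P (F z) $ 2 + 2 * pi * of_int k" by auto
qed

lemma polar_coords_F_eq:
  assumes "0 < z $ 1" "z $ 1 < L" "0 \<le> z $ 2" "z $ 2 < 2 * pi"
  shows "P (F z) = z"
proof -
  obtain k :: int where k: "z $ 2 = P (F z) $ 2 + 2 * pi * of_int k" using polar_coords_F(2)[OF assms(1,2)] by blast
  have "0 \<le> P (F z) $ 2" "P (F z) $ 2 < 2 * pi"
    using polar_coords(2,3)[OF \<Omega>0_subset[OF F_in_\<Omega>0[OF assms(1,2)]]] by auto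
  then have "2 * pi * of_int k < 2 * pi * 1" "2 * pi * (- 1) < 2 * pi * of_int k" using k assms by linarith+
  moreover have "2 * pi * 1 \<le> 2 * pi * real_of_int k" if "k \<ge> 1" using that by (intro mult_left_mono) auto
  moreover have "2 * pi * real_of_int k \<le> 2 * pi * (- 1)" if "k \<le> - 1" using that by (intro mult_left_mono) auto
  ultimately have "\<not> k \<ge> 1" "\<not> k \<le> - 1" by linarith+
  then have "k = 0" by linarith
  then show ?thesis using k polar_coords_F(1)[OF assms(1,2)] by (simp add: vec_eq_iff forall_2)
qed

lemma polar_coords_inner:
  assumes "x \<in> \<Omega>0"
  shows "0 < P x $ 1" "P x $ 1 < L" "0 \<le> P x $ 2" "P x $ 2 < 2 * pi" "F (P x) = x"
proof -
  note pc = polar_coords[OF \<Omega>0_subset[OF assms]]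
  show "0 < P x $ 1" using pc(1) by (simp add: strip0_def)
  have "x \<in> F ` {z \<in> strip L. z $ 1 < L}" using assms by (simp add: F_inner \<Omega>0_def)
  then obtain z where z: "z \<in> strip L" "z $ 1 < L" "F z = x" by blast
  have "z $ 1 \<noteq> 0" using F_pole[OF z(1)] z(3) assms by (auto simp: \<Omega>0_def)
  then show "P x $ 1 < L" using polar_coords_F(1)[of z] z by (auto simp: strip_def)
qed (use polar_coords[OF \<Omega>0_subset[OF assms]] in auto)

text \<open>\<open>JF\<close> rests on a chosen derivative within the strip. In the interior the
  derivative is unique, so the choice coincides there with the continuous matrix field supplied by
  the C^1 property.\<close>

lemma F_has_derivative:
  assumes "0 < z $ 1" "z $ 1 < L"
  shows "(F has_derivative (\<lambda>h. J z *v h)) (at z)"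
    and "continuous_on {z. 0 < z $ 1 \<and> z $ 1 < L} J"
proof -
  obtain A where A: "\<And>x. x \<in> strip L \<Longrightarrow> (F has_derivative (\<lambda>h. A x *v h)) (at x within strip L)"
    and Ac: "continuous_on (strip L) A" using F_C1 unfolding C1_map_on_def by blast
  have o: "open {z::real^2. 0 < z $ 1 \<and> z $ 1 < L}"
    by (intro open_Collect_conj open_Collect_less continuous_intros)
  have sub: "{z. 0 < z $ 1 \<and> z $ 1 < L} \<subseteq> strip L" by (auto simp: strip_def)
  have eq: "J z = A z \<and> (F has_derivative (\<lambda>h. A z *v h)) (at z)" if "0 < z $ 1" "z $ 1 < L" for z
  proof -
    have "z \<in> interior (strip L)" using interior_maximal[OF sub o] that by blast
    then have at: "at z within strip L = at z" by (rule at_within_interior)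
    have d: "(F has_derivative (\<lambda>h. A z *v h)) (at z)" using A[of z] that unfolding at by (auto simp: strip_def)
    have "frechet_derivative F (at z) = (\<lambda>h. A z *v h)" using frechet_derivative_at[OF d] by simp
    then have "J z = A z" unfolding JF_def jacobian_def at by (simp add: matrix_of_matrix_vector_mul)
    then show ?thesis using d by simp
  qed
  show "(F has_derivative (\<lambda>h. J z *v h)) (at z)" using eq[OF assms] by simp
  show "continuous_on {z. 0 < z $ 1 \<and> z $ 1 < L} J"
    using continuous_on_subset[OF Ac sub] by (rule continuous_on_eq) (use eq in auto)
qed

lemma continuous_F: "continuous_on (strip L) F"
  using F_C1 unfolding C1_map_on_def
  by (meson continuous_on_eq_continuous_within has_derivative_continuous)

text \<open>The rows of the inverse Jacobian matrix, i.e. the gradients of \<open>s\<close> and of \<open>\<theta>\<close>.\<close>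

definition R1 :: "real^2 \<Rightarrow> real^2" where
  "R1 x = vector [J (P x) $ 2 $ 2 / det (J (P x)), - J (P x) $ 1 $ 2 / det (J (P x))]"

definition R2 :: "real^2 \<Rightarrow> real^2" where
  "R2 x = vector [- J (P x) $ 2 $ 1 / det (J (P x)), J (P x) $ 1 $ 1 / det (J (P x))]"

text \<open>Gathers under one constant what is later used of the polar singularity. One period of
  the angle suffices and is compact, which bounds \<open>C\<close>, \<open>S\<close> and their
  derivatives; \<open>C\<close> and \<open>S\<close> have no common zero because D > 0.\<close>

lemma jacobian_asymptotics:
  obtains C S :: "real \<Rightarrow> real" and K Dm where "continuous_on UNIV C" "continuous_on UNIV S" "\<forall>t. C t \<noteq> 0 \<or> S t \<noteq> 0"
    "K > 0" "Dm > 0"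
    "\<forall>z. 0 < z $ 1 \<and> z $ 1 < L \<and> 0 \<le> z $ 2 \<and> z $ 2 < 2 * pi \<longrightarrow>
       z $ 1 * Dm \<le> det (J z) \<and> det (J z) \<le> K * z $ 1 \<and>
       \<bar>J z $ 1 $ 1\<bar> \<le> K \<and> \<bar>J z $ 2 $ 1\<bar> \<le> K \<and> \<bar>J z $ 1 $ 2\<bar> \<le> K * z $ 1 \<and> \<bar>J z $ 2 $ 2\<bar> \<le> K * z $ 1 \<and>
       \<bar>J z $ 1 $ 1 - C (z $ 2)\<bar> \<le> K * z $ 1 \<and> \<bar>J z $ 2 $ 1 - S (z $ 2)\<bar> \<le> K * z $ 1"
proof -
  let ?J = "\<lambda>C C' S S' r11 r12 r21 r22. Os L r11 \<and> Os L r12 \<and> Os L r21 \<and> Os L r22 \<and>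
           (\<forall>z\<in>strip L. J z =
              vector [vector [C (z $ 2) + r11 z, z $ 1 * (C' (z $ 2) + r12 z)],
                      vector [S (z $ 2) + r21 z, z $ 1 * (S' (z $ 2) + r22 z)]])"
  obtain C C' S S' D where fo: "C1_periodic C C' \<and> C1_periodic S S' \<and>
        (\<forall>t. D t = C t * S' t - S t * C' t) \<and> (\<forall>t. 0 < D t) \<and>
        (\<exists>r11 r12 r21 r22. ?J C C' S S' r11 r12 r21 r22) \<and>
        (\<exists>r. Os L r \<and> (\<forall>z\<in>strip L. det (J z) = z $ 1 * (D (z $ 2) + r z))) \<and>
        (\<exists>Dmin>0. \<forall>z\<in>strip L. z $ 1 * Dmin \<le> det (J z)) \<and>
        (\<exists>r. Os L r \<and> (\<forall>z\<in>strip0 L. inverse (det (J z)) = (1 + r z) / (z $ 1 * D (z $ 2))))"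
    using first_order unfolding first_order_polar_singularity_def by (elim exE) (rule that)
  note fo2 = fo[THEN conjunct2]
  note fo3 = fo2[THEN conjunct2]
  note fo4 = fo3[THEN conjunct2]
  note fo5 = fo4[THEN conjunct2]
  note C = fo[THEN conjunct1] and S = fo2[THEN conjunct1] and D = fo3[THEN conjunct1] fo4[THEN conjunct1]
  obtain r11 r12 r21 r22 where rJ: "?J C C' S S' r11 r12 r21 r22"
    using fo5[THEN conjunct1] by (elim exE) (rule that)
  have r: "Os L r11" "Os L r12" "Os L r21" "Os L r22"
    and Jz: "\<forall>z\<in>strip L. J z =
              vector [vector [C (z $ 2) + r11 z, z $ 1 * (C' (z $ 2) + r12 z)],
                      vector [S (z $ 2) + r21 z, z $ 1 * (S' (z $ 2) + r22 z)]]"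
    using rJ by simp_all
  obtain Dm where Dm: "0 < Dm" "\<forall>z\<in>strip L. z $ 1 * Dm \<le> det (J z)"
    using fo5[THEN conjunct2, THEN conjunct2, THEN conjunct1] by blast
  obtain c1 where c1: "c1 > 0" "\<forall>z\<in>strip L. \<bar>r11 z\<bar> \<le> c1 * z $ 1" using r(1) unfolding Os_def by blast
  obtain c2 where c2: "c2 > 0" "\<forall>z\<in>strip L. \<bar>r12 z\<bar> \<le> c2 * z $ 1" using r(2) unfolding Os_def by blast
  obtain c3 where c3: "c3 > 0" "\<forall>z\<in>strip L. \<bar>r21 z\<bar> \<le> c3 * z $ 1" using r(3) unfolding Os_def by blast
  obtain c4 where c4: "c4 > 0" "\<forall>z\<in>strip L. \<bar>r22 z\<bar> \<le> c4 * z $ 1" using r(4) unfolding Os_def by blast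
  note c = c1(1) c2(1) c3(1) c4(1) and rb = c1(2) c2(2) c3(2) c4(2)
  have cont: "continuous_on UNIV C" "continuous_on UNIV C'" "continuous_on UNIV S" "continuous_on UNIV S'"
    using C S unfolding C1_periodic_def
    by (auto intro!: continuous_at_imp_continuous_on DERIV_isCont)
  have bd: "\<exists>B\<ge>0. \<forall>t\<in>{0..2 * pi}. \<bar>f t\<bar> \<le> B" if "continuous_on UNIV f" for f :: "real \<Rightarrow> real"
  proof -
    have "bounded (f ` {0..2 * pi})"
      using that by (intro compact_imp_bounded compact_continuous_image) (auto intro: continuous_on_subset)
    then obtain B where "\<forall>t\<in>{0..2 * pi}. \<bar>f t\<bar> \<le> B" unfolding bounded_iff by auto
    then show ?thesis by (intro exI[of _ "\<bar>B\<bar>"]) auto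
  qed
  obtain b1 b2 b3 b4 where b: "b1 \<ge> 0" "b2 \<ge> 0" "b3 \<ge> 0" "b4 \<ge> 0"
    "\<forall>t\<in>{0..2 * pi}. \<bar>C t\<bar> \<le> b1" "\<forall>t\<in>{0..2 * pi}. \<bar>C' t\<bar> \<le> b2" "\<forall>t\<in>{0..2 * pi}. \<bar>S t\<bar> \<le> b3" "\<forall>t\<in>{0..2 * pi}. \<bar>S' t\<bar> \<le> b4"
    using bd[OF cont(1)] bd[OF cont(2)] bd[OF cont(3)] bd[OF cont(4)] by (elim exE conjE) (rule that)
  \<comment> \<open>The factor L + 1 lets \<open>M\<close> dominate both the constants ci and the
    products ci s for 0 < s < L.\<close>
  define M where "M = b1 + b2 + b3 + b4 + (c1 + c2 + c3 + c4) * (L + 1)"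
  have "M > 0" using b c L_pos by (auto simp: M_def intro!: add_nonneg_pos)
  have cM: "ci * s \<le> M" "ci \<le> M" "bi + ci * s \<le> M" if "ci \<in> {c1, c2, c3, c4}" "bi \<in> {b1, b2, b3, b4}" "0 < s" "s < L" for ci bi s
  proof -
    have ci: "ci > 0" "ci \<le> c1 + c2 + c3 + c4" using that c by auto
    have bi: "bi \<ge> 0" "bi \<le> b1 + b2 + b3 + b4" using that b by auto
    have 1: "ci * s \<le> (c1 + c2 + c3 + c4) * (L + 1)" using ci that c by (intro mult_mono) auto
    have 2: "ci * 1 \<le> (c1 + c2 + c3 + c4) * (L + 1)" using ci that c L_pos by (intro mult_mono) auto
    show "ci * s \<le> M" "ci \<le> M" "bi + ci * s \<le> M" using 1 2 bi b by (auto simp: M_def)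
  qed
  \<comment> \<open>The two products in the determinant are each at most M^2 s.\<close>
  define K where "K = M + 2 * M * M"
  have K: "K > 0" "M \<le> K" using \<open>M > 0\<close> by (auto simp: K_def intro: add_pos_pos)
  show thesis
  proof (rule that[of C S K Dm])
    have "C t \<noteq> 0 \<or> S t \<noteq> 0" for t using spec[OF D(1), of t] spec[OF D(2), of t] by auto
    then show "\<forall>t. C t \<noteq> 0 \<or> S t \<noteq> 0" by blast
  next
    show "\<forall>z. 0 < z $ 1 \<and> z $ 1 < L \<and> 0 \<le> z $ 2 \<and> z $ 2 < 2 * pi \<longrightarrow>
       z $ 1 * Dm \<le> det (J z) \<and> det (J z) \<le> K * z $ 1 \<and>
       \<bar>J z $ 1 $ 1\<bar> \<le> K \<and> \<bar>J z $ 2 $ 1\<bar> \<le> K \<and> \<bar>J z $ 1 $ 2\<bar> \<le> K * z $ 1 \<and> \<bar>J z $ 2 $ 2\<bar> \<le> K * z $ 1 \<and>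
       \<bar>J z $ 1 $ 1 - C (z $ 2)\<bar> \<le> K * z $ 1 \<and> \<bar>J z $ 2 $ 1 - S (z $ 2)\<bar> \<le> K * z $ 1"
    proof (intro allI impI; elim conjE)
    fix z :: "real^2" assume z: "0 < z $ 1" "z $ 1 < L" "0 \<le> z $ 2" "z $ 2 < 2 * pi"
    define s t where "s = z $ 1" and "t = z $ 2"
    have zs: "z \<in> strip L" and t: "t \<in> {0..2 * pi}" and s: "0 < s" "s < L" using z by (auto simp: strip_def s_def t_def)
    note rz = rb[THEN bspec, OF zs, folded s_def]
    have J11: "J z $ 1 $ 1 = C t + r11 z" and J12: "J z $ 1 $ 2 = s * (C' t + r12 z)"
      and J21: "J z $ 2 $ 1 = S t + r21 z" and J22: "J z $ 2 $ 2 = s * (S' t + r22 z)"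
      using bspec[OF Jz zs] by (simp_all add: s_def t_def)
    have B: "\<bar>C t\<bar> \<le> b1" "\<bar>C' t\<bar> \<le> b2" "\<bar>S t\<bar> \<le> b3" "\<bar>S' t\<bar> \<le> b4" using b t by auto
    have e11: "\<bar>J z $ 1 $ 1\<bar> \<le> M" unfolding J11 using B(1) rz(1) cM(3)[of c1 b1 s] s by (simp; linarith)
    have e21: "\<bar>J z $ 2 $ 1\<bar> \<le> M" unfolding J21 using B(3) rz(3) cM(3)[of c3 b3 s] s by (simp; linarith)
    have "\<bar>C' t + r12 z\<bar> \<le> M" using B(2) rz(2) cM(3)[of c2 b2 s] s by (simp; linarith)
    then have e12: "\<bar>J z $ 1 $ 2\<bar> \<le> M * s" unfolding J12 abs_mult using s by simp
    have "\<bar>S' t + r22 z\<bar> \<le> M" using B(4) rz(4) cM(3)[of c4 b4 s] s by (simp; linarith)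
    then have e22: "\<bar>J z $ 2 $ 2\<bar> \<le> M * s" unfolding J22 abs_mult using s by simp
    have MK: "M * s \<le> K * s" using K s by (intro mult_right_mono) auto
    have "\<bar>J z $ 1 $ 1 * J z $ 2 $ 2\<bar> \<le> M * (M * s)" "\<bar>J z $ 1 $ 2 * J z $ 2 $ 1\<bar> \<le> (M * s) * M"
      unfolding abs_mult using e11 e12 e21 e22 \<open>M > 0\<close> s by (auto intro!: mult_mono)
    then have "det (J z) \<le> M * (M * s) + (M * s) * M" unfolding det_2 by linarith
    also have "\<dots> \<le> K * s" using \<open>M > 0\<close> s by (simp add: K_def algebra_simps)
    finally have "det (J z) \<le> K * s" .
    moreover have "c1 * s \<le> K * s" "c3 * s \<le> K * s"
      using cM(2)[of c1 b1 s] cM(2)[of c3 b1 s] K s by (auto intro!: mult_right_mono)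
    moreover have "\<bar>J z $ 1 $ 1 - C t\<bar> \<le> c1 * s" "\<bar>J z $ 2 $ 1 - S t\<bar> \<le> c3 * s"
      using rz unfolding J11 J21 by auto
    moreover note bspec[OF Dm(2) zs] e11 e12 e21 e22 MK K
    ultimately show "z $ 1 * Dm \<le> det (J z) \<and> det (J z) \<le> K * z $ 1 \<and>
       \<bar>J z $ 1 $ 1\<bar> \<le> K \<and> \<bar>J z $ 2 $ 1\<bar> \<le> K \<and> \<bar>J z $ 1 $ 2\<bar> \<le> K * z $ 1 \<and> \<bar>J z $ 2 $ 2\<bar> \<le> K * z $ 1 \<and>
       \<bar>J z $ 1 $ 1 - C (z $ 2)\<bar> \<le> K * z $ 1 \<and> \<bar>J z $ 2 $ 1 - S (z $ 2)\<bar> \<le> K * z $ 1"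
      unfolding s_def t_def by linarith
    qed
  qed (use cont K Dm in auto)
qed

lemma det_pos: "x \<in> \<Omega>0 \<Longrightarrow> det (J (P x)) > 0"
proof -
  assume x: "x \<in> \<Omega>0"
  obtain Dm where Dm: "Dm > 0" "\<forall>z\<in>strip L. z $ 1 * Dm \<le> det (J z)"
    using first_order unfolding first_order_polar_singularity_def by (elim exE conjE) (rule that)
  note pc = polar_coords_inner[OF x]
  have "P x $ 1 * Dm \<le> det (J (P x))" using Dm pc by (auto simp: strip_def)
  moreover have "P x $ 1 * Dm > 0" using Dm pc by simp
  ultimately show ?thesis by linarith
qed

text \<open>The form ds \<and> d\<theta> in Cartesian coordinates; it is what puts the Jacobian
  determinant into the curl.\<close>

lemma R1_cross_R2: "x \<in> \<Omega>0 \<Longrightarrow> R1 x $ 1 * R2 x $ 2 - R1 x $ 2 * R2 x $ 1 = 1 / det (J (P x))"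
proof -
  assume "x \<in> \<Omega>0"
  then have d: "det (J (P x)) \<noteq> 0" using det_pos by fastforce
  have "R1 x $ 1 * R2 x $ 2 - R1 x $ 2 * R2 x $ 1 =
      (J (P x) $ 1 $ 1 * J (P x) $ 2 $ 2 - J (P x) $ 1 $ 2 * J (P x) $ 2 $ 1) / (det (J (P x)) * det (J (P x)))"
    by (simp add: R1_def R2_def diff_divide_distrib mult.commute)
  then show ?thesis unfolding det_2[symmetric] using d by simp
qed

lemma pullback_matrix:
  assumes "x \<in> \<Omega>0"
  shows "transpose (matrix_inv (J (P x))) *v vector [u, v] = u *\<^sub>R R1 x + v *\<^sub>R R2 x"
proof -
  have "det (J (P x)) \<noteq> 0" using det_pos[OF assms] by simp
  from matrix_inv_2x2[OF this] show ?thesis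
    by (simp add: vec_eq_iff forall_2 matrix_vector_mult_def transpose_def sum_2 R1_def R2_def mult.commute)
qed

text \<open>Cramer's rule: up to sign the numerators of \<open>R1\<close> form the second column of
  \<open>J\<close>, which is O(s), those of \<open>R2\<close> the first column, which is O(1), and
  the determinant is at least s times \<open>Dm\<close>.\<close>

lemma R_bounds:
  obtains K where "K > 0" "\<And>x. x \<in> \<Omega>0 \<Longrightarrow> norm (R1 x) \<le> K" "\<And>x. x \<in> \<Omega>0 \<Longrightarrow> norm (R2 x) \<le> K / P x $ 1"
proof -
  obtain C S :: "real \<Rightarrow> real" and K Dm where "continuous_on UNIV C" "continuous_on UNIV S" "\<forall>t. C t \<noteq> 0 \<or> S t \<noteq> 0"
    and K: "K > 0" "Dm > 0" and bnd: "\<forall>z. 0 < z $ 1 \<and> z $ 1 < L \<and> 0 \<le> z $ 2 \<and> z $ 2 < 2 * pi \<longrightarrow>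
       z $ 1 * Dm \<le> det (J z) \<and> det (J z) \<le> K * z $ 1 \<and>
       \<bar>J z $ 1 $ 1\<bar> \<le> K \<and> \<bar>J z $ 2 $ 1\<bar> \<le> K \<and> \<bar>J z $ 1 $ 2\<bar> \<le> K * z $ 1 \<and> \<bar>J z $ 2 $ 2\<bar> \<le> K * z $ 1 \<and>
       \<bar>J z $ 1 $ 1 - C (z $ 2)\<bar> \<le> K * z $ 1 \<and> \<bar>J z $ 2 $ 1 - S (z $ 2)\<bar> \<le> K * z $ 1"
    by (rule jacobian_asymptotics)
  note b = bnd[rule_format, OF conjI, OF _ conjI, OF _ _ conjI]
  have *: "norm (R1 x) \<le> 2 * K / Dm \<and> norm (R2 x) \<le> 2 * K / Dm / P x $ 1" if x: "x \<in> \<Omega>0" for x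
  proof -
    note pc = polar_coords_inner[OF x]
    define s where "s = P x $ 1"
    have s: "s > 0" using pc by (simp add: s_def)
    define d where "d = det (J (P x))"
    have d: "s * Dm \<le> d" "d > 0" using b[of "P x"] pc det_pos[OF x] by (auto simp: d_def s_def)
    have q: "\<bar>j / d\<bar> \<le> M / (s * Dm)" if "\<bar>j\<bar> \<le> M" for j M
    proof -
      have "\<bar>j\<bar> / d \<le> M / (s * Dm)" using that d s K by (intro frac_le) auto
      then show ?thesis using d by simp
    qed
    have e: "\<bar>J (P x) $ 1 $ 1\<bar> \<le> K" "\<bar>J (P x) $ 2 $ 1\<bar> \<le> K" "\<bar>J (P x) $ 1 $ 2\<bar> \<le> K * s" "\<bar>J (P x) $ 2 $ 2\<bar> \<le> K * s"
      using b[of "P x"] pc by (auto simp: s_def)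
    have n: "norm (v::real^2) \<le> \<bar>v $ 1\<bar> + \<bar>v $ 2\<bar>" for v
      using norm_le_l1_cart[of v] by (simp add: sum_2)
    have "K * s / (s * Dm) = K / Dm" using s by simp
    then have "\<bar>R1 x $ 1\<bar> \<le> K / Dm" "\<bar>R1 x $ 2\<bar> \<le> K / Dm"
      using q[OF e(3)] q[OF e(4)] by (simp_all add: R1_def d_def)
    then have 1: "norm (R1 x) \<le> K / Dm + K / Dm" using n[of "R1 x"] by linarith
    have "\<bar>R2 x $ 1\<bar> \<le> K / (s * Dm)" "\<bar>R2 x $ 2\<bar> \<le> K / (s * Dm)"
      using q[OF e(1)] q[OF e(2)] by (simp_all add: R2_def d_def)
    then have 2: "norm (R2 x) \<le> K / (s * Dm) + K / (s * Dm)" using n[of "R2 x"] by linarith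
    have "K / Dm + K / Dm = 2 * K / Dm" "K / (s * Dm) + K / (s * Dm) = 2 * K / Dm / s" by simp_all
    then show ?thesis using 1 2 unfolding s_def by simp
  qed
  show thesis by (rule that[of "2 * K / Dm"]) (use * K in auto)
qed

end

lemma norm_matrix_vector_mult_le:
  fixes A :: "real^'n::finite^'m::finite"
  shows "norm (A *v h) \<le> real CARD('m) * norm A * norm h"
proof -
  have "norm (A *v h) \<le> (\<Sum>i\<in>UNIV. \<bar>(A *v h) $ i\<bar>)" by (rule norm_le_l1_cart)
  also have "\<dots> \<le> (\<Sum>i\<in>(UNIV::'m set). norm A * norm h)"
  proof (rule sum_mono)
    fix i
    have "\<bar>(A *v h) $ i\<bar> \<le> norm (A $ i) * norm h"
      unfolding matrix_vector_mul_component by (rule Cauchy_Schwarz_ineq2)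
    also have "\<dots> \<le> norm A * norm h" by (intro mult_right_mono Finite_Cartesian_Product.norm_nth_le) auto
    finally show "\<bar>(A *v h) $ i\<bar> \<le> norm A * norm h" .
  qed
  finally show ?thesis by simp
qed

section \<open>Local lifts of the polar coordinates\<close>

context polar_map
begin

text \<open>\<open>P\<close> jumps where the angle passes 2 pi. The lift follows the angle
  continuously and agrees with \<open>P\<close> at y; elsewhere it may differ by a multiple of 2 pi,
  which periodic functions do not notice. Its derivative comes from differentiating F (G x) =
  x.\<close>

lemma local_lift:
  assumes y: "y \<in> \<Omega>0"
  obtains r G M where "r > 0" "ball y r \<subseteq> \<Omega>0" "G y = P y"
    "\<forall>x\<in>ball y r. G x $ 1 = P x $ 1 \<and> (\<exists>k::int. G x $ 2 = P x $ 2 + 2 * pi * of_int k)"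
    "(G has_derivative (\<lambda>h. vector [R1 y \<bullet> h, R2 y \<bullet> h])) (at y)"
    "\<forall>x\<in>ball y r. \<forall>x'\<in>ball y r. dist (G x) (G x') \<le> M * dist x x'"
proof -
  let ?Y = "closure \<Omega> - {x0}"
  have yY: "y \<in> ?Y" using \<Omega>0_subset[OF y] .
  obtain U G0 where U: "open U" "y \<in> U" and C1: "C1_map_on (U \<inter> ?Y) G0" and Gs: "G0 ` (U \<inter> ?Y) \<subseteq> strip0 L"
    and FG: "\<forall>x\<in>U \<inter> ?Y. F (G0 x) = x"
    by (rule local_inverse[OF yY])
  obtain A where A: "\<forall>x\<in>U \<inter> ?Y. (G0 has_derivative (\<lambda>h. A x *v h)) (at x within U \<inter> ?Y)"
    and Ac: "continuous_on (U \<inter> ?Y) A" using C1 unfolding C1_map_on_def by blast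
  define W where "W = U \<inter> \<Omega>0"
  have W: "open W" "y \<in> W" "W \<subseteq> U \<inter> ?Y" using U y open_\<Omega>0 \<Omega>0_subset by (auto simp: W_def)
  have dG0: "(G0 has_derivative (\<lambda>h. A x *v h)) (at x)" if "x \<in> W" for x
  proof -
    have "(G0 has_derivative (\<lambda>h. A x *v h)) (at x within W)"
      by (rule has_derivative_subset[OF bspec[OF A] W(3)]) (use that W(3) in blast)
    then show ?thesis using at_within_open[OF that W(1)] by simp
  qed
  have GP: "G0 x $ 1 = P x $ 1 \<and> (\<exists>k::int. G0 x $ 2 = P x $ 2 + 2 * pi * of_int k)" if "x \<in> W" for x
  proof (rule F_inj)
    have x: "x \<in> U \<inter> ?Y" using that W by blast
    show "G0 x \<in> strip0 L" using Gs x by blast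
    show "P x \<in> strip0 L" using polar_coords(1) x by blast
    show "F (G0 x) = F (P x)" using FG x polar_coords(4)[of x] by simp
  qed
  then obtain k :: int where k: "G0 y $ 2 = P y $ 2 + 2 * pi * of_int k" using W(2) by blast
  \<comment> \<open>The given local inverse may sit in another period; subtracting the multiple
    found at y makes it agree with \<open>P\<close> there.\<close>
  define G where "G x = G0 x + vector [0, 2 * pi * of_int (- k)]" for x
  have G1: "G x $ 1 = P x $ 1 \<and> (\<exists>l::int. G x $ 2 = P x $ 2 + 2 * pi * of_int l)" if xW: "x \<in> W" for x
  proof -
    obtain l :: int where "G0 x $ 2 = P x $ 2 + 2 * pi * of_int l" using GP[OF xW] by blast
    then have "G x $ 2 = P x $ 2 + 2 * pi * of_int (l - k)" by (simp add: G_def algebra_simps)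
    moreover have "G x $ 1 = P x $ 1" using GP[OF xW] by (simp add: G_def)
    ultimately show ?thesis by blast
  qed
  have Gy: "G y = P y" using GP[OF W(2)] k by (simp add: G_def vec_eq_iff forall_2)
  have dG: "(G has_derivative (\<lambda>h. A x *v h)) (at x)" if "x \<in> W" for x
    unfolding G_def using has_derivative_add[OF dG0[OF that] has_derivative_const] by simp
  have FGx: "F (G x) = x" if "x \<in> W" for x
  proof -
    have x: "x \<in> U \<inter> ?Y" using that W(3) by blast
    then have "G0 x \<in> strip L" using Gs strip0_subset by blast
    then have "F (G x) = F (G0 x)" unfolding G_def by (rule F_shift)
    then show ?thesis using FG x by simp
  qed
  have "continuous (at y) A"
    using continuous_on_subset[OF Ac W(3)] W(1,2) continuous_on_eq_continuous_at by blast
  then obtain d where d: "d > 0" "\<And>x. dist x y < d \<Longrightarrow> dist (A x) (A y) < 1"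
    unfolding continuous_at_eps_delta using zero_less_one by blast
  obtain e where e: "e > 0" "ball y e \<subseteq> W" using W(1,2) open_contains_ball by blast
  define r where "r = min d e"
  \<comment> \<open>The 2 is the number of rows in the crude matrix bound, the added 1 the
    oscillation of \<open>A\<close> allowed on the ball.\<close>
  define M where "M = 2 * (norm (A y) + 1)"
  have r: "r > 0" "ball y r \<subseteq> W" using d e by (auto simp: r_def)
  have lip: "dist (G x) (G x') \<le> M * dist x x'" if "x \<in> ball y r" "x' \<in> ball y r" for x x'
    unfolding dist_norm
  proof (rule differentiable_bound[OF convex_ball _ _ that])
    fix v assume v: "v \<in> ball y r"
    show "(G has_derivative (\<lambda>h. A v *v h)) (at v within ball y r)"
      using dG r v by (blast intro: has_derivative_at_withinI)
    show "onorm (\<lambda>h. A v *v h) \<le> M"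
    proof (rule onorm_le)
      fix h :: "real^2"
      have "dist (A v) (A y) < 1" using d(2)[of v] v by (simp add: r_def dist_commute)
      then have "norm (A v) \<le> norm (A y) + 1" using norm_triangle_sub[of "A v" "A y"] by (simp add: dist_norm)
      then have "2 * norm (A v) * norm h \<le> M * norm h" unfolding M_def by (intro mult_right_mono mult_left_mono) auto
      then show "norm (A v *v h) \<le> M * norm h" using norm_matrix_vector_mult_le[of "A v" h] by simp
    qed
  qed
  have pc: "0 < P y $ 1" "P y $ 1 < L" using polar_coords_inner[OF y] by auto
  have inv: "J (P y) *v (A y *v h) = h" for h
  proof -
    have "((\<lambda>x. F (G x)) has_derivative (\<lambda>h. J (P y) *v (A y *v h))) (at y)"
      by (rule has_derivative_compose[OF dG[OF W(2)]]) (use F_has_derivative(1)[OF pc] Gy in simp)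
    moreover have "((\<lambda>x. F (G x)) has_derivative (\<lambda>h. h)) (at y)"
      by (rule has_derivative_transform_within_open[OF has_derivative_ident W(1,2)]) (simp add: FGx)
    ultimately have "(\<lambda>h. J (P y) *v (A y *v h)) = (\<lambda>h. h)" by (rule has_derivative_unique)
    then show ?thesis by meson
  qed
  have A_eq: "A y *v h = vector [R1 y \<bullet> h, R2 y \<bullet> h]" for h
  proof -
    define j11 j12 j21 j22 where "j11 = J (P y) $ 1 $ 1" and "j12 = J (P y) $ 1 $ 2" and "j21 = J (P y) $ 2 $ 1" and "j22 = J (P y) $ 2 $ 2"
    define g1 g2 where "g1 = (A y *v h) $ 1" and "g2 = (A y *v h) $ 2"
    define dd where "dd = det (J (P y))"
    have dd: "dd = j11 * j22 - j12 * j21" "dd \<noteq> 0"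
      using det_pos[OF y] by (simp_all add: dd_def det_2 j11_def j12_def j21_def j22_def)
    have h: "h $ 1 = j11 * g1 + j12 * g2" "h $ 2 = j21 * g1 + j22 * g2"
      using inv[of h] unfolding vec_eq_iff forall_2
      by (simp_all add: matrix_vector_mult_def sum_2 j11_def j12_def j21_def j22_def g1_def g2_def)
    have "R1 y \<bullet> h = (j22 * h $ 1 - j12 * h $ 2) / dd" "R2 y \<bullet> h = (j11 * h $ 2 - j21 * h $ 1) / dd"
      by (simp_all add: R1_def R2_def inner_vec_def sum_2 j11_def j12_def j21_def j22_def dd_def diff_divide_distrib)
    moreover have "j22 * h $ 1 - j12 * h $ 2 = dd * g1" "j11 * h $ 2 - j21 * h $ 1 = dd * g2"
      unfolding h dd(1) by (simp_all add: algebra_simps)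
    ultimately have "R1 y \<bullet> h = g1" "R2 y \<bullet> h = g2" using dd(2) by simp_all
    then show ?thesis by (simp add: vec_eq_iff forall_2 g1_def g2_def)
  qed
  show thesis
  proof (rule that[of r G M])
    show "ball y r \<subseteq> \<Omega>0" using r by (auto simp: W_def)
    show "(G has_derivative (\<lambda>h. vector [R1 y \<bullet> h, R2 y \<bullet> h])) (at y)"
      using dG[OF W(2)] unfolding A_eq .
    show "\<forall>x\<in>ball y r. G x $ 1 = P x $ 1 \<and> (\<exists>k::int. G x $ 2 = P x $ 2 + 2 * pi * of_int k)"
      using G1 r by blast
  qed (use r Gy lip in auto)
qed

section \<open>Regularity of functions of one polar coordinate\<close>

lemma has_derivative_radial:
  assumes y: "y \<in> \<Omega>0" and a: "(a has_real_derivative a') (at (P y $ 1))"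
  shows "((\<lambda>x. a (P x $ 1)) has_derivative (\<lambda>h. a' * (R1 y \<bullet> h))) (at y)"
proof -
  obtain r G M where r: "r > 0" and Gy: "G y = P y"
    and G: "\<forall>x\<in>ball y r. G x $ 1 = P x $ 1 \<and> (\<exists>k::int. G x $ 2 = P x $ 2 + 2 * pi * of_int k)"
    and dG: "(G has_derivative (\<lambda>h. vector [R1 y \<bullet> h, R2 y \<bullet> h])) (at y)"
    by (rule local_lift[OF y])
  have d1: "((\<lambda>x. G x $ 1) has_derivative (\<lambda>h. R1 y \<bullet> h)) (at y)"
    using bounded_linear.has_derivative[OF bounded_linear_vec_nth[of 1] dG] by simp
  have "((\<lambda>x. a (G x $ 1)) has_derivative (\<lambda>h. a' * (R1 y \<bullet> h))) (at y)"
    by (rule has_derivative_compose[OF d1]) (use a in \<open>simp add: Gy has_field_derivative_def\<close>)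
  then show ?thesis
    by (rule has_derivative_transform_within_open[OF _ open_ball[of y r]]) (use r G in auto)
qed

text \<open>Periodicity allows \<open>b\<close> to be evaluated at the continuous lift in place of
  the jumping angle, so the ray of discontinuity of \<open>P\<close> leaves no trace.\<close>

lemma has_derivative_angular:
  assumes y: "y \<in> \<Omega>0" and b: "(b has_real_derivative b') (at (P y $ 2))"
    and per: "\<And>t (k::int). b (t + 2 * pi * of_int k) = b t"
  shows "((\<lambda>x. b (P x $ 2)) has_derivative (\<lambda>h. b' * (R2 y \<bullet> h))) (at y)"
proof -
  obtain r G M where r: "r > 0" and Gy: "G y = P y"
    and G: "\<forall>x\<in>ball y r. G x $ 1 = P x $ 1 \<and> (\<exists>k::int. G x $ 2 = P x $ 2 + 2 * pi * of_int k)"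
    and dG: "(G has_derivative (\<lambda>h. vector [R1 y \<bullet> h, R2 y \<bullet> h])) (at y)"
    by (rule local_lift[OF y])
  have d1: "((\<lambda>x. G x $ 2) has_derivative (\<lambda>h. R2 y \<bullet> h)) (at y)"
    using bounded_linear.has_derivative[OF bounded_linear_vec_nth[of 2] dG] by simp
  have d2: "((\<lambda>x. b (G x $ 2)) has_derivative (\<lambda>h. b' * (R2 y \<bullet> h))) (at y)"
    by (rule has_derivative_compose[OF d1]) (use b in \<open>simp add: Gy has_field_derivative_def\<close>)
  have bG: "b (G x $ 2) = b (P x $ 2)" if "x \<in> ball y r" for x using G that per by metis
  show ?thesis
    by (rule has_derivative_transform_within_open[OF d2 open_ball[of y r]]) (use r bG in auto)
qed

lemma loc_lip_radial:
  assumes "lipschitzian_on {0..<L} a"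
  shows "loc_lip \<Omega>0 (\<lambda>x. a (P x $ 1))"
  unfolding loc_lip_def
proof
  fix y assume y: "y \<in> \<Omega>0"
  obtain r M and G :: "real^2 \<Rightarrow> real^2" where r: "r > 0" "ball y r \<subseteq> \<Omega>0"
    and G: "\<forall>x\<in>ball y r. G x $ 1 = P x $ 1 \<and> (\<exists>k::int. G x $ 2 = P x $ 2 + 2 * pi * of_int k)"
    and lip: "\<forall>x\<in>ball y r. \<forall>x'\<in>ball y r. dist (G x) (G x') \<le> M * dist x x'"
    by (rule local_lift[OF y])
  obtain K where K: "K \<ge> 0" "\<And>s t. s \<in> {0..<L} \<Longrightarrow> t \<in> {0..<L} \<Longrightarrow> \<bar>a s - a t\<bar> \<le> K * dist s t"
    using assms lipschitzian_onE by blast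
  have "lipschitzian_on (ball y r) (\<lambda>x. a (P x $ 1))"
  proof (rule lipschitzian_onI[of _ _ "K * M"])
    fix x x' assume x: "x \<in> ball y r" "x' \<in> ball y r"
    have "dist (P x $ 1) (P x' $ 1) = dist (G x $ 1) (G x' $ 1)" using G x by simp
    also have "\<dots> \<le> dist (G x) (G x')" by (rule dist_vec_nth_le)
    also have "\<dots> \<le> M * dist x x'" using lip x by blast
    finally have "K * dist (P x $ 1) (P x' $ 1) \<le> K * (M * dist x x')" using K(1) by (rule mult_left_mono)
    moreover have "\<bar>a (P x $ 1) - a (P x' $ 1)\<bar> \<le> K * dist (P x $ 1) (P x' $ 1)"
      using x r(2) polar_coords_inner[of x] polar_coords_inner[of x'] by (intro K(2)) auto
    ultimately show "\<bar>a (P x $ 1) - a (P x' $ 1)\<bar> \<le> K * M * dist x x'" by simp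
  qed
  then show "\<exists>r>0. ball y r \<subseteq> \<Omega>0 \<and> lipschitzian_on (ball y r) (\<lambda>x. a (P x $ 1))" using r by blast
qed

lemma loc_lip_angular:
  assumes b: "\<And>X. bounded X \<Longrightarrow> lipschitzian_on X b"
    and per: "\<And>t (k::int). b (t + 2 * pi * of_int k) = b t"
  shows "loc_lip \<Omega>0 (\<lambda>x. b (P x $ 2))"
  unfolding loc_lip_def
proof
  fix y assume y: "y \<in> \<Omega>0"
  obtain r M and G :: "real^2 \<Rightarrow> real^2" where r: "r > 0" "ball y r \<subseteq> \<Omega>0"
    and G: "\<forall>x\<in>ball y r. G x $ 1 = P x $ 1 \<and> (\<exists>k::int. G x $ 2 = P x $ 2 + 2 * pi * of_int k)"
    and lip: "\<forall>x\<in>ball y r. \<forall>x'\<in>ball y r. dist (G x) (G x') \<le> M * dist x x'"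
    by (rule local_lift[OF y])
  have lip2: "dist (G x $ 2) (G x' $ 2) \<le> M * dist x x'" if "x \<in> ball y r" "x' \<in> ball y r" for x x'
    using lip that dist_vec_nth_le[of "G x" 2 "G x'"] by fastforce
  have "bounded ((\<lambda>x. G x $ 2) ` ball y r)"
  proof -
    have "dist (G y $ 2) (G x $ 2) \<le> \<bar>M\<bar> * r" if "x \<in> ball y r" for x
    proof -
      have "M * dist y x \<le> \<bar>M\<bar> * r" using that by (intro mult_mono) auto
      then show ?thesis using lip2[of y x] that r by simp
    qed
    then show ?thesis unfolding bounded_def by blast
  qed
  from b[OF this] obtain K where K: "K \<ge> 0"
    "\<And>s t. s \<in> (\<lambda>x. G x $ 2) ` ball y r \<Longrightarrow> t \<in> (\<lambda>x. G x $ 2) ` ball y r \<Longrightarrow> \<bar>b s - b t\<bar> \<le> K * dist s t"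
    using lipschitzian_onE by blast
  have bG: "b (P x $ 2) = b (G x $ 2)" if "x \<in> ball y r" for x using G that per by metis
  have "lipschitzian_on (ball y r) (\<lambda>x. b (P x $ 2))"
  proof (rule lipschitzian_onI[of _ _ "K * M"])
    fix x x' assume x: "x \<in> ball y r" "x' \<in> ball y r"
    have "\<bar>b (G x $ 2) - b (G x' $ 2)\<bar> \<le> K * dist (G x $ 2) (G x' $ 2)" using x by (intro K(2)) auto
    also have "\<dots> \<le> K * (M * dist x x')" using lip2[OF x] K(1) by (rule mult_left_mono)
    finally show "\<bar>b (P x $ 2) - b (P x' $ 2)\<bar> \<le> K * M * dist x x'" using bG x by simp
  qed
  then show "\<exists>r>0. ball y r \<subseteq> \<Omega>0 \<and> lipschitzian_on (ball y r) (\<lambda>x. b (P x $ 2))" using r by blast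
qed

text \<open>Coordinate lines are null sets and the differentiable map F sends null sets to null
  sets. Hence what happens over the knots is invisible almost everywhere.\<close>

lemma negligible_coordinate:
  assumes "countable N"
  shows "negligible {x \<in> \<Omega>0. P x $ i \<in> N}"
proof -
  let ?Z = "{z. 0 < z $ 1 \<and> z $ 1 < L} \<inter> {z. z $ i \<in> N}"
  have h: "negligible {z::real^2. z $ i = c}" for c
  proof -
    have "negligible {z::real^2. axis i 1 \<bullet> z = c}" by (rule negligible_hyperplane) (simp add: axis_eq_0_iff)
    then show ?thesis by (simp add: inner_axis')
  qed
  have "negligible (\<Union>((\<lambda>c. {z::real^2. z $ i = c}) ` N))"
    using assms h by (intro negligible_countable_Union) auto
  then have "negligible ?Z" by (rule negligible_subset) auto
  moreover have "F differentiable_on ?Z"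
    unfolding differentiable_on_def using F_has_derivative(1)
    by (auto simp: differentiable_def intro: has_derivative_at_withinI)
  ultimately have "negligible (F ` ?Z)" by (intro negligible_differentiable_image_negligible) auto
  moreover have "{x \<in> \<Omega>0. P x $ i \<in> N} \<subseteq> F ` ?Z"
  proof
    fix x assume "x \<in> {x \<in> \<Omega>0. P x $ i \<in> N}"
    then have "x = F (P x)" "P x \<in> ?Z" using polar_coords_inner[of x] by auto
    then show "x \<in> F ` ?Z" by (rule image_eqI)
  qed
  ultimately show ?thesis by (rule negligible_subset)
qed

lemma AE_coordinate: "countable N \<Longrightarrow> AE x in lebesgue. x \<in> \<Omega>0 \<longrightarrow> P x $ i \<notin> N"
  using AE_not_negligible[OF negligible_coordinate[of N i]] by (auto elim: eventually_mono)

lemma lip_ae_diff_radial: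
  assumes "lipschitzian_on {0..<L} a" "countable N" "\<And>t. t \<notin> N \<Longrightarrow> (a has_real_derivative a' t) (at t)"
  shows "lip_ae_diff \<Omega>0 (\<lambda>x. a (P x $ 1))"
    and "AE x in lebesgue. x \<in> \<Omega>0 \<longrightarrow> (\<forall>i. partial i (\<lambda>x. a (P x $ 1)) x = a' (P x $ 1) * R1 x $ i)"
proof -
  have d: "((\<lambda>x. a (P x $ 1)) has_derivative (\<lambda>h. a' (P x $ 1) * (R1 x \<bullet> h))) (at x)"
    if "x \<in> \<Omega>0" "P x $ 1 \<notin> N" for x
    using that assms(3) by (intro has_derivative_radial)
  show "lip_ae_diff \<Omega>0 (\<lambda>x. a (P x $ 1))" unfolding lip_ae_diff_def
  proof
    show "loc_lip \<Omega>0 (\<lambda>x. a (P x $ 1))" by (rule loc_lip_radial[OF assms(1)])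
    show "AE x in lebesgue. x \<in> \<Omega>0 \<longrightarrow> (\<lambda>x. a (P x $ 1)) differentiable at x"
      using AE_coordinate[OF assms(2), of 1] by eventually_elim (use d in \<open>auto simp: differentiable_def\<close>)
  qed
  show "AE x in lebesgue. x \<in> \<Omega>0 \<longrightarrow> (\<forall>i. partial i (\<lambda>x. a (P x $ 1)) x = a' (P x $ 1) * R1 x $ i)"
    using AE_coordinate[OF assms(2), of 1]
    by eventually_elim (use partial_eqI[OF d] in \<open>auto simp: inner_axis\<close>)
qed

lemma lip_ae_diff_angular:
  assumes "\<And>X. bounded X \<Longrightarrow> lipschitzian_on X b" "countable N" "\<And>t. t \<notin> N \<Longrightarrow> (b has_real_derivative b' t) (at t)"
    and "\<And>t (k::int). b (t + 2 * pi * of_int k) = b t"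
  shows "lip_ae_diff \<Omega>0 (\<lambda>x. b (P x $ 2))"
    and "AE x in lebesgue. x \<in> \<Omega>0 \<longrightarrow> (\<forall>i. partial i (\<lambda>x. b (P x $ 2)) x = b' (P x $ 2) * R2 x $ i)"
proof -
  have d: "((\<lambda>x. b (P x $ 2)) has_derivative (\<lambda>h. b' (P x $ 2) * (R2 x \<bullet> h))) (at x)"
    if "x \<in> \<Omega>0" "P x $ 2 \<notin> N" for x
    using that assms(3,4) by (intro has_derivative_angular)
  show "lip_ae_diff \<Omega>0 (\<lambda>x. b (P x $ 2))" unfolding lip_ae_diff_def
  proof
    show "loc_lip \<Omega>0 (\<lambda>x. b (P x $ 2))" by (rule loc_lip_angular[OF assms(1,4)])
    show "AE x in lebesgue. x \<in> \<Omega>0 \<longrightarrow> (\<lambda>x. b (P x $ 2)) differentiable at x"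
      using AE_coordinate[OF assms(2), of 2] by eventually_elim (use d in \<open>auto simp: differentiable_def\<close>)
  qed
  show "AE x in lebesgue. x \<in> \<Omega>0 \<longrightarrow> (\<forall>i. partial i (\<lambda>x. b (P x $ 2)) x = b' (P x $ 2) * R2 x $ i)"
    using AE_coordinate[OF assms(2), of 2]
    by eventually_elim (use partial_eqI[OF d] in \<open>auto simp: inner_axis\<close>)
qed

section \<open>Compactness and measurability in polar coordinates\<close>

lemma compact_F_box:
  assumes "0 < e" "closed C"
  shows "compact (F ` {z. e \<le> z $ 1 \<and> z $ 1 \<le> L' \<and> 0 \<le> z $ 2 \<and> z $ 2 \<le> c \<and> L' \<le> L \<and> z \<in> C})"
proof -
  let ?B = "{z::real^2. e \<le> z $ 1 \<and> z $ 1 \<le> L' \<and> 0 \<le> z $ 2 \<and> z $ 2 \<le> c \<and> L' \<le> L \<and> z \<in> C}"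
  have "?B = (if L' \<le> L then cbox (vector [e, 0]) (vector [L', c]) \<inter> C else {})"
    by (auto simp: mem_box_cart forall_2)
  then have "compact ?B" using assms(2) by (auto intro: compact_Int_closed)
  moreover have "?B \<subseteq> strip L" using assms(1) by (auto simp: strip_def)
  ultimately show ?thesis using continuous_on_subset[OF continuous_F] compact_continuous_image by blast
qed

text \<open>\<open>P\<close> is not continuous, but the domain is exhausted by compact boxes that
  keep away from s = 0, s = L and from the angle 2 pi, and \<open>P\<close> inverts F on each of
  them. So the preimage of a closed set is a countable union of compact images.\<close>

lemma measurable_polar_coords: "P \<in> borel_measurable (restrict_space borel \<Omega>0)"
proof (subst (2) borel_eq_closed, rule measurable_measure_of)
  fix C :: "(real^2) set" assume "C \<in> Collect closed"
  then have C: "closed C" by simp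
  define Q where "Q n = F ` {z. 1 / real (Suc n) \<le> z $ 1 \<and> z $ 1 \<le> L - 1 / real (Suc n) \<and> 0 \<le> z $ 2 \<and>
      z $ 2 \<le> 2 * pi - 1 / real (Suc n) \<and> L - 1 / real (Suc n) \<le> L \<and> z \<in> C}" for n
  have "Q n \<in> sets borel" for n
    unfolding Q_def by (rule borel_compact, rule compact_F_box) (use C in auto)
  then have m: "(\<Union>n. Q n) \<in> sets borel" by blast
  have "P -` C \<inter> \<Omega>0 = (\<Union>n. Q n)"
  proof (intro equalityI subsetI)
    fix x assume x: "x \<in> P -` C \<inter> \<Omega>0"
    note pc = polar_coords_inner[of x]
    define m where "m = min (P x $ 1) (min (L - P x $ 1) (2 * pi - P x $ 2))"
    have "m > 0" using pc x by (auto simp: m_def)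
    then obtain n where n: "1 / real (Suc n) < m" using nat_approx_posE by (metis inverse_eq_divide)
    then have "x \<in> Q n" unfolding Q_def using pc x by (intro image_eqI[of _ _ "P x"]) (auto simp: m_def)
    then show "x \<in> (\<Union>n. Q n)" by blast
  next
    fix x assume "x \<in> (\<Union>n. Q n)"
    then obtain n z where z: "x = F z" "1 / real (Suc n) \<le> z $ 1" "z $ 1 \<le> L - 1 / real (Suc n)" "0 \<le> z $ 2"
      "z $ 2 \<le> 2 * pi - 1 / real (Suc n)" "z \<in> C" unfolding Q_def by blast
    have "1 / real (Suc n) > 0" by simp
    then have b: "0 < z $ 1" "z $ 1 < L" "0 \<le> z $ 2" "z $ 2 < 2 * pi" using z by linarith+
    then show "x \<in> P -` C \<inter> \<Omega>0" using polar_coords_F_eq[OF b] F_in_\<Omega>0[OF b(1,2)] z by auto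
  qed
  then show "P -` C \<inter> space (restrict_space borel \<Omega>0) \<in> sets (restrict_space borel \<Omega>0)"
    using m open_\<Omega>0 by (auto simp: space_restrict_space sets_restrict_space_iff)
qed auto

lemma measurable_J: "(\<lambda>x. J (P x) $ i $ j) \<in> borel_measurable (restrict_space borel \<Omega>0)"
proof -
  let ?S = "{z::real^2. 0 < z $ 1 \<and> z $ 1 < L}"
  have "open ?S" by (intro open_Collect_conj open_Collect_less continuous_intros)
  moreover have "continuous_on ?S (\<lambda>z. J z $ i $ j)"
    using F_has_derivative(2)[of "vector [L / 2, 0]"] L_pos by (intro continuous_intros) auto
  ultimately have m: "(\<lambda>z. indicator ?S z *\<^sub>R J z $ i $ j) \<in> borel_measurable borel"
    by (intro borel_measurable_continuous_on_indicator) auto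
  have "(\<lambda>x. indicator ?S (P x) *\<^sub>R J (P x) $ i $ j) \<in> borel_measurable (restrict_space borel \<Omega>0)"
    by (rule measurable_compose[OF measurable_polar_coords m])
  moreover have "indicator ?S (P x) *\<^sub>R J (P x) $ i $ j = J (P x) $ i $ j" if "x \<in> space (restrict_space borel \<Omega>0)" for x
    using that polar_coords_inner[of x] by (auto simp: space_restrict_space)
  ultimately show ?thesis using measurable_cong by (metis (no_types, lifting))
qed

lemma measurable_det: "(\<lambda>x. det (J (P x))) \<in> borel_measurable (restrict_space borel \<Omega>0)"
  unfolding det_2 using measurable_J by (intro borel_measurable_diff borel_measurable_times)

lemma measurable_R:
  "(\<lambda>x. R1 x $ i) \<in> borel_measurable (restrict_space borel \<Omega>0)" "(\<lambda>x. R2 x $ i) \<in> borel_measurable (restrict_space borel \<Omega>0)"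
proof -
  note [measurable] = measurable_J measurable_det
  have "i = 1 \<or> i = 2" using exhaust_2 by blast
  then show "(\<lambda>x. R1 x $ i) \<in> borel_measurable (restrict_space borel \<Omega>0)" "(\<lambda>x. R2 x $ i) \<in> borel_measurable (restrict_space borel \<Omega>0)"
    unfolding R1_def R2_def by (auto simp del: times_divide_eq_left)
qed

lemma measurable_coordinate: "f \<in> borel_measurable borel \<Longrightarrow> (\<lambda>x. f (P x $ i)) \<in> borel_measurable (restrict_space borel \<Omega>0)"
proof -
  have "(\<lambda>z::real^2. z $ i) \<in> borel_measurable borel" by (intro borel_measurable_continuous_onI continuous_intros)
  from measurable_compose[OF measurable_polar_coords this]
  show "f \<in> borel_measurable borel \<Longrightarrow> (\<lambda>x. f (P x $ i)) \<in> borel_measurable (restrict_space borel \<Omega>0)"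
    by (rule measurable_compose)
qed

lemma measurable_lebesgue_indicator:
  fixes f :: "real^2 \<Rightarrow> 'b::euclidean_space"
  assumes "f \<in> borel_measurable (restrict_space borel \<Omega>0)"
  shows "(\<lambda>x. indicator (\<Omega> - {x0}) x *\<^sub>R f x) \<in> borel_measurable lebesgue"
proof -
  have "(\<lambda>x. indicator \<Omega>0 x *\<^sub>R f x) \<in> borel_measurable borel"
    using assms open_\<Omega>0 by (subst (asm) borel_measurable_restrict_space_iff) auto
  then show ?thesis unfolding \<Omega>0_def by (auto intro: measurable_completion)
qed

text \<open>The points of radius at least e form the image of a compact box that misses the pole, so
  they keep a positive distance from it.\<close>

lemma radius_tendsto_0:
  assumes "e > 0"
  shows "\<exists>d>0. \<forall>x\<in>\<Omega>0. dist x x0 < d \<longrightarrow> P x $ 1 < e"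
proof -
  let ?K = "F ` {z. e \<le> z $ 1 \<and> z $ 1 \<le> L \<and> 0 \<le> z $ 2 \<and> z $ 2 \<le> 2 * pi \<and> L \<le> L \<and> z \<in> UNIV}"
  have "closed ?K" using compact_F_box[OF assms closed_UNIV] by (rule compact_imp_closed)
  moreover have "x0 \<notin> ?K"
  proof
    assume "x0 \<in> ?K"
    then obtain z where z: "e \<le> z $ 1" "z $ 1 \<le> L" "x0 = F z" by blast
    then have "F z \<in> F ` strip0 L" using assms by (auto simp: strip0_def)
    then show False using F_strip0 z(3) by simp
  qed
  ultimately have "open (- ?K)" "x0 \<in> - ?K" by (auto simp: open_Compl)
  then obtain d where d: "d > 0" "ball x0 d \<subseteq> - ?K" using open_contains_ball by blast
  have "P x $ 1 < e" if "x \<in> \<Omega>0" "dist x x0 < d" for x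
  proof (rule ccontr)
    assume "\<not> P x $ 1 < e"
    then have "x \<in> ?K" using polar_coords_inner[OF that(1)] by (intro image_eqI[of _ _ "P x"]) auto
    then show False using d(2) that(2) by (auto simp: dist_commute)
  qed
  then show ?thesis using d(1) by blast
qed

lemma F_ray_tendsto: "((\<lambda>\<sigma>. F (vector [\<sigma>, t])) \<longlongrightarrow> x0) (at_right 0)"
proof -
  have "continuous_on {0..L} (\<lambda>\<sigma>. F (vector [\<sigma>, t]))"
  proof (rule continuous_on_compose2[OF continuous_F])
    have e: "vector [\<sigma>, t] = (\<sigma> *\<^sub>R axis 1 1 + axis 2 t :: real^2)" for \<sigma>
      by (auto simp: vec_eq_iff forall_2 axis_def)
    show "continuous_on {0..L} (\<lambda>\<sigma>. vector [\<sigma>, t] :: real^2)" unfolding e by (intro continuous_intros)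
  qed (auto simp: strip_def)
  then have "((\<lambda>\<sigma>. F (vector [\<sigma>, t])) \<longlongrightarrow> F (vector [0, t])) (at 0 within {0..L})"
    using L_pos by (auto simp: continuous_on_def)
  moreover have "F (vector [0, t]) = x0" using L_pos by (intro F_pole) (auto simp: strip_def)
  moreover have "at 0 within {0..L} = at_right (0::real)" using L_pos by (rule at_within_Icc_at_right)
  ultimately show ?thesis by simp
qed

text \<open>The radius is Lipschitz on discs avoiding the pole and \<open>cos (\<theta> - t)\<close> is so with constant
  \<open>O(1/s)\<close>, hence a disc of radius \<open>\<kappa> \<sigma>\<close> about \<open>F(\<sigma>, t)\<close> lies in a prescribed sector.\<close>

lemma disc_in_sector:
  assumes t: "0 < t" "t < 2 * pi" and "\<delta> > 0" and "\<epsilon> > 0"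
  obtains \<kappa> \<sigma>0 where "\<kappa> > 0" "\<sigma>0 > 0"
    "\<forall>\<sigma>. 0 < \<sigma> \<and> \<sigma> < \<sigma>0 \<longrightarrow> ball (F (vector [\<sigma>, t])) (\<kappa> * \<sigma>) \<subseteq> \<Omega>0 \<and>
       (\<forall>x\<in>ball (F (vector [\<sigma>, t])) (\<kappa> * \<sigma>). P x $ 1 < \<epsilon> \<and> P x $ 1 \<le> 2 * \<sigma> \<and> \<bar>P x $ 2 - t\<bar> < \<delta>)"
proof -
  obtain K where K: "K > 0" and R1: "\<And>x. x \<in> \<Omega>0 \<Longrightarrow> norm (R1 x) \<le> K" and R2: "\<And>x. x \<in> \<Omega>0 \<Longrightarrow> norm (R2 x) \<le> K / P x $ 1"
    using R_bounds by blast
  \<comment> \<open>The sector is narrowed so as to stay clear of the ray where the angle jumps;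
    this also gives \<delta>' <= pi, a range on which the cosine decreases.\<close>
  define m where "m = min t (2 * pi - t)"
  have m: "m > 0" "m \<le> t" "m \<le> 2 * pi - t" using t by (auto simp: m_def)
  define \<delta>' where "\<delta>' = min \<delta> (m / 2)"
  have "\<delta>' > 0" "\<delta>' \<le> \<delta>" "\<delta>' \<le> m / 2" using m assms(3) by (auto simp: \<delta>'_def)
  then have \<delta>': "\<delta>' > 0" "\<delta>' \<le> \<delta>" "\<delta>' < t" "\<delta>' < 2 * pi - t" "\<delta>' \<le> pi" using m by linarith+
  have "cos \<delta>' < cos 0" using \<delta>' by (subst cos_mono_less_eq) auto
  then have c1: "cos \<delta>' < 1" by simp
  obtain r where r: "r > 0" "ball x0 r \<subseteq> \<Omega>" using open_\<Omega> x0_in open_contains_ball by blast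
  \<comment> \<open>The first bound keeps the radius within \<sigma> / 2 of \<sigma> on the disc.
    The second keeps the cosine of \<theta> - t, which is 1 at the centre and varies by at most 2 K
    \<kappa>, above cos \<delta>'.\<close>
  define \<kappa> where "\<kappa> = min (1 / (2 * K)) ((1 - cos \<delta>') / (4 * K))"
  have \<kappa>: "\<kappa> > 0" "\<kappa> * K \<le> 1 / 2" "\<kappa> * (4 * K) \<le> 1 - cos \<delta>'"
  proof -
    show "\<kappa> > 0" using K c1 by (simp add: \<kappa>_def)
    have "\<kappa> \<le> 1 / (2 * K)" "\<kappa> \<le> (1 - cos \<delta>') / (4 * K)" by (auto simp: \<kappa>_def)
    then show "\<kappa> * K \<le> 1 / 2" "\<kappa> * (4 * K) \<le> 1 - cos \<delta>'" using K by (auto simp: field_simps)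
  qed
  have "\<forall>\<^sub>F \<sigma> in at_right 0. dist (F (vector [\<sigma>, t])) x0 < r / 2"
    using F_ray_tendsto[of t] r(1) by (intro tendstoD) auto
  then obtain \<sigma>1 where \<sigma>1: "\<sigma>1 > 0" "\<And>\<sigma>. 0 < \<sigma> \<Longrightarrow> \<sigma> < \<sigma>1 \<Longrightarrow> dist (F (vector [\<sigma>, t])) x0 < r / 2"
    unfolding eventually_at_right_field by auto
  define \<sigma>0 where "\<sigma>0 = min (min \<sigma>1 L) (min (\<epsilon> / 2) (r / (2 * \<kappa>)))"
  have s_lip: "\<bar>P x $ 1 - P y $ 1\<bar> \<le> K * dist x y" if "convex S" "S \<subseteq> \<Omega>0" "x \<in> S" "y \<in> S" for S x y
  proof -
    have "norm (P x $ 1 - P y $ 1) \<le> K * norm (x - y)"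
    proof (rule differentiable_bound[OF that(1) _ _ that(3,4)])
      fix v assume v: "v \<in> S"
      show "((\<lambda>x. P x $ 1) has_derivative (\<lambda>h. 1 * (R1 v \<bullet> h))) (at v within S)"
        by (rule has_derivative_at_withinI, rule has_derivative_radial[of v "\<lambda>s. s"]) (use v that in \<open>auto intro!: derivative_eq_intros\<close>)
      show "onorm (\<lambda>h. 1 * (R1 v \<bullet> h)) \<le> K"
      proof (rule onorm_le)
        fix h
        have "norm (1 * (R1 v \<bullet> h)) \<le> norm (R1 v) * norm h" using Cauchy_Schwarz_ineq2[of "R1 v" h] by simp
        also have "\<dots> \<le> K * norm h" using R1 v that by (intro mult_right_mono) auto
        finally show "norm (1 * (R1 v \<bullet> h)) \<le> K * norm h" .
      qed
    qed
    then show ?thesis by (simp add: dist_norm)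
  qed
  show thesis
  proof (rule that[of \<kappa> \<sigma>0])
    show "\<sigma>0 > 0" using \<sigma>1 L_pos assms(4) r \<kappa> by (simp add: \<sigma>0_def)
    show "\<forall>\<sigma>. 0 < \<sigma> \<and> \<sigma> < \<sigma>0 \<longrightarrow> ball (F (vector [\<sigma>, t])) (\<kappa> * \<sigma>) \<subseteq> \<Omega>0 \<and>
       (\<forall>x\<in>ball (F (vector [\<sigma>, t])) (\<kappa> * \<sigma>). P x $ 1 < \<epsilon> \<and> P x $ 1 \<le> 2 * \<sigma> \<and> \<bar>P x $ 2 - t\<bar> < \<delta>)"
    proof (intro allI impI; elim conjE)
      fix \<sigma> assume \<sigma>: "0 < \<sigma>" "\<sigma> < \<sigma>0"
      have \<sigma>b: "\<sigma> < \<sigma>1" "\<sigma> < L" "2 * \<sigma> < \<epsilon>" "\<kappa> * \<sigma> < r / 2"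
        using \<sigma> \<kappa>(1) by (auto simp: \<sigma>0_def field_simps)
      define X where "X = F (vector [\<sigma>, t])"
      have PX: "P X = vector [\<sigma>, t]" unfolding X_def using \<sigma> \<sigma>b t by (intro polar_coords_F_eq) auto
      have XO: "X \<in> \<Omega>0" unfolding X_def using \<sigma> \<sigma>b by (intro F_in_\<Omega>0) auto
      have Xr: "dist X x0 < r / 2" unfolding X_def using \<sigma> \<sigma>b by (intro \<sigma>1) auto
      \<comment> \<open>The distance to the pole is at least \<sigma> / K, because the radius is
        K-Lipschitz on the segment towards the pole. Polar coordinates are unspecified at the pole,
        so the segment stops short of it, at a point of radius below e.\<close>
      have far: "\<sigma> \<le> K * dist X x0"
      proof (rule field_le_epsilon)
        fix e :: real assume e: "e > 0"
        obtain d where d: "d > 0" "\<And>x. x \<in> \<Omega>0 \<Longrightarrow> dist x x0 < d \<Longrightarrow> P x $ 1 < e"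
          using radius_tendsto_0[OF e] by blast
        have D: "dist X x0 > 0" using XO by (auto simp: \<Omega>0_def)
        define q where "q = min (1 / 2) (d / (2 * dist X x0))"
        have q: "0 < q" "q < 1" "q * dist X x0 < d"
        proof -
          show "0 < q" "q < 1" using d D by (auto simp: q_def)
          have "q * dist X x0 \<le> d / (2 * dist X x0) * dist X x0" using D by (intro mult_right_mono) (auto simp: q_def)
          also have "\<dots> < d" using D d by simp
          finally show "q * dist X x0 < d" .
        qed
        define y where "y = x0 + q *\<^sub>R (X - x0)"
        have yd: "dist y x0 = q * dist X x0" using q by (simp add: y_def dist_norm)
        have seg: "closed_segment X y \<subseteq> \<Omega>0"
        proof
          fix v assume "v \<in> closed_segment X y"
          then obtain u where u: "0 \<le> u" "u \<le> 1" "v = (1 - u) *\<^sub>R X + u *\<^sub>R y" by (auto simp: closed_segment_def)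
          define m where "m = (1 - u) + u * q"
          have m: "0 < m" "m \<le> 1"
          proof -
            show "0 < m"
            proof (cases "u = 1")
              case True then show ?thesis using q by (simp add: m_def)
            next
              case False then show ?thesis unfolding m_def using u q by (intro add_pos_nonneg) auto
            qed
            have "u * q \<le> u * 1" using u q by (intro mult_left_mono) auto
            then show "m \<le> 1" by (simp add: m_def)
          qed
          have v: "v - x0 = m *\<^sub>R (X - x0)" unfolding u(3) y_def m_def by (simp add: algebra_simps)
          have dv: "dist v x0 = m * dist X x0" using m by (simp add: dist_norm v)
          also have "\<dots> \<le> 1 * dist X x0" using m by (intro mult_right_mono) auto
          finally have "dist v x0 < r" using Xr r by simp
          moreover have "dist v x0 > 0" unfolding dv using m D by simp
          ultimately show "v \<in> \<Omega>0" using r(2) by (auto simp: \<Omega>0_def dist_commute)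
        qed
        have "\<bar>P X $ 1 - P y $ 1\<bar> \<le> K * dist X y" by (rule s_lip[OF _ seg]) auto
        moreover have "dist X y \<le> dist X x0"
        proof -
          have "X - y = (1 - q) *\<^sub>R (X - x0)" by (simp add: y_def algebra_simps)
          then have "dist X y = (1 - q) * dist X x0" using q by (simp add: dist_norm)
          also have "\<dots> \<le> 1 * dist X x0" using q by (intro mult_right_mono) auto
          finally show ?thesis by simp
        qed
        then have "K * dist X y \<le> K * dist X x0" using K by simp
        moreover have "P y $ 1 < e"
        proof (rule d(2))
          show "y \<in> \<Omega>0" using seg by auto
          show "dist y x0 < d" using yd q by simp
        qed
        ultimately show "\<sigma> \<le> K * dist X x0 + e" unfolding PX by simp
      qed
      have sub: "ball X (\<kappa> * \<sigma>) \<subseteq> \<Omega>0"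
      proof
        fix x assume x: "x \<in> ball X (\<kappa> * \<sigma>)"
        have "dist x x0 \<le> dist X x + dist X x0" by (metis dist_commute dist_triangle)
        then have "dist x x0 < r" using x \<sigma>b(4) Xr by simp
        moreover have "x \<noteq> x0"
        proof
          assume "x = x0"
          then have "dist X x0 < \<kappa> * \<sigma>" using x by simp
          then have "K * dist X x0 < K * (\<kappa> * \<sigma>)" using K by simp
          also have "\<dots> = (\<kappa> * K) * \<sigma>" by simp
          also have "\<dots> \<le> 1 / 2 * \<sigma>" using \<kappa>(2) \<sigma> by (intro mult_right_mono) auto
          finally show False using far \<sigma> by simp
        qed
        ultimately show "x \<in> \<Omega>0" using r(2) by (auto simp: \<Omega>0_def dist_commute)
      qed
      have XB: "X \<in> ball X (\<kappa> * \<sigma>)" using \<kappa> \<sigma> by simp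
      have Ps: "\<sigma> / 2 \<le> P x $ 1 \<and> P x $ 1 \<le> 2 * \<sigma>" if x: "x \<in> ball X (\<kappa> * \<sigma>)" for x
      proof -
        have "\<bar>P X $ 1 - P x $ 1\<bar> \<le> K * dist X x" by (rule s_lip[OF convex_ball sub XB x])
        also have "\<dots> \<le> K * (\<kappa> * \<sigma>)" using K x by (intro mult_left_mono) auto
        also have "\<dots> = (\<kappa> * K) * \<sigma>" by simp
        also have "\<dots> \<le> 1 / 2 * \<sigma>" using \<kappa>(2) \<sigma> by (intro mult_right_mono) auto
        finally have "\<bar>\<sigma> - P x $ 1\<bar> \<le> 1 / 2 * \<sigma>" unfolding PX by simp
        then show ?thesis using \<sigma> by linarith
      qed
      have ang: "\<bar>P x $ 2 - t\<bar> < \<delta>" if x: "x \<in> ball X (\<kappa> * \<sigma>)" for x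
      proof -
        have per: "cos (u + 2 * pi * of_int k - t) = cos (u - t)" for u and k :: int
        proof -
          have "u + 2 * pi * of_int k - t = (u - t) + 2 * pi * of_int k" by simp
          then show ?thesis by (simp only: cos_add cos_int_2pin sin_int_2pin mult_1_right mult_zero_right diff_zero)
        qed
        have "norm (cos (P X $ 2 - t) - cos (P x $ 2 - t)) \<le> 2 * K / \<sigma> * norm (X - x)"
        proof (rule differentiable_bound[OF convex_ball _ _ XB x])
          fix v assume v: "v \<in> ball X (\<kappa> * \<sigma>)"
          show "((\<lambda>x. cos (P x $ 2 - t)) has_derivative (\<lambda>h. - sin (P v $ 2 - t) * (R2 v \<bullet> h))) (at v within ball X (\<kappa> * \<sigma>))"
            by (rule has_derivative_at_withinI, rule has_derivative_angular[where b = "\<lambda>u. cos (u - t)"])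
               (use v sub per in \<open>auto intro!: derivative_eq_intros\<close>)
          show "onorm (\<lambda>h. - sin (P v $ 2 - t) * (R2 v \<bullet> h)) \<le> 2 * K / \<sigma>"
          proof (rule onorm_le)
            fix h
            have "norm (R2 v) \<le> K / P v $ 1" using v sub by (intro R2) blast
            also have "\<dots> \<le> K / (\<sigma> / 2)" using Ps[OF v] \<sigma> K by (intro divide_left_mono) auto
            also have "\<dots> = 2 * K / \<sigma>" by simp
            finally have n: "norm (R2 v) \<le> 2 * K / \<sigma>" .
            have "norm (- sin (P v $ 2 - t) * (R2 v \<bullet> h)) = \<bar>sin (P v $ 2 - t)\<bar> * \<bar>R2 v \<bullet> h\<bar>" by (simp add: abs_mult)
            also have "\<dots> \<le> 1 * (norm (R2 v) * norm h)"
              by (intro mult_mono Cauchy_Schwarz_ineq2) auto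
            also have "\<dots> \<le> 2 * K / \<sigma> * norm h" using mult_right_mono[OF n, of "norm h"] by simp
            finally show "norm (- sin (P v $ 2 - t) * (R2 v \<bullet> h)) \<le> 2 * K / \<sigma> * norm h" .
          qed
        qed
        also have "\<dots> \<le> 2 * K / \<sigma> * (\<kappa> * \<sigma>)" using K \<sigma> x by (intro mult_left_mono) (auto simp: dist_norm)
        also have "\<dots> = \<kappa> * (2 * K)" using \<sigma> by simp
        also have "\<dots> < \<kappa> * (4 * K)" using \<kappa>(1) K by simp
        also note \<kappa>(3)
        finally have cos: "cos (P x $ 2 - t) > cos \<delta>'" unfolding PX by simp
        have pc: "0 \<le> P x $ 2" "P x $ 2 < 2 * pi" using polar_coords_inner sub x by auto
        define w where "w = \<bar>P x $ 2 - t\<bar>"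
        have cw: "cos w > cos \<delta>'" using cos by (simp add: w_def)
        \<comment> \<open>A cosine above cos \<delta>' would also be compatible with w close to 2
          pi. The margins of t to both ends of the period exclude this.\<close>
        have w: "0 \<le> w" "w < 2 * pi - \<delta>'" using pc t \<delta>' by (auto simp: w_def)
        have "w < \<delta>'"
        proof (rule ccontr)
          assume "\<not> w < \<delta>'"
          then have wd: "\<delta>' \<le> w" by simp
          show False
          proof (cases "w \<le> pi")
            case True
            then have "cos w \<le> cos \<delta>'" using wd \<delta>' w by (subst cos_mono_le_eq) auto
            then show False using cw by simp
          next
            case False
            have "cos (2 * pi - w) \<le> cos \<delta>'" using False w \<delta>' by (subst cos_mono_le_eq) auto
            moreover have "cos (2 * pi - w) = cos w" by (simp add: cos_diff)
            ultimately show False using cw by simp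
          qed
        qed
        then show ?thesis using \<delta>' by (simp add: w_def)
      qed
      show "ball (F (vector [\<sigma>, t])) (\<kappa> * \<sigma>) \<subseteq> \<Omega>0 \<and>
        (\<forall>x\<in>ball (F (vector [\<sigma>, t])) (\<kappa> * \<sigma>). P x $ 1 < \<epsilon> \<and> P x $ 1 \<le> 2 * \<sigma> \<and> \<bar>P x $ 2 - t\<bar> < \<delta>)"
        unfolding X_def[symmetric] using sub Ps ang \<sigma>b(3) by fastforce
    qed
  qed (rule \<kappa>(1))
qed

end

section \<open>The pushforward spline spaces\<close>

text \<open>On the compact support |w| <= 1 + w^2, so square integrability already controls the
  product with a bounded function.\<close>

lemma L2_mult_test_function:
  fixes w :: "real^2 \<Rightarrow> real"
  assumes \<Omega>: "open \<Omega>" and w: "w \<in> L2 \<Omega>" and \<phi>: "\<phi> \<in> test_functions \<Omega>"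
  shows "integrable lebesgue (\<lambda>x. w x * \<phi> x)" "(LINT x|lebesgue. w x * \<phi> x) = (LINT x|lebesgue_on \<Omega>. w x * \<phi> x)"
proof -
  define K where "K = closure {x. \<phi> x \<noteq> 0}"
  have K: "compact K" "K \<subseteq> \<Omega>" using \<phi> by (auto simp: test_functions_def K_def)
  have supp: "\<phi> x = 0" if "x \<notin> K" for x
    using that closure_subset[of "{x. \<phi> x \<noteq> 0}"] unfolding K_def by blast
  have "Ck 0 \<phi>" using \<phi> unfolding test_functions_def by blast
  then have c: "continuous_on UNIV \<phi>" by simp
  have "bounded (\<phi> ` K)"
    using c K(1) by (intro compact_imp_bounded compact_continuous_image) (auto intro: continuous_on_subset)
  then obtain B0 where "\<forall>x\<in>K. \<bar>\<phi> x\<bar> \<le> B0" unfolding bounded_iff by auto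
  then have B: "\<bar>\<phi> x\<bar> \<le> \<bar>B0\<bar>" for x using supp[of x] by (cases "x \<in> K") force+
  have wm [measurable]: "w \<in> borel_measurable (lebesgue_on \<Omega>)" and wi: "integrable (lebesgue_on \<Omega>) (\<lambda>x. (w x)\<^sup>2)"
    using w by (auto simp: L2_def)
  have [measurable]: "\<phi> \<in> borel_measurable (lebesgue_on \<Omega>)"
    by (intro continuous_imp_measurable_on_sets_lebesgue) (use \<Omega> c in \<open>auto intro: continuous_on_subset\<close>)
  have iK: "integrable (lebesgue_on \<Omega>) (indicat_real K)"
  proof (rule integrable_real_indicator)
    have "emeasure lebesgue K < \<infinity>" using emeasure_compact_finite[OF K(1)] K(1) by (simp add: borel_compact)
    then show "emeasure (lebesgue_on \<Omega>) K < \<infinity>" using K \<Omega> by (simp add: emeasure_restrict_space borel_compact)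
    show "K \<in> sets (lebesgue_on \<Omega>)" using K \<Omega> by (simp add: sets_restrict_space_iff borel_compact)
  qed
  have bnd: "\<bar>w x * \<phi> x\<bar> \<le> \<bar>B0\<bar> * (indicat_real K x + (w x)\<^sup>2)" for x
  proof (cases "x \<in> K")
    case True
    have "0 \<le> (\<bar>w x\<bar> - 1)\<^sup>2" by simp
    then have "2 * \<bar>w x\<bar> \<le> 1 + (w x)\<^sup>2" by (simp add: power2_diff)
    then have "\<bar>w x\<bar> \<le> 1 + (w x)\<^sup>2" by linarith
    then have "\<bar>w x\<bar> * \<bar>\<phi> x\<bar> \<le> (1 + (w x)\<^sup>2) * \<bar>B0\<bar>" using B[of x] by (intro mult_mono) auto
    then show ?thesis using True by (simp add: abs_mult mult.commute)
  qed (simp add: supp)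
  have "integrable (lebesgue_on \<Omega>) (\<lambda>x. w x * \<phi> x)"
  proof (rule Bochner_Integration.integrable_bound)
    show "integrable (lebesgue_on \<Omega>) (\<lambda>x. \<bar>B0\<bar> * (indicat_real K x + (w x)\<^sup>2))" using iK wi by simp
    show "AE x in lebesgue_on \<Omega>. norm (w x * \<phi> x) \<le> norm (\<bar>B0\<bar> * (indicat_real K x + (w x)\<^sup>2))"
      using bnd by (intro AE_I2) (auto intro: order_trans)
  qed measurable
  moreover have "(\<lambda>x. indicator \<Omega> x *\<^sub>R (w x * \<phi> x)) = (\<lambda>x. w x * \<phi> x)"
    using supp K(2) by (auto simp: fun_eq_iff indicator_def)
  ultimately show "integrable lebesgue (\<lambda>x. w x * \<phi> x)" using \<Omega> by (simp add: integrable_restrict_space)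
  show "(LINT x|lebesgue. w x * \<phi> x) = (LINT x|lebesgue_on \<Omega>. w x * \<phi> x)"
    by (rule integral_lebesgue_on_supported[OF \<Omega>, symmetric]) (use supp K(2) in auto)
qed

lemma L2_component:
  fixes v :: "'a::euclidean_space \<Rightarrow> real^'n::finite"
  assumes "v \<in> L2 \<Omega>"
  shows "(\<lambda>x. v x $ k) \<in> L2 \<Omega>"
proof -
  have [measurable]: "v \<in> borel_measurable (lebesgue_on \<Omega>)" and i: "integrable (lebesgue_on \<Omega>) (\<lambda>x. (norm (v x))\<^sup>2)"
    using assms by (auto simp: L2_def)
  have "(\<lambda>z::real^'n. z $ k) \<in> borel_measurable borel" by (intro borel_measurable_continuous_onI continuous_intros)
  then have m [measurable]: "(\<lambda>x. v x $ k) \<in> borel_measurable (lebesgue_on \<Omega>)" by measurable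
  have "integrable (lebesgue_on \<Omega>) (\<lambda>x. (norm (v x $ k))\<^sup>2)"
  proof (rule Bochner_Integration.integrable_bound[OF i])
    have "\<bar>v x $ k\<bar>\<^sup>2 \<le> (norm (v x))\<^sup>2" for x by (intro power_mono component_le_norm_cart) auto
    then show "AE x in lebesgue_on \<Omega>. norm ((norm (v x $ k))\<^sup>2) \<le> norm ((norm (v x))\<^sup>2)" by (intro AE_I2) simp
  qed measurable
  then show ?thesis using m by (simp add: L2_def)
qed

locale polar_splines = polar_map L \<Omega> x0 F + radial_knots L p ns s + periodic_knots nt
  for L \<Omega> x0 F p ns s nt
begin

section \<open>Angular spline combinations with given coefficients\<close>

definition bt :: "(nat \<Rightarrow> real) \<Rightarrow> real \<Rightarrow> real" where
  "bt e t = (\<Sum>j<nt. e j * Bt p nt j t)"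

definition mt :: "(nat \<Rightarrow> real) \<Rightarrow> real \<Rightarrow> real" where
  "mt e t = (\<Sum>j<nt. e j * Mt p nt j t)"

definition cyc_diff :: "(nat \<Rightarrow> real) \<Rightarrow> nat \<Rightarrow> real" where
  "cyc_diff e j = e ((j + 1) mod nt) - e j"

abbreviation "M \<equiv> Ms p s"
abbreviation "B \<equiv> Bs p s"

lemma comb0_eq: "comb0 L F p ns s nt c x = (\<Sum>i<ns. B i (P x $ 1) * bt (c i) (P x $ 2))"
  by (simp add: comb0_def T0_def bt_def Let_def sum_distrib_left mult_ac)

lemma comb1_eq:
  assumes "x \<in> \<Omega>0"
  shows "comb1 L F p ns s nt cs ct x = (\<Sum>i<ns - 1. M i (P x $ 1) * bt (cs i) (P x $ 2)) *\<^sub>R R1 x +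
     (\<Sum>i<ns. B i (P x $ 1) * mt (ct i) (P x $ 2)) *\<^sub>R R2 x"
  by (simp add: comb1_def T1s_def T1t_def bt_def mt_def Let_def pullback_matrix[OF assms]
      scaleR_sum_left sum_distrib_left mult_ac del: transpose_matrix_vector)

lemma comb2_eq: "comb2 L F p ns s nt c x = (\<Sum>i<ns - 1. M i (P x $ 1) * mt (c i) (P x $ 2)) / det (J (P x))"
  by (simp add: comb2_def T2_def mt_def Let_def sum_distrib_left sum_distrib_right sum_divide_distrib divide_inverse mult_ac)

lemma bt_has_derivative: "t \<notin> knots \<Longrightarrow> (bt e has_real_derivative mt (cyc_diff e) t) (at t)"
  unfolding bt_def[abs_def] mt_def cyc_diff_def by (rule Bt_has_derivative[OF p_pos])

lemma bt_shift: "bt e (t + 2 * pi * of_int k) = bt e t"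
  by (simp add: bt_def Bt_shift)

lemma mt_shift: "mt e (t + 2 * pi * of_int k) = mt e t"
  by (simp add: mt_def Mt_shift)

lemma bt_lipschitzian: "bounded X \<Longrightarrow> lipschitzian_on X (bt e)"
  unfolding bt_def[abs_def] by (rule Bt_lipschitzian[OF p_pos])

lemma bt_diff: "bt (\<lambda>j. e j - e' j) t = bt e t - bt e' t"
  by (simp add: bt_def left_diff_distrib sum_subtractf)

lemma mt_diff: "mt (\<lambda>j. e j - e' j) t = mt e t - mt e' t"
  by (simp add: mt_def left_diff_distrib sum_subtractf)

lemma bt_mt_measurable [measurable]: "bt e \<in> borel_measurable borel" "mt e \<in> borel_measurable borel"
  unfolding bt_def[abs_def] mt_def[abs_def] by measurable

lemma bt_mt_bounded: "\<exists>K\<ge>0. \<forall>t. 0 \<le> t \<and> t \<le> 2 * pi \<longrightarrow> \<bar>bt e t\<bar> \<le> K \<and> \<bar>mt e t\<bar> \<le> K"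
proof -
  obtain K where K: "\<And>t j. 0 \<le> t \<Longrightarrow> t \<le> 2 * pi \<Longrightarrow> j < nt \<Longrightarrow> \<bar>Bt p nt j t\<bar> \<le> K \<and> \<bar>Mt p nt j t\<bar> \<le> K"
    using Bt_Mt_bounded[of p] by blast
  have "\<bar>\<Sum>j<nt. e j * f j\<bar> \<le> (\<Sum>j<nt. \<bar>e j\<bar> * \<bar>K\<bar>)" if "\<And>j. j < nt \<Longrightarrow> \<bar>f j\<bar> \<le> K" for f
  proof -
    have "\<bar>\<Sum>j<nt. e j * f j\<bar> \<le> (\<Sum>j<nt. \<bar>e j * f j\<bar>)" by (rule sum_abs)
    also have "\<dots> \<le> (\<Sum>j<nt. \<bar>e j\<bar> * \<bar>K\<bar>)"
      unfolding abs_mult using that by (intro sum_mono mult_left_mono) force+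
    finally show ?thesis .
  qed
  then show ?thesis
    unfolding bt_def mt_def using K by (intro exI[of _ "\<Sum>j<nt. \<bar>e j\<bar> * \<bar>K\<bar>"]) (auto intro!: sum_nonneg)
qed

lemma mt_zero_coefficients: "(\<forall>j<nt. e j = 0) \<Longrightarrow> mt e t = 0"
  by (simp add: mt_def)

lemma bt_const_coefficients: "(\<forall>j<nt. e j = \<gamma>) \<Longrightarrow> bt e t = \<gamma>"
  using Bt_partition_of_unity[of p t] by (simp add: bt_def sum_distrib_left[symmetric])

lemma cyc_diff_zero_imp_const:
  assumes "\<forall>j<nt. cyc_diff e j = 0" "j < nt"
  shows "e j = e 0"
  using assms(2)
proof (induction j)
  case (Suc j)
  then show ?case using assms(1)[rule_format, of j] by (simp add: cyc_diff_def)
qed simp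

subsection \<open>Gradients and curls\<close>

text \<open>Pairs a function with an explicit formula for its gradient. The formula makes sense also
  over the knots, where \<open>partial\<close> may be unspecified, so forms can be computed with
  formulas alone.\<close>

definition grad_ae :: "(real^2 \<Rightarrow> real) \<Rightarrow> (real^2 \<Rightarrow> real^2) \<Rightarrow> bool" where
  "grad_ae f g \<longleftrightarrow> lip_ae_diff \<Omega>0 f \<and> (AE x in lebesgue. x \<in> \<Omega>0 \<longrightarrow> (\<forall>k. partial k f x = g x $ k))"

lemma grad_ae_cong_AE:
  assumes "grad_ae f g" "AE x in lebesgue. x \<in> \<Omega>0 \<longrightarrow> g x = g' x"
  shows "grad_ae f g'"
proof -
  have "AE x in lebesgue. x \<in> \<Omega>0 \<longrightarrow> (\<forall>k. partial k f x = g' x $ k)"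
    using assms(1)[unfolded grad_ae_def, THEN conjunct2] assms(2) by eventually_elim auto
  then show ?thesis using assms(1) by (simp add: grad_ae_def)
qed

lemma grad_ae_mult:
  assumes "grad_ae f f'" "grad_ae g g'"
  shows "grad_ae (\<lambda>x. f x * g x) (\<lambda>x. f x *\<^sub>R g' x + g x *\<^sub>R f' x)"
proof -
  have l: "lip_ae_diff \<Omega>0 f" "lip_ae_diff \<Omega>0 g" using assms by (auto simp: grad_ae_def)
  have d: "AE x in lebesgue. x \<in> \<Omega>0 \<longrightarrow> f differentiable (at x)" "AE x in lebesgue. x \<in> \<Omega>0 \<longrightarrow> g differentiable (at x)"
    using l by (auto simp: lip_ae_diff_def)
  have p: "AE x in lebesgue. x \<in> \<Omega>0 \<longrightarrow> (\<forall>k. partial k f x = f' x $ k)" "AE x in lebesgue. x \<in> \<Omega>0 \<longrightarrow> (\<forall>k. partial k g x = g' x $ k)"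
    using assms by (auto simp: grad_ae_def)
  from d(1) d(2) p(1) p(2)
  have "AE x in lebesgue. x \<in> \<Omega>0 \<longrightarrow> (\<forall>k. partial k (\<lambda>x. f x * g x) x = (f x *\<^sub>R g' x + g x *\<^sub>R f' x) $ k)"
    by eventually_elim (auto simp: partial_mult)
  then show ?thesis using lip_ae_diff_mult[OF l] by (simp add: grad_ae_def)
qed

lemma grad_ae_add:
  assumes "grad_ae f f'" "grad_ae g g'"
  shows "grad_ae (\<lambda>x. f x + g x) (\<lambda>x. f' x + g' x)"
proof -
  have l: "lip_ae_diff \<Omega>0 f" "lip_ae_diff \<Omega>0 g" using assms by (auto simp: grad_ae_def)
  have d: "AE x in lebesgue. x \<in> \<Omega>0 \<longrightarrow> f differentiable (at x)" "AE x in lebesgue. x \<in> \<Omega>0 \<longrightarrow> g differentiable (at x)"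
    using l by (auto simp: lip_ae_diff_def)
  have p: "AE x in lebesgue. x \<in> \<Omega>0 \<longrightarrow> (\<forall>k. partial k f x = f' x $ k)" "AE x in lebesgue. x \<in> \<Omega>0 \<longrightarrow> (\<forall>k. partial k g x = g' x $ k)"
    using assms by (auto simp: grad_ae_def)
  have pa: "partial k (\<lambda>x. f x + g x) x = partial k f x + partial k g x"
    if fg: "f differentiable (at x)" "g differentiable (at x)" for x k
  proof -
    obtain D E where D: "(f has_derivative D) (at x)" "(g has_derivative E) (at x)"
      using fg unfolding differentiable_def by blast
    show ?thesis using partial_eqI[OF has_derivative_add[OF D]] partial_eqI[OF D(1)] partial_eqI[OF D(2)] by simp
  qed
  from d(1) d(2) p(1) p(2)
  have "AE x in lebesgue. x \<in> \<Omega>0 \<longrightarrow> (\<forall>k. partial k (\<lambda>x. f x + g x) x = (f' x + g' x) $ k)"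
    by eventually_elim (auto simp: pa)
  then show ?thesis using lip_ae_diff_add[OF l] by (simp add: grad_ae_def)
qed

lemma grad_ae_const: "grad_ae (\<lambda>x. c) (\<lambda>x. 0)"
  by (simp add: grad_ae_def lip_ae_diff_const open_\<Omega>0)

lemma grad_ae_sum:
  "(\<And>i. i \<in> I \<Longrightarrow> grad_ae (f i) (g i)) \<Longrightarrow> grad_ae (\<lambda>x. \<Sum>i\<in>I. f i x) (\<lambda>x. \<Sum>i\<in>I. g i x)"
  by (induction I rule: infinite_finite_induct) (auto intro: grad_ae_add grad_ae_const)

definition Bs' :: "nat \<Rightarrow> real \<Rightarrow> real" where
  "Bs' i t = (if i = 0 then 0 else M (i - 1) t) - M i t"

text \<open>Abel summation obtained without index manipulation: both sides are the derivative of the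
  same spline.\<close>

lemma Bs'_sum:
  assumes "t \<notin> breakpoints"
  shows "(\<Sum>i<ns. d i * Bs' i t) = (\<Sum>i<ns - 1. (d (i + 1) - d i) * M i t)"
proof (rule DERIV_unique)
  show "((\<lambda>y. \<Sum>i<ns. d i * B i y) has_real_derivative (\<Sum>i<ns. d i * Bs' i t)) (at t)"
    unfolding Bs'_def using assms by (intro DERIV_sum DERIV_cmult Bs_has_derivative) auto
  show "((\<lambda>y. \<Sum>i<ns. d i * B i y) has_real_derivative (\<Sum>i<ns - 1. (d (i + 1) - d i) * M i t)) (at t)"
    by (rule Bs_sum_has_derivative[OF assms])
qed

lemma countable_breakpoints: "countable breakpoints"
  using finite_breakpoints by (rule countable_finite)

lemma grad_ae_radial:
  assumes "lipschitzian_on {0..<L} a" "\<And>t. t \<notin> breakpoints \<Longrightarrow> (a has_real_derivative a' t) (at t)"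
  shows "grad_ae (\<lambda>x. a (P x $ 1)) (\<lambda>x. a' (P x $ 1) *\<^sub>R R1 x)"
  unfolding grad_ae_def using lip_ae_diff_radial[OF assms(1) countable_breakpoints assms(2)] by simp

lemma grad_ae_angular:
  assumes "\<And>X. bounded X \<Longrightarrow> lipschitzian_on X b" "\<And>t. t \<notin> knots \<Longrightarrow> (b has_real_derivative b' t) (at t)"
    and "\<And>t (k::int). b (t + 2 * pi * of_int k) = b t"
  shows "grad_ae (\<lambda>x. b (P x $ 2)) (\<lambda>x. b' (P x $ 2) *\<^sub>R R2 x)"
  unfolding grad_ae_def using lip_ae_diff_angular[OF assms(1) countable_knots assms(2,3)] by simp

lemma grad_ae_B: "i < ns \<Longrightarrow> grad_ae (\<lambda>x. B i (P x $ 1)) (\<lambda>x. Bs' i (P x $ 1) *\<^sub>R R1 x)"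
  unfolding Bs'_def by (rule grad_ae_radial[OF Bs_lipschitzian Bs_has_derivative])

lemma grad_ae_bt: "grad_ae (\<lambda>x. bt e (P x $ 2)) (\<lambda>x. mt (cyc_diff e) (P x $ 2) *\<^sub>R R2 x)"
  by (rule grad_ae_angular[OF bt_lipschitzian bt_has_derivative bt_shift])

lemma lipschitzian_sin_cos: "lipschitzian_on X (sin :: real \<Rightarrow> real)" "lipschitzian_on X (cos :: real \<Rightarrow> real)"
proof -
  have "\<bar>sin x - sin y\<bar> \<le> 1 * dist x y" for x y :: real
  proof -
    have "norm (sin x - sin y) \<le> 1 * norm (x - y)"
      by (rule field_differentiable_bound[of UNIV sin cos]) (auto intro: DERIV_sin)
    then show ?thesis by (simp add: dist_norm)
  qed
  then show "lipschitzian_on X (sin :: real \<Rightarrow> real)" by (rule lipschitzian_onI)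
  have "\<bar>cos x - cos y\<bar> \<le> 1 * dist x y" for x y :: real
  proof -
    have "norm (cos x - cos y) \<le> 1 * norm (x - y)"
      by (rule field_differentiable_bound[of UNIV cos "\<lambda>x. - sin x"]) (auto intro: DERIV_cos)
    then show ?thesis by (simp add: dist_norm)
  qed
  then show "lipschitzian_on X (cos :: real \<Rightarrow> real)" by (rule lipschitzian_onI)
qed

lemma grad_ae_sin_cos:
  "grad_ae (\<lambda>x. sin (P x $ 2)) (\<lambda>x. cos (P x $ 2) *\<^sub>R R2 x)"
  "grad_ae (\<lambda>x. cos (P x $ 2)) (\<lambda>x. (- sin (P x $ 2)) *\<^sub>R R2 x)"
proof -
  have "sin (t + 2 * pi * of_int k) = sin t" "cos (t + 2 * pi * of_int k) = cos t" for t and k :: int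
    by (simp_all only: sin_add cos_add cos_int_2pin sin_int_2pin mult_1_right mult_zero_right diff_zero add_0_right)
  then show "grad_ae (\<lambda>x. sin (P x $ 2)) (\<lambda>x. cos (P x $ 2) *\<^sub>R R2 x)"
    "grad_ae (\<lambda>x. cos (P x $ 2)) (\<lambda>x. (- sin (P x $ 2)) *\<^sub>R R2 x)"
    using grad_ae_angular[of sin cos] grad_ae_angular[of cos "\<lambda>t. - sin t"] lipschitzian_sin_cos DERIV_sin DERIV_cos by auto
qed

text \<open>The discrete gradient: differences in i come from the radial derivative through
  \<open>Bs'_sum\<close>, cyclic differences in j from the derivative of \<open>bt\<close>.\<close>

lemma comb0_grad:
  "grad_ae (comb0 L F p ns s nt c)
     (comb1 L F p ns s nt (\<lambda>i j. c (i + 1) j - c i j) (\<lambda>i. cyc_diff (c i)))"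
proof -
  have "grad_ae (\<lambda>x. \<Sum>i<ns. B i (P x $ 1) * bt (c i) (P x $ 2))
     (\<lambda>x. \<Sum>i<ns. B i (P x $ 1) *\<^sub>R (mt (cyc_diff (c i)) (P x $ 2) *\<^sub>R R2 x) + bt (c i) (P x $ 2) *\<^sub>R (Bs' i (P x $ 1) *\<^sub>R R1 x))"
    by (intro grad_ae_sum grad_ae_mult grad_ae_B grad_ae_bt) simp
  then have "grad_ae (comb0 L F p ns s nt c)
     (\<lambda>x. \<Sum>i<ns. B i (P x $ 1) *\<^sub>R (mt (cyc_diff (c i)) (P x $ 2) *\<^sub>R R2 x) + bt (c i) (P x $ 2) *\<^sub>R (Bs' i (P x $ 1) *\<^sub>R R1 x))"
    unfolding comb0_eq[abs_def] .
  then show ?thesis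
  proof (rule grad_ae_cong_AE)
    show "AE x in lebesgue. x \<in> \<Omega>0 \<longrightarrow> (\<Sum>i<ns. B i (P x $ 1) *\<^sub>R (mt (cyc_diff (c i)) (P x $ 2) *\<^sub>R R2 x) + bt (c i) (P x $ 2) *\<^sub>R (Bs' i (P x $ 1) *\<^sub>R R1 x))
        = comb1 L F p ns s nt (\<lambda>i j. c (i + 1) j - c i j) (\<lambda>i. cyc_diff (c i)) x"
      using AE_coordinate[OF countable_breakpoints, of 1]
    proof eventually_elim
      case (elim x)
      show ?case
      proof
        assume x: "x \<in> \<Omega>0"
        have "(\<Sum>i<ns. bt (c i) (P x $ 2) * Bs' i (P x $ 1)) = (\<Sum>i<ns - 1. M i (P x $ 1) * bt (\<lambda>j. c (i + 1) j - c i j) (P x $ 2))"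
          using Bs'_sum[of "P x $ 1" "\<lambda>i. bt (c i) (P x $ 2)"] elim x by (simp add: bt_diff mult.commute)
        then show "(\<Sum>i<ns. B i (P x $ 1) *\<^sub>R (mt (cyc_diff (c i)) (P x $ 2) *\<^sub>R R2 x) + bt (c i) (P x $ 2) *\<^sub>R (Bs' i (P x $ 1) *\<^sub>R R1 x))
          = comb1 L F p ns s nt (\<lambda>i j. c (i + 1) j - c i j) (\<lambda>i. cyc_diff (c i)) x"
          unfolding comb1_eq[OF x] by (simp add: sum.distrib scaleR_sum_left[symmetric] add.commute)
      qed
    qed
  qed
qed

text \<open>A quarter turn, clockwise, for which the divergence of \<open>rot v\<close> is the curl
  of v.\<close>

definition rot :: "real^2 \<Rightarrow> real^2" where
  "rot v = vector [v $ 2, - v $ 1]"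

lemma weak_div_form:
  assumes "grad_ae \<beta> \<beta>'" "grad_ae \<alpha> \<alpha>'"
  shows "weak_div \<Omega>0 (\<lambda>x. rot (\<beta> x *\<^sub>R \<alpha>' x)) (\<lambda>x. \<beta>' x $ 1 * \<alpha>' x $ 2 - \<beta>' x $ 2 * \<alpha>' x $ 1)"
proof -
  have l: "lip_ae_diff \<Omega>0 \<beta>" "lip_ae_diff \<Omega>0 \<alpha>" using assms by (auto simp: grad_ae_def)
  have p: "AE x in lebesgue. x \<in> \<Omega>0 \<longrightarrow> (\<forall>k. partial k \<beta> x = \<beta>' x $ k)" "AE x in lebesgue. x \<in> \<Omega>0 \<longrightarrow> (\<forall>k. partial k \<alpha> x = \<alpha>' x $ k)"
    using assms by (auto simp: grad_ae_def)
  show ?thesis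
  proof (rule weak_div_cong_AE[OF weak_div_curl[OF open_\<Omega>0 l]])
    show "AE x in lebesgue. x \<in> \<Omega>0 \<longrightarrow> vector [\<beta> x * partial 2 \<alpha> x, - \<beta> x * partial 1 \<alpha> x] = rot (\<beta> x *\<^sub>R \<alpha>' x)"
      using p(2) by eventually_elim (auto simp: rot_def)
    show "AE x in lebesgue. x \<in> \<Omega>0 \<longrightarrow> partial 1 \<beta> x * partial 2 \<alpha> x - partial 2 \<beta> x * partial 1 \<alpha> x =
        \<beta>' x $ 1 * \<alpha>' x $ 2 - \<beta>' x $ 2 * \<alpha>' x $ 1"
      using p(1) p(2) by eventually_elim auto
  qed
qed

text \<open>The factor M_i may jump and is not differentiated: M_i ds is the differential of a tail
  sum of the B_k and serves as d\<alpha>, with the angular spline as \<beta>. The sign stems from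
  d\<theta> \<and> ds = - ds \<and> d\<theta>.\<close>

lemma weak_div_radial_form:
  assumes "i < ns - 1"
  shows "weak_div \<Omega>0 (\<lambda>x. rot ((M i (P x $ 1) * bt e (P x $ 2)) *\<^sub>R R1 x))
     (\<lambda>x. - (M i (P x $ 1) * mt (cyc_diff e) (P x $ 2)) / det (J (P x)))"
proof -
  have "grad_ae (\<lambda>x. \<Sum>k<ns. (if i < k then 1 else 0) * B k (P x $ 1)) (\<lambda>x. M i (P x $ 1) *\<^sub>R R1 x)"
    by (rule grad_ae_radial[OF Bs_sum_lipschitzian Ms_antiderivative[OF assms]])
  from weak_div_form[OF grad_ae_bt[of e] this]
  show ?thesis
  proof (rule weak_div_cong_AE; intro AE_I2 impI)
    fix x assume x: "x \<in> \<Omega>0"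
    show "rot (bt e (P x $ 2) *\<^sub>R (M i (P x $ 1) *\<^sub>R R1 x)) = rot ((M i (P x $ 1) * bt e (P x $ 2)) *\<^sub>R R1 x)"
      by (simp add: mult.commute)
    define m d where "m = M i (P x $ 1)" and "d = mt (cyc_diff e) (P x $ 2)"
    have "(d *\<^sub>R R2 x) $ 1 * (m *\<^sub>R R1 x) $ 2 - (d *\<^sub>R R2 x) $ 2 * (m *\<^sub>R R1 x) $ 1
        = - (m * d) * (R1 x $ 1 * R2 x $ 2 - R1 x $ 2 * R2 x $ 1)" by (simp add: algebra_simps)
    also have "\<dots> = - (m * d) / det (J (P x))" unfolding R1_cross_R2[OF x] by simp
    finally show "(mt (cyc_diff e) (P x $ 2) *\<^sub>R R2 x) $ 1 * (M i (P x $ 1) *\<^sub>R R1 x) $ 2 -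
        (mt (cyc_diff e) (P x $ 2) *\<^sub>R R2 x) $ 2 * (M i (P x $ 1) *\<^sub>R R1 x) $ 1 =
        - (M i (P x $ 1) * mt (cyc_diff e) (P x $ 2)) / det (J (P x))"
      unfolding m_def d_def .
  qed
qed

text \<open>The angle itself is multivalued, but \<open>d\<theta> = cos \<theta> d(sin \<theta>) - sin \<theta> d(cos \<theta>)\<close>.\<close>

lemma weak_div_angular_form:
  assumes i: "i < ns"
  shows "weak_div \<Omega>0 (\<lambda>x. rot ((B i (P x $ 1) * mt e (P x $ 2)) *\<^sub>R R2 x))
     (\<lambda>x. Bs' i (P x $ 1) * mt e (P x $ 2) / det (J (P x)))"
proof -
  \<comment> \<open>The mean of \<open>mt e\<close>; after its removal there is a periodic
    antiderivative \<open>bt b\<close>.\<close>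
  define m where "m = (\<Sum>j<nt. e j) / (2 * pi)"
  obtain b where b: "\<And>t. t \<notin> knots \<Longrightarrow> ((\<lambda>y. \<Sum>j<nt. b j * Bt p nt j y) has_real_derivative
      (\<Sum>j<nt. e j * Mt p nt j t) - (\<Sum>j<nt. e j) / (2 * pi)) (at t)"
    using Mt_antiderivative[OF p_pos, of e] by blast
  have g: "grad_ae (\<lambda>x. bt b (P x $ 2)) (\<lambda>x. (mt e (P x $ 2) - m) *\<^sub>R R2 x)"
  proof (rule grad_ae_angular[OF bt_lipschitzian _ bt_shift])
    show "(bt b has_real_derivative mt e t - m) (at t)" if "t \<notin> knots" for t
      using b[OF that] unfolding bt_def[abs_def] mt_def m_def .
  qed
  have gB: "grad_ae (\<lambda>x. m * B i (P x $ 1)) (\<lambda>x. m *\<^sub>R (Bs' i (P x $ 1) *\<^sub>R R1 x) + B i (P x $ 1) *\<^sub>R 0)"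
    by (rule grad_ae_mult[OF grad_ae_const grad_ae_B[OF i]])
  have gms: "grad_ae (\<lambda>x. - 1 * sin (P x $ 2)) (\<lambda>x. (- 1) *\<^sub>R (cos (P x $ 2) *\<^sub>R R2 x) + sin (P x $ 2) *\<^sub>R 0)"
    by (rule grad_ae_mult[OF grad_ae_const grad_ae_sin_cos(1)])
  \<comment> \<open>The form is B_i d(bt b) + m B_i cos \<theta> d(sin \<theta>) - m B_i sin
    \<theta> d(cos \<theta>), a sum of three terms \<beta> d\<alpha> with globally defined
    functions.\<close>
  note W = weak_div_add[OF weak_div_form[OF grad_ae_B[OF i] g]
      weak_div_add[OF weak_div_form[OF grad_ae_mult[OF gB grad_ae_sin_cos(2)] grad_ae_sin_cos(1)]
        weak_div_form[OF grad_ae_mult[OF gB gms] grad_ae_sin_cos(2)]]]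
  show ?thesis
  proof (rule weak_div_cong_AE[OF W]; intro AE_I2 impI)
    fix x assume x: "x \<in> \<Omega>0"
    define \<beta> \<beta>' \<mu> u v where "\<beta> = B i (P x $ 1)" and "\<beta>' = Bs' i (P x $ 1)" and "\<mu> = mt e (P x $ 2)"
      and "u = cos (P x $ 2)" and "v = sin (P x $ 2)"
    have uv: "u * u + v * v = 1" unfolding u_def v_def by (metis sin_cos_squared_add3)
    have "m * \<beta> * u * u + m * \<beta> * v * v = m * \<beta> * (u * u + v * v)" by (simp only: distrib_left mult.assoc)
    then have r: "\<beta> * (\<mu> - m) + (m * \<beta> * u * u + m * \<beta> * v * v) = \<beta> * \<mu>"
      unfolding uv by (simp add: algebra_simps)
    show "rot (B i (P x $ 1) *\<^sub>R ((mt e (P x $ 2) - m) *\<^sub>R R2 x)) +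
       (rot ((m * B i (P x $ 1) * cos (P x $ 2)) *\<^sub>R (cos (P x $ 2) *\<^sub>R R2 x)) +
        rot ((m * B i (P x $ 1) * (- 1 * sin (P x $ 2))) *\<^sub>R ((- sin (P x $ 2)) *\<^sub>R R2 x))) =
       rot ((B i (P x $ 1) * mt e (P x $ 2)) *\<^sub>R R2 x)"
    proof -
      have "rot (\<beta> *\<^sub>R ((\<mu> - m) *\<^sub>R R2 x)) + (rot ((m * \<beta> * u) *\<^sub>R (u *\<^sub>R R2 x)) + rot ((m * \<beta> * (- 1 * v)) *\<^sub>R ((- v) *\<^sub>R R2 x)))
         = rot ((\<beta> * (\<mu> - m) + (m * \<beta> * u * u + m * \<beta> * v * v)) *\<^sub>R R2 x)"
        by (simp add: rot_def vec_eq_iff forall_2 algebra_simps)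
      then show ?thesis
        unfolding r unfolding \<beta>_def \<mu>_def u_def v_def .
    qed
    define a1 a2 b1 b2 where "a1 = R1 x $ 1" and "a2 = R1 x $ 2" and "b1 = R2 x $ 1" and "b2 = R2 x $ 2"
    have X: "a1 * b2 - a2 * b1 = 1 / det (J (P x))" unfolding a1_def a2_def b1_def b2_def by (rule R1_cross_R2[OF x])
    show "(Bs' i (P x $ 1) *\<^sub>R R1 x) $ 1 * ((mt e (P x $ 2) - m) *\<^sub>R R2 x) $ 2 -
         (Bs' i (P x $ 1) *\<^sub>R R1 x) $ 2 * ((mt e (P x $ 2) - m) *\<^sub>R R2 x) $ 1 +
         (((m * B i (P x $ 1)) *\<^sub>R ((- sin (P x $ 2)) *\<^sub>R R2 x) +
            cos (P x $ 2) *\<^sub>R (m *\<^sub>R (Bs' i (P x $ 1) *\<^sub>R R1 x) + B i (P x $ 1) *\<^sub>R 0)) $ 1 * (cos (P x $ 2) *\<^sub>R R2 x) $ 2 -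
          ((m * B i (P x $ 1)) *\<^sub>R ((- sin (P x $ 2)) *\<^sub>R R2 x) +
            cos (P x $ 2) *\<^sub>R (m *\<^sub>R (Bs' i (P x $ 1) *\<^sub>R R1 x) + B i (P x $ 1) *\<^sub>R 0)) $ 2 * (cos (P x $ 2) *\<^sub>R R2 x) $ 1 +
          (((m * B i (P x $ 1)) *\<^sub>R ((- 1) *\<^sub>R (cos (P x $ 2) *\<^sub>R R2 x) + sin (P x $ 2) *\<^sub>R 0) +
            (- 1 * sin (P x $ 2)) *\<^sub>R (m *\<^sub>R (Bs' i (P x $ 1) *\<^sub>R R1 x) + B i (P x $ 1) *\<^sub>R 0)) $ 1 * ((- sin (P x $ 2)) *\<^sub>R R2 x) $ 2 -
           ((m * B i (P x $ 1)) *\<^sub>R ((- 1) *\<^sub>R (cos (P x $ 2) *\<^sub>R R2 x) + sin (P x $ 2) *\<^sub>R 0) +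
            (- 1 * sin (P x $ 2)) *\<^sub>R (m *\<^sub>R (Bs' i (P x $ 1) *\<^sub>R R1 x) + B i (P x $ 1) *\<^sub>R 0)) $ 2 * ((- sin (P x $ 2)) *\<^sub>R R2 x) $ 1)) =
         Bs' i (P x $ 1) * mt e (P x $ 2) / det (J (P x))" (is "?lhs = _")
    proof -
      have "?lhs = \<beta>' * (\<mu> - m + m * (u * u + v * v)) * (a1 * b2 - a2 * b1)"
        unfolding \<beta>_def[symmetric] \<beta>'_def[symmetric] \<mu>_def[symmetric] u_def[symmetric] v_def[symmetric]
        by (simp add: a1_def[symmetric] a2_def[symmetric] b1_def[symmetric] b2_def[symmetric] algebra_simps)
      then show ?thesis unfolding X uv by (simp add: \<beta>'_def \<mu>_def)
    qed
  qed
qed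

text \<open>The cellular coboundary: radial difference of the angular coefficients minus cyclic
  difference of the radial ones. If \<open>ct 0\<close> vanishes, then its row i = 0 vanishes
  exactly when \<open>ct 1\<close> is the cyclic difference of \<open>cs 0\<close>.\<close>

definition curl_coeff :: "(nat \<Rightarrow> nat \<Rightarrow> real) \<Rightarrow> (nat \<Rightarrow> nat \<Rightarrow> real) \<Rightarrow> nat \<Rightarrow> nat \<Rightarrow> real" where
  "curl_coeff cs ct i j = (ct (i + 1) j - ct i j) - cyc_diff (cs i) j"

lemma comb1_curl:
  "weak_div \<Omega>0 (\<lambda>x. rot (comb1 L F p ns s nt cs ct x)) (comb2 L F p ns s nt (curl_coeff cs ct))"
proof -
  have W: "weak_div \<Omega>0
     (\<lambda>x. (\<Sum>i<ns - 1. rot ((M i (P x $ 1) * bt (cs i) (P x $ 2)) *\<^sub>R R1 x)) +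
          (\<Sum>i<ns. rot ((B i (P x $ 1) * mt (ct i) (P x $ 2)) *\<^sub>R R2 x)))
     (\<lambda>x. (\<Sum>i<ns - 1. - (M i (P x $ 1) * mt (cyc_diff (cs i)) (P x $ 2)) / det (J (P x))) +
          (\<Sum>i<ns. Bs' i (P x $ 1) * mt (ct i) (P x $ 2) / det (J (P x))))"
    by (intro weak_div_add weak_div_sum weak_div_radial_form weak_div_angular_form) auto
  show ?thesis
  proof (rule weak_div_cong_AE[OF W])
    show "AE x in lebesgue. x \<in> \<Omega>0 \<longrightarrow> (\<Sum>i<ns - 1. rot ((M i (P x $ 1) * bt (cs i) (P x $ 2)) *\<^sub>R R1 x)) +
          (\<Sum>i<ns. rot ((B i (P x $ 1) * mt (ct i) (P x $ 2)) *\<^sub>R R2 x)) = rot (comb1 L F p ns s nt cs ct x)"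
      by (intro AE_I2 impI) (simp add: comb1_eq rot_def vec_eq_iff forall_2 sum_distrib_right sum_negf)
    show "AE x in lebesgue. x \<in> \<Omega>0 \<longrightarrow> (\<Sum>i<ns - 1. - (M i (P x $ 1) * mt (cyc_diff (cs i)) (P x $ 2)) / det (J (P x))) +
          (\<Sum>i<ns. Bs' i (P x $ 1) * mt (ct i) (P x $ 2) / det (J (P x))) = comb2 L F p ns s nt (curl_coeff cs ct) x"
      using AE_coordinate[OF countable_breakpoints, of 1]
    proof eventually_elim
      case (elim x)
      show ?case
      proof
        assume x: "x \<in> \<Omega>0"
        have cc: "mt (curl_coeff cs ct i) t = mt (ct (i + 1)) t - mt (ct i) t - mt (cyc_diff (cs i)) t" for i t
          unfolding curl_coeff_def[abs_def] by (simp only: mt_diff)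
        have "(\<Sum>i<ns. Bs' i (P x $ 1) * mt (ct i) (P x $ 2)) =
            (\<Sum>i<ns - 1. M i (P x $ 1) * (mt (ct (i + 1)) (P x $ 2) - mt (ct i) (P x $ 2)))"
          using Bs'_sum[of "P x $ 1" "\<lambda>i. mt (ct i) (P x $ 2)"] elim x by (simp add: mult.commute)
        then have "(\<Sum>i<ns. Bs' i (P x $ 1) * mt (ct i) (P x $ 2)) - (\<Sum>i<ns - 1. M i (P x $ 1) * mt (cyc_diff (cs i)) (P x $ 2))
           = (\<Sum>i<ns - 1. M i (P x $ 1) * mt (curl_coeff cs ct i) (P x $ 2))"
          by (simp add: cc sum_subtractf[symmetric] right_diff_distrib)
        then show "(\<Sum>i<ns - 1. - (M i (P x $ 1) * mt (cyc_diff (cs i)) (P x $ 2)) / det (J (P x))) +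
          (\<Sum>i<ns. Bs' i (P x $ 1) * mt (ct i) (P x $ 2) / det (J (P x))) = comb2 L F p ns s nt (curl_coeff cs ct) x"
          unfolding comb2_eq by (simp add: sum_divide_distrib[symmetric] sum_negf diff_divide_distrib[symmetric])
      qed
    qed
  qed
qed

subsection \<open>Behaviour near the pole\<close>

text \<open>At s = 0 only the innermost radial function survives, with the value \<open>v\<close>: 1
  for the B_i and \<open>M 0 0\<close> for the M_i. One statement thus serves all four kinds of
  combinations.\<close>

lemma sum_near_pole:
  fixes n :: nat
  assumes f: "\<And>i. i < n \<Longrightarrow> \<exists>K\<ge>0. \<forall>x\<in>{0..<L}. \<bar>f i x - (if i = 0 then v else 0)\<bar> \<le> K * x"
    and g: "\<And>i. i < n \<Longrightarrow> \<exists>K\<ge>0. \<forall>t. 0 \<le> t \<and> t \<le> 2 * pi \<longrightarrow> \<bar>g i t\<bar> \<le> K"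
    and n: "n > 0"
  shows "\<exists>K\<ge>0. \<forall>x\<in>\<Omega>0. \<bar>(\<Sum>i<n. f i (P x $ 1) * g i (P x $ 2)) - v * g 0 (P x $ 2)\<bar> \<le> K * P x $ 1"
proof -
  obtain Kf where Kf: "\<And>i. i < n \<Longrightarrow> Kf i \<ge> 0 \<and> (\<forall>x\<in>{0..<L}. \<bar>f i x - (if i = 0 then v else 0)\<bar> \<le> Kf i * x)"
    using f by metis
  obtain Kg where Kg: "\<And>i. i < n \<Longrightarrow> Kg i \<ge> 0 \<and> (\<forall>t. 0 \<le> t \<and> t \<le> 2 * pi \<longrightarrow> \<bar>g i t\<bar> \<le> Kg i)"
    using g by metis
  have "\<bar>(\<Sum>i<n. f i (P x $ 1) * g i (P x $ 2)) - v * g 0 (P x $ 2)\<bar> \<le> (\<Sum>i<n. Kf i * Kg i) * P x $ 1" if x: "x \<in> \<Omega>0" for x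
  proof -
    note pc = polar_coords_inner[OF x]
    have "(\<Sum>i<n. (if i = 0 then v else 0) * g i (P x $ 2)) = (\<Sum>i<n. if i = 0 then v * g 0 (P x $ 2) else 0)"
      by (intro sum.cong) auto
    also have "\<dots> = v * g 0 (P x $ 2)"
      using n by (cases n) (simp_all add: sum.lessThan_Suc_shift del: sum.lessThan_Suc)
    finally have "(\<Sum>i<n. (if i = 0 then v else 0) * g i (P x $ 2)) = v * g 0 (P x $ 2)" .
    then have "(\<Sum>i<n. f i (P x $ 1) * g i (P x $ 2)) - v * g 0 (P x $ 2) = (\<Sum>i<n. (f i (P x $ 1) - (if i = 0 then v else 0)) * g i (P x $ 2))"
      by (simp add: left_diff_distrib sum_subtractf)
    also have "\<bar>\<dots>\<bar> \<le> (\<Sum>i<n. \<bar>(f i (P x $ 1) - (if i = 0 then v else 0)) * g i (P x $ 2)\<bar>)" by (rule sum_abs)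
    also have "\<dots> \<le> (\<Sum>i<n. Kf i * P x $ 1 * Kg i)"
      unfolding abs_mult using Kf Kg pc by (intro sum_mono mult_mono) auto
    also have "\<dots> = (\<Sum>i<n. Kf i * Kg i) * P x $ 1"
      unfolding sum_distrib_right by (intro sum.cong) (simp_all add: mult_ac)
    finally show ?thesis .
  qed
  moreover have "(\<Sum>i<n. Kf i * Kg i) \<ge> 0" using Kf Kg by (intro sum_nonneg mult_nonneg_nonneg) auto
  ultimately show ?thesis by blast
qed

lemma bt_bounded: "\<exists>K\<ge>0. \<forall>t. 0 \<le> t \<and> t \<le> 2 * pi \<longrightarrow> \<bar>bt e t\<bar> \<le> K"
  using bt_mt_bounded[of e] by blast

lemma mt_bounded: "\<exists>K\<ge>0. \<forall>t. 0 \<le> t \<and> t \<le> 2 * pi \<longrightarrow> \<bar>mt e t\<bar> \<le> K"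
  using bt_mt_bounded[of e] by blast

lemma ns_pos: "ns > 0" "ns - 1 > 0"
  using p_pos p_less_ns by auto

lemma B_mt_near_pole: "\<exists>K\<ge>0. \<forall>x\<in>\<Omega>0. \<bar>(\<Sum>i<ns. B i (P x $ 1) * mt (e i) (P x $ 2)) - 1 * mt (e 0) (P x $ 2)\<bar> \<le> K * P x $ 1"
  by (rule sum_near_pole[OF Bs_near_0 mt_bounded ns_pos(1)])

lemma B_bt_near_pole: "\<exists>K\<ge>0. \<forall>x\<in>\<Omega>0. \<bar>(\<Sum>i<ns. B i (P x $ 1) * bt (e i) (P x $ 2)) - 1 * bt (e 0) (P x $ 2)\<bar> \<le> K * P x $ 1"
  by (rule sum_near_pole[OF Bs_near_0 bt_bounded ns_pos(1)])

lemma M_mt_near_pole: "\<exists>K\<ge>0. \<forall>x\<in>\<Omega>0. \<bar>(\<Sum>i<ns - 1. M i (P x $ 1) * mt (e i) (P x $ 2)) - M 0 0 * mt (e 0) (P x $ 2)\<bar> \<le> K * P x $ 1"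
  by (rule sum_near_pole[OF Ms_near_0 mt_bounded ns_pos(2)])

lemma M_bt_near_pole: "\<exists>K\<ge>0. \<forall>x\<in>\<Omega>0. \<bar>(\<Sum>i<ns - 1. M i (P x $ 1) * bt (e i) (P x $ 2)) - M 0 0 * bt (e 0) (P x $ 2)\<bar> \<le> K * P x $ 1"
  by (rule sum_near_pole[OF Ms_near_0 bt_bounded ns_pos(2)])

lemma near_pole_imp_bounded:
  assumes "\<exists>K\<ge>0. \<forall>x\<in>\<Omega>0. \<bar>f x - v * g (P x $ 2)\<bar> \<le> K * P x $ 1"
    and "\<exists>K\<ge>0. \<forall>t. 0 \<le> t \<and> t \<le> 2 * pi \<longrightarrow> \<bar>g t\<bar> \<le> K"
  shows "\<exists>K\<ge>0. \<forall>x\<in>\<Omega>0. \<bar>f x\<bar> \<le> K"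
proof -
  obtain K1 where K1: "K1 \<ge> 0" "\<And>x. x \<in> \<Omega>0 \<Longrightarrow> \<bar>f x - v * g (P x $ 2)\<bar> \<le> K1 * P x $ 1" using assms(1) by blast
  obtain K2 where K2: "K2 \<ge> 0" "\<And>t. 0 \<le> t \<Longrightarrow> t \<le> 2 * pi \<Longrightarrow> \<bar>g t\<bar> \<le> K2" using assms(2) by blast
  have "\<bar>f x\<bar> \<le> K1 * L + \<bar>v\<bar> * K2" if x: "x \<in> \<Omega>0" for x
  proof -
    note pc = polar_coords_inner[OF x]
    have "K1 * P x $ 1 \<le> K1 * L" using K1(1) pc by (intro mult_left_mono) auto
    moreover have "\<bar>v * g (P x $ 2)\<bar> \<le> \<bar>v\<bar> * K2" unfolding abs_mult using K2(2) pc by (intro mult_left_mono) auto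
    ultimately show ?thesis using K1(2)[OF x] by linarith
  qed
  moreover have "K1 * L + \<bar>v\<bar> * K2 \<ge> 0" using K1(1) K2(1) L_pos by simp
  ultimately show ?thesis by blast
qed

lemma comb0_bounded: "\<exists>K. \<forall>x\<in>\<Omega>0. \<bar>comb0 L F p ns s nt c x\<bar> \<le> K"
  using near_pole_imp_bounded[OF B_bt_near_pole[of c] bt_bounded[of "c 0"]] unfolding comb0_eq by blast

text \<open>With a vanishing innermost angular row the coefficient of \<open>R2\<close> is O(s),
  which compensates the growth 1 / s of \<open>R2\<close>; the \<open>R1\<close> part is bounded in
  any case.\<close>

lemma comb1_bounded:
  assumes "\<forall>j<nt. ct 0 j = 0"
  shows "\<exists>K. \<forall>x\<in>\<Omega>0. norm (comb1 L F p ns s nt cs ct x) \<le> K"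
proof -
  obtain K where K: "K > 0" and R1: "\<And>x. x \<in> \<Omega>0 \<Longrightarrow> norm (R1 x) \<le> K" and R2: "\<And>x. x \<in> \<Omega>0 \<Longrightarrow> norm (R2 x) \<le> K / P x $ 1"
    using R_bounds by blast
  obtain K1 where K1: "K1 \<ge> 0" "\<And>x. x \<in> \<Omega>0 \<Longrightarrow> \<bar>\<Sum>i<ns - 1. M i (P x $ 1) * bt (cs i) (P x $ 2)\<bar> \<le> K1"
    using near_pole_imp_bounded[OF M_bt_near_pole[of cs] bt_bounded[of "cs 0"]] by blast
  obtain K2 where K2: "K2 \<ge> 0" "\<And>x. x \<in> \<Omega>0 \<Longrightarrow> \<bar>\<Sum>i<ns. B i (P x $ 1) * mt (ct i) (P x $ 2)\<bar> \<le> K2 * P x $ 1"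
    using B_mt_near_pole[of ct] mt_zero_coefficients[OF assms] by auto
  have "norm (comb1 L F p ns s nt cs ct x) \<le> K1 * K + K2 * K" if x: "x \<in> \<Omega>0" for x
  proof -
    define a b where "a = (\<Sum>i<ns - 1. M i (P x $ 1) * bt (cs i) (P x $ 2))" and "b = (\<Sum>i<ns. B i (P x $ 1) * mt (ct i) (P x $ 2))"
    have s: "P x $ 1 > 0" using polar_coords_inner[OF x] by simp
    have "norm (comb1 L F p ns s nt cs ct x) \<le> \<bar>a\<bar> * norm (R1 x) + \<bar>b\<bar> * norm (R2 x)"
      unfolding comb1_eq[OF x] a_def[symmetric] b_def[symmetric] by (rule norm_triangle_le) simp
    also have "\<dots> \<le> K1 * K + (K2 * P x $ 1) * (K / P x $ 1)"
      using K1 K2 R1[OF x] R2[OF x] x s by (intro add_mono mult_mono) (auto simp: a_def b_def)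
    also have "(K2 * P x $ 1) * (K / P x $ 1) = K2 * K" using s by simp
    finally show ?thesis .
  qed
  then show ?thesis by blast
qed

lemma det_bounds:
  obtains K Dm where "K > 0" "Dm > 0" "\<forall>x\<in>\<Omega>0. P x $ 1 * Dm \<le> det (J (P x)) \<and> det (J (P x)) \<le> K * P x $ 1"
proof -
  obtain C S :: "real \<Rightarrow> real" and K Dm where "continuous_on UNIV C" "continuous_on UNIV S" "\<forall>t. C t \<noteq> 0 \<or> S t \<noteq> 0"
    and K: "K > 0" "Dm > 0" and bnd: "\<forall>z. 0 < z $ 1 \<and> z $ 1 < L \<and> 0 \<le> z $ 2 \<and> z $ 2 < 2 * pi \<longrightarrow>
       z $ 1 * Dm \<le> det (J z) \<and> det (J z) \<le> K * z $ 1 \<and>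
       \<bar>J z $ 1 $ 1\<bar> \<le> K \<and> \<bar>J z $ 2 $ 1\<bar> \<le> K \<and> \<bar>J z $ 1 $ 2\<bar> \<le> K * z $ 1 \<and> \<bar>J z $ 2 $ 2\<bar> \<le> K * z $ 1 \<and>
       \<bar>J z $ 1 $ 1 - C (z $ 2)\<bar> \<le> K * z $ 1 \<and> \<bar>J z $ 2 $ 1 - S (z $ 2)\<bar> \<le> K * z $ 1"
    by (rule jacobian_asymptotics)
  show thesis
  proof (rule that[OF K], rule ballI)
    fix x assume "x \<in> \<Omega>0"
    from polar_coords_inner[OF this] bnd show "P x $ 1 * Dm \<le> det (J (P x)) \<and> det (J (P x)) \<le> K * P x $ 1" by blast
  qed
qed

text \<open>The vanishing innermost row makes the numerator O(s), and the determinant is at least s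
  times \<open>Dm\<close>.\<close>

lemma comb2_bounded:
  assumes "\<forall>j<nt. c 0 j = 0"
  shows "\<exists>K. \<forall>x\<in>\<Omega>0. \<bar>comb2 L F p ns s nt c x\<bar> \<le> K"
proof -
  obtain K Dm where D: "K > 0" "Dm > 0" and b: "\<forall>x\<in>\<Omega>0. P x $ 1 * Dm \<le> det (J (P x)) \<and> det (J (P x)) \<le> K * P x $ 1"
    by (rule det_bounds)
  obtain K2 where K2: "K2 \<ge> 0" "\<And>x. x \<in> \<Omega>0 \<Longrightarrow> \<bar>\<Sum>i<ns - 1. M i (P x $ 1) * mt (c i) (P x $ 2)\<bar> \<le> K2 * P x $ 1"
    using M_mt_near_pole[of c] mt_zero_coefficients[OF assms] by auto
  have "\<bar>comb2 L F p ns s nt c x\<bar> \<le> K2 / Dm" if x: "x \<in> \<Omega>0" for x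
  proof -
    have s: "P x $ 1 > 0" using polar_coords_inner[OF x] by simp
    have "\<bar>comb2 L F p ns s nt c x\<bar> \<le> (K2 * P x $ 1) / (P x $ 1 * Dm)"
      unfolding comb2_eq abs_divide using K2 b x s D det_pos[OF x] by (intro frac_le) auto
    then show ?thesis using s by simp
  qed
  then show ?thesis by blast
qed

lemma comb_measurable:
  "comb0 L F p ns s nt c \<in> borel_measurable (restrict_space borel \<Omega>0)"
  "comb1 L F p ns s nt cs ct \<in> borel_measurable (restrict_space borel \<Omega>0)"
  "comb2 L F p ns s nt c \<in> borel_measurable (restrict_space borel \<Omega>0)"
proof -
  let ?N = "restrict_space borel \<Omega>0"
  have [measurable]: "(\<lambda>x. B i (P x $ 1)) \<in> borel_measurable ?N" "(\<lambda>x. M i (P x $ 1)) \<in> borel_measurable ?N"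
    "(\<lambda>x. bt e (P x $ 2)) \<in> borel_measurable ?N" "(\<lambda>x. mt e (P x $ 2)) \<in> borel_measurable ?N" for i e
    by (intro measurable_coordinate Bs_Ms_measurable bt_mt_measurable)+
  note [measurable] = measurable_R measurable_det
  show "comb0 L F p ns s nt c \<in> borel_measurable ?N" unfolding comb0_eq[abs_def] by measurable
  show "comb2 L F p ns s nt c \<in> borel_measurable ?N" unfolding comb2_eq[abs_def] by measurable
  have "R1 x = R1 x $ 1 *\<^sub>R axis 1 1 + R1 x $ 2 *\<^sub>R axis 2 1" "R2 x = R2 x $ 1 *\<^sub>R axis 1 1 + R2 x $ 2 *\<^sub>R axis 2 1" for x
    by (auto simp: vec_eq_iff forall_2 axis_def)
  moreover have "(\<lambda>x. R1 x $ 1 *\<^sub>R axis 1 1 + R1 x $ 2 *\<^sub>R axis 2 1 :: real^2) \<in> borel_measurable ?N"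
    "(\<lambda>x. R2 x $ 1 *\<^sub>R axis 1 1 + R2 x $ 2 *\<^sub>R axis 2 1 :: real^2) \<in> borel_measurable ?N" by measurable
  ultimately have [measurable]: "R1 \<in> borel_measurable ?N" "R2 \<in> borel_measurable ?N" by presburger+
  have "(\<lambda>x. (\<Sum>i<ns - 1. M i (P x $ 1) * bt (cs i) (P x $ 2)) *\<^sub>R R1 x +
     (\<Sum>i<ns. B i (P x $ 1) * mt (ct i) (P x $ 2)) *\<^sub>R R2 x) \<in> borel_measurable ?N" by measurable
  then show "comb1 L F p ns s nt cs ct \<in> borel_measurable ?N"
    by (rule measurable_cong[THEN iffD1, rotated]) (simp add: comb1_eq space_restrict_space)
qed

subsection \<open>Necessity of the pole conditions\<close>

text \<open>The sign \<epsilon> of f at t is carried along, so that a one-sided bound can express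
  that f keeps away from 0.\<close>

lemma isCont_sector:
  fixes f :: "real \<Rightarrow> real"
  assumes "isCont f t" "f t \<noteq> 0"
  obtains \<delta> c \<epsilon> where "\<delta> > 0" "c > 0" "\<bar>\<epsilon>\<bar> = 1" "\<forall>u. \<bar>u - t\<bar> < \<delta> \<longrightarrow> c \<le> \<epsilon> * f u"
proof -
  define c where "c = \<bar>f t\<bar> / 2"
  have c: "c > 0" using assms(2) by (simp add: c_def)
  obtain \<delta> where \<delta>: "\<delta> > 0" "\<And>u. dist u t < \<delta> \<Longrightarrow> dist (f u) (f t) < c"
    using assms(1) c unfolding continuous_at_eps_delta by blast
  have "c \<le> sgn (f t) * f u" if "\<bar>u - t\<bar> < \<delta>" for u
  proof -
    have "\<bar>f u - f t\<bar> < c" using \<delta>(2)[of u] that by (simp add: dist_real_def)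
    then have "f u - f t < c" "f t - f u < c" by linarith+
    then show ?thesis using assms(2) unfolding c_def by (auto simp: sgn_if)
  qed
  moreover have "\<bar>sgn (f t)\<bar> = 1" using assms(2) by (simp add: abs_sgn_eq)
  ultimately show thesis using that[of \<delta> c "sgn (f t)"] \<delta>(1) c by blast
qed

lemma mt_nonzero:
  assumes "\<not> (\<forall>j<nt. e j = 0)"
  obtains t where "0 < t" "t < 2 * pi" "mt e t \<noteq> 0" "isCont (mt e) t"
proof -
  obtain u where u: "u \<notin> knots" "mt e u \<noteq> 0"
    using Mt_independent[of e p] assms unfolding mt_def by blast
  define k where "k = - \<lfloor>u / (2 * pi)\<rfloor>"
  define t where "t = u + 2 * pi * of_int k"
  have "of_int (- k) \<le> u / (2 * pi)" "u / (2 * pi) < of_int (- k) + 1" unfolding k_def by linarith+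
  then have t: "0 \<le> t" "t < 2 * pi" by (simp_all add: t_def field_simps)
  have tk: "t \<notin> knots" using u(1) knots_shift[of u k] by (simp add: t_def)
  \<comment> \<open>Since 0 is a knot, a point of [0, 2 pi) that is not a knot lies in the open
    interval, as sectors around the ray require.\<close>
  have "0 \<in> knots" unfolding knots_def by (rule range_eqI[of _ _ 0]) simp
  then have "t \<noteq> 0" using tk by metis
  moreover have "mt e t \<noteq> 0" using u(2) by (simp add: t_def mt_shift)
  moreover have "isCont (mt e) t" unfolding mt_def[abs_def]
    by (intro isCont_sum ballI isCont_mult continuous_const isCont_Mt[OF tk])
  ultimately show thesis using that[of t] t by simp
qed

text \<open>What remains of square integrability when a function is explicit only off the pole and
  its weak counterpart is known only through test functions. It holds for \<open>w0\<close> itself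
  in L^2, and also for the classical derivative off the pole of a function whose weak derivative is
  in L^2.\<close>

definition dual_L2 :: "(real^2 \<Rightarrow> real) \<Rightarrow> bool" where
  "dual_L2 w0 \<longleftrightarrow> (\<exists>w\<in>L2 \<Omega>. \<forall>\<phi>\<in>test_functions \<Omega>. closure {x. \<phi> x \<noteq> 0} \<subseteq> \<Omega>0 \<longrightarrow>
     integrable lebesgue (\<lambda>x. w0 x * \<phi> x) \<and> (LINT x|lebesgue. w0 x * \<phi> x) = (LINT x|lebesgue_on \<Omega>. w x * \<phi> x))"

lemma L2_imp_dual_L2: "w \<in> L2 \<Omega> \<Longrightarrow> dual_L2 w"
  unfolding dual_L2_def using L2_mult_test_function[OF open_\<Omega>] by blast

lemma dual_L2_blow_up:
  assumes w0: "dual_L2 w0" and t: "0 < t" "t < 2 * pi" and pos: "\<delta> > 0" "\<epsilon> > 0" "c > 0" and e: "\<bar>e\<bar> = 1"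
    and low: "\<And>x. x \<in> \<Omega>0 \<Longrightarrow> P x $ 1 < \<epsilon> \<Longrightarrow> \<bar>P x $ 2 - t\<bar> < \<delta> \<Longrightarrow> c / P x $ 1 \<le> e * w0 x"
  shows False
proof -
  obtain \<kappa> \<sigma>0 where k: "\<kappa> > 0" "\<sigma>0 > 0" and
    disc: "\<forall>\<sigma>. 0 < \<sigma> \<and> \<sigma> < \<sigma>0 \<longrightarrow> ball (F (vector [\<sigma>, t])) (\<kappa> * \<sigma>) \<subseteq> \<Omega>0 \<and>
       (\<forall>x\<in>ball (F (vector [\<sigma>, t])) (\<kappa> * \<sigma>). P x $ 1 < \<epsilon> \<and> P x $ 1 \<le> 2 * \<sigma> \<and> \<bar>P x $ 2 - t\<bar> < \<delta>)"
    by (rule disc_in_sector[OF t pos(1,2)])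
  obtain w where w: "w \<in> L2 \<Omega>" and dual: "\<forall>\<phi>\<in>test_functions \<Omega>. closure {x. \<phi> x \<noteq> 0} \<subseteq> \<Omega>0 \<longrightarrow>
     integrable lebesgue (\<lambda>x. w0 x * \<phi> x) \<and> (LINT x|lebesgue. w0 x * \<phi> x) = (LINT x|lebesgue_on \<Omega>. w x * \<phi> x)"
    using w0 unfolding dual_L2_def by blast
  show False
  proof (rule not_L2_blow_up[OF open_\<Omega> w _ k e F_ray_tendsto[of t], where c = "c / 2" and ?w0.0 = w0])
    show "c / 2 > 0" using pos by simp
    show "ball (F (vector [\<sigma>, t])) (\<kappa> * \<sigma>) \<subseteq> \<Omega> - {x0}" if "0 < \<sigma>" "\<sigma> < \<sigma>0" for \<sigma>
      using disc that unfolding \<Omega>0_def by blast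
    show "c / 2 / \<sigma> \<le> e * w0 x" if \<sigma>: "0 < \<sigma>" "\<sigma> < \<sigma>0" and x: "x \<in> ball (F (vector [\<sigma>, t])) (\<kappa> * \<sigma>)" for \<sigma> x
    proof -
      have xO: "x \<in> \<Omega>0" and b: "P x $ 1 < \<epsilon>" "P x $ 1 \<le> 2 * \<sigma>" "\<bar>P x $ 2 - t\<bar> < \<delta>" using disc \<sigma> x by blast+
      \<comment> \<open>The disc reaches up to radius 2 \<sigma>, which costs the factor 1 /
        2.\<close>
      have "c / 2 / \<sigma> = c / (2 * \<sigma>)" by simp
      also have "\<dots> \<le> c / P x $ 1" using b(2) polar_coords_inner(1)[OF xO] pos by (intro divide_left_mono) auto
      also have "\<dots> \<le> e * w0 x" by (rule low[OF xO b(1,3)])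
      finally show ?thesis .
    qed
    show "integrable lebesgue (\<lambda>x. w0 x * \<phi> x) \<and> (LINT x|lebesgue. w0 x * \<phi> x) = (LINT x|lebesgue_on \<Omega>. w x * \<phi> x)"
      if "\<phi> \<in> test_functions \<Omega>" "closure {x. \<phi> x \<noteq> 0} \<subseteq> \<Omega> - {x0}" for \<phi>
      using dual that unfolding \<Omega>0_def by blast
  qed
qed

text \<open>If the innermost row is not 0, then \<open>mt (c 0)\<close> is bounded away from 0 in
  some sector. There the numerator stays away from 0 near the pole, while the determinant is at most
  K s, so the quotient grows like 1 / s.\<close>

lemma comb2_dual_L2:
  assumes "dual_L2 (comb2 L F p ns s nt c)"
  shows "\<forall>j<nt. c 0 j = 0"
proof (rule ccontr)
  assume "\<not> (\<forall>j<nt. c 0 j = 0)"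
  then obtain t where t: "0 < t" "t < 2 * pi" and nz: "mt (c 0) t \<noteq> 0" "isCont (mt (c 0)) t" by (rule mt_nonzero)
  obtain \<delta> c1 \<epsilon> where \<delta>: "\<delta> > 0" and c1: "c1 > 0" and \<epsilon>: "\<bar>\<epsilon>\<bar> = 1" and sec: "\<forall>u. \<bar>u - t\<bar> < \<delta> \<longrightarrow> c1 \<le> \<epsilon> * mt (c 0) u"
    by (rule isCont_sector[OF nz(2,1)])
  obtain K Dm where D: "K > 0" "Dm > 0" and b: "\<forall>x\<in>\<Omega>0. P x $ 1 * Dm \<le> det (J (P x)) \<and> det (J (P x)) \<le> K * P x $ 1"
    by (rule det_bounds)
  obtain K2 where K2: "K2 \<ge> 0" "\<And>x. x \<in> \<Omega>0 \<Longrightarrow> \<bar>(\<Sum>i<ns - 1. M i (P x $ 1) * mt (c i) (P x $ 2)) - M 0 0 * mt (c 0) (P x $ 2)\<bar> \<le> K2 * P x $ 1"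
    using M_mt_near_pole[of c] by blast
  define q where "q = M 0 0 * c1"
  have q: "q > 0" using Ms_0_pos c1 by (simp add: q_def)
  \<comment> \<open>Below this radius the error \<open>K2\<close> times s uses up at most half of
    the leading term; the added 1 keeps the denominator positive.\<close>
  define e0 where "e0 = q / 2 / (K2 + 1)"
  have e0: "e0 > 0" using q K2 by (simp add: e0_def)
  show False
  proof (rule dual_L2_blow_up[OF assms t \<delta> e0 _ \<epsilon>, of "q / (2 * K)"])
    show "q / (2 * K) > 0" using q D by simp
    fix x assume x: "x \<in> \<Omega>0" "P x $ 1 < e0" "\<bar>P x $ 2 - t\<bar> < \<delta>"
    define \<Sigma> where "\<Sigma> = (\<Sum>i<ns - 1. M i (P x $ 1) * mt (c i) (P x $ 2))"
    have s: "P x $ 1 > 0" using polar_coords_inner[OF x(1)] by simp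
    have "K2 + 1 \<noteq> 0" using K2(1) by linarith
    then have e0_eq: "(K2 + 1) * e0 = q / 2" unfolding e0_def by (metis nonzero_mult_div_cancel_left times_divide_eq_right)
    have "K2 * P x $ 1 \<le> (K2 + 1) * e0" using x(2) K2(1) s by (intro mult_mono) auto
    also note e0_eq
    finally have small: "K2 * P x $ 1 \<le> q / 2" .
    have "q \<le> M 0 0 * (\<epsilon> * mt (c 0) (P x $ 2))"
      unfolding q_def using sec x(3) Ms_0_pos by (intro mult_left_mono) auto
    moreover have "\<bar>\<epsilon> * (\<Sigma> - M 0 0 * mt (c 0) (P x $ 2))\<bar> \<le> q / 2"
      using K2(2)[OF x(1)] small \<epsilon> unfolding abs_mult \<Sigma>_def by simp
    moreover have "\<epsilon> * (\<Sigma> - M 0 0 * mt (c 0) (P x $ 2)) = \<epsilon> * \<Sigma> - M 0 0 * (\<epsilon> * mt (c 0) (P x $ 2))"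
      by (simp add: algebra_simps)
    ultimately have low: "q / 2 \<le> \<epsilon> * \<Sigma>" by linarith
    have "q / (2 * K) / P x $ 1 = (q / 2) / (K * P x $ 1)" by simp
    also have "\<dots> \<le> (\<epsilon> * \<Sigma>) / det (J (P x))"
      using low b x(1) q det_pos[OF x(1)] by (intro frac_le) auto
    finally show "q / (2 * K) / P x $ 1 \<le> \<epsilon> * comb2 L F p ns s nt c x"
      unfolding comb2_eq \<Sigma>_def by simp
  qed
qed

text \<open>Where \<open>mt (ct 0)\<close> does not vanish, the \<open>R2\<close> part is of order 1
  / s and dominates the bounded \<open>R1\<close> part. Since \<open>R2\<close> is a vector, one
  first needs a component that does not degenerate along the ray.\<close>

lemma comb1_dual_L2:
  assumes "\<And>k. dual_L2 (\<lambda>x. comb1 L F p ns s nt cs ct x $ k)"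
  shows "\<forall>j<nt. ct 0 j = 0"
proof (rule ccontr)
  assume "\<not> (\<forall>j<nt. ct 0 j = 0)"
  then obtain t where t: "0 < t" "t < 2 * pi" and nz: "mt (ct 0) t \<noteq> 0" "isCont (mt (ct 0)) t" by (rule mt_nonzero)
  obtain \<delta>1 c1 \<epsilon> where \<delta>1: "\<delta>1 > 0" and c1: "c1 > 0" and \<epsilon>: "\<bar>\<epsilon>\<bar> = 1" and sec1: "\<forall>u. \<bar>u - t\<bar> < \<delta>1 \<longrightarrow> c1 \<le> \<epsilon> * mt (ct 0) u"
    by (rule isCont_sector[OF nz(2,1)])
  obtain C S :: "real \<Rightarrow> real" and K Dm where CS: "continuous_on UNIV C" "continuous_on UNIV S" "\<forall>t. C t \<noteq> 0 \<or> S t \<noteq> 0"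
    and K: "K > 0" "Dm > 0" and bnd: "\<forall>z. 0 < z $ 1 \<and> z $ 1 < L \<and> 0 \<le> z $ 2 \<and> z $ 2 < 2 * pi \<longrightarrow>
       z $ 1 * Dm \<le> det (J z) \<and> det (J z) \<le> K * z $ 1 \<and>
       \<bar>J z $ 1 $ 1\<bar> \<le> K \<and> \<bar>J z $ 2 $ 1\<bar> \<le> K \<and> \<bar>J z $ 1 $ 2\<bar> \<le> K * z $ 1 \<and> \<bar>J z $ 2 $ 2\<bar> \<le> K * z $ 1 \<and>
       \<bar>J z $ 1 $ 1 - C (z $ 2)\<bar> \<le> K * z $ 1 \<and> \<bar>J z $ 2 $ 1 - S (z $ 2)\<bar> \<le> K * z $ 1"
    by (rule jacobian_asymptotics)
  \<comment> \<open>The determinant times \<open>R2\<close> is (- J21, J11), which tends to (- S, C)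
    at the pole. As \<open>C\<close> and \<open>S\<close> do not vanish together, \<open>k\<close>
    selects a component whose limit \<open>l\<close> is not 0 at t.\<close>
  define k :: 2 where "k = (if C t \<noteq> 0 then 2 else 1)"
  define l where "l = (if C t \<noteq> 0 then C else (\<lambda>u. - S u))"
  have lt: "l t \<noteq> 0" using CS(3) by (auto simp: l_def)
  have "continuous_on UNIV l" using CS(1,2) by (auto simp: l_def intro: continuous_intros)
  then have lc: "isCont l t" by (simp add: continuous_on_eq_continuous_at)
  obtain \<delta>2 c2 \<eta> where \<delta>2: "\<delta>2 > 0" and c2: "c2 > 0" and \<eta>: "\<bar>\<eta>\<bar> = 1" and sec2: "\<forall>u. \<bar>u - t\<bar> < \<delta>2 \<longrightarrow> c2 \<le> \<eta> * l u"
    by (rule isCont_sector[OF lc lt])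
  have R2k: "\<bar>det (J (P x)) * R2 x $ k\<bar> \<le> K \<and> \<bar>det (J (P x)) * R2 x $ k - l (P x $ 2)\<bar> \<le> K * P x $ 1" if x: "x \<in> \<Omega>0" for x
  proof -
    have b: "\<bar>J (P x) $ 1 $ 1\<bar> \<le> K" "\<bar>J (P x) $ 2 $ 1\<bar> \<le> K" "\<bar>J (P x) $ 1 $ 1 - C (P x $ 2)\<bar> \<le> K * P x $ 1" "\<bar>J (P x) $ 2 $ 1 - S (P x $ 2)\<bar> \<le> K * P x $ 1"
      using bnd polar_coords_inner[OF x] by blast+
    have d: "det (J (P x)) \<noteq> 0" using det_pos[OF x] by simp
    show ?thesis
    proof (cases "C t \<noteq> 0")
      case True
      have "det (J (P x)) * R2 x $ 2 = J (P x) $ 1 $ 1" using d by (simp add: R2_def)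
      then show ?thesis using True b by (simp add: k_def l_def)
    next
      case False
      have "det (J (P x)) * R2 x $ 1 = - J (P x) $ 2 $ 1" using d by (simp add: R2_def)
      then show ?thesis using False b by (simp add: k_def l_def abs_minus_commute)
    qed
  qed
  obtain KR where KR: "KR > 0" "\<And>x. x \<in> \<Omega>0 \<Longrightarrow> norm (R1 x) \<le> KR" "\<And>x. x \<in> \<Omega>0 \<Longrightarrow> norm (R2 x) \<le> KR / P x $ 1"
    using R_bounds by blast
  obtain Ka where Ka: "Ka \<ge> 0" "\<And>x. x \<in> \<Omega>0 \<Longrightarrow> \<bar>\<Sum>i<ns - 1. M i (P x $ 1) * bt (cs i) (P x $ 2)\<bar> \<le> Ka"
    using near_pole_imp_bounded[OF M_bt_near_pole[of cs] bt_bounded[of "cs 0"]] by blast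
  obtain K1 where K1: "K1 \<ge> 0" "\<And>x. x \<in> \<Omega>0 \<Longrightarrow> \<bar>(\<Sum>i<ns. B i (P x $ 1) * mt (ct i) (P x $ 2)) - mt (ct 0) (P x $ 2)\<bar> \<le> K1 * P x $ 1"
    using B_mt_near_pole[of ct] unfolding mult_1 by blast
  obtain K2 where K2: "K2 \<ge> 0" "\<And>u. 0 \<le> u \<Longrightarrow> u \<le> 2 * pi \<Longrightarrow> \<bar>mt (ct 0) u\<bar> \<le> K2" using mt_bounded[of "ct 0"] by blast
  \<comment> \<open>The error of \<open>b * m\<close> against \<open>b0 * l0\<close>, per unit of s:
    \<open>K1 * K\<close> for replacing b by b0 and \<open>K2 * K\<close> for replacing m by
    l0.\<close>
  define K3 where "K3 = K1 * K + K2 * K"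
  define A1 where "A1 = Ka * KR"
  \<comment> \<open>Half of \<open>c1 * c2\<close> is left after that error, and the determinant is
    at most K s, so the \<open>R2\<close> part is at least q / s for s < e1. For s < e2 the
    \<open>R1\<close> part takes away at most half of this.\<close>
  define q where "q = c1 * c2 / (2 * K)"
  have nn: "K3 \<ge> 0" "A1 \<ge> 0" "q > 0" using K K1 K2 Ka KR c1 c2 by (auto simp: K3_def A1_def q_def)
  define e1 where "e1 = c1 * c2 / 2 / (K3 + 1)"
  define e2 where "e2 = q / 2 / (A1 + 1)"
  have ne: "K3 + 1 \<noteq> 0" "A1 + 1 \<noteq> 0" using nn by linarith+
  have e: "e1 > 0" "e2 > 0" using nn c1 c2 by (auto simp: e1_def e2_def)
  show False
  proof (rule dual_L2_blow_up[OF assms[of k] t, of "min \<delta>1 \<delta>2" "min e1 e2" "q / 2" "\<epsilon> * \<eta>"])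
    show "min \<delta>1 \<delta>2 > 0" "min e1 e2 > 0" "q / 2 > 0" using \<delta>1 \<delta>2 e nn by auto
    show "\<bar>\<epsilon> * \<eta>\<bar> = 1" using \<epsilon> \<eta> by (simp add: abs_mult)
    fix x assume x: "x \<in> \<Omega>0" "P x $ 1 < min e1 e2" "\<bar>P x $ 2 - t\<bar> < min \<delta>1 \<delta>2"
    define a b where "a = (\<Sum>i<ns - 1. M i (P x $ 1) * bt (cs i) (P x $ 2))" and "b = (\<Sum>i<ns. B i (P x $ 1) * mt (ct i) (P x $ 2))"
    define d where "d = det (J (P x))"
    define m where "m = d * R2 x $ k"
    define b0 l0 \<sigma> where "b0 = mt (ct 0) (P x $ 2)" and "l0 = l (P x $ 2)" and "\<sigma> = P x $ 1"
    note pc = polar_coords_inner[OF x(1)]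
    have \<sigma>: "\<sigma> > 0" "\<sigma> < e1" "\<sigma> < e2" using pc x(2) by (auto simp: \<sigma>_def)
    have d: "d > 0" "d \<le> K * \<sigma>" using det_pos[OF x(1)] bnd pc by (auto simp: d_def \<sigma>_def)
    have m: "\<bar>m\<bar> \<le> K" "\<bar>m - l0\<bar> \<le> K * \<sigma>" using R2k[OF x(1)] by (auto simp: m_def d_def l0_def \<sigma>_def)
    have bb: "\<bar>b - b0\<bar> \<le> K1 * \<sigma>" "\<bar>b0\<bar> \<le> K2" using K1(2)[OF x(1)] K2(2) pc by (auto simp: b_def b0_def \<sigma>_def)
    have "\<bar>b * m - b0 * l0\<bar> = \<bar>(b - b0) * m + b0 * (m - l0)\<bar>" by (simp add: algebra_simps)
    also have "\<dots> \<le> \<bar>b - b0\<bar> * \<bar>m\<bar> + \<bar>b0\<bar> * \<bar>m - l0\<bar>" by (metis abs_mult abs_triangle_ineq)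
    also have "\<dots> \<le> (K1 * \<sigma>) * K + K2 * (K * \<sigma>)" using m bb K1 K2 K \<sigma> by (intro add_mono mult_mono) auto
    also have "\<dots> = K3 * \<sigma>" by (simp add: K3_def algebra_simps)
    also have "\<dots> \<le> (K3 + 1) * e1" using nn \<sigma> by (intro mult_mono) auto
    also have "\<dots> = c1 * c2 / 2" unfolding e1_def using ne(1) by (metis nonzero_mult_div_cancel_left times_divide_eq_right)
    finally have err: "\<bar>b * m - b0 * l0\<bar> \<le> c1 * c2 / 2" .
    have "c1 * c2 \<le> (\<epsilon> * b0) * (\<eta> * l0)"
      using sec1 sec2 x(3) c1 c2 by (intro mult_mono) (auto simp: b0_def l0_def intro: order_trans less_imp_le)
    moreover have "\<bar>(\<epsilon> * \<eta>) * (b * m - b0 * l0)\<bar> \<le> c1 * c2 / 2" using err \<epsilon> \<eta> by (simp add: abs_mult)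
    moreover have "(\<epsilon> * \<eta>) * (b * m - b0 * l0) = (\<epsilon> * \<eta>) * (b * m) - (\<epsilon> * b0) * (\<eta> * l0)" by (simp add: algebra_simps)
    ultimately have bm: "c1 * c2 / 2 \<le> (\<epsilon> * \<eta>) * (b * m)" by linarith
    have "q / \<sigma> = (c1 * c2 / 2) / (K * \<sigma>)" by (simp add: q_def)
    also have "\<dots> \<le> ((\<epsilon> * \<eta>) * (b * m)) / d"
    proof (rule frac_le[OF _ bm d])
      have "0 < c1 * c2" using c1 c2 by simp
      then show "0 \<le> (\<epsilon> * \<eta>) * (b * m)" using bm by linarith
    qed
    also have "\<dots> = (\<epsilon> * \<eta>) * (b * R2 x $ k)" using d by (simp add: m_def)
    finally have main: "q / \<sigma> \<le> (\<epsilon> * \<eta>) * (b * R2 x $ k)" .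
    have "\<bar>(\<epsilon> * \<eta>) * (a * R1 x $ k)\<bar> = \<bar>a\<bar> * \<bar>R1 x $ k\<bar>" using \<epsilon> \<eta> by (simp add: abs_mult)
    also have "\<dots> \<le> Ka * KR"
      using Ka(2)[OF x(1)] Ka(1) KR(2)[OF x(1)] component_le_norm_cart[of "R1 x" k] by (intro mult_mono) (auto simp: a_def)
    finally have rest: "\<bar>(\<epsilon> * \<eta>) * (a * R1 x $ k)\<bar> \<le> A1" by (simp add: A1_def)
    have "A1 * \<sigma> \<le> (A1 + 1) * e2" using nn \<sigma> by (intro mult_mono) auto
    also have "\<dots> = q / 2" unfolding e2_def using ne(2) by (metis nonzero_mult_div_cancel_left times_divide_eq_right)
    finally have "A1 \<le> q / 2 / \<sigma>" using \<sigma> by (simp add: field_simps)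
    moreover have "q / \<sigma> = q / 2 / \<sigma> + q / 2 / \<sigma>" by simp
    moreover have "\<epsilon> * \<eta> * comb1 L F p ns s nt cs ct x $ k = (\<epsilon> * \<eta>) * (a * R1 x $ k) + (\<epsilon> * \<eta>) * (b * R2 x $ k)"
      unfolding comb1_eq[OF x(1)] a_def[symmetric] b_def[symmetric] by (simp add: distrib_left)
    ultimately show "q / 2 / P x $ 1 \<le> \<epsilon> * \<eta> * comb1 L F p ns s nt cs ct x $ k"
      using main rest unfolding \<sigma>_def by linarith
  qed
qed

subsection \<open>Characterisation of the conforming spaces\<close>

text \<open>A test function supported off the pole is admissible there, so the explicit divergence
  off the pole and the weak one on \<Omega> meet the same test functions.\<close>

lemma weak_div_dual:
  assumes "weak_div \<Omega>0 V w0" "w \<in> L2 \<Omega>"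
    and "\<And>\<phi>. \<phi> \<in> test_functions \<Omega> \<Longrightarrow>
      (LINT x|lebesgue_on \<Omega>. V x $ 1 * partial 1 \<phi> x + V x $ 2 * partial 2 \<phi> x) = - (LINT x|lebesgue_on \<Omega>. w x * \<phi> x)"
  shows "dual_L2 w0"
  unfolding dual_L2_def
proof (intro bexI[OF _ assms(2)] ballI impI)
  fix \<phi> assume \<phi>: "\<phi> \<in> test_functions \<Omega>" and supp: "closure {x. \<phi> x \<noteq> 0} \<subseteq> \<Omega>0"
  have adm: "admissible \<Omega>0 \<phi>" by (rule test_function_admissible[OF \<phi> supp])
  obtain K where K: "compact K" "K \<subseteq> \<Omega>0" "\<And>x. x \<notin> K \<Longrightarrow> \<phi> x = 0" using adm unfolding admissible_def by blast
  have "(LINT x|lebesgue_on \<Omega>. V x $ 1 * partial 1 \<phi> x + V x $ 2 * partial 2 \<phi> x)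
      = (LINT x|lebesgue. V x $ 1 * partial 1 \<phi> x + V x $ 2 * partial 2 \<phi> x)"
  proof (rule integral_lebesgue_on_supported[OF open_\<Omega>])
    fix x assume "x \<notin> \<Omega>"
    then have "x \<notin> K" using K(2) by (auto simp: \<Omega>0_def)
    then show "V x $ 1 * partial 1 \<phi> x + V x $ 2 * partial 2 \<phi> x = 0"
      using partial_zero_outside[OF K(1,3)] by simp
  qed
  then show "integrable lebesgue (\<lambda>x. w0 x * \<phi> x) \<and> (LINT x|lebesgue. w0 x * \<phi> x) = (LINT x|lebesgue_on \<Omega>. w x * \<phi> x)"
    using assms(1,3) \<phi> adm unfolding weak_div_def by simp
qed

lemma axis_gradient: "axis k (u::real) $ 1 * (f::2 \<Rightarrow> real) 1 + axis k u $ 2 * f 2 = u * f k"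
  using exhaust_2[of k] by (auto simp: axis_def)

lemma L2_bounded_off_pole:
  fixes f :: "real^2 \<Rightarrow> 'b::euclidean_space"
  assumes "f \<in> borel_measurable (restrict_space borel \<Omega>0)" "\<And>x. x \<in> \<Omega>0 \<Longrightarrow> norm (f x) \<le> K"
  shows "f \<in> L2 \<Omega>"
  by (rule L2_bounded[OF open_\<Omega> bounded_\<Omega> measurable_lebesgue_indicator[OF assms(1)], where B = K])
    (simp add: assms(2) \<Omega>0_def)

lemma L2_comb:
  shows "(\<And>x. x \<in> \<Omega>0 \<Longrightarrow> \<bar>comb0 L F p ns s nt c x\<bar> \<le> K) \<Longrightarrow> comb0 L F p ns s nt c \<in> L2 \<Omega>"
    and "(\<And>x. x \<in> \<Omega>0 \<Longrightarrow> norm (comb1 L F p ns s nt cs ct x) \<le> K) \<Longrightarrow> comb1 L F p ns s nt cs ct \<in> L2 \<Omega>"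
    and "(\<And>x. x \<in> \<Omega>0 \<Longrightarrow> \<bar>comb2 L F p ns s nt c x\<bar> \<le> K) \<Longrightarrow> comb2 L F p ns s nt c \<in> L2 \<Omega>"
  by (erule L2_bounded_off_pole[OF comb_measurable(1), unfolded real_norm_def]
      L2_bounded_off_pole[OF comb_measurable(2)]
      L2_bounded_off_pole[OF comb_measurable(3), unfolded real_norm_def])+

lemma component_measurable:
  fixes f :: "real^2 \<Rightarrow> real^2"
  assumes "f \<in> borel_measurable (restrict_space borel \<Omega>0)"
  shows "(\<lambda>x. f x $ k) \<in> borel_measurable (restrict_space borel \<Omega>0)"
  using assms by (rule measurable_compose) (intro borel_measurable_continuous_onI continuous_intros)

text \<open>Necessity is the field case applied to the gradient, whose innermost angular row is
  \<open>cyc_diff (c 0)\<close>. For sufficiency, function and gradient are bounded off the pole, so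
  that the point can be removed.\<close>

lemma comb0_in_H1_iff:
  "comb0 L F p ns s nt c \<in> H1 \<Omega> \<longleftrightarrow> (\<forall>j<nt. cyc_diff (c 0) j = 0)"
proof
  let ?u = "comb0 L F p ns s nt c" and ?v = "comb1 L F p ns s nt (\<lambda>i j. c (i + 1) j - c i j) (\<lambda>i. cyc_diff (c i))"
  have lip: "lip_ae_diff \<Omega>0 ?u" and grad: "AE x in lebesgue. x \<in> \<Omega>0 \<longrightarrow> (\<forall>k. partial k ?u x = ?v x $ k)"
    using comb0_grad[of c] by (auto simp: grad_ae_def)
  have wd: "weak_div \<Omega>0 (\<lambda>x. axis k (?u x)) (\<lambda>x. ?v x $ k)" for k
  proof (rule weak_div_cong_AE[OF weak_div_grad[OF open_\<Omega>0 lip]])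
    show "AE x in lebesgue. x \<in> \<Omega>0 \<longrightarrow> partial k ?u x = ?v x $ k" using grad by eventually_elim auto
  qed simp
  show "\<forall>j<nt. cyc_diff (c 0) j = 0" if H: "?u \<in> H1 \<Omega>"
  proof (rule comb1_dual_L2)
    fix k
    obtain g where g: "g \<in> L2 \<Omega>" "weak_partial \<Omega> k ?u g" using H unfolding H1_def by blast
    show "dual_L2 (\<lambda>x. ?v x $ k)"
    proof (rule weak_div_dual[OF wd g(1)])
      fix \<phi> assume "\<phi> \<in> test_functions \<Omega>"
      then show "(LINT x|lebesgue_on \<Omega>. axis k (?u x) $ 1 * partial 1 \<phi> x + axis k (?u x) $ 2 * partial 2 \<phi> x) = - (LINT x|lebesgue_on \<Omega>. g x * \<phi> x)"
        using g(2) unfolding weak_partial_def axis_gradient[of k _ "\<lambda>k. partial k \<phi> x" for x] by blast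
    qed
  qed
  assume c: "\<forall>j<nt. cyc_diff (c 0) j = 0"
  obtain K0 where K0: "\<And>x. x \<in> \<Omega>0 \<Longrightarrow> \<bar>?u x\<bar> \<le> K0" using comb0_bounded[of c] by blast
  obtain K1 where K1: "\<And>x. x \<in> \<Omega>0 \<Longrightarrow> norm (?v x) \<le> K1"
    using comb1_bounded[of "\<lambda>i. cyc_diff (c i)"] c by blast
  define K where "K = max K0 K1"
  have K: "\<bar>?u x\<bar> \<le> K" "norm (?v x) \<le> K" if "x \<in> \<Omega>0" for x using K0[OF that] K1[OF that] by (auto simp: K_def)
  show "?u \<in> H1 \<Omega>" unfolding H1_def
  proof (intro CollectI conjI allI)
    show "?u \<in> L2 \<Omega>" by (rule L2_comb(1)[OF K(1)])
    fix k
    have vL2: "(\<lambda>x. ?v x $ k) \<in> L2 \<Omega>" by (rule L2_component[OF L2_comb(2)[OF K(2)]])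
    have "weak_partial \<Omega> k ?u (\<lambda>x. ?v x $ k)" unfolding weak_partial_def
    proof
      fix \<phi> assume \<phi>: "\<phi> \<in> test_functions \<Omega>"
      have "(LINT x|lebesgue_on \<Omega>. axis k (?u x) $ 1 * partial 1 \<phi> x + axis k (?u x) $ 2 * partial 2 \<phi> x) = - (LINT x|lebesgue_on \<Omega>. ?v x $ k * \<phi> x)"
      proof (rule weak_div_remove_point[OF open_\<Omega> wd[unfolded \<Omega>0_def] _ _ _ _ \<phi>])
        have ax: "axis k (?u x) = ?u x *\<^sub>R axis k 1" for x by (simp add: vec_eq_iff axis_def)
        have "(\<lambda>x. ?u x *\<^sub>R axis k 1 :: real^2) \<in> borel_measurable (restrict_space borel \<Omega>0)"
          by (intro borel_measurable_scaleR comb_measurable) simp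
        then show "(\<lambda>x. indicator (\<Omega> - {x0}) x *\<^sub>R axis k (?u x)) \<in> borel_measurable lebesgue"
          unfolding ax by (intro measurable_lebesgue_indicator) simp
        show "(\<lambda>x. indicator (\<Omega> - {x0}) x *\<^sub>R ?v x $ k) \<in> borel_measurable lebesgue"
          by (intro measurable_lebesgue_indicator component_measurable comb_measurable)
        show "norm (axis k (?u x)) \<le> K" if "x \<in> \<Omega> - {x0}" for x
          using K(1)[of x] that by (simp add: \<Omega>0_def ax)
        show "\<bar>?v x $ k\<bar> \<le> K" if "x \<in> \<Omega> - {x0}" for x
          using K(2)[of x] that component_le_norm_cart[of "?v x" k] by (simp add: \<Omega>0_def)
      qed
      then show "(LINT x|lebesgue_on \<Omega>. ?u x * partial k \<phi> x) = - (LINT x|lebesgue_on \<Omega>. ?v x $ k * \<phi> x)"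
        unfolding axis_gradient[of k _ "\<lambda>k. partial k \<phi> x" for x] .
    qed
    then show "\<exists>g\<in>L2 \<Omega>. weak_partial \<Omega> k ?u g" using vL2 by blast
  qed
qed

lemma comb2_in_L2_iff:
  "comb2 L F p ns s nt c \<in> L2 \<Omega> \<longleftrightarrow> (\<forall>j<nt. c 0 j = 0)"
proof
  show "comb2 L F p ns s nt c \<in> L2 \<Omega> \<Longrightarrow> \<forall>j<nt. c 0 j = 0"
    by (rule comb2_dual_L2[OF L2_imp_dual_L2])
  assume "\<forall>j<nt. c 0 j = 0"
  then obtain K where "\<And>x. x \<in> \<Omega>0 \<Longrightarrow> \<bar>comb2 L F p ns s nt c x\<bar> \<le> K" using comb2_bounded by blast
  then show "comb2 L F p ns s nt c \<in> L2 \<Omega>" by (rule L2_comb(3))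
qed

lemma rot_integrand: "rot v $ 1 * a + rot v $ 2 * b = v $ 2 * a - v $ 1 * b"
  by (simp add: rot_def)

text \<open>Square integrability of the field alone gives the first condition. The curl off the pole
  is an explicit \<open>comb2\<close>, which the weak curl forces through duality to satisfy the
  condition for L^2.\<close>

lemma comb1_in_Hcurl_iff:
  "comb1 L F p ns s nt cs ct \<in> Hcurl \<Omega> \<longleftrightarrow> (\<forall>j<nt. ct 0 j = 0 \<and> curl_coeff cs ct 0 j = 0)"
proof
  let ?v = "comb1 L F p ns s nt cs ct" and ?w = "comb2 L F p ns s nt (curl_coeff cs ct)"
  assume "?v \<in> Hcurl \<Omega>"
  then obtain w where v: "?v \<in> L2 \<Omega>" and w: "w \<in> L2 \<Omega>" "weak_curl \<Omega> ?v w" unfolding Hcurl_def by blast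
  have "\<forall>j<nt. ct 0 j = 0"
    by (rule comb1_dual_L2, rule L2_imp_dual_L2, rule L2_component[OF v])
  moreover have "dual_L2 ?w"
  proof (rule weak_div_dual[OF comb1_curl w(1)])
    fix \<phi> assume "\<phi> \<in> test_functions \<Omega>"
    then have "- (LINT x|lebesgue_on \<Omega>. ?v x $ 2 * partial 1 \<phi> x - ?v x $ 1 * partial 2 \<phi> x) = (LINT x|lebesgue_on \<Omega>. w x * \<phi> x)"
      using w(2) unfolding weak_curl_def by blast
    then show "(LINT x|lebesgue_on \<Omega>. rot (?v x) $ 1 * partial 1 \<phi> x + rot (?v x) $ 2 * partial 2 \<phi> x) = - (LINT x|lebesgue_on \<Omega>. w x * \<phi> x)"
      unfolding rot_integrand by linarith
  qed
  ultimately show "\<forall>j<nt. ct 0 j = 0 \<and> curl_coeff cs ct 0 j = 0" using comb2_dual_L2 by blast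
next
  let ?v = "comb1 L F p ns s nt cs ct" and ?w = "comb2 L F p ns s nt (curl_coeff cs ct)"
  assume c: "\<forall>j<nt. ct 0 j = 0 \<and> curl_coeff cs ct 0 j = 0"
  obtain K1 where K1: "\<And>x. x \<in> \<Omega>0 \<Longrightarrow> norm (?v x) \<le> K1" using comb1_bounded[of ct cs] c by blast
  obtain K2 where K2: "\<And>x. x \<in> \<Omega>0 \<Longrightarrow> \<bar>?w x\<bar> \<le> K2" using comb2_bounded[of "curl_coeff cs ct"] c by blast
  define K where "K = max (2 * K1) K2"
  have rotn: "norm (rot v) \<le> 2 * norm v" for v
    using norm_le_l1_cart[of "rot v"] component_le_norm_cart[of v 1] component_le_norm_cart[of v 2]
    by (simp add: sum_2 rot_def)
  have "weak_curl \<Omega> ?v ?w" unfolding weak_curl_def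
  proof
    fix \<phi> assume \<phi>: "\<phi> \<in> test_functions \<Omega>"
    have "(LINT x|lebesgue_on \<Omega>. rot (?v x) $ 1 * partial 1 \<phi> x + rot (?v x) $ 2 * partial 2 \<phi> x) = - (LINT x|lebesgue_on \<Omega>. ?w x * \<phi> x)"
    proof (rule weak_div_remove_point[OF open_\<Omega> comb1_curl[unfolded \<Omega>0_def] _ _ _ _ \<phi>])
      have "rot v = v $ 2 *\<^sub>R axis 1 1 + (- v $ 1) *\<^sub>R axis 2 1" for v by (auto simp: rot_def vec_eq_iff forall_2 axis_def)
      moreover have "(\<lambda>x. ?v x $ 2 *\<^sub>R axis 1 1 + (- ?v x $ 1) *\<^sub>R axis 2 1 :: real^2) \<in> borel_measurable (restrict_space borel \<Omega>0)"
        using component_measurable[OF comb_measurable(2), of cs ct 1] component_measurable[OF comb_measurable(2), of cs ct 2]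
        by measurable
      ultimately show "(\<lambda>x. indicator (\<Omega> - {x0}) x *\<^sub>R rot (?v x)) \<in> borel_measurable lebesgue"
        by (intro measurable_lebesgue_indicator) simp
      show "(\<lambda>x. indicator (\<Omega> - {x0}) x *\<^sub>R ?w x) \<in> borel_measurable lebesgue"
        by (intro measurable_lebesgue_indicator comb_measurable)
      show "norm (rot (?v x)) \<le> K" if "x \<in> \<Omega> - {x0}" for x
        using K1[of x] rotn[of "?v x"] that by (simp add: \<Omega>0_def K_def)
      show "\<bar>?w x\<bar> \<le> K" if "x \<in> \<Omega> - {x0}" for x using K2[of x] that by (simp add: \<Omega>0_def K_def)
    qed
    then show "- (LINT x|lebesgue_on \<Omega>. ?v x $ 2 * partial 1 \<phi> x - ?v x $ 1 * partial 2 \<phi> x) = (LINT x|lebesgue_on \<Omega>. ?w x * \<phi> x)"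
      unfolding rot_integrand by linarith
  qed
  then show "?v \<in> Hcurl \<Omega>" unfolding Hcurl_def using L2_comb(2)[OF K1] L2_comb(3)[OF K2] by blast
qed

section \<open>Continuity at the pole\<close>

lemma comb0_continuous: "continuous_on \<Omega>0 (comb0 L F p ns s nt c)"
  using comb0_grad[of c] loc_lip_continuous_on by (auto simp: grad_ae_def lip_ae_diff_def)

text \<open>A constant innermost row makes \<open>bt (c 0)\<close> constant by the partition of
  unity, so the limit at the pole is the same in all directions, with deviation O(s). The
  combination has an unspecified value at the pole itself and is redefined there.\<close>

lemma comb0_continuous_representative:
  assumes "\<forall>j<nt. c 0 j = \<gamma>"
  shows "\<exists>g. continuous_representative \<Omega> (comb0 L F p ns s nt c) g \<and> g x0 = \<gamma>"
proof -
  let ?u = "comb0 L F p ns s nt c"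
  define g where "g x = (if x = x0 then \<gamma> else ?u x)" for x
  obtain K where K: "K \<ge> 0" "\<And>x. x \<in> \<Omega>0 \<Longrightarrow> \<bar>?u x - \<gamma>\<bar> \<le> K * P x $ 1"
    using B_bt_near_pole[of c] bt_const_coefficients[OF assms] unfolding comb0_eq by auto
  have c0: "continuous_on \<Omega>0 g"
    using comb0_continuous by (rule continuous_on_eq) (simp add: g_def \<Omega>0_def)
  have "isCont g x" if x: "x \<in> \<Omega>" for x
  proof (cases "x = x0")
    case False
    then have "x \<in> \<Omega>0" using x by (simp add: \<Omega>0_def)
    then show ?thesis using c0 open_\<Omega>0 continuous_on_eq_continuous_at by blast
  next
    case True
    show ?thesis unfolding True continuous_at_eps_delta
    proof (intro allI impI)
      fix e :: real assume e: "e > 0"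
      define e' where "e' = e / (K + 1)"
      have e': "e' > 0" using e K by (simp add: e'_def)
      obtain d where d: "d > 0" "\<forall>x\<in>\<Omega>0. dist x x0 < d \<longrightarrow> P x $ 1 < e'" using radius_tendsto_0[OF e'] by blast
      obtain r where r: "r > 0" "ball x0 r \<subseteq> \<Omega>" using open_\<Omega> x0_in open_contains_ball by blast
      have "dist (g y) (g x0) < e" if y: "dist y x0 < min d r" for y
      proof (cases "y = x0")
        case True
        then show ?thesis using e by simp
      next
        case False
        have "y \<in> \<Omega>" using r(2) y by (auto simp: dist_commute)
        then have yO: "y \<in> \<Omega>0" using False by (simp add: \<Omega>0_def)
        have s: "0 < P y $ 1" "P y $ 1 < e'" using polar_coords_inner(1)[OF yO] d(2) yO y by auto
        have "\<bar>?u y - \<gamma>\<bar> \<le> K * P y $ 1" by (rule K(2)[OF yO])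
        also have "\<dots> \<le> K * e'" using K(1) s by (intro mult_left_mono) auto
        also have "\<dots> < (K + 1) * e'" using e' by simp
        also have "\<dots> = e" using K(1) by (simp add: e'_def)
        finally show ?thesis using False by (simp add: g_def dist_real_def)
      qed
      then show "\<exists>d>0. \<forall>x'. dist x' x0 < d \<longrightarrow> dist (g x') (g x0) < e" using d(1) r(1) by (intro exI[of _ "min d r"]) auto
    qed
  qed
  then have "continuous_on \<Omega> g" by (rule continuous_at_imp_continuous_on[OF ballI])
  moreover have "AE x in lebesgue_on \<Omega>. ?u x = g x"
  proof -
    have "AE x in lebesgue. x \<in> \<Omega> \<longrightarrow> ?u x = g x" using AE_not_point[of x0] by eventually_elim (simp add: g_def)
    then show ?thesis using open_\<Omega> by (subst AE_restrict_space_iff) auto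
  qed
  ultimately show ?thesis unfolding continuous_representative_def by (intro exI[of _ g]) (simp add: g_def)
qed

text \<open>Along the ray of angle t the combination tends to \<open>bt (c 0) t\<close>, while
  continuity makes the limit independent of t. A constant angular spline has derivative 0, and the
  independence of the \<open>Mt\<close> turns this into equal coefficients.\<close>

lemma continuous_representative_imp:
  assumes "continuous_representative \<Omega> (comb0 L F p ns s nt c) g"
  shows "\<forall>j<nt. cyc_diff (c 0) j = 0"
proof -
  let ?u = "comb0 L F p ns s nt c"
  have gc: "continuous_on \<Omega> g" and ae: "AE x in lebesgue_on \<Omega>. ?u x = g x"
    using assms by (auto simp: continuous_representative_def)
  \<comment> \<open>Off the pole both functions are continuous, so the set where they differ is
    open, and being null it is empty. Equality almost everywhere would say nothing along a single
    ray.\<close>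
  have eq: "?u x = g x" if x: "x \<in> \<Omega>0" for x
  proof -
    let ?D = "{x \<in> \<Omega>0. ?u x - g x \<in> - {0}}"
    have "continuous_on \<Omega>0 (\<lambda>x. ?u x - g x)"
      using comb0_continuous continuous_on_subset[OF gc] by (intro continuous_intros) (auto simp: \<Omega>0_def)
    then have "open ((\<lambda>x. ?u x - g x) -` (- {0}) \<inter> \<Omega>0)"
      using open_\<Omega>0 continuous_on_open_vimage[OF open_\<Omega>0] open_Compl[OF closed_singleton[of "0::real"]] by blast
    moreover have "(\<lambda>x. ?u x - g x) -` (- {0}) \<inter> \<Omega>0 = ?D" by auto
    ultimately have o: "open ?D" by simp
    have "AE x in lebesgue. x \<in> \<Omega> \<longrightarrow> ?u x = g x" using ae open_\<Omega> by (subst (asm) AE_restrict_space_iff) auto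
    then have "AE x in lebesgue. x \<notin> ?D" by eventually_elim (auto simp: \<Omega>0_def)
    then have "?D \<in> null_sets lebesgue" by (simp add: completion.null_sets_iff_AE)
    then have "negligible ?D" by (simp add: negligible_iff_null_sets)
    then have "?D = {}" using o open_not_negligible by blast
    then show ?thesis using x by auto
  qed
  have const: "bt (c 0) t = g x0" for t
  proof -
    define k where "k = - \<lfloor>t / (2 * pi)\<rfloor>"
    define t' where "t' = t + 2 * pi * of_int k"
    have "of_int (- k) \<le> t / (2 * pi)" "t / (2 * pi) < of_int (- k) + 1" unfolding k_def by linarith+
    then have t': "0 \<le> t'" "t' < 2 * pi" by (simp_all add: t'_def field_simps)
    obtain K where K: "K \<ge> 0" "\<And>x. x \<in> \<Omega>0 \<Longrightarrow> \<bar>?u x - bt (c 0) (P x $ 2)\<bar> \<le> K * P x $ 1"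
      using B_bt_near_pole[of c] unfolding comb0_eq by auto
    have ev: "\<forall>\<^sub>F \<sigma> in at_right 0. 0 < \<sigma> \<and> \<sigma> < L"
      using L_pos by (auto simp: eventually_at_right_field)
    have l1: "((\<lambda>\<sigma>. g (F (vector [\<sigma>, t']))) \<longlongrightarrow> g x0) (at_right 0)"
    proof (rule isCont_tendsto_compose[OF _ F_ray_tendsto])
      show "isCont g x0" using gc open_\<Omega> x0_in continuous_on_eq_continuous_at by blast
    qed
    have "((\<lambda>\<sigma>. g (F (vector [\<sigma>, t'])) - bt (c 0) t') \<longlongrightarrow> 0) (at_right 0)"
    proof (rule Lim_null_comparison)
      show "\<forall>\<^sub>F \<sigma> in at_right 0. norm (g (F (vector [\<sigma>, t'])) - bt (c 0) t') \<le> K * \<sigma>"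
        using ev
      proof eventually_elim
        case (elim \<sigma>)
        have xO: "F (vector [\<sigma>, t']) \<in> \<Omega>0" using elim by (intro F_in_\<Omega>0) auto
        have "P (F (vector [\<sigma>, t'])) = vector [\<sigma>, t']" using elim t' by (intro polar_coords_F_eq) auto
        then show ?case using K(2)[OF xO] eq[OF xO] by simp
      qed
      have "((\<lambda>\<sigma>::real. K * \<sigma>) \<longlongrightarrow> K * 0) (at_right 0)" by (intro tendsto_intros)
      then show "((\<lambda>\<sigma>::real. K * \<sigma>) \<longlongrightarrow> 0) (at_right 0)" by simp
    qed
    then have "((\<lambda>\<sigma>. g (F (vector [\<sigma>, t']))) \<longlongrightarrow> bt (c 0) t') (at_right 0)" by (simp add: LIM_zero_iff)
    then have "bt (c 0) t' = g x0" using l1 tendsto_unique[OF trivial_limit_at_right_real] by blast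
    then show ?thesis by (simp add: t'_def bt_shift)
  qed
  have "mt (cyc_diff (c 0)) t = 0" if t: "t \<notin> knots" for t
  proof (rule DERIV_unique[OF bt_has_derivative[OF t]])
    have "bt (c 0) = (\<lambda>t. g x0)" using const by blast
    then show "(bt (c 0) has_real_derivative 0) (at t)" by simp
  qed
  then show ?thesis using Mt_independent[of "cyc_diff (c 0)" p] unfolding mt_def by blast
qed

section \<open>The three spaces in terms of coefficients\<close>

lemma row_const_iff: "(\<exists>\<gamma>. \<forall>j<nt. c 0 j = \<gamma>) \<longleftrightarrow> (\<forall>j<nt. cyc_diff (c 0) j = 0)"
proof
  show "\<forall>j<nt. cyc_diff (c 0) j = 0" if "\<exists>\<gamma>. \<forall>j<nt. c 0 j = \<gamma>"
    using that nt_pos by (auto simp: cyc_diff_def)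
  show "\<exists>\<gamma>. \<forall>j<nt. c 0 j = \<gamma>" if "\<forall>j<nt. cyc_diff (c 0) j = 0"
    using cyc_diff_zero_imp_const[OF that] by blast
qed

lemma V0_eq: "V0 L \<Omega> F p ns s nt = {comb0 L F p ns s nt c | c. \<exists>\<gamma>0. \<forall>j<nt. c 0 j = \<gamma>0}"
  unfolding V0_def W0_def row_const_iff using comb0_in_H1_iff by blast

lemma V1_eq: "V1 L \<Omega> F p ns s nt =
   {comb1 L F p ns s nt vs vt | vs vt. \<forall>j<nt. vt 0 j = 0 \<and> vt 1 j = vs 0 ((j + 1) mod nt) - vs 0 j}"
proof -
  have "(\<forall>j<nt. vt 0 j = 0 \<and> curl_coeff vs vt 0 j = 0) \<longleftrightarrow>
      (\<forall>j<nt. vt 0 j = 0 \<and> vt 1 j = vs 0 ((j + 1) mod nt) - vs 0 j)" for vs vt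
    by (auto simp: curl_coeff_def cyc_diff_def)
  then have "comb1 L F p ns s nt vs vt \<in> Hcurl \<Omega> \<longleftrightarrow>
      (\<forall>j<nt. vt 0 j = 0 \<and> vt 1 j = vs 0 ((j + 1) mod nt) - vs 0 j)" for vs vt
    using comb1_in_Hcurl_iff[of vs vt] by blast
  then show ?thesis unfolding V1_def W1_def by blast
qed

lemma V2_eq: "V2 L \<Omega> F p ns s nt = {comb2 L F p ns s nt c | c. \<forall>j<nt. c 0 j = 0}"
  unfolding V2_def W2_def using comb2_in_L2_iff by blast

lemma V0_eq_C0: "V0 L \<Omega> F p ns s nt = W0 L F p ns s nt \<inter> C0 \<Omega>"
proof -
  have "comb0 L F p ns s nt c \<in> C0 \<Omega> \<longleftrightarrow> (\<exists>\<gamma>0. \<forall>j<nt. c 0 j = \<gamma>0)" for c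
    unfolding C0_def using comb0_continuous_representative[of c] continuous_representative_imp[of c]
    by (auto simp: row_const_iff) (metis row_const_iff)
  then show ?thesis unfolding V0_eq W0_def by blast
qed

end

theorem theorem3p1:
  fixes L :: real and \<Omega> :: "(real^2) set" and x0 :: "real^2" and F :: "real^2 \<Rightarrow> real^2"
    and p ns nt :: nat and s :: "nat \<Rightarrow> real"
  assumes "polar_mapping L \<Omega> x0 F"
    and "first_order_polar_singularity L F"
    and "1 \<le> p"
    and "open_knots L p ns s"
    and "p + 1 \<le> nt"
  shows "V0 L \<Omega> F p ns s nt =
           {comb0 L F p ns s nt c | c. \<exists>\<gamma>0. \<forall>j<nt. c 0 j = \<gamma>0} \<and>
         V1 L \<Omega> F p ns s nt =
           {comb1 L F p ns s nt vs vt | vs vt.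
              \<forall>j<nt. vt 0 j = 0 \<and> vt 1 j = vs 0 ((j + 1) mod nt) - vs 0 j} \<and>
         V2 L \<Omega> F p ns s nt =
           {comb2 L F p ns s nt c | c. \<forall>j<nt. c 0 j = 0} \<and>
         (\<forall>c \<gamma>0. (\<forall>j<nt. c 0 j = \<gamma>0) \<longrightarrow>
           (\<exists>g. continuous_representative \<Omega> (comb0 L F p ns s nt c) g \<and> g x0 = \<gamma>0)) \<and>
         V0 L \<Omega> F p ns s nt = W0 L F p ns s nt \<inter> C0 \<Omega>"
proof -
  interpret polar_splines L \<Omega> x0 F p ns s nt
    by unfold_locales (use assms in auto)
  show ?thesis
    using V0_eq V1_eq V2_eq comb0_continuous_representative V0_eq_C0 by blast
qed

end
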